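(* Let $G$ be a finitely generated free Fuchsian group with parabolic elements, with Dirichlet fundamental domain $R$ having a unique vertex $p$ and with $\gamma_0\in G_0$ such that $\gamma_0(p)=p$. Let $f$ be the associated Bowen–Series map, $\tilde f$ the induced map on $\Lambda_c(G)$, $B_i(x)$ the blocks of $x\in\Lambda_c(G)$, and $\pi\colon X\to\Lambda_c(G)$ the coding by the countable Markov shift $X$ over $F$. Assume $f$ is topologically mixing. As $n\to\infty$, the measure $$\left(\sum_{x\in{\rm Per}_n(\tilde f)}\exp\left(-\sum_{i=1}^n|B_i(x)|\right)\right)^{-1}\sum_{x\in{\rm Per}_n(\tilde f)}\exp\left(-\sum_{i=1}^n|B_i(x)|\right)\delta_x^n(\tilde f)$$ converges in the weak*-topology to the Borel probability measure on $\Lambda_c(G)$ corresponding (under $\pi$) to the equilibrium state for the potential $-|B_1\circ\pi|$ on $X$.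
   Context: Fuchsian group. $\mathbb D\subset\mathbb R^2$ is the open unit disk around the origin, $\mathbb S^1$ its boundary. A Fuchsian group is a discrete subgroup of Möbius transformations preserving $\mathbb D$. $G$ is a finitely generated free Fuchsian group with parabolic elements, $\Lambda(G)\subset\mathbb S^1$ its limit set and $\Lambda_c(G)$ its conical limit set. Fix a Dirichlet fundamental domain $R\subset\mathbb D$ for $G$. Each side $s$ of $R$ gives a side-pairing transformation $g_s\in G$, and $s$ is contained in the isometric circle of $g_s$; $G_0=\{g_s: s\text{ a side of }R\}$ is a symmetric set of generators of $G$. Since $G$ is free, every vertex of $R$ is in $\mathbb S^1$ and is a parabolic fixed point of some element of $G$. It is assumed that the vertex of $R$ is unique, denoted $p$, and that there is $\gamma_0\in G_0$ with $\gamma_0(p)=p$. Put $\Gamma_0=\{\gamma_0^{\pm1}\}$, $H_0=G_0\setminus\Gamma_0$. Bowen–Series map. For $g\in G_0$ let $\varDelta_g=\mathbb S^1\cap\{z\in\mathbb R^2:|g'(z)|\ge1\}$, and $\varDelta=\bigcup_{g\in G_0}\varDelta_g$. The Bowen–Series map $f\colon\varDelta\to\mathbb S^1$ is $f|_{\varDelta_g}=g|_{\varDelta_g}$, $g\in G_0$. It codes the points $x$ of $\Lambda(G)$ by sequences $(\omega_n)_{n\ge0}\in G_0^{\mathbb N}$ with $f^nx\in\varDelta_{\omega_n}$ and $\omega_n\omega_{n+1}\ne1$ in $G$ for all $n\ge0$. Topological mixing of $f$ refers to its action on the limit set through this coding, i.e. to the shift on these sequences. Blocks. The symbolic sequence $\omega$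 of $x\in\Lambda_c(G)$ is decomposed into blocks $(B_i(x))_{i\ge1}$: each letter of $H_0$ in $\omega$ forms a block of length one, and letters of $\Gamma_0$ are grouped into maximal blocks of consecutive appearances of the same letter. Thus either $B_i(x)=h$ with $h\in H_0$ or $B_i(x)=\gamma_0^n$ with $n\in\mathbb Z\setminus\{0\}$. $|B_i(x)|$ is the word length of $B_i(x)$. Induced map. For a reduced word $\omega=\omega_0\cdots\omega_{n-1}\in G_0^n$, $n\ge2$, $\varDelta_\omega$ is the domain of $f|_{\varDelta_{\omega_{n-1}}}\circ\cdots\circ f|_{\varDelta_{\omega_0}}$. Let $$F=\bigcup_{n=1}^\infty\{\gamma^ng:\gamma\in\Gamma_0,\ g\in G_0\setminus\{\gamma^{\pm1}\}\}\cup\{hg:h\in H_0,\ g\in G_0\setminus\{h^{-1}\}\},$$ and define $\tilde f\colon\bigcup_{\omega\in F}\varDelta_\omega\to\mathbb S^1$ by $\tilde fx=f^{|B_1(x)|}x$ (so $\tilde f=f^n$ on $\varDelta_{\gamma^ng}$ and $\tilde f=f$ on $\varDelta_{hg}$). The maximal invariant set of $\tilde f$ is $\Lambda_c(G)$, and $B_i(x)=B_1(\tilde f^{i-1}x)$ for $x\in\Lambda_c(G)$, $i\ge1$. $X\subset F^{\mathbb N}$ is the countable Markov shift determined by $\tilde f$ and the sets $\varDelta_\omega$, $\omega\in F$: the transition $\omega\to\omega'$ is allowed iff $\tilde f(\varDelta_\omega)\supset\varDelta_{\omega'}$, i.e. iff the last letter of $\omega$ equals the first letter of $\omega'$. $\sigma|_X$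 is the left shift on $X$, and $\pi\colon X\to\Lambda_c(G)$ is the conjugacy sending a sequence $(\omega^{(i)})_{i\ge0}$ to the point $x$ with $\tilde f^ix\in\varDelta_{\omega^{(i)}}$ for all $i\geq 0$; $\tilde f\circ\pi=\pi\circ\sigma|_X$. Shift-invariant Borel probability measures on $X$ and $\tilde f$-invariant ones on $\Lambda_c(G)$ are in one-to-one correspondence through $\mu\mapsto\mu\circ\pi^{-1}$. Periodic points. $\delta_x^n(\tilde f)$ is the uniform probability distribution on $\{x,\tilde fx,\ldots,\tilde f^{n-1}x\}$ and ${\rm Per}_n(\tilde f)=\{x\in\Lambda_c(G):B_i(x)=B_{i+n}(x)\ \forall i\ge1\}$. Equilibrium state. For a potential $\phi\colon X\to\mathbb R$ (here $\phi(y)=-|B_1(\pi(y))|$), an equilibrium state is a shift-invariant Borel probability measure $\mu$ on $X$ with $\int\phi\,d\mu>-\infty$ attaining $\sup\{h(\nu)+\int\phi\,d\nu\}$ over all shift-invariant Borel probability measures $\nu$ on $X$ with $\int\phi\,d\nu>-\infty$, where $h$ is the Kolmogorov–Sinai entropy; it exists and is unique here. Weak*-convergence is convergence of integrals of bounded continuous functions on $\Lambda_c(G)$. *)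

theory Defs
  imports
    "HOL-Algebra.Bij"
    "HOL-Algebra.Generated_Groups"
    "HOL-Complex_Analysis.Riemann_Mapping"
    "HOL-Probability.Probability"
begin

section \<open>Fuchsian groups\<close>

text \<open>
  A Moebius transformation preserving the unit disk is identified with its restriction to the
  closed unit disk (an extensional function), so that composition is that of the library group of
  bijections of the closed disk and no point at infinity is needed.
\<close>

abbreviation D_group :: "(complex \<Rightarrow> complex) monoid" where
  "D_group \<equiv> BijGroup (cball 0 1)"

definition disk_moebius :: "(complex \<Rightarrow> complex) set" where
  "disk_moebius = {restrict (Moebius_function t w) (cball 0 1) | t w. norm w < 1}"

text \<open>
  Discreteness refers to the topology of uniform convergence on the closed disk, which on
  disk-preserving Moebius transformations is the usual Lie group topology.
\<close>

definition fuchsian_group :: "(complex \<Rightarrow> complex) set \<Rightarrow> bool" where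
  "fuchsian_group G \<longleftrightarrow> subgroup G D_group \<and> G \<subseteq> disk_moebius \<and>
     (\<forall>g\<in>G. \<exists>e>0. \<forall>h\<in>G. (\<forall>z\<in>cball 0 1. dist (h z) (g z) < e) \<longrightarrow> h = g)"

definition finitely_generated :: "('a, 'b) monoid_scheme \<Rightarrow> 'a set \<Rightarrow> bool" where
  "finitely_generated K G \<longleftrightarrow> (\<exists>S. finite S \<and> S \<subseteq> G \<and> generate K S = G)"

text \<open>A letter \<open>(a, True)\<close> of a word stands for \<open>a\<close>, and \<open>(a, False)\<close> for its inverse.\<close>

definition eval_word :: "('a, 'b) monoid_scheme \<Rightarrow> ('a \<times> bool) list \<Rightarrow> 'a" where
  "eval_word K ws =
     foldr (\<lambda>(a, s) y. (if s then a else m_inv K a) \<otimes>\<^bsub>K\<^esub> y) ws \<one>\<^bsub>K\<^esub>"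

definition reduced_word :: "('a \<times> bool) list \<Rightarrow> bool" where
  "reduced_word ws \<longleftrightarrow> successively (\<lambda>(a, s) (b, t). a = b \<longrightarrow> s = t) ws"

definition free_basis :: "('a, 'b) monoid_scheme \<Rightarrow> 'a set \<Rightarrow> 'a set \<Rightarrow> bool" where
  "free_basis K G S \<longleftrightarrow> S \<subseteq> G \<and> generate K S = G \<and>
     (\<forall>ws. set ws \<subseteq> S \<times> UNIV \<and> reduced_word ws \<and> ws \<noteq> [] \<longrightarrow> eval_word K ws \<noteq> \<one>\<^bsub>K\<^esub>)"

definition free_subgroup :: "('a, 'b) monoid_scheme \<Rightarrow> 'a set \<Rightarrow> bool" where
  "free_subgroup K G \<longleftrightarrow> (\<exists>S. free_basis K G S)"

definition parabolic :: "(complex \<Rightarrow> complex) \<Rightarrow> bool" where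
  "parabolic g \<longleftrightarrow> g \<in> disk_moebius \<and> (\<exists>q\<in>sphere 0 1. {z \<in> cball 0 1. g z = z} = {q})"

definition limit_set :: "(complex \<Rightarrow> complex) set \<Rightarrow> complex set" where
  "limit_set G = {x \<in> sphere 0 1. x islimpt ((\<lambda>g. g 0) ` G)}"

text \<open>Conical approach: some sequence in the orbit of \<open>0\<close> tends to \<open>x\<close> inside a Stolz angle at \<open>x\<close>.\<close>

definition conical_limit_set :: "(complex \<Rightarrow> complex) set \<Rightarrow> complex set" where
  "conical_limit_set G = {x \<in> sphere 0 1. \<exists>g :: nat \<Rightarrow> complex \<Rightarrow> complex. \<exists>M.
     (\<forall>n. g n \<in> G) \<and> (\<lambda>n. g n 0) \<longlonglongrightarrow> x \<and>
     (\<forall>n. dist (g n 0) x \<le> M * (1 - norm (g n 0)))}"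


section \<open>Dirichlet domains\<close>

definition hyp_dist :: "complex \<Rightarrow> complex \<Rightarrow> real" where
  "hyp_dist z w = 2 * artanh (norm (Moebius_function 0 w z))"

definition dirichlet_domain :: "(complex \<Rightarrow> complex) set \<Rightarrow> complex \<Rightarrow> complex set" where
  "dirichlet_domain G c =
     {z \<in> ball 0 1. \<forall>g\<in>G - {\<one>\<^bsub>D_group\<^esub>}. hyp_dist z c < hyp_dist z (g c)}"

text \<open>
  The common part of the closures (in the disk) of the domain and its translate by the inverse of
  \<open>g\<close>. It is a side if it is a segment of positive length; \<open>g\<close> then maps it to another side.
\<close>

definition side_of :: "(complex \<Rightarrow> complex) set \<Rightarrow> complex \<Rightarrow> (complex \<Rightarrow> complex) \<Rightarrow> complex set" where
  "side_of G c g = closure (dirichlet_domain G c)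
     \<inter> m_inv D_group g ` closure (dirichlet_domain G c) \<inter> ball 0 1"

definition side_pairings :: "(complex \<Rightarrow> complex) set \<Rightarrow> complex \<Rightarrow> (complex \<Rightarrow> complex) set" where
  "side_pairings G c = {g \<in> G - {\<one>\<^bsub>D_group\<^esub>}.
     \<exists>z\<in>side_of G c g. \<exists>w\<in>side_of G c g. z \<noteq> w}"

text \<open>Vertices may lie in the disk or on the circle; endpoints of a single side are no vertices.\<close>

definition vertices :: "(complex \<Rightarrow> complex) set \<Rightarrow> complex \<Rightarrow> complex set" where
  "vertices G c = {v. \<exists>s\<in>side_of G c ` side_pairings G c. \<exists>s'\<in>side_of G c ` side_pairings G c.
     s \<noteq> s' \<and> v \<in> closure s \<inter> closure s'}"

text \<open>The derivative within the closed disk; on the circle it is that of the extension to the plane.\<close>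

definition disk_deriv :: "(complex \<Rightarrow> complex) \<Rightarrow> complex \<Rightarrow> complex" where
  "disk_deriv g z = (THE d. (g has_field_derivative d) (at z within cball 0 1))"

text \<open>Only the part in the closed disk, which suffices since sides lie in the disk.\<close>

definition isometric_circle :: "(complex \<Rightarrow> complex) \<Rightarrow> complex set" where
  "isometric_circle g = {z \<in> cball 0 1. norm (disk_deriv g z) = 1}"


section \<open>The Bowen--Series map\<close>

text \<open>Below, \<open>A\<close> is the set of side pairings.\<close>

definition Delta :: "(complex \<Rightarrow> complex) \<Rightarrow> complex set" where
  "Delta g = {z \<in> sphere 0 1. norm (disk_deriv g z) \<ge> 1}"

text \<open>
  Two of the arcs can only meet at the vertex, which is fixed by both branches, so the value is
  unique for every point of the union of the arcs.
\<close>

definition bowen_series :: "(complex \<Rightarrow> complex) set \<Rightarrow> complex \<Rightarrow> complex" where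
  "bowen_series A x = (THE y. \<exists>g\<in>A. x \<in> Delta g \<and> y = g x)"

definition codes :: "(complex \<Rightarrow> complex) set \<Rightarrow> (nat \<Rightarrow> complex \<Rightarrow> complex) \<Rightarrow> complex \<Rightarrow> bool" where
  "codes A \<omega> x \<longleftrightarrow> (\<forall>n. \<omega> n \<in> A \<and> (bowen_series A ^^ n) x \<in> Delta (\<omega> n)
     \<and> \<omega> n \<otimes>\<^bsub>D_group\<^esub> \<omega> (Suc n) \<noteq> \<one>\<^bsub>D_group\<^esub>)"

definition shift :: "(nat \<Rightarrow> 'a) \<Rightarrow> nat \<Rightarrow> 'a" where
  "shift \<omega> = (\<lambda>n. \<omega> (Suc n))"

definition topologically_mixing :: "'a topology \<Rightarrow> ('a \<Rightarrow> 'a) \<Rightarrow> bool" where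
  "topologically_mixing T f \<longleftrightarrow> (\<forall>U V. openin T U \<and> U \<noteq> {} \<and> openin T V \<and> V \<noteq> {} \<longrightarrow>
     (\<exists>N. \<forall>n\<ge>N. (f ^^ n) ` U \<inter> V \<noteq> {}))"

definition sequence_topology :: "'a set \<Rightarrow> (nat \<Rightarrow> 'a) set \<Rightarrow> (nat \<Rightarrow> 'a) topology" where
  "sequence_topology A Y = subtopology (product_topology (\<lambda>_. discrete_topology A) UNIV) Y"

definition coding_space ::
    "(complex \<Rightarrow> complex) set \<Rightarrow> (complex \<Rightarrow> complex) set \<Rightarrow> (nat \<Rightarrow> complex \<Rightarrow> complex) set" where
  "coding_space G A = {\<omega>. \<exists>x\<in>limit_set G. codes A \<omega> x}"

definition bowen_series_mixing ::
    "(complex \<Rightarrow> complex) set \<Rightarrow> (complex \<Rightarrow> complex) set \<Rightarrow> bool" where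
  "bowen_series_mixing G A \<longleftrightarrow>
     topologically_mixing (sequence_topology A (coding_space G A)) shift"


section \<open>Blocks and the induced map\<close>

definition parabolic_letters :: "(complex \<Rightarrow> complex) \<Rightarrow> (complex \<Rightarrow> complex) set" where
  "parabolic_letters \<gamma>0 = {\<gamma>0, m_inv D_group \<gamma>0}"

definition hyperbolic_letters ::
    "(complex \<Rightarrow> complex) set \<Rightarrow> (complex \<Rightarrow> complex) \<Rightarrow> (complex \<Rightarrow> complex) set" where
  "hyperbolic_letters A \<gamma>0 = A - parabolic_letters \<gamma>0"

text \<open>The coding sequence is unique for points of the conical limit set.\<close>

definition symbolic_sequence ::
    "(complex \<Rightarrow> complex) set \<Rightarrow> complex \<Rightarrow> nat \<Rightarrow> complex \<Rightarrow> complex" where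
  "symbolic_sequence A x = (THE \<omega>. codes A \<omega> x)"

definition first_block_length :: "'a set \<Rightarrow> (nat \<Rightarrow> 'a) \<Rightarrow> nat" where
  "first_block_length H \<omega> = (if \<omega> 0 \<in> H then 1 else (LEAST n. \<omega> n \<noteq> \<omega> 0))"

text \<open>\<open>block_start H \<omega> i\<close> is the total length of the first \<open>i\<close> blocks.\<close>

fun block_start :: "'a set \<Rightarrow> (nat \<Rightarrow> 'a) \<Rightarrow> nat \<Rightarrow> nat" where
  "block_start H \<omega> 0 = 0"
| "block_start H \<omega> (Suc i) =
     block_start H \<omega> i + first_block_length H (\<lambda>n. \<omega> (block_start H \<omega> i + n))"

text \<open>
  Blocks are reduced words, so their word length is the length of the list. As in \<open>B\<^sub>i(x)\<close>, the
  index \<open>i\<close> starts at \<open>1\<close>.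
\<close>

definition block ::
    "(complex \<Rightarrow> complex) set \<Rightarrow> (complex \<Rightarrow> complex) \<Rightarrow> nat \<Rightarrow> complex \<Rightarrow> (complex \<Rightarrow> complex) list" where
  "block A \<gamma>0 i x =
     (let H = hyperbolic_letters A \<gamma>0; \<omega> = symbolic_sequence A x
      in map \<omega> [block_start H \<omega> (i - 1) ..< block_start H \<omega> i])"

definition induced_alphabet ::
    "(complex \<Rightarrow> complex) set \<Rightarrow> (complex \<Rightarrow> complex) \<Rightarrow> (complex \<Rightarrow> complex) list set" where
  "induced_alphabet A \<gamma>0 =
     {replicate n \<gamma> @ [g] | n \<gamma> g.
        n \<ge> 1 \<and> \<gamma> \<in> parabolic_letters \<gamma>0 \<and> g \<in> A - {\<gamma>, m_inv D_group \<gamma>}} \<union>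
     {[h, g] | h g. h \<in> hyperbolic_letters A \<gamma>0 \<and> g \<in> A - {m_inv D_group h}}"

definition Delta_word ::
    "(complex \<Rightarrow> complex) set \<Rightarrow> (complex \<Rightarrow> complex) list \<Rightarrow> complex set" where
  "Delta_word A w = {x. \<forall>i<length w. (bowen_series A ^^ i) x \<in> Delta (w ! i)}"

text \<open>
  On \<open>Delta_word A w\<close> with \<open>w\<close> in the induced alphabet, the first block of a point consists of
  all letters of \<open>w\<close> but the last. Stated through \<open>w\<close>, the definition also covers the points of
  the domain that have no infinite coding.
\<close>

definition induced_map ::
    "(complex \<Rightarrow> complex) set \<Rightarrow> (complex \<Rightarrow> complex) \<Rightarrow> complex \<Rightarrow> complex" where
  "induced_map A \<gamma>0 x = (THE y. \<exists>w\<in>induced_alphabet A \<gamma>0.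
     x \<in> Delta_word A w \<and> y = (bowen_series A ^^ (length w - 1)) x)"

definition markov_shift ::
    "(complex \<Rightarrow> complex) set \<Rightarrow> (complex \<Rightarrow> complex) \<Rightarrow> (nat \<Rightarrow> (complex \<Rightarrow> complex) list) set" where
  "markov_shift A \<gamma>0 =
     {y. \<forall>i. y i \<in> induced_alphabet A \<gamma>0 \<and> last (y i) = hd (y (Suc i))}"

definition markov_borel ::
    "(complex \<Rightarrow> complex) set \<Rightarrow> (complex \<Rightarrow> complex) \<Rightarrow> (nat \<Rightarrow> (complex \<Rightarrow> complex) list) measure" where
  "markov_borel A \<gamma>0 = sigma (markov_shift A \<gamma>0)
     {U. openin (sequence_topology (induced_alphabet A \<gamma>0) (markov_shift A \<gamma>0)) U}"

definition coding_map ::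
    "(complex \<Rightarrow> complex) set \<Rightarrow> (complex \<Rightarrow> complex) set \<Rightarrow> (complex \<Rightarrow> complex) \<Rightarrow>
      (nat \<Rightarrow> (complex \<Rightarrow> complex) list) \<Rightarrow> complex" where
  "coding_map G A \<gamma>0 y = (THE x. x \<in> conical_limit_set G \<and>
     (\<forall>i. (induced_map A \<gamma>0 ^^ i) x \<in> Delta_word A (y i)))"


section \<open>Equilibrium states\<close>

definition invariant_probabilities :: "'a measure \<Rightarrow> ('a \<Rightarrow> 'a) \<Rightarrow> 'a measure set" where
  "invariant_probabilities B T =
     {\<nu>. prob_space \<nu> \<and> space \<nu> = space B \<and> sets \<nu> = sets B \<and> T \<in> B \<rightarrow>\<^sub>M B \<and> distr \<nu> B T = \<nu>}"

text \<open>Here \<open>ln 0 = 0\<close>, so that null sets contribute \<open>0\<close>.\<close>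

definition partition_entropy :: "'a measure \<Rightarrow> 'a set set \<Rightarrow> real" where
  "partition_entropy \<nu> P = - (\<Sum>C\<in>P. measure \<nu> C * ln (measure \<nu> C))"

definition refined_partition :: "'a measure \<Rightarrow> ('a \<Rightarrow> 'a) \<Rightarrow> 'a set set \<Rightarrow> nat \<Rightarrow> 'a set set" where
  "refined_partition \<nu> T P n =
     {space \<nu> \<inter> (\<Inter>i<n. (T ^^ i) -` C i) | C. \<forall>i<n. C i \<in> P} - {{}}"

definition ks_entropy :: "'a measure \<Rightarrow> ('a \<Rightarrow> 'a) \<Rightarrow> ereal" where
  "ks_entropy \<nu> T = (SUP P \<in> {P. finite P \<and> P \<subseteq> sets \<nu> \<and> partition_on (space \<nu>) P}.
     ereal (lim (\<lambda>n. partition_entropy \<nu> (refined_partition \<nu> T P n) / real n)))"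

text \<open>
  For a measurable potential that is bounded above, \<open>\<integral>\<phi> d\<nu> > -\<infinity>\<close> means that \<open>\<phi>\<close> is
  \<open>\<nu>\<close>-integrable.
\<close>

definition equilibrium_state ::
    "'a measure \<Rightarrow> ('a \<Rightarrow> 'a) \<Rightarrow> ('a \<Rightarrow> real) \<Rightarrow> 'a measure \<Rightarrow> bool" where
  "equilibrium_state B T \<phi> \<mu> \<longleftrightarrow>
     \<mu> \<in> invariant_probabilities B T \<and> integrable \<mu> \<phi> \<and>
     ks_entropy \<mu> T + ereal (integral\<^sup>L \<mu> \<phi>) =
       (SUP \<nu> \<in> {\<nu> \<in> invariant_probabilities B T. integrable \<nu> \<phi>}.
          ks_entropy \<nu> T + ereal (integral\<^sup>L \<nu> \<phi>))"


section \<open>Periodic points and weak* convergence\<close>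

definition periodic_points ::
    "(complex \<Rightarrow> complex) set \<Rightarrow> (complex \<Rightarrow> complex) set \<Rightarrow> (complex \<Rightarrow> complex) \<Rightarrow> nat \<Rightarrow> complex set" where
  "periodic_points G A \<gamma>0 n =
     {x \<in> conical_limit_set G. \<forall>i\<ge>1. block A \<gamma>0 i x = block A \<gamma>0 (i + n) x}"

definition orbit_distribution :: "('a \<Rightarrow> 'a) \<Rightarrow> nat \<Rightarrow> 'a \<Rightarrow> 'a pmf" where
  "orbit_distribution T n x = pmf_of_set ((\<lambda>i. (T ^^ i) x) ` {..<n})"

definition block_weight ::
    "(complex \<Rightarrow> complex) set \<Rightarrow> (complex \<Rightarrow> complex) \<Rightarrow> nat \<Rightarrow> complex \<Rightarrow> real" where
  "block_weight A \<gamma>0 n x = exp (- (\<Sum>i=1..n. real (length (block A \<gamma>0 i x))))"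

text \<open>The sums over the (countably infinite) set of periodic points are unordered infinite sums.\<close>

definition periodic_measure ::
    "(complex \<Rightarrow> complex) set \<Rightarrow> (complex \<Rightarrow> complex) set \<Rightarrow> (complex \<Rightarrow> complex) \<Rightarrow> nat \<Rightarrow> complex measure" where
  "periodic_measure G A \<gamma>0 n =
     measure_of (conical_limit_set G) (sets (restrict_space borel (conical_limit_set G)))
       (\<lambda>E. ennreal (inverse (\<Sum>\<^sub>\<infinity>x\<in>periodic_points G A \<gamma>0 n. block_weight A \<gamma>0 n x) *
          (\<Sum>\<^sub>\<infinity>x\<in>periodic_points G A \<gamma>0 n. block_weight A \<gamma>0 n x *
             measure_pmf.prob (orbit_distribution (induced_map A \<gamma>0) n x) E)))"

definition weak_star_convergence ::
    "'a::topological_space set \<Rightarrow> (nat \<Rightarrow> 'a measure) \<Rightarrow> 'a measure \<Rightarrow> bool" where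
  "weak_star_convergence S M N \<longleftrightarrow>
     (\<forall>\<phi> :: 'a \<Rightarrow> real. continuous_on S \<phi> \<and> bounded (\<phi> ` S) \<longrightarrow>
        (\<lambda>n. integral\<^sup>L (M n) \<phi>) \<longlonglongrightarrow> integral\<^sup>L N \<phi>)"

end

theory Submission
  imports Defs
begin

text \<open>
 In the Klein model the Dirichlet domain is an intersection of half planes, bounded by the isometric
 circles of its side pairings. The arcs \<open>Delta g\<close> meet only at \<open>p\<close>, so reduced words expand and
 a point of the conical limit set is the same as a sequence of blocks. The shift of blocks has finitely
 many states (letters), countably many edges (words of \<open>F\<close>) and a potential depending on one edge;
 a Perron eigenvector turns the potential into transition probabilities. For any invariant measure,
 Gibbs' inequality bounds the entropy by the mean information of an edge, and comparison with a chain
 biased after a single word shows that equality holds for the Markov measure only. Weighted periodic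
 points are closed paths, and the frequency of a cylinder among them is governed by powers of the finite
 transition matrix, which converge. Mixing is used only to exclude the cyclic group.
\<close>

subsection \<open>Free groups are torsion-free\<close>

text \<open>The Dirichlet domain has an arbitrary centre c, whereas isometric circles refer to the
  origin; the hypothesis only says that sides lie on such circles. The two sets of half planes are
  therefore identified first, and torsion-freeness enters through the absence of fixed points in the
  disk. From there on the geometry is governed by the conformal factor \<open>dn g\<close> alone.
  Expansion is not uniform, since both parabolic letters have factor 1 at p; but no element of G has
  factor above 1 at p, which keeps the orbit of p out of the conical limit set and makes codes there
  unique. On the symbolic side the alphabet is infinite, while \<open>ks_entropy\<close> allows
  finite partitions into arbitrary measurable cells. So the upper bound codes an itinerary jointly
  with a path of the shift, the cells being guessed from windows of the path, and uniqueness results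
  from differentiating this bound in the bias at 0. The Markov measure attains the bound in the
  limit of partitions that see finitely many edges. Orbit averages are harmless: weights are
  constant along a periodic orbit.\<close>

lemma not_successively_split:
 "\<not> successively P xs ==> EX us x y vs. xs = us @ x # y # vs \<and> \<not> P x y"
proof (induction P xs rule: successively.induct)
 case (3 P x y xs)
 show ?case
 proof (cases "P x y")
  case True
  then obtain us a b vs where "y # xs = us @ a # b # vs" "\<not> P a b" using 3 by auto
  then have "x # y # xs = (x # us) @ a # b # vs" by simp
  with \<open>\<not> P a b\<close> show ?thesis by blast
 next
  case False
  then show ?thesis by (metis append_Nil)
 qed
qed auto

context group
begin

lemma eval_word_Cons:
 "eval_word G ((a, s) # ws) = (if s then a else inv a) \<otimes> eval_word G ws"
 by (simp add: eval_word_def)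

lemma eval_word_Nil [simp]: "eval_word G [] = \<one>"
 by (simp add: eval_word_def)

lemma eval_word_closed:
 "set ws\<subseteq>S \<times> UNIV ==> S\<subseteq>carrier G ==> eval_word G ws\<in>carrier G"
 by (induction ws) (auto simp: eval_word_Cons)

lemma eval_word_append:
 "set us\<subseteq>S \<times> UNIV ==> set vs\<subseteq>S \<times> UNIV ==> S\<subseteq>carrier G ==>
   eval_word G (us @ vs) = eval_word G us \<otimes> eval_word G vs"
proof (induction us)
 case Nil
 then show ?case by (simp add: eval_word_closed)
next
 case (Cons x us)
 obtain a s where x: "x = (a, s)" by fastforce
 have "a\<in>carrier G" using Cons.prems x by auto
 then show ?case using Cons
  by (auto simp: x eval_word_Cons m_assoc eval_word_closed)
qed

lemma generate_eval_word:
 assumes "g\<in>generate G S" "S\<subseteq>carrier G"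
 shows "EX ws. set ws\<subseteq>S \<times> UNIV \<and> eval_word G ws = g"
 using assms(1)
proof induction
 case one
 show ?case by (rule exI[of _ "[]"]) simp
next
 case (incl h)
 then show ?case using assms(2) by (intro exI[of _ "[(h, True)]"]) (auto simp: eval_word_Cons)
next
 case (inv h)
 then show ?case using assms(2) by (intro exI[of _ "[(h, False)]"]) (auto simp: eval_word_Cons)
next
 case (eng h1 h2)
 then obtain us vs where "set us\<subseteq>S \<times> UNIV" "eval_word G us = h1"
  "set vs\<subseteq>S \<times> UNIV" "eval_word G vs = h2" by blast
 then show ?case using assms(2)
  by (intro exI[of _ "us @ vs"]) (auto simp: eval_word_append)
qed

lemma eval_word_pow:
 assumes "set ws\<subseteq>S \<times> UNIV" "S\<subseteq>carrier G"
 shows "eval_word G (concat (replicate n ws)) = eval_word G ws [^] n"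
proof (induction n)
 case (Suc n)
 have "set (concat (replicate n ws))\<subseteq>S \<times> UNIV" using assms by auto
 then have "eval_word G (concat (replicate (Suc n) ws)) = eval_word G ws \<otimes> eval_word G ws [^] n"
  using Suc assms by (simp add: eval_word_append)
 also have "... = eval_word G ws [^] Suc n"
  using assms eval_word_closed nat_pow_Suc2 by metis
 finally show ?case .
qed simp

lemma conj_pow:
 assumes "x\<in>carrier G" "y\<in>carrier G"
 shows "(x \<otimes> y \<otimes> inv x) [^] (n::nat) = x \<otimes> y [^] n \<otimes> inv x"
proof (induction n)
 case (Suc n)
 have "(x \<otimes> y \<otimes> inv x) [^] Suc n = (x \<otimes> y [^] n \<otimes> inv x) \<otimes> (x \<otimes> y \<otimes> inv x)"
  using Suc by simp
 also have "... = x \<otimes> y [^] n \<otimes> (inv x \<otimes> x) \<otimes> y \<otimes> inv x"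
  using assms by (simp only: m_assoc m_closed inv_closed nat_pow_closed)
 finally show ?case using assms by (simp add: m_assoc)
qed (use assms in auto)

text \<open>A shortest word among those representing conjugates of the element is cyclically reduced, so
 its powers are reduced words.\<close>
lemma free_basis_torsion_free:
 assumes fb: "free_basis G H S" and S: "S\<subseteq>carrier G"
  and g: "g\<in>H" "g~=\<one>" and n: "n > 0"
 shows "g [^] (n::nat)~=\<one>"
proof -
 define P where "P = (%ws. set ws\<subseteq>S \<times> UNIV \<and>
   (EX x:carrier G. g = x \<otimes> eval_word G ws \<otimes> inv x))"
 have gc: "g\<in>carrier G"
  using fb g S generate_incl[OF S] by (auto simp: free_basis_def)
 have "EX ws. P ws"
 proof -
  obtain ws where "set ws\<subseteq>S \<times> UNIV" "eval_word G ws = g"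
   using generate_eval_word[of g S] fb g S by (auto simp: free_basis_def)
  then have "P ws" unfolding P_def using gc by (intro conjI bexI[of _ \<one>]) auto
  then show ?thesis ..
 qed
 then obtain ws where P: "P ws" and min: "!!vs. P vs ==> length ws<=length vs"
  by (metis exists_least_lemma arg_min_natI arg_min_nat_le)
 obtain x where x: "x\<in>carrier G" "g = x \<otimes> eval_word G ws \<otimes> inv x"
  and ws: "set ws\<subseteq>S \<times> UNIV" using P by (auto simp: P_def)
 have ne: "ws~=[]" using x g by auto
 let ?C = "%(a, s) (b, t). a = b --> s = (t::bool)"
 have red: "successively ?C ws"
 proof (rule ccontr)
  assume "\<not> successively ?C ws"
  then obtain us y z vs where e: "ws = us @ y # z # vs" "\<not> ?C y z"
   using not_successively_split[of ?C ws] by blast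
  obtain a s where yz: "y = (a, s)" "z = (a, \<not> s)" using e(2) by (cases y; cases z) auto
  have a: "a\<in>S" and us: "set us\<subseteq>S \<times> UNIV" and vs: "set vs\<subseteq>S \<times> UNIV"
   using ws e yz by auto
  then have ac: "a\<in>carrier G" using S by auto
  have c: "eval_word G vs\<in>carrier G" using vs S by (rule eval_word_closed)
  have "eval_word G (y # z # vs) = eval_word G vs"
   using ac c by (cases s) (auto simp: yz eval_word_Cons m_assoc[symmetric])
  then have "eval_word G ws = eval_word G (us @ vs)"
   using us vs a by (simp add: e eval_word_append[OF _ _ S] yz)
  then have "P (us @ vs)" using us vs x unfolding P_def by auto
  from min[OF this] show False by (simp add: e)
 qed
 have cyc: "?C (last ws) (hd ws)"
 proof (rule ccontr)
  assume nc: "\<not> ?C (last ws) (hd ws)"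
  then obtain a s where as: "hd ws = (a, s)" "last ws = (a, \<not> s)"
   by (cases "hd ws"; cases "last ws") auto
  define vs where "vs = butlast (tl ws)"
  have "tl ws~=[]" using as ne by (cases ws) auto
  then have dec: "ws = (a, s) # vs @ [(a, \<not> s)]"
   using as ne unfolding vs_def by (metis append_butlast_last_id last_tl list.collapse)
  have a: "a\<in>carrier G" "a\<in>S" and vs: "set vs\<subseteq>S \<times> UNIV" using ws dec S by auto
  define b where "b = (if s then a else inv a)"
  have b: "b\<in>carrier G" using a by (simp add: b_def)
  have c: "eval_word G vs\<in>carrier G" using vs S by (rule eval_word_closed)
  have "eval_word G ws = b \<otimes> (eval_word G vs \<otimes> inv b)"
   using a vs S by (cases s) (auto simp: dec b_def eval_word_Cons eval_word_append)
  then have "g = (x \<otimes> b) \<otimes> eval_word G vs \<otimes> inv (x \<otimes> b)"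
   using x b c by (simp add: m_assoc inv_mult_group)
  then have "P vs" using vs x(1) b unfolding P_def by (intro conjI bexI[of _ "x \<otimes> b"]) simp_all
  from min[OF this] show False by (simp add: dec)
 qed
 have redn: "successively ?C (concat (replicate k ws))" for k
 proof (induction k)
  case (Suc k)
  show ?case
  proof (cases k)
   case 0 then show ?thesis using red by simp
  next
   case (Suc j)
   then have "hd (concat (replicate k ws)) = hd ws" using ne by simp
   then show ?thesis using \<open>successively ?C (concat (replicate k ws))\<close> red cyc
    by (simp add: successively_append_iff)
  qed
 qed simp
 have w: "set (concat (replicate n ws))\<subseteq>S \<times> UNIV" using ws by auto
 have "concat (replicate n ws)~=[]" using ne n by (cases n) auto
 then have ne1: "eval_word G ws [^] n~=\<one>"
  using fb redn[of n] w eval_word_pow[OF ws S, of n]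
  unfolding free_basis_def reduced_word_def by metis
 have c: "eval_word G ws\<in>carrier G" using ws S by (rule eval_word_closed)
 show ?thesis
 proof
  assume "g [^] n = \<one>"
  then have "x \<otimes> (eval_word G ws [^] n \<otimes> inv x) = \<one>"
   using x c conj_pow[of x "eval_word G ws" n] by (simp add: m_assoc)
  then have "eval_word G ws [^] n = \<one>"
   using x c by (metis inv_closed inv_equality inv_inv l_inv m_closed nat_pow_closed r_cancel_one' r_inv m_assoc inv_comm)
  then show False using ne1 by simp
 qed
qed

end

subsection \<open>Automorphisms of the closed disk\<close>

lemma one_minus_cnj_mult_ne_0:
 fixes a z :: complex
 assumes "norm a < 1" "norm z<=1"
 shows "1 - cnj a * z~=0"
proof
 assume "1 - cnj a * z = 0"
 then have "norm a * norm z = 1"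
  by (metis complex_mod_cnj eq_iff_diff_eq_0 norm_mult norm_one)
 then show False using assms
  by (metis less_irrefl mult_left_le norm_ge_zero order.strict_trans1)
qed

text \<open>The rotation of \<open>Moebius_function\<close> is recorded by the unit number u and not
  by an angle, so that the parameters of a bounded part of the group lie in a compact set.\<close>

definition mob :: "complex => complex => complex => complex" where
 "mob u a z = u * (z - a) / (1 - cnj a * z)"

lemma mob_diff:
 assumes "norm a < 1" "norm z<=1" "norm w<=1"
 shows "mob u a z - mob u a w =
  u * (1 - (norm a)^2) * (z - w) / ((1 - cnj a * z) * (1 - cnj a * w))"
proof -
 have "1 - cnj a * z~=0" "1 - cnj a * w~=0"
  using one_minus_cnj_mult_ne_0 assms by auto
 moreover have "(complex_of_real (norm a))^2 = a * cnj a" by (metis complex_norm_square of_real_power)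
 ultimately show ?thesis
  by (simp add: mob_def divide_simps) (simp add: algebra_simps)
qed

lemma cmod_sq_ident: "(norm (1 - cnj a * z))^2 - (norm (z - a))^2 = (1 - (norm a)^2) * (1 - (norm z)^2)"
 unfolding cmod_power2 by (simp add: algebra_simps power2_eq_square)

lemma mob_norm:
 assumes "norm a < 1" "norm z<=1" "norm u = 1"
 shows "1 - (norm (mob u a z))^2 = (1 - (norm a)^2) * (1 - (norm z)^2) / (norm (1 - cnj a * z))^2"
proof -
 have "norm (1 - cnj a * z)~=0" using one_minus_cnj_mult_ne_0[OF assms(1,2)] by simp
 then show ?thesis
  using cmod_sq_ident[of a z] assms(3)
  by (simp add: mob_def norm_divide norm_mult power_divide divide_simps)
qed

lemma mob_deriv:
 assumes "norm a < 1" "norm z<=1"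
 shows "(mob u a has_field_derivative u * (1 - (norm a)^2) / (1 - cnj a * z)^2) (at z within S)"
proof -
 have nz: "1 - cnj a * z~=0" using one_minus_cnj_mult_ne_0 assms by auto
 have sq: "(complex_of_real (norm a))^2 = a * cnj a" by (metis complex_norm_square of_real_power)
 show ?thesis
  unfolding mob_def
  by (rule derivative_eq_intros refl nz)+ 
   (use nz sq in "simp add: divide_simps power2_eq_square, simp add: algebra_simps")
qed

lemma disk_deriv_eqI:
 assumes "(g has_field_derivative d) (at z within cball 0 1)" "norm z<=1"
 shows "disk_deriv g z = d"
proof -
 have "z islimpt cball (0::complex) 1"
  using assms(2) islimpt_ball[of z 0 1] by (meson ball_subset_cball islimpt_subset zero_less_one mem_cball_0)
 then have "at z within cball (0::complex) 1~=bot" by (simp add: trivial_limit_within)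
 then show ?thesis
  unfolding disk_deriv_def using assms(1)
  by (metis (mono_tags, lifting) has_field_derivative_unique the_equality)
qed

abbreviation "U1 \<equiv> cball (0::complex) 1"

lemma disk_moebiusE:
 assumes "g\<in>disk_moebius"
 obtains u a where "norm u = 1" "norm a < 1" "g = restrict (mob u a) U1"
proof -
 obtain t w where "g = restrict (Moebius_function t w) U1" "norm w < 1"
  using assms by (auto simp: disk_moebius_def)
 then show ?thesis
  by (intro that[of "exp (\<i> * of_real t)" w]) (auto simp: mob_def Moebius_function_def restrict_def)
qed

lemma disk_deriv_mob:
 assumes "norm a < 1" "norm z<=1"
 shows "disk_deriv (restrict (mob u a) U1) z = u * (1 - (norm a)^2) / (1 - cnj a * z)^2"
proof (rule disk_deriv_eqI)
 show "(restrict (mob u a) U1 has_field_derivative u * (1 - (norm a)^2) / (1 - cnj a * z)^2) (at z within U1)"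
  by (rule has_field_derivative_transform_within[OF mob_deriv[OF assms] zero_less_one]) (use assms in auto)
qed (use assms in simp)

lemma mob_eq_0_iff: "norm a < 1 ==> norm z<=1 ==> norm u = 1 ==> mob u a z = 0 \<longleftrightarrow> z = a"
 using one_minus_cnj_mult_ne_0[of a z] by (auto simp: mob_def)

text \<open>The conformal factor |g'|. It has an explicit formula up to the circle; the value 1
  marks the isometric circle.\<close>

definition dn :: "(complex => complex) => complex => real" where
 "dn g z = norm (disk_deriv g z)"

lemma disk_group: "group D_group"
 by (simp add: group_BijGroup)

lemma D_mult: "f\<in>carrier D_group ==> g\<in>carrier D_group ==> z\<in>U1 ==> (f \<otimes>\<^bsub>D_group\<^esub> g) z = f (g z)"
 by (simp add: BijGroup_def compose_def)

lemma D_one: "z\<in>U1 ==> \<one>\<^bsub>D_group\<^esub> z = z"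
 by (simp add: BijGroup_def)

lemma D_carrier_maps: "f\<in>carrier D_group ==> z\<in>U1 ==> f z\<in>U1"
 using Bij_imp_funcset[of f U1] by (simp add: BijGroup_def Pi_iff del: mem_cball_0)

lemma D_ext: "f\<in>carrier D_group ==> g\<in>carrier D_group ==> (!!z. z\<in>U1 ==> f z = g z) ==> f = g"
 by (auto simp: BijGroup_def dest!: Bij_imp_extensional intro: extensionalityI)

text \<open>The product formulas for 1 - |g z|^2 and |g z - g w|^2 replace calculus in what follows:
  they hold on the closed disk and yield the chain rule, the invariance of the hyperbolic distance
  and the estimates near the circle. The parameter a is the zero of g.\<close>

lemma disk_moebius_formulas:
 assumes "g\<in>disk_moebius" "g\<in>carrier D_group" 
 defines "a \<equiv> (inv\<^bsub>D_group\<^esub> g) 0"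
 shows "norm a < 1" "norm (g 0) = norm a"
  and "!!z. norm z<=1 ==> dn g z = (1 - (norm a)^2) / (norm (1 - cnj a * z))^2"
  and "!!z. norm z<=1 ==> 1 - (norm (g z))^2 = dn g z * (1 - (norm z)^2)"
  and "!!z w. norm z<=1 ==> norm w<=1 ==> (norm (g z - g w))^2 = dn g z * dn g w * (norm (z - w))^2"
  and "EX u. norm u = 1 \<and> g = restrict (mob u a) U1"
  and "continuous_on U1 g"
  and "!!z. norm z<=1 ==> (g has_field_derivative disk_deriv g z) (at z within U1)"
proof -
 obtain u b where ub: "norm u = 1" "norm b < 1" "g = restrict (mob u b) U1"
  using disk_moebiusE assms(1) by blast
 interpret D: group D_group by (rule disk_group)
 have ac: "a\<in>U1" unfolding a_def using assms(2) D_carrier_maps[of "inv\<^bsub>D_group\<^esub> g" 0] by simp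
 have "g a = 0"
  using D_mult[of g "inv\<^bsub>D_group\<^esub> g" 0] assms(2) D_one[of 0] by (simp add: a_def)
 then have "mob u b a = 0" using ub ac by simp
 then have ab: "a = b" using mob_eq_0_iff ub ac by simp
 show na: "norm a < 1" using ub ab by simp
 show "norm (g 0) = norm a" using ub ab by (simp add: mob_def norm_mult norm_divide)
 show dn: "dn g z = (1 - (norm a)^2) / (norm (1 - cnj a * z))^2" if "norm z<=1" for z
 proof -
  have "norm (1 - (complex_of_real (norm a))^2) = 1 - (norm a)^2"
   using na norm_of_real[of "1 - (norm a)^2"] abs_square_le_1[of "norm a"] by (auto simp: abs_of_nonneg)
  then show ?thesis
   using ub ab that by (simp add: dn_def disk_deriv_mob norm_divide norm_mult norm_power)
 qed
 show "1 - (norm (g z))^2 = dn g z * (1 - (norm z)^2)" if "norm z<=1" for z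
  using that mob_norm[of b z u] ub ab dn[OF that] by simp
 show "(norm (g z - g w))^2 = dn g z * dn g w * (norm (z - w))^2" if "norm z<=1" "norm w<=1" for z w
 proof -
  have "norm (1 - (complex_of_real (norm a))^2) = 1 - (norm a)^2"
   using na norm_of_real[of "1 - (norm a)^2"] abs_square_le_1[of "norm a"] by (auto simp: abs_of_nonneg)
  moreover have "g z - g w = mob u a z - mob u a w" using ub ab that by simp
  ultimately show ?thesis
   using that na ub(1) by (simp add: mob_diff dn norm_divide norm_mult power_divide power_mult_distrib power2_eq_square mult_ac)
 qed
 show "EX u. norm u = 1 \<and> g = restrict (mob u a) U1" using ub ab by auto
 show der: "(g has_field_derivative disk_deriv g z) (at z within U1)" if "norm z<=1" for z
 proof -
  have d: "(restrict (mob u b) U1 has_field_derivative u * (1 - (norm b)^2) / (1 - cnj b * z)^2) (at z within U1)"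
   by (rule has_field_derivative_transform_within[OF mob_deriv[OF ub(2) that] zero_less_one]) (use that in auto)
  then show ?thesis using disk_deriv_eqI[OF d that] d ub by simp
 qed
 show "continuous_on U1 g"
  using der by (auto intro!: continuous_on_eq_continuous_within[THEN iffD2] DERIV_continuous)
qed

subsection \<open>Finite intersections of half planes in the disk\<close>

text \<open>In the plane the vectors orthogonal to d form a line.\<close>

lemma parallel_complex:
 fixes a b d :: complex
 assumes "a \<bullet> d = 0" "b \<bullet> d = 0" "d~=0" "a~=0"
 obtains t where "b = of_real t * a"
proof -
 define t where "t = (b \<bullet> a) / (a \<bullet> a)"
 define v where "v = b - of_real t * a"
 have "a \<bullet> a~=0" using assms by simp
 have ta: "of_real t * a = t *\<^sub>R a" by (simp add: scaleR_conv_of_real)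
 have va: "v \<bullet> a = 0" using \<open>a \<bullet> a ~= 0\<close> unfolding v_def ta by (simp add: inner_diff_left t_def)
 have vd: "v \<bullet> d = 0" unfolding v_def ta using assms by (simp add: inner_diff_left)
 have "v = 0"
 proof (rule ccontr)
  assume "v~=0"
  have e: "Re v * Re a + Im v * Im a = 0" "Re v * Re d + Im v * Im d = 0" "Re a * Re d + Im a * Im d = 0"
   using va vd assms by (auto simp: inner_complex_def)
  have "Re v * (Re a * Im d - Im a * Re d) = 0" "Im v * (Re a * Im d - Im a * Re d) = 0"
   using e by algebra+
  then have "Re a * Im d - Im a * Re d = 0" using \<open>v ~= 0\<close> by (auto simp: complex_eq_iff)
  then have "((Re a)^2 + (Im a)^2) * ((Re d)^2 + (Im d)^2) = 0" using e(3) by algebra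
  then show False using assms by (auto simp: complex_eq_iff sum_power2_eq_zero_iff)
 qed
 then show ?thesis using that[of t] by (simp add: v_def)
qed

text \<open>The domain in Klein coordinates, where geodesics are chords and every bisector is the
  zero line of an affine function. The index set will consist of all nontrivial group elements;
  local finiteness takes the place of finiteness.\<close>

locale half_planes =
 fixes I :: "'i set" and \<alpha> :: "'i => real" and \<beta> :: "'i => complex" and c :: complex
 assumes c: "norm c < 1" and pos: "i\<in>I ==> \<alpha> i - \<beta> i \<bullet> c > 0"
  and locally_finite: "r < 1 ==> finite {i\<in>I. EX x. norm x<=r \<and> \<alpha> i - \<beta> i \<bullet> x<=0}"
begin

definition L :: "'i => complex => real" where "L i x = \<alpha> i - \<beta> i \<bullet> x"

definition region :: "complex set" where "region = {x. norm x < 1 \<and> (ALL i:I. L i x>=0)}"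

definition face :: "'i => complex set" where "face i = {x\<in>region. L i x = 0}"

text \<open>Faces are convex, so two distinct points already mean positive length. Constraints that
  touch the region at a corner only are left out.\<close>

definition sides :: "'i set" where "sides = {i\<in>I. EX x:face i. EX y:face i. x~=y}"

lemma L_c: "i\<in>I ==> L i c > 0" using pos by (simp add: L_def)

lemma L_affine: "L i (x + \<tau> *\<^sub>R (y - x)) = (1 - \<tau>) * L i x + \<tau> * L i y"
 by (simp add: L_def inner_add_right inner_diff_right algebra_simps)

lemma fin: "r < 1 ==> finite {i\<in>I. EX x. norm x<=r \<and> L i x<=0}"
 using locally_finite by (simp add: L_def)

lemma fin_at: assumes "norm x < 1" shows "finite {i\<in>I. L i x<=0}"
 by (rule finite_subset[OF _ fin[OF assms]]) auto

lemma open_L: "open {x. L i x > 0}"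
 unfolding L_def by (intro open_Collect_less continuous_intros)

lemma seg_norm: fixes x y :: complex
 assumes "norm x<=1" "norm y < 1" "0 < \<tau>" "\<tau><=1" shows "norm (x + \<tau> *\<^sub>R (y - x)) < 1"
proof -
 have "x + \<tau> *\<^sub>R (y - x) = (1 - \<tau>) *\<^sub>R x + \<tau> *\<^sub>R y" by (simp add: algebra_simps)
 then have "norm (x + \<tau> *\<^sub>R (y - x))<=(1 - \<tau>) * norm x + \<tau> * norm y"
  using norm_triangle_ineq[of "(1 - \<tau>) *\<^sub>R x" "\<tau> *\<^sub>R y"] assms by simp
 also have "... < (1 - \<tau>) * 1 + \<tau> * 1"
  using assms by (intro add_le_less_mono mult_left_mono mult_strict_left_mono) auto
 finally show ?thesis by simp
qed

text \<open>Near e only finitely many constraints can fail, so those that are positive at e stay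
  positive on a common neighbourhood.\<close>

lemma local_inactive:
 assumes "e\<in>region"
 obtains \<rho> where "\<rho> > 0" "!!x. dist e x < \<rho> ==> norm x < 1"
  "!!i x. i\<in>I ==> L i e > 0 ==> dist e x < \<rho> ==> L i x > 0"
proof -
 have ne: "norm e < 1" using assms by (simp add: region_def)
 define r where "r = (1 + norm e) / 2"
 have r: "r < 1" "norm e < r" using ne by (auto simp: r_def)
 define J where "J = {i\<in>I. EX x. norm x<=r \<and> L i x<=0}"
 define U where "U = ball 0 r Int (\<Inter>i\<in>{i\<in>J. L i e > 0}. {x. L i x > 0})"
 have "finite J" using fin r J_def by simp
 then have "open U" unfolding U_def by (intro open_Int open_INT ballI open_L) auto
 moreover have "e\<in>U" using r by (auto simp: U_def)
 ultimately obtain \<rho> where \<rho>: "\<rho> > 0" "ball e \<rho>\<subseteq>U" using open_contains_ball by blast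
 show ?thesis
 proof (rule that[OF \<rho>(1)])
  fix x assume "dist e x < \<rho>"
  then have x: "x\<in>U" using \<rho> by auto
  then show "norm x < 1" using r by (auto simp: U_def)
  fix i assume i: "i\<in>I" "L i e > 0"
  show "L i x > 0"
  proof (cases "i\<in>J")
   case True then show ?thesis using i x by (auto simp: U_def)
  next
   case False
   then have "\<not> (norm x<=r \<and> L i x<=0)" using i J_def by blast
   then show ?thesis using x by (auto simp: U_def)
  qed
 qed
qed

text \<open>Where the segment from \<open>c\<close> to a point outside the tangent cone of the region at \<open>e\<close> leaves
 that cone, it meets the direction of a side emanating from \<open>e\<close>.\<close>

lemma cone_exit:
 assumes e: "e\<in>region" and k: "k\<in>I" "L k e = 0" "L k x < 0"
 obtains h \<tau> where "h\<in>I" "0 < \<tau>" "\<tau> < 1" "L h e = 0" "L h (c + \<tau> *\<^sub>R (x - c)) = 0"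
  "ALL \<rho>>0. EX ep>0. ep < \<rho> \<and> e + ep *\<^sub>R ((c + \<tau> *\<^sub>R (x - c)) - e)\<in>face h"
proof -
 have ne: "norm e < 1" using e by (simp add: region_def)
 define J where "J = {i\<in>I. L i e = 0 \<and> L i x < 0}"
 have fJ: "finite J" by (rule finite_subset[OF _ fin_at[OF ne]]) (auto simp: J_def)
 have kJ: "k\<in>J" using k by (simp add: J_def)
 define T where "T i = L i c / (L i c - L i x)" for i
 obtain h where h: "h\<in>J" "!!i. i\<in>J ==> T h<=T i"
  using arg_min_if_finite[OF fJ, of T] kJ by (metis empty_iff not_le)
 define \<tau> where "\<tau> = T h"
 define y where "y = c + \<tau> *\<^sub>R (x - c)"
 have hI: "h\<in>I" "L h e = 0" "L h x < 0" using h by (auto simp: J_def)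
 have \<tau>: "0 < \<tau>" "\<tau> < 1" unfolding \<tau>_def T_def using L_c[OF hI(1)] hI(3) by (auto simp: divide_simps)
 have Lhy: "L h y = 0" unfolding y_def L_affine \<tau>_def T_def using L_c[OF hI(1)] hI(3)
  by (simp add: field_simps)
 have act: "L i y>=0" if i: "i\<in>I" "L i e = 0" for i
 proof (cases "L i x < 0")
  case True
  then have "\<tau><=T i" using h i by (auto simp: J_def \<tau>_def)
  then have "\<tau> * (L i c - L i x)<=L i c" unfolding T_def using L_c[OF i(1)] True by (simp add: field_simps)
  then show ?thesis unfolding y_def L_affine by (simp add: algebra_simps)
 next
  case False
  then show ?thesis unfolding y_def L_affine using L_c[OF i(1)] \<tau> by (simp add: add_nonneg_nonneg)
 qed
 obtain dl where dl: "dl > 0" "!!x. dist e x < dl ==> norm x < 1"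
  "!!i x. i\<in>I ==> L i e > 0 ==> dist e x < dl ==> L i x > 0"
  using local_inactive[OF e] by blast
 show ?thesis
 proof (rule that[OF hI(1) \<tau> hI(2)])
  show "L h (c + \<tau> *\<^sub>R (x - c)) = 0" using Lhy by (simp add: y_def)
  show "ALL \<rho>>0. EX ep>0. ep < \<rho> \<and> e + ep *\<^sub>R ((c + \<tau> *\<^sub>R (x - c)) - e)\<in>face h"
  proof (intro allI impI)
  fix \<rho> :: real assume \<rho>: "\<rho> > 0"
  \<comment> \<open>The displaced point has to stay within dl of e, where constraints inactive at e
    remain positive; the 1 in the denominator covers y = e.\<close>
  define ep where "ep = min (\<rho>/2) (min 1 (dl / (2 * (1 + norm (y - e)))))"
  have ep: "ep > 0" "ep < \<rho>" "ep<=1" unfolding ep_def using \<rho> dl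
   by (auto simp: min_less_iff_disj add_pos_nonneg)
  have "ep * norm (y - e)<=dl / (2 * (1 + norm (y - e))) * norm (y - e)"
   by (rule mult_right_mono) (auto simp: ep_def)
  also have "... = dl / 2 * (norm (y - e) / (1 + norm (y - e)))" by (simp add: field_simps)
  also have "...<=dl / 2 * 1" using dl(1) by (intro mult_left_mono) (auto simp: divide_le_eq add_pos_nonneg)
  finally have "ep * norm (y - e) < dl" using dl(1) by simp
  then have d: "dist e (e + ep *\<^sub>R (y - e)) < dl" using ep by (simp add: dist_norm)
  have "L i (e + ep *\<^sub>R (y - e))>=0" if i: "i\<in>I" for i
  proof (cases "L i e = 0")
   case True then show ?thesis using act[OF i True] ep by (simp add: L_affine)
  next
   case False
   then have "L i e > 0" using e i by (auto simp: region_def less_le)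
   then show ?thesis using dl(3)[OF i _ d] by simp
  qed
  moreover have "L h (e + ep *\<^sub>R (y - e)) = 0" using hI Lhy by (simp add: L_affine)
  ultimately have "e + ep *\<^sub>R (y - e)\<in>face h" using dl(2)[OF d] by (auto simp: face_def region_def)
  then show "EX ep>0. ep < \<rho> \<and> e + ep *\<^sub>R ((c + \<tau> *\<^sub>R (x - c)) - e)\<in>face h" using ep by (auto simp: y_def)
  qed
 qed
qed

text \<open>Only finitely many constraints fail at z, so one of them is the first to be reached on
  the segment.\<close>

lemma first_exit:
 assumes u: "u\<in>region" and z: "norm z < 1" "z\<notin>region"
 obtains k \<tau> where "k\<in>I" "0<=\<tau>" "\<tau> < 1" "L k z < 0" "L k (u + \<tau> *\<^sub>R (z - u)) = 0"
  "u + \<tau> *\<^sub>R (z - u)\<in>region"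
proof -
 define J where "J = {i\<in>I. L i z < 0}"
 have fJ: "finite J" by (rule finite_subset[OF _ fin_at[OF z(1)]]) (auto simp: J_def)
 have neJ: "J~={}" using z by (auto simp: J_def region_def)
 define T where "T i = L i u / (L i u - L i z)" for i
 obtain k where k: "k\<in>J" "!!i. i\<in>J ==> T k<=T i"
  using arg_min_if_finite[OF fJ neJ, of T] by (metis not_le)
 define \<tau> where "\<tau> = T k"
 define e where "e = u + \<tau> *\<^sub>R (z - u)"
 have kI: "k\<in>I" "L k z < 0" using k by (auto simp: J_def)
 have Lu: "L i u>=0" if "i\<in>I" for i using u that by (auto simp: region_def)
 have \<tau>: "0<=\<tau>" "\<tau> < 1" unfolding \<tau>_def T_def using Lu[OF kI(1)] kI(2) by (auto simp: divide_simps)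
 have Lke: "L k e = 0" unfolding e_def L_affine \<tau>_def T_def using Lu[OF kI(1)] kI(2)
  by (simp add: field_simps)
 have "L i e>=0" if i: "i\<in>I" for i
 proof (cases "L i z < 0")
  case True
  then have "\<tau><=T i" using k i by (auto simp: J_def \<tau>_def)
  then have "\<tau> * (L i u - L i z)<=L i u" unfolding T_def using Lu[OF i(1)] True by (simp add: field_simps)
  then show ?thesis unfolding e_def L_affine by (simp add: algebra_simps)
 next
  case False
  then show ?thesis unfolding e_def L_affine using Lu[OF i(1)] \<tau> by (simp add: add_nonneg_nonneg)
 qed
 moreover have "norm e < 1"
 proof -
  have "norm u < 1" using u by (simp add: region_def)
  then show ?thesis using seg_norm[of u z \<tau>] z \<tau> by (cases "\<tau> = 0") (auto simp: e_def)
 qed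
 ultimately show ?thesis using that[OF kI(1) \<tau> kI(2)] Lke by (auto simp: region_def e_def)
qed

lemma c_region: "c\<in>region" using c L_c by (auto simp: region_def less_imp_le)

text \<open>The difficulty is a segment that leaves the region through a corner, where the violated
  constraint need not carry a side. Tilting the target slightly makes the segment leave the tangent
  cone at the corner along a nonzero direction, hence along a genuine side.\<close>

lemma region_eq_sides:
 assumes x: "norm x < 1" and A: "!!i. i\<in>sides ==> L i x>=0"
 shows "x\<in>region"
proof (rule ccontr)
 assume "x\<notin>region"
 then obtain k \<tau> where k: "k\<in>I" "0<=\<tau>" "\<tau> < 1" "L k x < 0" "L k (c + \<tau> *\<^sub>R (x - c)) = 0"
  and e: "c + \<tau> *\<^sub>R (x - c)\<in>region" using first_exit[OF c_region x] by blast
 define e' where "e' = c + \<tau> *\<^sub>R (x - c)"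
 have \<tau>0: "\<tau> > 0" using k L_c[OF k(1)] by (cases "\<tau> = 0") auto
 have xc: "x~=c" using k(4) L_c[OF k(1)] by auto
 \<comment> \<open>dl is chosen so that the sideways displacement changes \<open>L k\<close> by at
   most half of |L k x|; the tilted point still violates k.\<close>
 define M where "M = \<bar>\<beta> k \<bullet> (\<i> * (x - c))\<bar>"
 define dl where "dl = - L k x / (2 * (M + 1))"
 have M0: "M>=0" by (simp add: M_def)
 have dl: "dl > 0" unfolding dl_def using k(4) M0 by (simp add: divide_simps)
 define x' where "x' = x + dl *\<^sub>R (\<i> * (x - c))"
 have "\<bar>dl * (\<beta> k \<bullet> (\<i> * (x - c)))\<bar> = dl * M" using dl by (simp add: M_def abs_mult)
 also have "dl * M <= - L k x / 2" unfolding dl_def using k(4) M0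
  by (simp add: divide_simps)
 finally have Lx': "L k x' < 0" using k(4) unfolding x'_def L_def by (simp add: inner_add_right)
 obtain h \<sigma> where h: "h\<in>I" "0 < \<sigma>" "\<sigma> < 1" "L h e' = 0" "L h (c + \<sigma> *\<^sub>R (x' - c)) = 0"
  and hf: "ALL \<rho>>0. EX ep>0. ep < \<rho> \<and> e' + ep *\<^sub>R ((c + \<sigma> *\<^sub>R (x' - c)) - e')\<in>face h"
  unfolding e'_def by (rule cone_exit[OF e k(1,5) Lx'])
 have "(c + \<sigma> *\<^sub>R (x' - c)) - e'~=0"
 proof
  assume "(c + \<sigma> *\<^sub>R (x' - c)) - e' = 0"
  then have "(of_real \<sigma> * (1 + \<i> * of_real dl) - of_real \<tau>) * (x - c) = 0"
   unfolding e'_def x'_def by (simp add: scaleR_conv_of_real algebra_simps)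
  then have "of_real \<sigma> * (1 + \<i> * of_real dl) - of_real \<tau> = (0::complex)" using xc by simp
  then have "Im (of_real \<sigma> * (1 + \<i> * of_real dl) - of_real \<tau>) = 0" by (simp only: zero_complex.sel)
  then have "\<sigma> * dl = 0" by simp
  then show False using h dl by simp
 qed
 moreover obtain ep where "ep > 0" "e' + ep *\<^sub>R ((c + \<sigma> *\<^sub>R (x' - c)) - e')\<in>face h" using hf[rule_format, of 1] by auto
 moreover have "e'\<in>face h" using h e by (simp add: face_def e'_def)
 ultimately have "h\<in>sides" unfolding sides_def using h(1)
  by (intro CollectI conjI bexI[of _ e'] bexI[of _ "e' + ep *\<^sub>R ((c + \<sigma> *\<^sub>R (x' - c)) - e')"]) auto
 then have "L h x>=0" by (rule A)
 moreover have "(1 - \<tau>) * L h c + \<tau> * L h x = 0" using h(4) by (simp add: e'_def L_affine)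
 moreover have "(1 - \<tau>) * L h c > 0" using k L_c[OF h(1)] by simp
 moreover have "\<tau> * L h x>=0" using \<tau>0 \<open>L h x >= 0\<close> by simp
 ultimately show False by linarith
qed

text \<open>A side shorter than its chord ends at a point e' where another constraint becomes
  active. Leaving the tangent cone at e' on the way from c to z gives a side through e' that departs
  from the line of k.\<close>

lemma side_end:
 assumes k: "k\<in>sides" and z: "norm z < 1" "L k z = 0" "z\<notin>face k"
 shows "EX h:sides. face h~=face k \<and> face h Int face k~={}"
proof -
 obtain u where u: "u\<in>face k" using k by (auto simp: sides_def)
 have kI: "k\<in>I" using k by (simp add: sides_def)
 have "z\<notin>region" using z by (simp add: face_def)
 then obtain j \<tau> where j: "j\<in>I" "0<=\<tau>" "\<tau> < 1" "L j z < 0" "L j (u + \<tau> *\<^sub>R (z - u)) = 0"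
  and e: "u + \<tau> *\<^sub>R (z - u)\<in>region" using first_exit[of u z] u z(1) by (auto simp: face_def)
 define e' where "e' = u + \<tau> *\<^sub>R (z - u)"
 have ek: "e'\<in>face k" using e u z by (simp add: e'_def face_def L_affine)
 obtain h \<sigma> where h: "h\<in>I" "0 < \<sigma>" "\<sigma> < 1" "L h e' = 0" "L h (c + \<sigma> *\<^sub>R (z - c)) = 0"
  and hf: "ALL \<rho>>0. EX ep>0. ep < \<rho> \<and> e' + ep *\<^sub>R ((c + \<sigma> *\<^sub>R (z - c)) - e')\<in>face h"
  unfolding e'_def by (rule cone_exit[OF e j(1,5,4)])
 define y where "y = c + \<sigma> *\<^sub>R (z - c)"
 have Lky: "L k y > 0" unfolding y_def L_affine using h L_c[OF kI] z by simp
 have Lke: "L k e' = 0" using ek by (simp add: face_def)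
 obtain ep where ep: "ep > 0" "e' + ep *\<^sub>R (y - e')\<in>face h" using hf[rule_format, of 1] by (auto simp: y_def)
 have pos: "L k (e' + ep *\<^sub>R (y - e')) > 0" using ep Lky Lke by (simp add: L_affine)
 have eh: "e'\<in>face h" using h e by (simp add: face_def e'_def)
 have "e' + ep *\<^sub>R (y - e')~=e'" using pos Lke by auto
 then have "h\<in>sides" using eh ep(2) h(1) unfolding sides_def by blast
 moreover have "e' + ep *\<^sub>R (y - e')\<notin>face k" using pos by (auto simp: face_def)
 then have "face h~=face k" using ep(2) by blast
 ultimately show ?thesis using eh ek by blast
qed

context
 assumes full: "!!k. k\<in>sides ==> face k = {x. norm x < 1 \<and> L k x = 0}"
begin

text \<open>If the chords crossed inside the disk, the full face of k would extend to both sides of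
  x, and \<open>L h\<close> would be nonnegative there and zero at x. So \<open>L h\<close> vanishes
  along the chord of k and the two faces agree.\<close>

lemma full_faces_meet:
 assumes k: "k\<in>sides" and h: "h\<in>sides" and ne: "face k~=face h"
  and x: "norm x<=1" "L k x = 0" "L h x = 0"
 shows "norm x = 1"
proof (rule ccontr)
 assume "norm x~=1"
 then have nx: "norm x < 1" using x by simp
 have kI: "k\<in>I" "h\<in>I" using k h by (auto simp: sides_def)
 have bk: "\<beta> k~=0" using L_c[OF kI(1)] x(2) by (auto simp: L_def)
 have bh: "\<beta> h~=0" using L_c[OF kI(2)] x(3) by (auto simp: L_def)
 define d where "d = \<i> * \<beta> k"
 have d0: "d~=0" "\<beta> k \<bullet> d = 0" using bk by (auto simp: d_def inner_complex_def)
 define ep where "ep = (1 - norm x) / (2 * norm d)"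
 have ep: "ep > 0" using nx d0 by (simp add: ep_def)
 have nrm: "norm (x + s *\<^sub>R d) < 1" if "\<bar>s\<bar> = ep" for s
 proof -
  have "norm (x + s *\<^sub>R d)<=norm x + ep * norm d" using norm_triangle_ineq[of x "s *\<^sub>R d"] that by simp
  also have "... = norm x + (1 - norm x) / 2" using d0 by (simp add: ep_def)
  finally show ?thesis using nx by (simp add: field_simps)
 qed
 have "L h (x + s *\<^sub>R d)>=0" if "\<bar>s\<bar> = ep" for s
 proof -
  have "L k (x + s *\<^sub>R d) = 0" using x d0 by (simp add: L_def inner_add_right)
  then have "x + s *\<^sub>R d\<in>face k" using full[OF k] nrm[OF that] by simp
  then show ?thesis using kI by (auto simp: face_def region_def)
 qed
 from this[of ep] this[of "- ep"] have "ep * (\<beta> h \<bullet> d) = 0"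
  using x ep by (simp add: L_def inner_add_right inner_diff_right)
 then have hd: "\<beta> h \<bullet> d = 0" using ep by simp
 obtain s where s: "\<beta> h = of_real s * \<beta> k" using parallel_complex[OF d0(2) hd d0(1) bk] by blast
 have s0: "s~=0" using s bh by auto
 have "L h y = s * L k y" for y
 proof -
  have "\<beta> h \<bullet> w = s * (\<beta> k \<bullet> w)" for w by (simp add: s scaleR_conv_of_real[symmetric])
  then show ?thesis using x by (simp add: L_def right_diff_distrib)
 qed
 then have "face k = face h" using full k h s0 by auto
 then show False using ne by simp
qed

text \<open>Otherwise the segment from c to x would meet the chord of h after that of k, and near
  this place a point of the face of h would violate k.\<close>

lemma full_faces_disjoint:
 assumes k: "k\<in>sides" and h: "h\<in>sides" and ne: "face k~=face h"
  and x: "norm x<=1" "L k x < 0"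
 shows "L h x > 0"
proof (rule ccontr)
 assume "\<not> L h x > 0"
 then have hx: "L h x<=0" by simp
 have kI: "k\<in>I" "h\<in>I" using k h by (auto simp: sides_def)
 have p: "L k c > 0" "L h c > 0" using L_c kI by auto
 define \<tau> where "\<tau> = L k c / (L k c - L k x)"
 have \<tau>: "0 < \<tau>" "\<tau> < 1" unfolding \<tau>_def using p x by (auto simp: divide_simps)
 define xk where "xk = c + \<tau> *\<^sub>R (x - c)"
 have nxk: "norm xk < 1"
 proof -
  have "xk = x + (1 - \<tau>) *\<^sub>R (c - x)" by (simp add: xk_def algebra_simps)
  then show ?thesis using seg_norm[of x c "1 - \<tau>"] x c \<tau> by simp
 qed
 have Lk: "L k xk = 0" unfolding xk_def L_affine \<tau>_def using p x by (simp add: field_simps)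
 have "xk\<in>face k" using full[OF k] nxk Lk by simp
 then have "L h xk>=0" using kI by (auto simp: face_def region_def)
 moreover have "L h xk~=0" using full_faces_meet[OF k h ne _ Lk] nxk by auto
 ultimately have hk: "L h xk > 0" by simp
 define \<sigma> where "\<sigma> = L h xk / (L h xk - L h x)"
 have \<sigma>: "0 < \<sigma>" "\<sigma><=1" unfolding \<sigma>_def using hk hx by (auto simp: divide_simps)
 define w where "w = xk + \<sigma> *\<^sub>R (x - xk)"
 have Lhw: "L h w = 0" unfolding w_def L_affine \<sigma>_def using hk hx by (simp add: field_simps)
 have Lkw: "L k w < 0" unfolding w_def L_affine using Lk x \<sigma> by (simp add: mult_pos_neg)
 have contra: False if "norm v < 1" "L h v = 0" "L k v < 0" for v
 proof -
  have "v\<in>face h" using full[OF h] that by simp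
  then show False using kI that by (auto simp: face_def region_def)
 qed
 have nw: "norm w<=1"
 proof -
  have "w = (1 - \<sigma>) *\<^sub>R xk + \<sigma> *\<^sub>R x" by (simp add: w_def algebra_simps)
  then have "norm w<=(1 - \<sigma>) * norm xk + \<sigma> * norm x"
   using norm_triangle_ineq[of "(1 - \<sigma>) *\<^sub>R xk" "\<sigma> *\<^sub>R x"] \<sigma> by simp
  also have "...<=(1 - \<sigma>) * 1 + \<sigma> * 1" using \<sigma> nxk x by (intro add_mono mult_left_mono) auto
  finally show ?thesis by simp
 qed
 obtain v where v: "norm v < 1" "L h v = 0" using h full[OF h] by (auto simp: sides_def)
 \<comment> \<open>w may lie on the circle. A displacement by ep along the chord of h towards v
   enters the open disk and keeps \<open>L k\<close> negative.\<close>
 define ep where "ep = - L k w / (2 * (- L k w + \<bar>L k v\<bar> + 1))"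
 have ep: "0 < ep" "ep<=1" unfolding ep_def using Lkw by (auto simp: divide_simps)
 have 1: "ep * (- L k w + \<bar>L k v\<bar> + 1) = - L k w / 2"
  unfolding ep_def using Lkw by (simp add: field_simps add_nonneg_eq_0_iff)
 have 2: "ep * L k v<=ep * \<bar>L k v\<bar>" using ep by simp
 have 3: "L k (w + ep *\<^sub>R (v - w)) = L k w + ep * (- L k w) + ep * L k v" unfolding L_affine by (simp add: algebra_simps)
 have "ep * (- L k w) + ep * \<bar>L k v\<bar> = - L k w / 2 - ep" using 1 by (simp add: algebra_simps)
 then have "L k (w + ep *\<^sub>R (v - w)) < 0" unfolding 3 using 2 Lkw ep by linarith
 moreover have "norm (w + ep *\<^sub>R (v - w)) < 1" using seg_norm nw v ep by simp
 moreover have "L h (w + ep *\<^sub>R (v - w)) = 0" using Lhw v by (simp add: L_affine)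
 ultimately show False using contra by blast
qed

end

end

subsection \<open>Fuchsian groups\<close>

abbreviation D_mul (infixl "\<odot>" 70) where "f \<odot> g \<equiv> f \<otimes>\<^bsub>D_group\<^esub> g"
abbreviation D_inv ("iv") where "iv g \<equiv> inv\<^bsub>D_group\<^esub> g"
abbreviation D_id ("\<e>") where "\<e> \<equiv> \<one>\<^bsub>D_group\<^esub>"

lemma mob_lip:
 assumes "norm a<=r" "r < 1" "norm u = 1" "norm z<=1" "norm w<=1"
 shows "norm (mob u a z - mob u a w)<=norm (z - w) / (1 - r)^2"
proof -
 have r0: "0<=r" using assms(1) norm_ge_zero order_trans by blast
 have low: "1 - r<=norm (1 - cnj a * x)" if "norm x<=1" for x
 proof -
  have "norm (cnj a * x)<=r * 1" unfolding norm_mult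
   using assms that r0 by (intro mult_mono) auto
  then show ?thesis using norm_triangle_ineq2[of 1 "cnj a * x"] by simp
 qed
 have "0 < (1 - r) * (1 - r)" using assms by simp
 have "(1 - r) * (1 - r)<=norm (1 - cnj a * z) * norm (1 - cnj a * w)"
  using low assms by (intro mult_mono) auto
 moreover have "norm (complex_of_real (1 - (norm a)^2))<=1"
  unfolding norm_of_real using assms abs_square_le_1[of "norm a"] by (simp add: abs_if)
 then have "norm (complex_of_real (1 - (norm a)^2)) * norm (z - w)<=1 * norm (z - w)"
  by (rule mult_right_mono) simp
 ultimately have "norm (complex_of_real (1 - (norm a)^2)) * norm (z - w) / (norm (1 - cnj a * z) * norm (1 - cnj a * w))
  <=norm (z - w) / ((1 - r) * (1 - r))"
  using \<open>0 < (1 - r) * (1 - r)\<close> by (intro frac_le) auto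
 moreover have "mob u a z - mob u a w = u * complex_of_real (1 - (norm a)^2) * (z - w) / ((1 - cnj a * z) * (1 - cnj a * w))"
  using assms by (subst mob_diff) auto
 ultimately show ?thesis using assms(3)
  by (simp add: norm_divide norm_mult power2_eq_square del: of_real_diff)
qed

text \<open>Together with \<open>mob_lip\<close> this bounds the uniform distance between inv h o g
  and the identity by the distance of the parameters of g and h, so discreteness in the uniform
  topology becomes discreteness of parameters.\<close>

lemma mob_param_lip:
 assumes "norm a<=r" "norm b<=r" "r < 1" "norm u = 1" "norm v = 1" "norm z<=1"
 shows "norm (mob u a z - mob v b z)<=4 * (norm (u - v) + norm (a - b)) / (1 - r)^2"
proof -
 have r0: "0<=r" using assms(1) norm_ge_zero order_trans by blast
 have low: "1 - r<=norm (1 - cnj x * z)" if "norm x<=r" for x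
 proof -
  have "norm (cnj x * z)<=r * 1" unfolding norm_mult
   using assms that r0 by (intro mult_mono) auto
  then show ?thesis using norm_triangle_ineq2[of 1 "cnj x * z"] by simp
 qed
 have nz: "1 - cnj a * z~=0" "1 - cnj b * z~=0"
  using low[of a] low[of b] assms by auto
 have den: "(1 - r)^2<=norm ((1 - cnj a * z) * (1 - cnj b * z))"
  unfolding norm_mult power2_eq_square using low assms by (intro mult_mono) auto
 define X where "X = (z - a) * (1 - cnj b * z)"
 define Y where "Y = (z - b) * (1 - cnj a * z)"
 have nX: "norm X<=4"
 proof -
  have "norm (z - a)<=2" using norm_triangle_ineq4[of z a] assms by simp
  moreover have "norm (cnj b * z)<=1 * 1"
   unfolding norm_mult using assms by (intro mult_mono) auto
  then have "norm (1 - cnj b * z)<=2" using norm_triangle_ineq4[of 1 "cnj b * z"] by simp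
  ultimately have "norm X<=2 * 2" unfolding X_def norm_mult by (intro mult_mono) auto
  then show ?thesis by simp
 qed
 have XY: "X - Y = (cnj a - cnj b) * z^2 - (a - b) + a * (cnj b - cnj a) * z + cnj a * (a - b) * z"
  unfolding X_def Y_def by (simp add: algebra_simps power2_eq_square)
 have cd: "norm (cnj a - cnj b) = norm (a - b)" "norm (cnj b - cnj a) = norm (a - b)"
  by (metis complex_cnj_diff complex_mod_cnj norm_minus_commute)+
 have z2: "norm (z^2)<=1" using assms by (simp add: norm_power power_le_one)
 have az: "norm a * norm z<=1" using assms mult_mono[of "norm a" 1 "norm z" 1] by simp
 have t1: "norm ((cnj a - cnj b) * z^2)<=norm (a - b)"
  unfolding norm_mult cd using z2 mult_left_mono[OF z2, of "norm (a-b)"] by simp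
 have t2: "norm (a * (cnj b - cnj a) * z)<=norm (a - b)"
  unfolding norm_mult cd using mult_left_mono[OF az, of "norm (a-b)"] by (simp add: mult_ac)
 have t3: "norm (cnj a * (a - b) * z)<=norm (a - b)"
  unfolding norm_mult using mult_left_mono[OF az, of "norm (a-b)"] by (simp add: mult_ac)
 have nXY: "norm (X - Y)<=4 * norm (a - b)"
  unfolding XY using t1 t2 t3
  using norm_triangle_ineq[of "(cnj a - cnj b) * z^2 - (a - b) + a * (cnj b - cnj a) * z" "cnj a * (a - b) * z"]
   norm_triangle_ineq[of "(cnj a - cnj b) * z^2 - (a - b)" "a * (cnj b - cnj a) * z"]
   norm_triangle_ineq4[of "(cnj a - cnj b) * z^2" "a - b"] by linarith
 have num: "norm (u * X - v * Y)<=4 * (norm (u - v) + norm (a - b))"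
 proof -
  have "u * X - v * Y = (u - v) * X + v * (X - Y)" by (simp add: algebra_simps)
  then have "norm (u * X - v * Y)<=norm (u - v) * norm X + norm (X - Y)"
   using norm_triangle_ineq[of "(u - v) * X" "v * (X - Y)"] assms by (simp add: norm_mult)
  then show ?thesis using nXY mult_left_mono[OF nX, of "norm (u - v)"] by simp
 qed
 have "mob u a z - mob v b z = (u * X - v * Y) / ((1 - cnj a * z) * (1 - cnj b * z))"
  unfolding mob_def X_def Y_def using nz by (simp add: divide_simps)
 then have "norm (mob u a z - mob v b z) = norm (u * X - v * Y) / norm ((1 - cnj a * z) * (1 - cnj b * z))"
  by (simp only: norm_divide)
 also have "...<=4 * (norm (u - v) + norm (a - b)) / (1 - r)^2"
  using num den assms by (intro frac_le) auto
 finally show ?thesis .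
qed

lemma infinite_two:
 assumes "infinite T"
 obtains x y where "x\<in>T" "y\<in>T" "x~=y"
proof -
 obtain x where x: "x\<in>T" using assms by (cases "T = {}") auto
 have "infinite (T - {x})" using assms by simp
 then obtain y where "y\<in>T - {x}" by (cases "T - {x} = {}") auto
 then show ?thesis using that[OF x] by blast
qed

locale fuchs =
 fixes G :: "(complex => complex) set"
 assumes fuchsian: "fuchsian_group G" and free: "free_subgroup D_group G"
begin

sublocale D: group D_group by (rule disk_group)

lemma G_subgroup: "subgroup G D_group" using fuchsian by (simp add: fuchsian_group_def)

lemma G_carrier: "g\<in>G ==> g\<in>carrier D_group" using G_subgroup subgroup.subset by blast

lemma G_moebius: "g\<in>G ==> g\<in>disk_moebius" using fuchsian by (auto simp: fuchsian_group_def)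

lemma G_one: "\<e>\<in>G" and G_mult: "g\<in>G ==> h\<in>G ==> g \<odot> h\<in>G"
 and G_inv: "g\<in>G ==> iv g\<in>G"
 using G_subgroup by (auto simp: subgroup_def intro: D.subgroupE)

lemma inv_inv_G [simp]: "g\<in>G ==> iv (iv g) = g" using G_carrier by simp

lemma act_mult: "g\<in>G ==> h\<in>G ==> norm z<=1 ==> (g \<odot> h) z = g (h z)"
 using D_mult G_carrier by (metis mem_cball_0)

lemma act_one: "norm z<=1 ==> \<e> z = z" using D_one by simp

lemma norm_act_le: "g\<in>G ==> norm z<=1 ==> norm (g z)<=1"
 using D_carrier_maps G_carrier by (metis mem_cball_0)

lemma act_inv [simp]: "g\<in>G ==> norm z<=1 ==> iv g (g z) = z"
 using act_mult[of "iv g" g z] G_inv G_carrier act_one by (simp add: D.l_inv)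

lemma act_inv' [simp]: "g\<in>G ==> norm z<=1 ==> g (iv g z) = z"
 using act_mult[of g "iv g" z] G_inv G_carrier act_one by (simp add: D.r_inv)

lemma act_inj: "g\<in>G ==> norm z<=1 ==> norm w<=1 ==> g z = g w ==> z = w"
 by (metis act_inv)

lemma G_ext: "g\<in>G ==> h\<in>G ==> (!!z. norm z<=1 ==> g z = h z) ==> g = h"
 by (rule D_ext) (auto intro: G_carrier)

lemma mf: assumes "g\<in>G"
 shows "norm (iv g 0) < 1" "norm (g 0) = norm (iv g 0)"
  and "!!z. norm z<=1 ==> dn g z = (1 - (norm (iv g 0))^2) / (norm (1 - cnj (iv g 0) * z))^2"
  and "!!z. norm z<=1 ==> 1 - (norm (g z))^2 = dn g z * (1 - (norm z)^2)"
  and "!!z w. norm z<=1 ==> norm w<=1 ==> (norm (g z - g w))^2 = dn g z * dn g w * (norm (z - w))^2"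
  and "EX u. norm u = 1 \<and> g = restrict (mob u (iv g 0)) U1"
  and "continuous_on U1 g"
 using disk_moebius_formulas[OF G_moebius[OF assms] G_carrier[OF assms]] by auto

lemma dn_pos: assumes "g\<in>G" "norm z<=1" shows "dn g z > 0"
proof -
 have "(norm (iv g 0))^2 < 1" using mf(1)[OF assms(1)] by (simp add: abs_square_less_1)
 moreover have "1 - cnj (iv g 0) * z~=0" using one_minus_cnj_mult_ne_0 mf(1) assms by auto
 ultimately show ?thesis by (simp add: mf(3)[OF assms])
qed

lemma norm_act_less: assumes "g\<in>G" "norm z < 1" shows "norm (g z) < 1"
proof -
 have "0 < 1 - (norm z)^2" using assms by (simp add: abs_square_less_1)
 then have "0 < 1 - (norm (g z))^2" using mf(4)[of g z] dn_pos[of g z] assms by simp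
 then show ?thesis by (simp add: abs_square_less_1)
qed

lemma norm_act_eq1: assumes "g\<in>G" "norm z = 1" shows "norm (g z) = 1"
 using mf(4)[of g z] assms norm_ge_zero[of "g z"] by (simp add: power2_eq_1_iff)

lemma dn_ge_iff: assumes "g\<in>G" "norm z < 1"
 shows "dn g z>=1 \<longleftrightarrow> norm (g z)<=norm z" "dn g z<=1 \<longleftrightarrow> norm (g z)>=norm z"
  "dn g z > 1 \<longleftrightarrow> norm (g z) < norm z" "dn g z = 1 \<longleftrightarrow> norm (g z) = norm z"
proof -
 have p: "0 < 1 - (norm z)^2" using assms by (simp add: abs_square_less_1)
 have e: "1 - (norm (g z))^2 = dn g z * (1 - (norm z)^2)" using mf(4) assms by simp
 have "dn g z>=1 \<longleftrightarrow> (norm (g z))^2<=(norm z)^2"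
  using mult_le_cancel_right_pos[OF p, of 1 "dn g z"] e by (smt (verit) mult_1)
 then show 1: "dn g z>=1 \<longleftrightarrow> norm (g z)<=norm z" by simp
 have "dn g z<=1 \<longleftrightarrow> (norm (g z))^2>=(norm z)^2"
  using mult_le_cancel_right_pos[OF p, of "dn g z" 1] e by (smt (verit) mult_1)
 then show 2: "dn g z<=1 \<longleftrightarrow> norm (g z)>=norm z" by simp
 show "dn g z > 1 \<longleftrightarrow> norm (g z) < norm z" "dn g z = 1 \<longleftrightarrow> norm (g z) = norm z"
  using 1 2 by linarith+
qed

text \<open>The chain rule without differentiation. Comparing the product formula for |g z - g w|^2
  of the composition with those of g and h shows that the quotient \<phi> of both sides satisfies
  \<phi> x * \<phi> y = 1 for all distinct points; three points give \<phi> = 1.\<close>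

lemma dn_mult: assumes g: "g\<in>G" and h: "h\<in>G" and z: "norm z<=1"
 shows "dn (g \<odot> h) z = dn g (h z) * dn h z"
proof -
 define \<phi> where "\<phi> x = dn (g \<odot> h) x / (dn g (h x) * dn h x)" for x
 have gh: "g \<odot> h\<in>G" using G_mult g h .
 have pos: "\<phi> x > 0" if "norm x<=1" for x
  unfolding \<phi>_def using dn_pos gh g h that norm_act_le by simp
 have pr: "\<phi> x * \<phi> y = 1" if "norm x<=1" "norm y<=1" "x~=y" for x y
 proof -
  have "dn (g \<odot> h) x * dn (g \<odot> h) y * (norm (x - y))^2 = 
   dn g (h x) * dn g (h y) * (dn h x * dn h y * (norm (x - y))^2)"
   using mf(5)[OF gh that(1,2)] mf(5)[OF g norm_act_le[OF h that(1)] norm_act_le[OF h that(2)]]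
    mf(5)[OF h that(1,2)] act_mult[OF g h] that by simp
  moreover have "(norm (x - y))^2~=0" using that by simp
  moreover have "dn g (h x) * dn h x~=0" "dn g (h y) * dn h y~=0"
   using dn_pos[OF g norm_act_le[OF h that(1)]] dn_pos[OF g norm_act_le[OF h that(2)]] dn_pos[OF h that(1)] dn_pos[OF h that(2)] by auto
  ultimately show ?thesis unfolding \<phi>_def by (simp add: field_simps)
 qed
 obtain x y where xy: "norm x<=1" "norm y<=1" "x~=y" "x~=z" "y~=z"
 proof -
  consider "z~=0 \<and> z~=1" | "z~=0 \<and> z ~= -1" | "z~=1 \<and> z ~= -1"
   by (cases "z = 0"; cases "z = 1") auto
  then show ?thesis
   by cases (auto intro: that[of 0 1] that[of 0 "-1"] that[of 1 "-1"])
 qed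
 have "\<phi> z * \<phi> z = (\<phi> z * \<phi> x) * (\<phi> z * \<phi> y) / (\<phi> x * \<phi> y)"
  using pos[OF xy(1)] pos[OF xy(2)] by simp
 then have "\<phi> z * \<phi> z = 1" using pr[OF z xy(1)] pr[OF z xy(2)] pr[OF xy(1,2)] xy by simp
 then have "(\<phi> z - 1) * (\<phi> z + 1) = 0" by algebra
 then have "\<phi> z = 1" using pos[OF z] by auto
 then show ?thesis unfolding \<phi>_def using dn_pos[OF g norm_act_le[OF h z]] dn_pos[OF h z] by simp
qed

lemma dn_one: "norm z<=1 ==> dn \<e> z = 1"
 using mf(3)[OF G_one, of z] act_one[of 0] by simp

lemma dn_inv: "g\<in>G ==> norm z<=1 ==> dn (iv g) (g z) * dn g z = 1"
 using dn_mult[of "iv g" g z] G_inv G_carrier dn_one by (simp add: D.l_inv)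

text \<open>Infinitely many such elements would have parameters accumulating in a compact set. Two
  of them with close parameters make inv h o g close to the identity, and discreteness at the
  identity makes them equal.\<close>

lemma finite_orbit_origin: assumes "r < 1" shows "finite {g\<in>G. norm (g 0)<=r}"
proof (rule ccontr)
 assume inf: "infinite {g\<in>G. norm (g 0)<=r}"
 let ?S = "{g\<in>G. norm (g 0)<=r}"
 have "ALL g:G. EX u. norm u = 1 \<and> g = restrict (mob u (iv g 0)) U1" using mf(6) by blast
 then obtain U where U: "!!g. g\<in>G ==> norm (U g) = 1" "!!g. g\<in>G ==> g = restrict (mob (U g) (iv g 0)) U1"
  by metis
 define par where "par g = (U g, iv g 0)" for g
 have inj: "inj_on par ?S"
  by (rule inj_onI) (metis (mono_tags, lifting) U(2) fst_conv mem_Collect_eq par_def snd_conv)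
 have cpt: "compact (cball (0::complex) 1 \<times> cball (0::complex) r)" by (intro compact_Times) auto
 have "par ` ?S\<subseteq>cball 0 1 \<times> cball 0 r"
  using U mf(2) by (auto simp: par_def)
 moreover have "infinite (par ` ?S)" using inf inj finite_imageD by blast
 ultimately obtain x where x: "x islimpt par ` ?S"
  using cpt unfolding compact_eq_Bolzano_Weierstrass by blast
 obtain e where e: "e > 0" "!!h. h\<in>G ==> (ALL z:cball 0 1. dist (h z) (\<e> z) < e) ==> h = \<e>"
  using fuchsian G_one unfolding fuchsian_group_def by meson
 \<comment> \<open>|g z - h z| is below 8 d / (1 - r)^2, and inv h is Lipschitz with constant 1 / (1
   - r)^2; the result is e / 2.\<close>
 define d where "d = e * (1 - r)^4 / 16"
 have dpos: "d > 0" using e assms by (simp add: d_def)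
 have "infinite (par ` ?S Int ball x (d/2))"
  using x dpos by (simp add: islimpt_eq_infinite_ball)
 then obtain P Q where PQ: "P\<in>par ` ?S Int ball x (d/2)" "Q\<in>par ` ?S Int ball x (d/2)" "P~=Q"
  by (rule infinite_two)
 obtain g h where g: "g\<in>G" "norm (g 0)<=r" "P = par g" and h: "h\<in>G" "norm (h 0)<=r" "Q = par h"
  using PQ by auto
 have "dist P Q < d" using PQ dist_triangle_half_r[of x P d Q] by (auto simp: dist_commute)
 then have "dist (U g) (U h) < d" "dist (iv g 0) (iv h 0) < d"
  unfolding g h par_def dist_Pair_Pair
  by (meson real_sqrt_sum_squares_ge1 real_sqrt_sum_squares_ge2 order.strict_trans1)+
 then have close: "norm (U g - U h) + norm (iv g 0 - iv h 0) < 2 * d" by (simp add: dist_norm)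
 have na: "norm (iv g 0)<=r" "norm (iv h 0)<=r" using g h mf(2) by auto
 let ?k = "iv h \<odot> g"
 have kG: "?k\<in>G" using G_mult G_inv g h by simp
 have ih: "iv h\<in>G" using G_inv h by simp
 have r2: "norm (iv (iv h) 0)<=r" using h by simp
 have "dist (?k z) (\<e> z) < e" if z: "z\<in>cball 0 1" for z
 proof -
  have z1: "norm z<=1" using z by simp
  have 1: "norm (g z - h z)<=4 * (norm (U g - U h) + norm (iv g 0 - iv h 0)) / (1 - r)^2"
  proof -
   have "g z = mob (U g) (iv g 0) z" "h z = mob (U h) (iv h 0) z"
    using U(2)[OF g(1)] U(2)[OF h(1)] z by (metis restrict_apply')+
   then show ?thesis using mob_param_lip[OF na assms U(1)[OF g(1)] U(1)[OF h(1)] z1] by simp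
  qed
  have 2: "norm (iv h (g z) - iv h (h z))<=norm (g z - h z) / (1 - r)^2"
  proof -
   have "g z\<in>U1" "h z\<in>U1" using norm_act_le g h z1 by auto
   moreover obtain u where "norm u = 1" "iv h = restrict (mob u (iv (iv h) 0)) U1" using mf(6)[OF ih] by blast
   ultimately show ?thesis using mob_lip[OF r2 assms, of u "g z" "h z"] by (metis mem_cball_0 restrict_apply')
  qed
  have rp: "0 < (1 - r)^2" using assms by simp
  have "norm (g z - h z) < 4 * (2 * d) / (1 - r)^2"
   using 1 close rp by (smt (verit) divide_strict_right_mono)
  then have "norm (g z - h z) / (1 - r)^2 < 4 * (2 * d) / (1 - r)^2 / (1 - r)^2"
   using rp divide_strict_right_mono by blast
  also have "... = e / 2"
  proof -
   have "4 * (2 * (e * q^4 / 16)) / q^2 / q^2 = e / 2" if "q~=0" for q :: real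
    using that by (simp add: field_simps power4_eq_xxxx power2_eq_square)
   from this[of "1 - r"] show ?thesis using assms by (simp add: d_def)
  qed
  also have "... < e" using e by simp
  finally have "norm (iv h (g z) - iv h (h z)) < e" using 2 by linarith
  then show ?thesis using z1 g h ih act_mult act_one by (simp add: dist_norm)
 qed
 then have "?k = \<e>" using e(2) kG by blast
 then have "iv g = iv h" using D.inv_equality[of "iv h" g] G_carrier g h G_inv by simp
 then have "g = h" using g h by (metis inv_inv_G)
 then show False using PQ g h by simp
qed

lemma norm_origin_bound: assumes "g\<in>G" "norm w < 1"
 shows "(norm (g 0))^2<=1 - (1 - norm w)^2 * (1 - (norm (g w))^2)"
proof -
 let ?a = "iv g 0"
 have "norm (cnj ?a * w)<=1 * norm w" unfolding norm_mult
  using mf(1)[OF assms(1)] by (intro mult_right_mono) auto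
 then have l: "1 - norm w<=norm (1 - cnj ?a * w)"
  using norm_triangle_ineq2[of 1 "cnj ?a * w"] by simp
 have l2: "(1 - norm w)^2<=(norm (1 - cnj ?a * w))^2" using l assms by (intro power_mono) auto
 have p: "0 < (1 - norm w)^2" using assms by simp
 have a1: "0<=1 - (norm ?a)^2" using mf(1)[OF assms(1)] by (simp add: abs_square_le_1)
 have "1 - (norm (g w))^2 = dn g w * (1 - (norm w)^2)" using mf(4) assms by simp
 also have "...<=dn g w * 1" using dn_pos[of g w] assms by (intro mult_left_mono) auto
 also have "... = (1 - (norm ?a)^2) / (norm (1 - cnj ?a * w))^2" using mf(3) assms by simp
 also have "...<=(1 - (norm ?a)^2) / (1 - norm w)^2" using l2 p a1 by (intro frac_le) auto
 finally have "(1 - norm w)^2 * (1 - (norm (g w))^2)<=1 - (norm ?a)^2"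
  using p by (simp add: field_simps)
 then show ?thesis using mf(2)[OF assms(1)] by simp
qed

text \<open>Uniform in "w", so that it also bounds the number of returns of an orbit to a compact set.\<close>

lemma finite_returns: assumes "r < 1"
 shows "finite {g\<in>G. EX w. norm w<=r \<and> norm (g w)<=r}"
proof (cases "r < 0")
 case True
 then have "{g\<in>G. EX w. norm w<=r \<and> norm (g w)<=r} = {}"
  by (smt (verit) Collect_empty_eq norm_ge_zero)
 then show ?thesis by (simp only: finite.emptyI)
next
 case False
 define s where "s = 1 - (1 - r)^2 * (1 - r^2)"
 have r2: "0 < 1 - r^2" using False assms by (simp add: abs_square_less_1)
 then have s: "s < 1" using assms by (simp add: s_def)
 have "(1 - r)^2 * (1 - r^2)<=1 * 1" using False assms r2
  by (intro mult_mono power_le_one) auto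
 then have s0: "s>=0" by (simp add: s_def)
 have "norm (g 0)<=sqrt s" if "g\<in>G" "norm w<=r" "norm (g w)<=r" for g w
 proof -
  have "(1 - r)^2 * (1 - r^2)<=(1 - norm w)^2 * (1 - (norm (g w))^2)"
   using that assms r2 False by (intro mult_mono power_mono) (auto intro: power_mono)
  then have "(norm (g 0))^2<=s" using norm_origin_bound[of g w] that assms unfolding s_def by simp
  then show ?thesis using real_le_rsqrt by blast
 qed
 then have "{g\<in>G. EX w. norm w<=r \<and> norm (g w)<=r}\<subseteq>{g\<in>G. norm (g 0)<=sqrt s}" by blast
 moreover have "sqrt s < 1" using s by simp
 ultimately show ?thesis using finite_orbit_origin finite_subset by blast
qed

lemma G_pow: "g\<in>G ==> g [^]\<^bsub>D_group\<^esub> (n::nat)\<in>G"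
 by (induction n) (auto simp: G_one G_mult)

text \<open>All powers of g would fix w and hence lie in the finite set of
  \<open>finite_returns\<close>, giving g finite order in a torsion-free group.\<close>

lemma no_fixed_point: assumes "g\<in>G" "g~=\<e>" "norm w < 1" shows "g w~=w"
proof
 assume fx: "g w = w"
 obtain S where S: "free_basis D_group G S" using free by (auto simp: free_subgroup_def)
 have Sc: "S\<subseteq>carrier D_group" using S G_carrier by (auto simp: free_basis_def)
 have fxn: "(g [^]\<^bsub>D_group\<^esub> (n::nat)) w = w" for n
 proof (induction n)
  case (Suc n) then show ?case using act_mult[OF G_pow[OF assms(1)] assms(1)] fx assms by simp
 qed (use act_one assms in simp)
 have "range (%n::nat. g [^]\<^bsub>D_group\<^esub> n)\<subseteq>{g\<in>G. EX v. norm v<=norm w \<and> norm (g v)<=norm w}"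
  using fxn G_pow[OF assms(1)] by (auto intro!: exI[of _ w])
 then have "finite (range (%n::nat. g [^]\<^bsub>D_group\<^esub> n))"
  using finite_returns[OF assms(3)] finite_subset by blast
 then have "\<not> inj (%n::nat. g [^]\<^bsub>D_group\<^esub> n)" using finite_imageD infinite_UNIV_nat by blast
 then obtain m n :: nat where mn: "m < n" "g [^]\<^bsub>D_group\<^esub> m = g [^]\<^bsub>D_group\<^esub> n"
  unfolding inj_def by (metis linorder_neqE_nat)
 have gc: "g\<in>carrier D_group" using G_carrier assms by simp
 have "g [^]\<^bsub>D_group\<^esub> m \<odot> g [^]\<^bsub>D_group\<^esub> (n - m) = g [^]\<^bsub>D_group\<^esub> m"
  using mn D.nat_pow_mult[OF gc, of m "n - m"] by simp
 then have "g [^]\<^bsub>D_group\<^esub> (n - m) = \<e>" using gc by (simp add: D.r_cancel_one)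
 then show False using D.free_basis_torsion_free[OF S Sc assms(1,2)] mn by simp
qed

end

subsection \<open>Dirichlet domains in the Klein model\<close>

text \<open>Beltrami-Klein coordinates: the change of model that straightens geodesics into chords
  and fixes every point of the circle.\<close>

definition klein :: "complex => complex" where
 "klein z = (2 / (1 + (norm z)^2)) *\<^sub>R z"

definition klein_inv :: "complex => complex" where
 "klein_inv x = (1 / (1 + sqrt (1 - (norm x)^2))) *\<^sub>R x"

lemma klein_sphere: "norm z = 1 ==> klein z = z"
 by (simp add: klein_def)

lemma norm_klein: "norm (klein z) = 2 * norm z / (1 + (norm z)^2)"
 by (simp add: klein_def)

lemma klein_norm_compl: "1 - (norm (klein z))^2 = ((1 - (norm z)^2) / (1 + (norm z)^2))^2"
proof -
 have "1 + (norm z)^2~=0" by (smt (verit) zero_le_power2)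
 then show ?thesis unfolding norm_klein power_divide
  by (simp add: diff_divide_eq_iff) (simp add: power2_eq_square algebra_simps)
qed

lemma klein_norm_le: "norm (klein z)<=1"
proof -
 have "(norm (klein z))^2<=1"
  using klein_norm_compl[of z] zero_le_power2[of "(1 - (norm z)^2) / (1 + (norm z)^2)"] by linarith
 then show ?thesis by (simp add: abs_square_le_1)
qed

lemma klein_norm_less: assumes "norm z < 1" shows "norm (klein z) < 1"
proof -
 have "0 < 1 - (norm z)^2" using assms by (simp add: abs_square_less_1)
 then have "0 < (1 - (norm z)^2) / (1 + (norm z)^2)" by (simp add: add_pos_nonneg)
 then have "0 < 1 - (norm (klein z))^2" unfolding klein_norm_compl by (rule zero_less_power)
 then show ?thesis by (simp add: abs_square_less_1)
qed

lemma klein_klein_inv: assumes "norm x<=1" shows "klein (klein_inv x) = x"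
proof -
 define q where "q = sqrt (1 - (norm x)^2)"
 have q: "q>=0" "q^2 = 1 - (norm x)^2" using assms by (auto simp: q_def abs_square_le_1)
 have q1: "1 + q > 0" using q by simp
 have n: "(norm (klein_inv x))^2 = (1 - q) / (1 + q)"
 proof -
  have "(norm (klein_inv x))^2 = (norm x)^2 / (1 + q)^2"
   using q by (simp add: klein_inv_def q_def[symmetric] power_divide)
  also have "(norm x)^2 = (1 - q) * (1 + q)" using q by (simp add: algebra_simps power2_eq_square)
  finally show ?thesis using q1 by (simp add: power2_eq_square)
 qed
 have "2 / (1 + (1 - q) / (1 + q)) = 1 + q" using q1 by (simp add: field_simps)
 then show ?thesis unfolding klein_def n using q1
  by (simp add: klein_inv_def q_def[symmetric])
qed

lemma klein_inv_klein: assumes "norm z<=1" shows "klein_inv (klein z) = z"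
proof -
 have p: "1 + (norm z)^2 > 0" by (simp add: add_pos_nonneg)
 have "0<=1 - (norm z)^2" using assms by (simp add: abs_square_le_1)
 then have "sqrt (1 - (norm (klein z))^2) = (1 - (norm z)^2) / (1 + (norm z)^2)"
  unfolding klein_norm_compl using p by (simp add: real_sqrt_unique)
 then have e: "1 + sqrt (1 - (norm (klein z))^2) = 2 / (1 + (norm z)^2)"
  using p by (simp add: field_simps)
 have "1 / (2 / (1 + (norm z)^2)) * (2 / (1 + (norm z)^2)) = 1" using p by simp
 moreover have "klein_inv (klein z) = (1 / (2 / (1 + (norm z)^2))) *\<^sub>R klein z"
  unfolding klein_inv_def e ..
 ultimately show ?thesis by (simp only: klein_def[of z] scaleR_scaleR) simp
qed

lemma klein_inv_norm_le: assumes "norm x<=1" shows "norm (klein_inv x)<=norm x"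
proof -
 define q where "q = sqrt (1 - (norm x)^2)"
 have q: "q>=0" using assms by (simp add: abs_square_le_1 q_def)
 have "norm x * 1<=norm x * (1 + q)" using q by (intro mult_left_mono) auto
 then have "norm x / (1 + q)<=norm x" using q by (simp add: divide_le_eq)
 then show ?thesis using q by (simp add: klein_inv_def q_def[symmetric])
qed

lemma continuous_klein: "continuous_on S klein"
proof -
 have "1 + (norm z)^2~=0" for z :: complex
  by (smt (verit) zero_le_power2)
 then show ?thesis unfolding klein_def by (intro continuous_intros) auto
qed

lemma continuous_klein_inv: "continuous_on (cball 0 1) klein_inv"
proof -
 have "1 + sqrt (1 - (norm x)^2)~=0" if "norm x<=1" for x :: complex
 proof -
  have "0<=1 - (norm x)^2" using that by (simp add: abs_square_le_1)
  then have "0<=sqrt (1 - (norm x)^2)" by simp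
  then show ?thesis by linarith
 qed
 then show ?thesis unfolding klein_inv_def by (intro continuous_intros) auto
qed

text \<open>A monotone function of the hyperbolic distance: the square of the hyperbolic sine of half of it.\<close>

definition hyp_quot :: "complex => complex => real" where
 "hyp_quot z w = (norm (z - w))^2 / ((1 - (norm z)^2) * (1 - (norm w)^2))"

lemma hyp_quot_nonneg: "norm z < 1 ==> norm w < 1 ==> hyp_quot z w>=0"
 unfolding hyp_quot_def by (intro divide_nonneg_nonneg mult_nonneg_nonneg) (auto simp: abs_square_le_1)

lemma hyp_quot_eq_0: "norm z < 1 ==> norm w < 1 ==> hyp_quot z w = 0 \<longleftrightarrow> z = w"
 unfolding hyp_quot_def using abs_square_less_1[of "norm z"] abs_square_less_1[of "norm w"] by auto

lemma Moebius_hyp_quot: assumes "norm z < 1" "norm w < 1"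
 shows "(norm (Moebius_function 0 w z))^2 = hyp_quot z w / (1 + hyp_quot z w)"
proof -
 let ?P = "(1 - (norm z)^2) * (1 - (norm w)^2)"
 have P: "?P > 0" using assms by (intro mult_pos_pos) (auto simp: abs_square_less_1)
 have "(norm (1 - cnj w * z))^2 = (norm (z - w))^2 + ?P"
  using cmod_sq_ident[of w z] by (simp add: mult.commute)
 then have "(norm (Moebius_function 0 w z))^2 = (norm (z - w))^2 / ((norm (z - w))^2 + ?P)"
  by (simp add: Moebius_function_simple norm_divide power_divide)
 moreover have "d / (d + q) = d / q / (1 + d / q)" if "q > 0" "d>=0" for d q :: real
  using that by (simp add: field_simps)
 ultimately show ?thesis using P unfolding hyp_quot_def by simp
qed

lemma artanh_less_iff: fixes x y :: real
 assumes "0<=x" "x < 1" "0<=y" "y < 1" shows "artanh x < artanh y \<longleftrightarrow> x < y"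
proof -
 have "(1 + x) / (1 - x) < (1 + y) / (1 - y) \<longleftrightarrow> x < y"
  using assms by (simp add: divide_simps) (auto simp: algebra_simps)
 then show ?thesis unfolding artanh_def using assms by simp
qed

lemma hyp_dist_less_iff: assumes "norm z < 1" "norm w < 1" "norm w' < 1"
 shows "hyp_dist z w < hyp_dist z w' \<longleftrightarrow> hyp_quot z w < hyp_quot z w'"
proof -
 let ?M = "%w. norm (Moebius_function 0 w z)"
 have "?M w < 1" "?M w' < 1" using Moebius_function_norm_lt_1 assms by auto
 then have "hyp_dist z w < hyp_dist z w' \<longleftrightarrow> ?M w < ?M w'"
  unfolding hyp_dist_def using artanh_less_iff[of "?M w" "?M w'"] by simp
 also have "... \<longleftrightarrow> (?M w)^2 < (?M w')^2"
  using power_mono_iff[of "?M w'" "?M w" 2] by (smt (verit) norm_ge_zero pos2)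
 also have "... \<longleftrightarrow> hyp_quot z w < hyp_quot z w'"
  unfolding Moebius_hyp_quot[OF assms(1,2)] Moebius_hyp_quot[OF assms(1,3)]
 proof -
  have "d / (1 + d) < e / (1 + e) \<longleftrightarrow> d < e" if "d>=0" "e>=0" for d e :: real
  proof -
   have "d / (1 + d) < e / (1 + e) \<longleftrightarrow> d * (1 + e) < e * (1 + d)" using that by (simp add: divide_simps)
   then show ?thesis by (simp add: algebra_simps)
  qed
  then show "hyp_quot z w / (1 + hyp_quot z w) < hyp_quot z w' / (1 + hyp_quot z w') \<longleftrightarrow> hyp_quot z w < hyp_quot z w'"
   using hyp_quot_nonneg[OF assms(1,2)] hyp_quot_nonneg[OF assms(1,3)] by blast
 qed
 finally show ?thesis .
qed

text \<open>In the Klein model the hyperbolic distance from a fixed point is an affine function up to a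
 factor that does not depend on the fixed point.\<close>

lemma hyp_quot_affine: assumes "norm z < 1" "norm w < 1"
 shows "2 * (1 - (norm z)^2) * hyp_quot z w = (1 + (norm z)^2) *
  ((1 + (norm w)^2) / (1 - (norm w)^2) - (2 / (1 - (norm w)^2)) * (w \<bullet> klein z)) - (1 - (norm z)^2)"
proof -
 have z: "1 - (norm z)^2 > 0" and w: "1 - (norm w)^2 > 0" using assms by (auto simp: abs_square_less_1)
 have p: "1 + (norm z)^2 > 0" by (simp add: add_pos_nonneg)
 have d: "(norm (z - w))^2 = (norm z)^2 + (norm w)^2 - 2 * (w \<bullet> z)"
  by (simp add: power2_norm_eq_inner inner_diff inner_commute)
 have k: "(1 + (norm z)^2) * (w \<bullet> klein z) = 2 * (w \<bullet> z)" using p by (simp add: klein_def)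
 have "2 * (1 - (norm z)^2) * hyp_quot z w = 2 * ((norm z)^2 + (norm w)^2 - 2 * (w \<bullet> z)) / (1 - (norm w)^2)"
 proof -
  have "2 * Z * (D / (Z * W)) = 2 * D / W" if "Z > 0" for Z W D :: real using that by simp
  then show ?thesis using z unfolding hyp_quot_def d by blast
 qed
 also have "... = ((1 + (norm z)^2) * (1 + (norm w)^2) - 2 * (2 * (w \<bullet> z)) - (1 - (norm z)^2) * (1 - (norm w)^2)) / (1 - (norm w)^2)"
  by (simp add: algebra_simps)
 also have "... = (1 + (norm z)^2) *
  ((1 + (norm w)^2) / (1 - (norm w)^2) - (2 / (1 - (norm w)^2)) * (w \<bullet> klein z)) - (1 - (norm z)^2)"
 proof -
  have "(K' * A - 2 * (K' * B) - Z * W) / W = K' * (A / W - 2 / W * B) - Z" if "W > 0" for K' A B Z W :: real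
   using that by (simp add: field_simps)
  then show ?thesis unfolding k[symmetric] using w by blast
 qed
 finally show ?thesis .
qed

context fuchs
begin

lemma hyp_quot_invariant: assumes "g\<in>G" "norm z < 1" "norm w < 1"
 shows "hyp_quot (g z) (g w) = hyp_quot z w"
 using mf(4)[OF assms(1), of z] mf(4)[OF assms(1), of w] mf(5)[OF assms(1), of z w] assms
  dn_pos[of g z] dn_pos[of g w] by (simp add: hyp_quot_def)

lemma hyp_quot_inv: assumes "g\<in>G" "norm z < 1" "norm w < 1"
 shows "hyp_quot z (iv g w) = hyp_quot (g z) w"
 using hyp_quot_invariant[OF assms(1,2), of "iv g w"] assms G_inv norm_act_less by simp

text \<open>The isometric circle is a straight chord in the Klein model.\<close>

lemma dn_klein: assumes "g\<in>G" "norm z<=1"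
 shows "dn g z > 1 \<longleftrightarrow> (norm (iv g 0))^2 - iv g 0 \<bullet> klein z < 0"
  "dn g z = 1 \<longleftrightarrow> (norm (iv g 0))^2 - iv g 0 \<bullet> klein z = 0"
  "dn g z < 1 \<longleftrightarrow> (norm (iv g 0))^2 - iv g 0 \<bullet> klein z > 0"
proof -
 let ?a = "iv g 0"
 have p: "1 + (norm z)^2 > 0" by (simp add: add_pos_nonneg)
 have n: "(norm (1 - cnj ?a * z))^2 > 0" using one_minus_cnj_mult_ne_0[OF mf(1)[OF assms(1)] assms(2)] by simp
 have "(norm (1 - cnj ?a * z))^2 = 1 - 2 * (?a \<bullet> z) + (norm ?a)^2 * (norm z)^2"
  unfolding cmod_power2 inner_complex_def by (simp add: power2_eq_square algebra_simps)
 moreover have "(1 + (norm z)^2) * (?a \<bullet> klein z) = 2 * (?a \<bullet> z)" using p by (simp add: klein_def)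
 ultimately have e: "(norm (1 - cnj ?a * z))^2 - (1 - (norm ?a)^2) = (1 + (norm z)^2) * ((norm ?a)^2 - ?a \<bullet> klein z)"
  by (simp add: algebra_simps)
 have d: "dn g z = (1 - (norm ?a)^2) / (norm (1 - cnj ?a * z))^2" using mf(3) assms by simp
 have 1: "dn g z > 1 \<longleftrightarrow> (1 + (norm z)^2) * ((norm ?a)^2 - ?a \<bullet> klein z) < 0"
  unfolding d e[symmetric] using n by (simp add: less_divide_eq)
 have 2: "dn g z < 1 \<longleftrightarrow> (1 + (norm z)^2) * ((norm ?a)^2 - ?a \<bullet> klein z) > 0"
  unfolding d e[symmetric] using n by (simp add: divide_less_eq)
 show 3: "dn g z > 1 \<longleftrightarrow> (norm ?a)^2 - ?a \<bullet> klein z < 0" unfolding 1 using p by (simp add: mult_less_0_iff)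
 show 4: "dn g z < 1 \<longleftrightarrow> (norm ?a)^2 - ?a \<bullet> klein z > 0" unfolding 2 using p by (simp add: zero_less_mult_iff)
 show "dn g z = 1 \<longleftrightarrow> (norm ?a)^2 - ?a \<bullet> klein z = 0" using 3 4 by linarith
qed

end

locale dirichlet = fuchs +
 fixes c :: complex
 assumes c1: "norm c < 1"
begin

text \<open>Coefficients of the affine function of the bisector of c and inv g c, read off from
  \<open>hyp_quot_affine\<close>. The index g belongs to the translate by inv g, as in
  \<open>side_of\<close>, so that g carries its face to that of inv g.\<close>

definition "\<alpha> g = (1 + (norm (iv g c))^2) / (1 - (norm (iv g c))^2) - (1 + (norm c)^2) / (1 - (norm c)^2)"
definition "\<beta> g = (2 / (1 - (norm (iv g c))^2)) *\<^sub>R iv g c - (2 / (1 - (norm c)^2)) *\<^sub>R c"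

lemma inv_c1: "g\<in>G ==> norm (iv g c) < 1" using norm_act_less G_inv c1 by blast

lemma inv_ne_one: "g\<in>G ==> g~=\<e> ==> iv g~=\<e>"
 by (metis inv_inv_G D.inv_one)

lemma inv_c_ne: "g\<in>G ==> g~=\<e> ==> iv g c~=c"
 using no_fixed_point[OF G_inv] inv_ne_one c1 by blast

lemma affine_hyp_quot: assumes "g\<in>G" "norm z < 1"
 shows "(1 + (norm z)^2) * (\<alpha> g - \<beta> g \<bullet> klein z) = 2 * (1 - (norm z)^2) * (hyp_quot z (iv g c) - hyp_quot z c)"
 unfolding right_diff_distrib[of "2 * (1 - (norm z)^2)"]
  hyp_quot_affine[OF assms(2) inv_c1[OF assms(1)]] hyp_quot_affine[OF assms(2) c1] \<alpha>_def \<beta>_def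
 by (simp add: inner_diff_left algebra_simps)

lemma affine_iff: assumes "g\<in>G" "norm z < 1"
 shows "\<alpha> g - \<beta> g \<bullet> klein z > 0 \<longleftrightarrow> hyp_quot z c < hyp_quot z (iv g c)"
  "\<alpha> g - \<beta> g \<bullet> klein z>=0 \<longleftrightarrow> hyp_quot z c<=hyp_quot z (iv g c)"
  "\<alpha> g - \<beta> g \<bullet> klein z = 0 \<longleftrightarrow> hyp_quot z c = hyp_quot z (iv g c)"
proof -
 have p: "1 + (norm z)^2 > 0" by (simp add: add_pos_nonneg)
 have z: "2 * (1 - (norm z)^2) > 0" using assms by (simp add: abs_square_less_1)
 show 1: "\<alpha> g - \<beta> g \<bullet> klein z > 0 \<longleftrightarrow> hyp_quot z c < hyp_quot z (iv g c)"
  using zero_less_mult_iff[of "1 + (norm z)^2" "\<alpha> g - \<beta> g \<bullet> klein z"] 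
   zero_less_mult_iff[of "2 * (1 - (norm z)^2)" "hyp_quot z (iv g c) - hyp_quot z c"] affine_hyp_quot[OF assms] p z by (smt (verit))
 show 2: "\<alpha> g - \<beta> g \<bullet> klein z>=0 \<longleftrightarrow> hyp_quot z c<=hyp_quot z (iv g c)"
  using zero_le_mult_iff[of "1 + (norm z)^2" "\<alpha> g - \<beta> g \<bullet> klein z"] 
   zero_le_mult_iff[of "2 * (1 - (norm z)^2)" "hyp_quot z (iv g c) - hyp_quot z c"] affine_hyp_quot[OF assms] p z by (smt (verit))
 show "\<alpha> g - \<beta> g \<bullet> klein z = 0 \<longleftrightarrow> hyp_quot z c = hyp_quot z (iv g c)" using 1 2 by linarith
qed

text \<open>If some x with |x| <= r violates the half plane of g, then inv g c stays away from the
  circle: its term in the affine function is at least (1 - r) / (1 - |inv g c|^2), while the term of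
  c is at most C.\<close>

lemma affine_locally_finite: assumes "r < 1"
 shows "finite {g\<in>G - {\<e>}. EX x. norm x<=r \<and> \<alpha> g - \<beta> g \<bullet> x<=0}" (is "finite ?S")
proof -
 define C where "C = (1 + norm c) / (1 - norm c)"
 have C: "C>=1" using c1 by (simp add: C_def)
 define s where "s = max (norm c) (sqrt (1 - (1 - r) / C))"
 have s1: "s < 1" using c1 assms C by (simp add: s_def real_less_lsqrt)
 have "norm (iv g c)<=s" if g: "g\<in>G" and x: "norm x<=r" "\<alpha> g - \<beta> g \<bullet> x<=0" for g x
 proof -
  let ?w = "iv g c"
  have r0: "0<=r" using x norm_ge_zero order_trans by blast
  have w: "1 - (norm ?w)^2 > 0" using inv_c1[OF g] by (simp add: abs_square_less_1)
  have cc: "1 - (norm c)^2 > 0" using c1 by (simp add: abs_square_less_1)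
  have "?w \<bullet> x<=norm ?w * r" using norm_cauchy_schwarz[of ?w x] x mult_left_mono[of "norm x" r "norm ?w"] by simp
  moreover have "2 * (norm ?w * r)<=(1 + (norm ?w)^2) * r"
   using mult_right_mono[OF _ r0, of "2 * norm ?w" "1 + (norm ?w)^2"] sum_squares_bound[of 1 "norm ?w"] by (simp add: mult.assoc)
  ultimately have "(1 + (norm ?w)^2) * (1 - r)<=(1 + (norm ?w)^2) - 2 * (?w \<bullet> x)" by (simp add: algebra_simps)
  moreover have "1 - r<=(1 + (norm ?w)^2) * (1 - r)" using mult_right_mono[of 1 "1 + (norm ?w)^2" "1 - r"] assms by simp
  ultimately have 1: "(1 - r) / (1 - (norm ?w)^2)<=((1 + (norm ?w)^2) - 2 * (?w \<bullet> x)) / (1 - (norm ?w)^2)"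
   using w by (intro divide_right_mono) auto
  have "- (c \<bullet> x)<=norm c * norm x" using Cauchy_Schwarz_ineq2[of c x] by simp
  also have "...<=norm c * 1" using x assms by (intro mult_left_mono) auto
  finally have "(1 + (norm c)^2) - 2 * (c \<bullet> x)<=(1 + norm c)^2" by (simp add: power2_eq_square algebra_simps)
  then have "((1 + (norm c)^2) - 2 * (c \<bullet> x)) / (1 - (norm c)^2)<=(1 + norm c)^2 / (1 - (norm c)^2)"
   using cc by (intro divide_right_mono) auto
  also have "... = C"
  proof -
   have "1 - (norm c)^2 = (1 + norm c) * (1 - norm c)" by (simp add: algebra_simps power2_eq_square)
   moreover have "1 + norm c~=0" by (metis add_nonneg_eq_0_iff norm_ge_zero zero_le_one zero_neq_one)
   ultimately show ?thesis unfolding C_def by (simp add: power2_eq_square)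
  qed
  finally have "((1 + (norm c)^2) - 2 * (c \<bullet> x)) / (1 - (norm c)^2)<=C" .
  moreover have "\<alpha> g - \<beta> g \<bullet> x = ((1 + (norm ?w)^2) - 2 * (?w \<bullet> x)) / (1 - (norm ?w)^2) - ((1 + (norm c)^2) - 2 * (c \<bullet> x)) / (1 - (norm c)^2)"
   unfolding \<alpha>_def \<beta>_def by (simp add: inner_diff_left diff_divide_distrib)
  ultimately have "(1 - r) / (1 - (norm ?w)^2)<=C" using 1 x(2) by linarith
  then have "(1 - r) / C<=1 - (norm ?w)^2" using w C by (simp add: field_simps)
  then have "norm ?w<=sqrt (1 - (1 - r) / C)" by (intro real_le_rsqrt) simp
  then show ?thesis by (simp add: s_def)
 qed
 then have "?S\<subseteq>iv ` {g\<in>G. EX w. norm w<=s \<and> norm (g w)<=s}" (is "_\<subseteq>iv ` ?T")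
 proof (intro subsetI)
  fix g assume small: "!!g x. g\<in>G ==> norm x<=r ==> \<alpha> g - \<beta> g \<bullet> x<=0 ==> norm (iv g c)<=s" and "g\<in>?S"
  then have g: "g\<in>G" "norm (iv g c)<=s" by auto
  moreover have "norm c<=s" by (simp add: s_def)
  ultimately have "iv g\<in>?T" using G_inv by blast
  moreover have "g = iv (iv g)" using g by simp
  ultimately show "g\<in>iv ` ?T" by blast
 qed
 then show ?thesis using finite_returns[OF s1] finite_surj by blast
qed

sublocale HP: half_planes "G - {\<e>}" \<alpha> \<beta> "klein c"
proof
 show "norm (klein c) < 1" using klein_norm_less c1 .
 show "\<alpha> i - \<beta> i \<bullet> klein c > 0" if "i\<in>G - {\<e>}" for i
  using that affine_iff(1)[of i c] inv_c_ne[of i] hyp_quot_eq_0[OF c1 inv_c1[of i]] hyp_quot_eq_0[OF c1 c1]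
   hyp_quot_nonneg[OF c1 inv_c1[of i]] c1 by (auto simp: less_le)
 show "finite {i\<in>G - {\<e>}. EX x. norm x<=r \<and> \<alpha> i - \<beta> i \<bullet> x<=0}" if "r < 1" for r
  using affine_locally_finite[OF that] .
qed

lemma dirichlet_domain_klein:
 "dirichlet_domain G c = {z. norm z < 1 \<and> (ALL g:G - {\<e>}. HP.L g (klein z) > 0)}"
proof -
 have "(ALL g:G - {\<e>}. hyp_dist z c < hyp_dist z (g c)) \<longleftrightarrow> (ALL g:G - {\<e>}. HP.L g (klein z) > 0)" if "norm z < 1" for z
 proof -
  have "(ALL g:G - {\<e>}. HP.L g (klein z) > 0) \<longleftrightarrow> (ALL g:G - {\<e>}. hyp_quot z c < hyp_quot z (iv g c))"
   using affine_iff(1) that by (simp add: HP.L_def)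
  also have "... \<longleftrightarrow> (ALL g:G - {\<e>}. hyp_quot z c < hyp_quot z (g c))"
   using G_inv inv_ne_one inv_inv_G by (metis Diff_iff singletonD singletonI)
  also have "... \<longleftrightarrow> (ALL g:G - {\<e>}. hyp_dist z c < hyp_dist z (g c))"
   using hyp_dist_less_iff[OF that c1] norm_act_less c1 by simp
  finally show ?thesis by simp
 qed
 then show ?thesis unfolding dirichlet_domain_def by auto
qed

text \<open>Moving a point of the region towards c in Klein coordinates makes every weak inequality
  strict.\<close>

lemma closure_dirichlet_domain:
 assumes "norm z < 1"
 shows "z\<in>closure (dirichlet_domain G c) \<longleftrightarrow> klein z\<in>HP.region"
proof
 assume z: "z\<in>closure (dirichlet_domain G c)"
 have "HP.L g (klein z)>=0" if "g\<in>G - {\<e>}" for g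
 proof -
  have "closed {z. HP.L g (klein z)>=0}"
   unfolding HP.L_def by (intro closed_Collect_le continuous_intros continuous_on_compose2[OF continuous_klein[of UNIV]]) auto
  moreover have "dirichlet_domain G c\<subseteq>{z. HP.L g (klein z)>=0}"
   using that unfolding dirichlet_domain_klein by (auto simp: less_imp_le)
  ultimately show ?thesis using z closure_minimal by blast
 qed
 then show "klein z\<in>HP.region" using klein_norm_less[OF assms] by (auto simp: HP.region_def)
next
 assume z: "klein z\<in>HP.region"
 define f where "f n = klein_inv (klein z + (1 / Suc n) *\<^sub>R (klein c - klein z))" for n :: nat
 have nk: "norm (klein z + (1 / Suc n) *\<^sub>R (klein c - klein z)) < 1" for n :: nat
  using HP.seg_norm[of "klein z" "klein c" "1 / Suc n"] klein_norm_less[OF assms] klein_norm_less[OF c1] by simp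
 have "f n\<in>dirichlet_domain G c" for n
 proof -
  have "norm (f n) < 1" unfolding f_def using klein_inv_norm_le[OF less_imp_le[OF nk]] nk order.strict_trans1 by blast
  moreover have "HP.L g (klein (f n)) > 0" if g: "g\<in>G - {\<e>}" for g
  proof -
   have "klein (f n) = klein z + (1 / Suc n) *\<^sub>R (klein c - klein z)"
    unfolding f_def by (rule klein_klein_inv[OF less_imp_le[OF nk]])
   moreover have "HP.L g (klein z)>=0" "HP.L g (klein c) > 0" using z g HP.L_c by (auto simp: HP.region_def)
   ultimately show ?thesis
    by (simp only: HP.L_affine) (simp add: add_nonneg_pos)
  qed
  ultimately show ?thesis unfolding dirichlet_domain_klein by simp
 qed
 moreover have "f \<longlonglongrightarrow> z"
 proof -
  have "(%n. klein z + (1 / Suc n) *\<^sub>R (klein c - klein z)) \<longlonglongrightarrow> klein z + 0 *\<^sub>R (klein c - klein z)"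
   by (intro tendsto_intros LIMSEQ_inverse_real_of_nat[unfolded inverse_eq_divide])
  then have "(%n. klein_inv (klein z + (1 / Suc n) *\<^sub>R (klein c - klein z))) \<longlonglongrightarrow> klein_inv (klein z)"
   using continuous_klein_inv nk klein_norm_less[OF assms]
   by (intro continuous_on_tendsto_compose[OF continuous_klein_inv]) (auto intro!: always_eventually less_imp_le)
  then show ?thesis using klein_inv_klein assms by (simp add: f_def[abs_def])
 qed
 ultimately show "z\<in>closure (dirichlet_domain G c)" using closure_sequential by blast
qed

text \<open>g z lies in the region exactly if inv g c is, in the orbit of c, a point nearest to z.
  Both memberships together say that c and inv g c are both nearest, that is, that z is in the
  region and on the bisector.\<close>

lemma side_of_klein: assumes g: "g\<in>G" "g~=\<e>"
 shows "side_of G c g = {z. norm z < 1 \<and> klein z\<in>HP.region \<and> klein (g z)\<in>HP.region}"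
  "side_of G c g = {z. norm z < 1 \<and> klein z\<in>HP.face g}"
proof -
 have sub: "closure (dirichlet_domain G c)\<subseteq>cball 0 1"
  by (rule closure_minimal) (auto simp: dirichlet_domain_def)
 have im: "z\<in>iv g ` closure (dirichlet_domain G c) \<longleftrightarrow> klein (g z)\<in>HP.region" if z: "norm z < 1" for z
 proof -
  have "z\<in>iv g ` closure (dirichlet_domain G c) \<longleftrightarrow> g z\<in>closure (dirichlet_domain G c)"
  proof
   assume "z\<in>iv g ` closure (dirichlet_domain G c)"
   then obtain w where w: "w\<in>closure (dirichlet_domain G c)" "z = iv g w" by blast
   then have "norm w<=1" using sub by auto
   then show "g z\<in>closure (dirichlet_domain G c)" using w g by simp
  next
   assume "g z\<in>closure (dirichlet_domain G c)"
   moreover have "z = iv g (g z)" using g z by simp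
   ultimately show "z\<in>iv g ` closure (dirichlet_domain G c)" by blast
  qed
  then show ?thesis using closure_dirichlet_domain[OF norm_act_less[OF g(1) z]] by simp
 qed
 show 1: "side_of G c g = {z. norm z < 1 \<and> klein z\<in>HP.region \<and> klein (g z)\<in>HP.region}"
 proof (rule Set.set_eqI)
  fix z show "z\<in>side_of G c g \<longleftrightarrow> z\<in>{z. norm z < 1 \<and> klein z\<in>HP.region \<and> klein (g z)\<in>HP.region}"
   using im[of z] closure_dirichlet_domain[of z]
   unfolding side_of_def Int_iff mem_ball_0 mem_Collect_eq by blast
 qed
 have reg: "klein z\<in>HP.region \<longleftrightarrow> (ALL k:G. hyp_quot z c<=hyp_quot z (k c))" if z: "norm z < 1" for z
 proof -
  have "klein z\<in>HP.region \<longleftrightarrow> (ALL k:G - {\<e>}. hyp_quot z c<=hyp_quot z (iv k c))"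
   using klein_norm_less[OF z] affine_iff(2)[OF _ z] by (auto simp: HP.region_def HP.L_def)
  also have "... \<longleftrightarrow> (ALL k:G - {\<e>}. hyp_quot z c<=hyp_quot z (k c))"
   using G_inv inv_ne_one inv_inv_G by (metis Diff_iff singletonD singletonI)
  also have "... \<longleftrightarrow> (ALL k:G. hyp_quot z c<=hyp_quot z (k c))" using act_one[of c] c1 by auto
  finally show ?thesis .
 qed
 have "klein z\<in>HP.region \<and> klein (g z)\<in>HP.region \<longleftrightarrow> klein z\<in>HP.face g" if z: "norm z < 1" for z
 proof -
  have f: "klein z\<in>HP.face g \<longleftrightarrow> klein z\<in>HP.region \<and> hyp_quot z c = hyp_quot z (iv g c)"
   using affine_iff(3)[OF g(1) z] by (auto simp: HP.face_def HP.L_def)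
  have inv: "hyp_quot (g z) (k c) = hyp_quot z ((iv g \<odot> k) c)" if "k\<in>G" for k
   using hyp_quot_inv[OF g(1) z norm_act_less[OF that c1]] act_mult[OF G_inv[OF g(1)] that] c1 by simp
  have inv1: "hyp_quot (g z) c = hyp_quot z (iv g c)" using hyp_quot_inv[OF g(1) z c1] by simp
  have trans: "(ALL k:G. P ((iv g \<odot> k) c)) \<longleftrightarrow> (ALL k:G. P (k c))" for P
  proof
   assume P: "ALL k:G. P ((iv g \<odot> k) c)"
   show "ALL k:G. P (k c)"
   proof
    fix k assume k: "k\<in>G"
    have "iv g \<odot> (g \<odot> k) = k" using G_carrier g k G_inv by (simp add: D.m_assoc[symmetric] D.l_inv)
    then show "P (k c)" using P G_mult[OF g(1) k] by metis
   qed
  qed (use G_mult G_inv g in blast)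
  have "klein (g z)\<in>HP.region \<longleftrightarrow> (ALL k:G. hyp_quot z (iv g c)<=hyp_quot z (k c))"
   unfolding reg[OF norm_act_less[OF g(1) z]] using inv inv1 trans[of "%x. hyp_quot z (iv g c)<=hyp_quot z x"] by simp
  moreover have "iv g\<in>G" "\<e>\<in>G" "\<e> c = c" using G_inv g G_one act_one c1 by auto
  ultimately show ?thesis unfolding f reg[OF z] by (metis order_antisym)
 qed
 then show "side_of G c g = {z. norm z < 1 \<and> klein z\<in>HP.face g}" unfolding 1 by blast
qed

lemma side_pairings_eq: "side_pairings G c = HP.sides"
proof -
 have "(EX z:side_of G c g. EX w:side_of G c g. z~=w) \<longleftrightarrow> (EX x:HP.face g. EX y:HP.face g. x~=y)" if g: "g\<in>G" "g~=\<e>" for g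
 proof
  assume "EX z:side_of G c g. EX w:side_of G c g. z~=w"
  then show "EX x:HP.face g. EX y:HP.face g. x~=y" unfolding side_of_klein(2)[OF g]
   by (metis (no_types, lifting) klein_inv_klein less_imp_le mem_Collect_eq)
 next
  assume "EX x:HP.face g. EX y:HP.face g. x~=y"
  then obtain x y where xy: "x\<in>HP.face g" "y\<in>HP.face g" "x~=y" by blast
  have "klein_inv v\<in>side_of G c g" "klein (klein_inv v) = v" if "v\<in>HP.face g" for v
  proof -
   have v: "norm v < 1" using that by (simp add: HP.face_def HP.region_def)
   then show "klein (klein_inv v) = v" by (simp add: klein_klein_inv)
   then show "klein_inv v\<in>side_of G c g" unfolding side_of_klein(2)[OF g] using klein_inv_norm_le[of v] v that by simp
  qed
  then show "EX z:side_of G c g. EX w:side_of G c g. z~=w" using xy by metis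
 qed
 then have "g\<in>side_pairings G c \<longleftrightarrow> g\<in>HP.sides" for g
  unfolding side_pairings_def HP.sides_def mem_Collect_eq Diff_iff singleton_iff by meson
 then show ?thesis by blast
qed

lemma side_pairings_G: "g\<in>side_pairings G c ==> g\<in>G \<and> g~=\<e>"
 by (auto simp: side_pairings_def)

lemma face_eq_klein_side: assumes "g\<in>G" "g~=\<e>" shows "HP.face g = klein ` side_of G c g"
proof -
 have "x\<in>klein ` side_of G c g" if "x\<in>HP.face g" for x
 proof (rule image_eqI)
  have v: "norm x < 1" using that by (simp add: HP.face_def HP.region_def)
  then show "x = klein (klein_inv x)" by (simp add: klein_klein_inv)
  then show "klein_inv x\<in>side_of G c g" unfolding side_of_klein(2)[OF assms] using klein_inv_norm_le[of x] v that by simp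
 qed
 then show ?thesis using side_of_klein(2)[OF assms] by auto
qed

lemma side_pairings_inv: assumes "g\<in>side_pairings G c" shows "iv g\<in>side_pairings G c"
proof -
 have g: "g\<in>G" "g~=\<e>" using side_pairings_G assms by auto
 have ig: "iv g\<in>G" "iv g~=\<e>" using G_inv inv_ne_one g by auto
 obtain z w where zw: "z\<in>side_of G c g" "w\<in>side_of G c g" "z~=w" using assms by (auto simp: side_pairings_def)
 have "g v\<in>side_of G c (iv g)" if "v\<in>side_of G c g" for v
  using that norm_act_less[OF g(1)] g unfolding side_of_klein(1)[OF g] side_of_klein(1)[OF ig] by auto
 moreover have "g z~=g w" using act_inj[OF g(1), of z w] zw unfolding side_of_klein(1)[OF g] by auto
 ultimately show ?thesis unfolding side_pairings_def using ig zw by blast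
qed

text \<open>An involution would be a torsion element.\<close>

lemma side_pairings_ne_inv: assumes "g\<in>side_pairings G c" shows "iv g~=g"
proof
 assume e: "iv g = g"
 have g: "g\<in>G" "g~=\<e>" using side_pairings_G assms by auto
 have "g [^]\<^bsub>D_group\<^esub> (2::nat) = g \<odot> iv g" using G_carrier[OF g(1)] e by (simp add: numeral_2_eq_2)
 also have "... = \<e>" using G_carrier[OF g(1)] by (simp add: D.r_inv)
 finally have "g [^]\<^bsub>D_group\<^esub> (2::nat) = \<e>" .
 moreover obtain S where S: "free_basis D_group G S" using free by (auto simp: free_subgroup_def)
 moreover have "S\<subseteq>carrier D_group" using S G_carrier by (auto simp: free_basis_def)
 ultimately show False using D.free_basis_torsion_free[of G S g 2] g by simp
qed

end

subsection \<open>Isometric circles of the side pairings\<close>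

locale cusped_domain = dirichlet +
 fixes A :: "(complex => complex) set" and p :: complex and g0 :: "complex => complex"
 assumes A_def: "A = side_pairings G c"
  and isometric: "ALL g:A. side_of G c g\<subseteq>isometric_circle g"
  and vertex: "vertices G c = {p}"
  and g0A: "g0\<in>A" and g0p: "g0 p = p"
begin

lemma A_G: "g\<in>A ==> g\<in>G" "g\<in>A ==> g~=\<e>"
 using side_pairings_G A_def by auto

lemma A_inv: "g\<in>A ==> iv g\<in>A" using side_pairings_inv A_def by auto

lemma A_ne_inv: "g\<in>A ==> iv g~=g" using side_pairings_ne_inv A_def by auto

lemma A_sides: "A = HP.sides" using side_pairings_eq A_def by simp

text \<open>All three conditions are closed, so they pass from the side to its endpoints on the
  circle.\<close>

lemma side_closure: assumes "g\<in>A" "z\<in>closure (side_of G c g)"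
 shows "norm z<=1" "HP.L g (klein z) = 0" "dn g z = 1"
proof -
 have g: "g\<in>G" "g~=\<e>" using A_G assms by auto
 have sub: "side_of G c g\<subseteq>{z. norm z<=1} Int {z. HP.L g (klein z) = 0} Int {z. (norm (iv g 0))^2 - iv g 0 \<bullet> klein z = 0}"
 proof
  fix z assume z: "z\<in>side_of G c g"
  then have n: "norm z < 1" "klein z\<in>HP.face g" using side_of_klein(2)[OF g] by auto
  have "z\<in>isometric_circle g" using isometric assms z by blast
  then have "dn g z = 1" by (simp add: isometric_circle_def dn_def)
  then show "z\<in>{z. norm z<=1} Int {z. HP.L g (klein z) = 0} Int {z. (norm (iv g 0))^2 - iv g 0 \<bullet> klein z = 0}"
   using n dn_klein(2)[OF g(1), of z] by (simp add: HP.face_def)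
 qed
 have "closed ({z. norm z<=1} Int {z. HP.L g (klein z) = 0} Int {z. (norm (iv g 0))^2 - iv g 0 \<bullet> klein z = 0})"
  unfolding HP.L_def
  by (intro closed_Int closed_Collect_le closed_Collect_eq continuous_intros continuous_on_compose2[OF continuous_klein[of UNIV]]) auto
 then have z: "z\<in>{z. norm z<=1} Int {z. HP.L g (klein z) = 0} Int {z. (norm (iv g 0))^2 - iv g 0 \<bullet> klein z = 0}"
  using sub assms closure_minimal by blast
 then show "norm z<=1" "HP.L g (klein z) = 0" "dn g z = 1"
  using dn_klein(2)[OF g(1), of z] by auto
qed

lemma center_ne_0: assumes "g\<in>A" shows "iv g 0~=0"
 using no_fixed_point[OF G_inv inv_ne_one, of g 0] A_G[OF assms] by simp

lemma p_vertex: obtains g h where "g\<in>A" "h\<in>A" "side_of G c g~=side_of G c h"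
 "p\<in>closure (side_of G c g)" "p\<in>closure (side_of G c h)"
 using vertex unfolding vertices_def A_def by blast

lemma p_sphere: "norm p = 1"
proof -
 obtain g where g: "g\<in>A" "p\<in>closure (side_of G c g)" using p_vertex by blast
 have "norm p<=1" by (rule side_closure(1)[OF g])
 moreover have "\<not> norm p < 1" using no_fixed_point[OF A_G[OF g0A]] g0p by blast
 ultimately show ?thesis by simp
qed

lemma vertexI: assumes "g\<in>A" "h\<in>A" "side_of G c g~=side_of G c h"
 "z\<in>closure (side_of G c g)" "z\<in>closure (side_of G c h)" shows "z = p"
proof -
 have "z\<in>vertices G c" using assms unfolding vertices_def A_def by blast
 then show ?thesis using vertex by simp
qed

text \<open>A side that stops inside the disk meets a second side there, which would be a vertex in
  the disk; but the only vertex p is on the circle.\<close>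

lemma full: assumes k: "k\<in>HP.sides" shows "HP.face k = {x. norm x < 1 \<and> HP.L k x = 0}"
proof (rule ccontr)
 assume "HP.face k~={x. norm x < 1 \<and> HP.L k x = 0}"
 then obtain z where "norm z < 1" "HP.L k z = 0" "z\<notin>HP.face k" by (auto simp: HP.face_def HP.region_def)
 then obtain h where h: "h\<in>HP.sides" "HP.face h~=HP.face k" "HP.face h Int HP.face k~={}"
  using HP.side_end[OF k] by blast
 then obtain x where x: "x\<in>HP.face h" "x\<in>HP.face k" by blast
 have kA: "k\<in>A" "h\<in>A" using k h A_sides by auto
 have nx: "norm x < 1" using x by (simp add: HP.face_def HP.region_def)
 have v: "norm (klein_inv x) < 1" "klein (klein_inv x) = x"
  using klein_inv_norm_le[of x] klein_klein_inv[of x] nx by auto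
 have "klein_inv x\<in>side_of G c k" "klein_inv x\<in>side_of G c h"
  using side_of_klein(2)[OF A_G[OF kA(1)]] side_of_klein(2)[OF A_G[OF kA(2)]] v x by auto
 moreover have "side_of G c k~=side_of G c h"
  using h(2) face_eq_klein_side[OF A_G[OF kA(1)]] face_eq_klein_side[OF A_G[OF kA(2)]] by auto
 ultimately have "klein_inv x = p" using vertexI[OF kA] closure_subset by blast
 then show False using v p_sphere by simp
qed

lemma chord: assumes "g\<in>A"
 obtains x y where "norm x < 1" "norm y < 1" "x~=y" "HP.L g x = 0" "HP.L g y = 0"
  "(norm (iv g 0))^2 - iv g 0 \<bullet> x = 0" "(norm (iv g 0))^2 - iv g 0 \<bullet> y = 0"
proof -
 have g: "g\<in>G" "g~=\<e>" using A_G assms by auto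
 obtain x y where xy: "x\<in>HP.face g" "y\<in>HP.face g" "x~=y" using assms unfolding A_sides HP.sides_def by blast
 have "norm v < 1 \<and> HP.L g v = 0 \<and> (norm (iv g 0))^2 - iv g 0 \<bullet> v = 0" if v: "v\<in>HP.face g" for v
 proof -
  obtain z where z: "z\<in>side_of G c g" "v = klein z" using v face_eq_klein_side[OF g] by blast
  then have "dn g z = 1" "norm z<=1" using side_closure[OF assms, of z] closure_subset by blast+
  then show ?thesis using dn_klein(2)[OF g(1), of z] z v by (auto simp: HP.face_def HP.region_def)
 qed
 then show ?thesis using that xy by blast
qed

text \<open>The bisector of \<open>c\<close> and \<open>inv g c\<close> is the isometric circle, and \<open>c\<close> is on the same side of it
 as the origin: otherwise \<open>g\<close> would fix a point of the segment between them.\<close>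

lemma L_isometric: assumes "g\<in>A"
 obtains \<tau> where "\<tau> > 0" "!!x. HP.L g x = \<tau> * ((norm (iv g 0))^2 - iv g 0 \<bullet> x)"
proof -
 let ?a = "iv g 0"
 have g: "g\<in>G" "g~=\<e>" using A_G assms by auto
 obtain x y where xy: "norm x < 1" "norm y < 1" "x~=y" "HP.L g x = 0" "HP.L g y = 0"
  "(norm ?a)^2 - ?a \<bullet> x = 0" "(norm ?a)^2 - ?a \<bullet> y = 0" by (rule chord[OF assms])
 have "?a \<bullet> (x - y) = 0" "\<beta> g \<bullet> (x - y) = 0" using xy by (auto simp: HP.L_def inner_diff_right)
 then obtain \<tau> where \<tau>: "\<beta> g = of_real \<tau> * ?a"
  using parallel_complex[of ?a "x - y" "\<beta> g"] center_ne_0[OF assms] xy by auto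
 have \<beta>: "\<beta> g \<bullet> v = \<tau> * (?a \<bullet> v)" for v by (simp add: \<tau> scaleR_conv_of_real[symmetric])
 have L: "HP.L g v = \<tau> * ((norm ?a)^2 - ?a \<bullet> v)" for v
  using xy(4,6) unfolding HP.L_def \<beta> by (simp add: algebra_simps)
 have Lc: "HP.L g (klein c) > 0" using HP.L_c g by simp
 have "\<not> \<tau> < 0"
 proof
  assume neg: "\<tau> < 0"
  then have mneg: "(norm ?a)^2 - ?a \<bullet> klein c < 0" using Lc unfolding L by (simp add: zero_less_mult_iff)
  have m0: "(norm ?a)^2 > 0" using center_ne_0[OF assms] by simp
  \<comment> \<open>For \<tau> < 0 the chord separates c from the origin; v is the point where the
    radius through c crosses it.\<close>
  define \<sigma> where "\<sigma> = (norm ?a)^2 / (?a \<bullet> klein c)"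
  have ac: "?a \<bullet> klein c > (norm ?a)^2" "?a \<bullet> klein c > 0" using mneg m0 by linarith+
  have \<sigma>: "0 < \<sigma>" "\<sigma> < 1" unfolding \<sigma>_def using divide_pos_pos[OF m0 ac(2)] ac by auto
  define v where "v = klein_inv (\<sigma> *\<^sub>R klein c)"
  have n\<sigma>: "norm (\<sigma> *\<^sub>R klein c) < 1"
  proof -
   have "norm (\<sigma> *\<^sub>R klein c)<=norm (klein c)" using \<sigma> by (simp add: mult_left_le_one_le)
   then show ?thesis using klein_norm_less[OF c1] by linarith
  qed
  have kv: "klein v = \<sigma> *\<^sub>R klein c" unfolding v_def using n\<sigma> by (simp add: klein_klein_inv)
  have nv: "norm v < 1" unfolding v_def using klein_inv_norm_le[of "\<sigma> *\<^sub>R klein c"] n\<sigma> by simp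
  obtain k where k: "k>=0" "v = k *\<^sub>R c"
  proof
   have "0<=1 - (norm (\<sigma> *\<^sub>R klein c))^2" using n\<sigma> by (simp add: abs_square_le_1 less_imp_le)
   then show "0<=1 / (1 + sqrt (1 - (norm (\<sigma> *\<^sub>R klein c))^2)) * \<sigma> * (2 / (1 + (norm c)^2))"
    using \<sigma> by (intro mult_nonneg_nonneg divide_nonneg_nonneg add_nonneg_nonneg) auto
   show "v = (1 / (1 + sqrt (1 - (norm (\<sigma> *\<^sub>R klein c))^2)) * \<sigma> * (2 / (1 + (norm c)^2))) *\<^sub>R c"
    by (simp only: v_def klein_inv_def klein_def[of c] scaleR_scaleR mult.assoc)
  qed
  have m: "(norm ?a)^2 - ?a \<bullet> klein v = 0" unfolding kv \<sigma>_def using ac(2) by simp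
  then have "dn g v = 1" using dn_klein(2)[OF g(1)] nv by simp
  then have ngv: "norm (g v) = norm v" using dn_ge_iff(4)[OF g(1) nv] by simp
  \<comment> \<open>v and g v have the same norm because v is on the isometric circle, and the same
    distance from c because v is on the bisector. As v lies on the ray of c, Cauchy-Schwarz is an
    equality for v, hence for g v, and g v = v.\<close>
  have "HP.L g (klein v) = 0" unfolding L m by simp
  then have "hyp_quot v c = hyp_quot (g v) c"
   using affine_iff(3)[OF g(1) nv] hyp_quot_inv[OF g(1) nv c1] by (simp add: HP.L_def)
  then have "(norm (v - c))^2 = (norm (g v - c))^2"
   unfolding hyp_quot_def ngv using nv c1 abs_square_less_1[of "norm v"] abs_square_less_1[of "norm c"] by simp
  then have "g v \<bullet> c = v \<bullet> c"
   using ngv by (simp add: power2_norm_eq_inner inner_diff inner_commute) (simp add: norm_eq)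
  also have "... = norm v * norm c" using k by (simp add: power2_norm_eq_inner[symmetric] power2_eq_square)
  finally have e: "g v \<bullet> c = norm (g v) * norm c" using ngv by simp
  have "c~=0" using mneg m0 by (auto simp: klein_def)
  moreover have "norm (g v) *\<^sub>R c = norm c *\<^sub>R g v" using e norm_cauchy_schwarz_eq[of "g v" c] by simp
  moreover have "norm v *\<^sub>R c = norm c *\<^sub>R v" using k by simp
  ultimately have "g v = v" using ngv by simp
  then show False using no_fixed_point[OF g nv] by simp
 qed
 moreover have "\<tau>~=0" using Lc L by auto
 ultimately show ?thesis using that L by (metis linorder_neqE_linordered_idom)
qed

lemma dn_L: assumes "g\<in>A" "norm z<=1"
 shows "dn g z > 1 \<longleftrightarrow> HP.L g (klein z) < 0" "dn g z = 1 \<longleftrightarrow> HP.L g (klein z) = 0"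
  "dn g z < 1 \<longleftrightarrow> HP.L g (klein z) > 0"
proof -
 obtain \<tau> where t: "\<tau> > 0" "!!x. HP.L g x = \<tau> * ((norm (iv g 0))^2 - iv g 0 \<bullet> x)" using L_isometric[OF assms(1)] by metis
 show "dn g z > 1 \<longleftrightarrow> HP.L g (klein z) < 0" "dn g z = 1 \<longleftrightarrow> HP.L g (klein z) = 0" "dn g z < 1 \<longleftrightarrow> HP.L g (klein z) > 0"
  using dn_klein[OF A_G(1)[OF assms(1)] assms(2)] t by (auto simp: mult_less_0_iff zero_less_mult_iff)
qed

text \<open>inv g 0 is the foot of the perpendicular from the origin to the chord, so the chord
  determines it. Then h o inv g fixes 0 and is trivial.\<close>

lemma face_inj: assumes g: "g\<in>A" and h: "h\<in>A" and eq: "HP.face g = HP.face h" shows "g = h"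
proof -
 let ?a = "iv g 0" and ?b = "iv h 0"
 obtain x y where xy: "norm x < 1" "norm y < 1" "x~=y" "HP.L g x = 0" "HP.L g y = 0"
  "(norm ?a)^2 - ?a \<bullet> x = 0" "(norm ?a)^2 - ?a \<bullet> y = 0" by (rule chord[OF g])
 have "x\<in>HP.face h" "y\<in>HP.face h" using xy full[of g] g A_sides eq by auto
 then have "HP.L h x = 0" "HP.L h y = 0" by (auto simp: HP.face_def)
 moreover obtain \<tau> where "\<tau> > 0" "!!x. HP.L h x = \<tau> * ((norm ?b)^2 - ?b \<bullet> x)" using L_isometric[OF h] by metis
 ultimately have h0: "(norm ?b)^2 = ?b \<bullet> x" "(norm ?b)^2 = ?b \<bullet> y" by auto
 then have "?a \<bullet> (x - y) = 0" "?b \<bullet> (x - y) = 0" using xy by (auto simp: inner_diff_right)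
 then obtain \<tau> where \<tau>: "?b = of_real \<tau> * ?a"
  using parallel_complex[of ?a "x - y" ?b] center_ne_0[OF g] xy by auto
 then have t: "?b = \<tau> *\<^sub>R ?a" by (simp add: scaleR_conv_of_real)
 have "\<tau>^2 * (norm ?a)^2 = \<tau> * (norm ?a)^2"
  using h0(1) xy(6) unfolding t by (simp add: power_mult_distrib)
 then have "\<tau>^2 = \<tau>" using center_ne_0[OF g] by simp
 moreover have "\<tau>~=0" using center_ne_0[OF h] t by auto
 ultimately have "?b = ?a" using t by (simp add: power2_eq_square)
 then have "h (iv g 0) = 0" using A_G[OF h] by (metis act_inv' norm_zero zero_le_one)
 then have "(h \<odot> iv g) 0 = 0" using act_mult A_G g h G_inv by simp
 then have "h \<odot> iv g = \<e>" using no_fixed_point[of "h \<odot> iv g" 0] G_mult G_inv A_G g h by auto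
 then have "iv (iv g) = h" using D.inv_equality[of h "iv g"] G_carrier G_inv A_G g h by simp
 then show ?thesis using A_G g by simp
qed

lemma arcs_disjoint: assumes "g\<in>A" "h\<in>A" "g~=h" "norm z<=1" "dn g z > 1" shows "dn h z < 1"
proof -
 have "HP.face g~=HP.face h" using face_inj assms by blast
 then have "HP.L h (klein z) > 0"
  using HP.full_faces_disjoint[OF full, of g h "klein z"] assms dn_L(1)[of g z] klein_norm_le A_sides by auto
 then show ?thesis using dn_L(3) assms by simp
qed

lemma side_closureI: assumes g: "g\<in>A" and z: "norm z = 1" "dn g z = 1" shows "z\<in>closure (side_of G c g)"
proof -
 have gG: "g\<in>G" "g~=\<e>" using A_G g by auto
 have Lz: "HP.L g z = 0" using dn_L(2)[OF g, of z] z klein_sphere[of z] by simp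
 obtain v where v: "norm v < 1" "HP.L g v = 0" using chord[OF g] by blast
 define f where "f n = klein_inv (z + (1 / Suc n) *\<^sub>R (v - z))" for n :: nat
 have nk: "norm (z + (1 / Suc n) *\<^sub>R (v - z)) < 1" for n :: nat
  using HP.seg_norm[of z v "1 / Suc n"] z v by simp
 have "f n\<in>side_of G c g" for n
 proof -
  have "norm (f n) < 1" unfolding f_def using klein_inv_norm_le[OF less_imp_le[OF nk]] nk order.strict_trans1 by blast
  moreover have "klein (f n) = z + (1 / Suc n) *\<^sub>R (v - z)"
   unfolding f_def by (rule klein_klein_inv[OF less_imp_le[OF nk]])
  moreover have "HP.L g (z + (1 / Suc n) *\<^sub>R (v - z)) = 0" unfolding HP.L_affine using Lz v by simp
  ultimately show ?thesis using side_of_klein(2)[OF gG] full[of g] g A_sides nk by simp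
 qed
 moreover have "f \<longlonglongrightarrow> z"
 proof -
  have "(%n. z + (1 / Suc n) *\<^sub>R (v - z)) \<longlonglongrightarrow> z + 0 *\<^sub>R (v - z)"
   by (intro tendsto_intros LIMSEQ_inverse_real_of_nat[unfolded inverse_eq_divide])
  then have "(%n. klein_inv (z + (1 / Suc n) *\<^sub>R (v - z))) \<longlonglongrightarrow> klein_inv z"
   using z nk
   by (intro continuous_on_tendsto_compose[OF continuous_klein_inv]) (auto intro!: always_eventually less_imp_le)
  then show ?thesis using klein_inv_klein[of z] klein_sphere[of z] z by (simp add: f_def[abs_def])
 qed
 ultimately show ?thesis using closure_sequential by blast
qed

lemma side_inj: assumes "g\<in>A" "h\<in>A" "g~=h" shows "side_of G c g~=side_of G c h"
 using face_inj[OF assms(1,2)] assms face_eq_klein_side[OF A_G[OF assms(1)]] face_eq_klein_side[OF A_G[OF assms(2)]] by auto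

lemma arcs_meet: assumes g: "g\<in>A" and h: "h\<in>A" and ne: "g~=h" and z: "norm z<=1" "dn g z>=1" "dn h z>=1"
 shows "z = p" "dn g z = 1" "dn h z = 1"
proof -
 have d1: "\<not> dn g z > 1" using arcs_disjoint[OF g h ne z(1)] z(3) by (meson leD)
 have d2: "\<not> dn h z > 1" using arcs_disjoint[OF h g ne[symmetric] z(1)] z(2) by (meson leD)
 show 1: "dn g z = 1" using d1 z(2) by simp
 show 2: "dn h z = 1" using d2 z(3) by simp
 have "HP.face g~=HP.face h" using face_inj assms by blast
 then have "norm (klein z) = 1"
  using HP.full_faces_meet[OF full, of g h "klein z"] g h A_sides 1 2 dn_L(2)[OF g z(1)] dn_L(2)[OF h z(1)] klein_norm_le by auto
 then have nz: "norm z = 1" using klein_norm_less[of z] z(1) by (cases "norm z < 1") auto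
 show "z = p" by (rule vertexI[OF g h side_inj[OF g h ne]]) (use side_closureI g h nz 1 2 in auto)
qed

text \<open>Where no letter expands, all side inequalities hold, and by
  \<open>region_eq_sides\<close> they imply the inequalities for the whole group. This is the link
  between derivatives and distances from c.\<close>

lemma in_domain: assumes "norm z < 1" "!!g. g\<in>A ==> dn g z<=1" "k\<in>G"
 shows "hyp_quot z c<=hyp_quot z (k c)"
proof -
 have "klein z\<in>HP.region"
 proof (rule HP.region_eq_sides)
  show "norm (klein z) < 1" using klein_norm_less assms by blast
  fix i assume "i\<in>HP.sides"
  then show "HP.L i (klein z)>=0" using assms(2)[of i] dn_L(1)[of i z] A_sides assms(1) by force
 qed
 then have "HP.L (iv k) (klein z)>=0" if "k~=\<e>" using that assms inv_ne_one G_inv by (auto simp: HP.region_def)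
 then show ?thesis
  using affine_iff(2)[OF G_inv[OF assms(3)] assms(1)] assms act_one[of c] c1
  by (cases "k = \<e>") (auto simp: HP.L_def)
qed

text \<open>p is an endpoint of sides, so by disjointness no arc contains it in its interior:
  neither g0 nor its inverse has factor above 1 there. At the common fixed point the two factors are
  reciprocal.\<close>

lemma dn_g0_p: "dn g0 p = 1"
proof -
 obtain g h where gh: "g\<in>A" "h\<in>A" "side_of G c g~=side_of G c h"
  "p\<in>closure (side_of G c g)" "p\<in>closure (side_of G c h)" by (rule p_vertex)
 have d: "dn g p = 1" using side_closure gh by blast
 have p1: "norm p<=1" using p_sphere by simp
 have *: "\<not> dn k p > 1" if "k\<in>A" for k
  using arcs_disjoint[OF that gh(1) _ p1] d by force
 have "dn (iv g0) p * dn g0 p = 1" using dn_inv[of g0 p] g0p A_G g0A p1 by simp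
 moreover have "dn (iv g0) p > 0" "dn g0 p > 0" using dn_pos G_inv A_G g0A p1 by auto
 ultimately show ?thesis using *[OF g0A] *[OF A_inv[OF g0A]]
  by (smt (verit) mult_le_cancel_left1 mult_le_cancel_right1)
qed

lemma inv_g0_p: "iv g0 p = p"
 using act_inv[of g0 p] g0p A_G g0A p_sphere by simp

lemma dn_inv_g0_p: "dn (iv g0) p = 1"
 using dn_inv[of g0 p] g0p A_G g0A p_sphere dn_g0_p by simp

text \<open>Two arcs ending at \<open>p\<close> lie on different sides of \<open>p\<close>.\<close>

lemma arcs_at_p_sides: assumes g: "g\<in>A" and h: "h\<in>A" and ne: "g~=h" and "dn g p = 1" "dn h p = 1"
 shows "Im (iv g 0 * cnj p) * Im (iv h 0 * cnj p) < 0"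
proof (rule ccontr)
 assume nn: "\<not> Im (iv g 0 * cnj p) * Im (iv h 0 * cnj p) < 0"
 have pp: "cnj p * p = 1" using p_sphere complex_norm_square[of p] by (simp add: mult.commute)
 define w where "w k = iv k 0 * cnj p" for k
 have wk: "iv k 0 = w k * p" for k using pp by (simp add: w_def mult.assoc)
 have nw: "norm (w k) = norm (iv k 0)" for k using p_sphere by (simp add: w_def norm_mult)
 have Re: "Re (w k) = (norm (w k))^2" "Im (w k)~=0" "Re (w k) > 0" if "k\<in>A" "dn k p = 1" for k
 proof -
  have "(norm (iv k 0))^2 - iv k 0 \<bullet> p = 0"
   using dn_klein(2)[OF A_G(1)[OF that(1)], of p] that p_sphere klein_sphere[of p] by simp
  moreover have "iv k 0 \<bullet> p = Re (w k)" by (simp add: w_def inner_complex_def)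
  ultimately show 1: "Re (w k) = (norm (w k))^2" by (simp add: nw)
  have n0: "norm (w k) > 0" "norm (w k) < 1" unfolding nw using center_ne_0[OF that(1)] mf(1)[OF A_G(1)[OF that(1)]] by auto
  then show "Re (w k) > 0" using 1 by simp
  show "Im (w k)~=0"
  proof
   assume "Im (w k) = 0"
   then have "norm (w k) = \<bar>Re (w k)\<bar>" by (simp add: cmod_eq_Re)
   then have "norm (w k) = (norm (w k))^2" using 1 by simp
   then show False using n0 by (simp add: power2_eq_square)
  qed
 qed
 \<comment> \<open>The point is p turned by the angle 2 arctan r, and the hypothesis on r is the
   condition for expansion there. A small r of the right sign serves both letters if their centres
   are on the same side of p.\<close>
 have test: "dn k (p * (1 + \<i> * of_real r)^2 / of_real (1 + r^2)) > 1"
  if k: "k\<in>A" "dn k p = 1" and r: "r * Im (w k) > r^2 * Re (w k)" for k r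
 proof -
  let ?z = "p * (1 + \<i> * of_real r)^2 / of_real (1 + r^2)"
  have rp: "1 + r^2 > 0" by (simp add: add_pos_nonneg)
  have "(norm (1 + \<i> * of_real r))^2 = 1 + r^2" by (simp add: cmod_power2)
  then have nz: "norm ?z = 1" using rp p_sphere by (simp add: norm_mult norm_divide norm_power del: of_real_add)
  have q: "(1 + \<i> * of_real r)^2 = Complex (1 - r^2) (2 * r)" by (simp add: complex_eq_iff power2_eq_square)
  have "iv k 0 \<bullet> ?z = Re (w k * cnj ((1 + \<i> * of_real r)^2)) / (1 + r^2)"
  proof -
   have "a \<bullet> b = Re (a * cnj b)" for a b :: complex by (simp add: inner_complex_def)
   then have "iv k 0 \<bullet> ?z = Re (iv k 0 * cnj ?z)" .
   also have "iv k 0 * cnj ?z = w k * (p * cnj p) * cnj ((1 + \<i> * of_real r)^2) / of_real (1 + r^2)"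
    by (simp add: wk[of k] mult_ac)
   also have "p * cnj p = 1" using pp by (simp add: mult.commute)
   finally show ?thesis by (simp only: mult_1_right Re_divide_of_real)
  qed
  also have "... = (Re (w k) * (1 - r^2) + Im (w k) * (2 * r)) / (1 + r^2)" unfolding q by simp
  finally have i: "iv k 0 \<bullet> ?z = (Re (w k) * (1 - r^2) + Im (w k) * (2 * r)) / (1 + r^2)" .
  have "Re (w k) * (1 + r^2) < Re (w k) * (1 - r^2) + Im (w k) * (2 * r)" using r by (simp add: algebra_simps)
  then have "Re (w k) < iv k 0 \<bullet> ?z" unfolding i using rp by (simp add: less_divide_eq)
  then show ?thesis using dn_klein(1)[OF A_G(1)[OF k(1)], of ?z] nz klein_sphere[OF nz] Re(1)[OF k] nw by simp
 qed
 define m where "m = min (\<bar>Im (w g)\<bar> / Re (w g)) (\<bar>Im (w h)\<bar> / Re (w h)) / 2"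
 have pos: "Re (w g) > 0" "Re (w h) > 0" "Im (w g)~=0" "Im (w h)~=0" using Re assms by auto
 then have m: "m > 0" by (simp add: m_def)
 have ml: "m * Re (w k) < \<bar>Im (w k)\<bar>" if "k = g \<or> k = h" for k
 proof -
  have "min (\<bar>Im (w g)\<bar> / Re (w g)) (\<bar>Im (w h)\<bar> / Re (w h))<=\<bar>Im (w k)\<bar> / Re (w k)" using that by auto
  then have "m < \<bar>Im (w k)\<bar> / Re (w k)" using m unfolding m_def by linarith
  then show ?thesis using that pos by (auto simp: less_divide_eq)
 qed
 define r where "r = (if Im (w g) > 0 then m else - m)"
 have sgn: "r * Im (w k) = m * \<bar>Im (w k)\<bar>" if "k = g \<or> k = h" for k
 proof -
  have "Im (w g) * Im (w h) > 0" using nn pos unfolding w_def[symmetric] by (metis linorder_neqE_linordered_idom mult_eq_0_iff)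
  then show ?thesis using that by (auto simp: r_def zero_less_mult_iff)
 qed
 have "r * Im (w k) > r^2 * Re (w k)" if "k = g \<or> k = h" for k
  unfolding sgn[OF that] using mult_strict_left_mono[OF ml[OF that] m] by (simp add: r_def power2_eq_square mult.assoc)
 then have d: "dn g (p * (1 + \<i> * of_real r)^2 / of_real (1 + r^2)) > 1" "dn h (p * (1 + \<i> * of_real r)^2 / of_real (1 + r^2)) > 1"
  using test assms by blast+
 have "1 + r^2 > 0" by (simp add: add_pos_nonneg)
 moreover have "(norm (1 + \<i> * of_real r))^2 = 1 + r^2" by (simp add: cmod_power2)
 ultimately have "norm (p * (1 + \<i> * of_real r)^2 / of_real (1 + r^2))<=1"
  using p_sphere by (simp add: norm_mult norm_divide norm_power del: of_real_add)
 then show False using arcs_disjoint[OF g h ne _ d(1)] d(2) by simp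
qed

text \<open>The arcs of g0 and its inverse already occupy both sides of p, so a third arc would
  share a side with one of them.\<close>

lemma arcs_at_p: assumes "g\<in>A" "dn g p>=1" shows "g\<in>{g0, iv g0}"
proof (rule ccontr)
 assume n: "g\<notin>{g0, iv g0}"
 have p1: "norm p<=1" using p_sphere by simp
 have d: "dn g p = 1" using arcs_meet(2)[OF assms(1) g0A _ p1 assms(2)] n dn_g0_p by auto
 have "Im (iv g 0 * cnj p) * Im (iv g0 0 * cnj p) < 0"
  using arcs_at_p_sides[OF assms(1) g0A] n d dn_g0_p by auto
 moreover have "Im (iv g 0 * cnj p) * Im (iv (iv g0) 0 * cnj p) < 0"
  using arcs_at_p_sides[OF assms(1) A_inv[OF g0A]] n d dn_inv_g0_p by auto
 moreover have "Im (iv g0 0 * cnj p) * Im (iv (iv g0) 0 * cnj p) < 0"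
  using arcs_at_p_sides[OF g0A A_inv[OF g0A]] A_ne_inv[OF g0A] dn_g0_p dn_inv_g0_p by auto
 ultimately show False by (smt (verit) mult_less_0_iff)
qed

end

subsection \<open>Reduced words and expansion\<close>

lemma mult_eq_1_bounds: fixes x y :: real
 assumes "x * y = 1" "y > 0" shows "y<=1 ==> x>=1" "y < 1 ==> x > 1"
proof -
 have "x = 1 / y" using assms by (simp add: field_simps)
 then show "y<=1 ==> x>=1" "y < 1 ==> x > 1" using assms(2) by simp_all
qed

context cusped_domain
begin

text \<open>The first letter acts first, as in the coding by iterates of the map, so the product is
  taken in reverse order.\<close>

fun wprod :: "(complex => complex) list => complex => complex" where
 "wprod [] = \<e>"
| "wprod (a # w) = wprod w \<odot> a"

definition red :: "(complex => complex) list => bool" where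
 "red w \<longleftrightarrow> set w\<subseteq>A \<and> successively (%a b. b~=iv a) w"

lemma red_Nil [simp]: "red []" by (simp add: red_def)

lemma red_Cons: "red (a # w) \<longleftrightarrow> a\<in>A \<and> red w \<and> (w~=[] --> hd w~=iv a)"
 by (cases w) (auto simp: red_def)

lemma wprod_G: "set w\<subseteq>A ==> wprod w\<in>G"
 by (induction w) (auto simp: G_one G_mult A_G)

lemma red_set: "red w ==> set w\<subseteq>A" by (simp add: red_def)

lemma wprod_append: "set u\<subseteq>A ==> set v\<subseteq>A ==> wprod (u @ v) = wprod v \<odot> wprod u"
proof (induction u)
 case Nil
 then show ?case using G_carrier[OF wprod_G[of v]] by simp
next
 case (Cons a u)
 then show ?case using G_carrier wprod_G A_G by (simp add: D.m_assoc)
qed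

text \<open>If a does not expand at z, its inverse does not contract at a z; so by disjointness of
  arcs no other letter expands strictly there.\<close>

lemma step_le: assumes "a\<in>A" "norm z<=1" "dn a z<=1" "b\<in>A" "b~=iv a" shows "dn b (a z)<=1"
proof (rule ccontr)
 assume "\<not> dn b (a z)<=1"
 have n: "norm (a z)<=1" by (rule norm_act_le[OF A_G(1)[OF assms(1)] assms(2)])
 have "dn (iv a) (a z) < 1"
  using arcs_disjoint[OF assms(4) A_inv[OF assms(1)] assms(5) n] \<open>\<not> dn b (a z) <= 1\<close> by simp
 then show False
  using mult_eq_1_bounds(1)[OF dn_inv[OF A_G(1)[OF assms(1)] assms(2)] dn_pos[OF A_G(1)[OF assms(1)] assms(2)] assms(3)] by simp
qed

lemma inv_expand: assumes "a\<in>A" "norm z<=1"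
 shows "dn a z<=1 ==> dn (iv a) (a z)>=1" "dn a z < 1 ==> dn (iv a) (a z) > 1"
 using mult_eq_1_bounds[OF dn_inv[OF A_G(1)[OF assms(1)] assms(2)] dn_pos[OF A_G(1)[OF assms(1)] assms(2)]] by auto

lemma comp_contract: "red w ==> norm z<=1 ==> (w~=[] --> dn (hd w) z<=1) ==> dn (wprod w) z<=1"
proof (induction w arbitrary: z)
 case Nil then show ?case by (simp add: dn_one)
next
 case (Cons a w)
 have a: "a\<in>A" "red w" using Cons by (auto simp: red_Cons)
 have az: "norm (a z)<=1" by (rule norm_act_le[OF A_G(1)[OF a(1)] Cons.prems(2)])
 have "dn (wprod w) (a z)<=1"
 proof (rule Cons.IH[OF a(2) az], intro impI)
  assume "w~=[]"
  then have "hd w\<in>A" "hd w~=iv a" using Cons.prems(1) a red_set[OF a(2)] by (auto simp: red_Cons)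
  then show "dn (hd w) (a z)<=1" using step_le a Cons.prems by simp
 qed
 moreover have "dn a z<=1" using Cons.prems by simp
 moreover have "dn (wprod (a # w)) z = dn (wprod w) (a z) * dn a z"
  using dn_mult[OF wprod_G[OF red_set[OF a(2)]] A_G(1)[OF a(1)] Cons.prems(2)] by simp
 moreover have "dn a z > 0" "dn (wprod w) (a z) > 0"
  using dn_pos A_G a Cons.prems az wprod_G[OF red_set[OF a(2)]] by auto
 ultimately show ?case by (simp add: mult_le_one)
qed

lemma dn_letter_0: assumes "a\<in>A" shows "dn a 0 < 1"
proof -
 have "a 0~=0" using no_fixed_point[of a 0] A_G assms by auto
 then show ?thesis using dn_ge_iff(1)[of a 0] A_G assms by auto
qed

text \<open>Ping-pong: a letter that contracts at z puts the image where its inverse expands, and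
  there the next letter of a reduced word contracts.\<close>

lemma comp_0_strict: "red w ==> norm z<=1 ==> (w~=[] --> dn (hd w) z < 1) ==> w~=[] ==> dn (iv (last w)) (wprod w z) > 1"
proof (induction w arbitrary: z)
 case Nil then show ?case by simp
next
 case (Cons a w)
 have a: "a\<in>A" "red w" using Cons by (auto simp: red_Cons)
 have az: "norm (a z)<=1" by (rule norm_act_le[OF A_G(1)[OF a(1)] Cons.prems(2)])
 have e: "dn (iv a) (a z) > 1" using inv_expand(2)[OF a(1) Cons.prems(2)] Cons.prems by simp
 have c: "wprod (a # w) z = wprod w (a z)"
  using act_mult[OF wprod_G[OF red_set[OF a(2)]] A_G(1)[OF a(1)] Cons.prems(2)] by simp
 show ?case
 proof (cases "w = []")
  case True then show ?thesis using e c az by (simp add: act_one)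
 next
  case False
  then have "hd w\<in>A" "hd w~=iv a" using Cons.prems(1) a red_set[OF a(2)] by (auto simp: red_Cons)
  then have "dn (hd w) (a z) < 1" using arcs_disjoint[OF A_inv[OF a(1)] _ _ az e] by auto
  then show ?thesis using Cons.IH[OF a(2) az] False c by simp
 qed
qed

lemma comp_0: assumes "red w" "w~=[]" shows "dn (iv (last w)) (wprod w 0) > 1" "wprod w~=\<e>"
proof -
 have A: "hd w\<in>A" "last w\<in>A" using red_set[OF assms(1)] assms(2) by auto
 show 1: "dn (iv (last w)) (wprod w 0) > 1" using comp_0_strict[OF assms(1), of 0] dn_letter_0 A assms by simp
 show "wprod w~=\<e>"
 proof
  assume "wprod w = \<e>"
  then have "dn (iv (last w)) 0 > 1" using 1 act_one[of 0] by simp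
  then show False using dn_letter_0[OF A_inv[OF A(2)]] by simp
 qed
qed

text \<open>The inverse word carries 0 into the region where the first letter expands, so the
  position of the orbit point reveals the word. \<open>approached_step\<close> uses this to read
  codes off limits of orbit points.\<close>

lemma comp_inv_0: "red (b # w) ==> dn b (iv (wprod (b # w)) 0) > 1"
proof (induction w arbitrary: b)
 case Nil
 then have b: "b\<in>A" by (simp add: red_Cons)
 have "dn (iv (iv b)) (iv b 0) > 1" using inv_expand(2)[OF A_inv[OF b], of 0] dn_letter_0[OF A_inv[OF b]] by simp
 then show ?case using b A_G G_carrier by simp
next
 case (Cons d w)
 have b: "b\<in>A" "d\<in>A" "d~=iv b" "red (d # w)" using Cons.prems by (auto simp: red_Cons)
 let ?y = "iv (wprod (d # w)) 0"
 have cG: "wprod (d # w)\<in>G" using wprod_G[OF red_set[OF b(4)]] .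
 have ny: "norm ?y<=1" using norm_act_le[OF G_inv[OF cG]] by simp
 have "dn (iv b) ?y < 1" using arcs_disjoint[OF b(2) A_inv[OF b(1)] b(3) ny Cons.IH[OF b(4)]] .
 then have "dn (iv (iv b)) (iv b ?y) > 1" using inv_expand(2)[OF A_inv[OF b(1)] ny] by simp
 moreover have "iv (wprod (b # d # w)) = iv b \<odot> iv (wprod (d # w))"
  using D.inv_mult_group[OF G_carrier[OF cG] G_carrier[OF A_G(1)[OF b(1)]]] by simp
 then have "iv (wprod (b # d # w)) 0 = iv b ?y"
  using act_mult[OF G_inv[OF A_G(1)[OF b(1)]] G_inv[OF cG]] by simp
 ultimately show ?case using b A_G by simp
qed

section \<open>Generation of the group by the side pairings\<close>

lemma reduce_word: assumes "A'\<subseteq>A" "!!a. a\<in>A' ==> iv a\<in>A'"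
 shows "set w\<subseteq>A' ==> EX w'. set w'\<subseteq>A' \<and> red w' \<and> wprod w' = wprod w"
proof (induction w)
 case Nil then show ?case by (intro exI[of _ "[]"]) simp
next
 case (Cons a w)
 then obtain w' where w': "set w'\<subseteq>A'" "red w'" "wprod w' = wprod w" by auto
 have a: "a\<in>A'" "a\<in>A" using Cons assms by auto
 show ?case
 proof (cases "w'~=[] \<and> hd w' = iv a")
  case False
  then have "red (a # w')" using w' a by (auto simp: red_Cons)
  then show ?thesis using w' a by (intro exI[of _ "a # w'"]) auto
 next
  case True
  then obtain u where u: "w' = iv a # u" by (cases w') auto
  have ru: "red u" "set u\<subseteq>A'" using w' u by (auto simp: red_Cons)
  have "wprod (a # w) = (wprod u \<odot> iv a) \<odot> a" using w'(3) u by simp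
  also have "... = wprod u"
   using G_carrier[OF wprod_G[OF red_set[OF ru(1)]]] G_carrier[OF A_G(1)[OF a(2)]] by (simp add: D.m_assoc D.l_inv)
  finally show ?thesis using ru by auto
 qed
qed

lemma words_subgroup: assumes "A'\<subseteq>A" "!!a. a\<in>A' ==> iv a\<in>A'"
 and S: "!!x. x\<in>S ==> EX w. set w\<subseteq>A' \<and> wprod w = x"
 shows "g\<in>generate D_group S ==> EX w. set w\<subseteq>A' \<and> wprod w = g"
proof (induction rule: generate.induct)
 case one show ?case by (rule exI[of _ "[]"]) simp
next
 case (incl h) then show ?case by (rule S)
next
 case (inv h)
 have "EX v. set v\<subseteq>A' \<and> wprod v = iv (wprod w)" if "set w\<subseteq>A'" for w using that
 proof (induction w)
  case Nil show ?case by (rule exI[of _ "[]"]) simp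
 next
  case (Cons a w)
  then obtain v where v: "set v\<subseteq>A'" "wprod v = iv (wprod w)" by auto
  have a: "a\<in>A'" "a\<in>A" "set w\<subseteq>A" "set v\<subseteq>A" using Cons assms v by auto
  have "wprod (v @ [iv a]) = iv a \<odot> iv (wprod w)"
   using wprod_append[of v "[iv a]"] v a A_inv G_carrier[OF A_G(1)[OF A_inv[OF a(2)]]] by simp
  also have "... = iv (wprod (a # w))"
   using D.inv_mult_group[OF G_carrier[OF wprod_G[OF a(3)]] G_carrier[OF A_G(1)[OF a(2)]]] by simp
  finally show ?case using v a assms(2) by (intro exI[of _ "v @ [iv a]"]) auto
 qed
 then show ?case using S[OF inv] by blast
next
 case (eng h1 h2)
 then obtain u v where uv: "set u\<subseteq>A'" "wprod u = h1" "set v\<subseteq>A'" "wprod v = h2" by blast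
 then have "wprod (v @ u) = h1 \<odot> h2" using wprod_append[of v u] assms(1) by auto
 then show ?case using uv by (intro exI[of _ "v @ u"]) auto
qed

text \<open>Descent in the Euclidean norm: choose h in the generated subgroup with |h (k c)|
  minimal. No letter expands at this point, so c is the point of its orbit nearest to it; but it
  belongs to that orbit and therefore equals c.\<close>

lemma A_generates: assumes k: "k\<in>G" shows "k\<in>generate D_group A"
proof -
 let ?H = "generate D_group A"
 have Ac: "A\<subseteq>carrier D_group" using A_G G_carrier by blast
 have HG: "?H\<subseteq>G" using D.generate_subgroup_incl[OF _ G_subgroup, of A] A_G by blast
 define z where "z = k c"
 have nz: "norm z < 1" unfolding z_def using norm_act_less k c1 by blast
 define T where "T = {h\<in>?H. norm (h z)<=norm z}"
 have "T\<subseteq>{g\<in>G. EX w. norm w<=norm z \<and> norm (g w)<=norm z}" using HG by (auto simp: T_def)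
 then have fT: "finite T" using finite_returns[OF nz] finite_subset by blast
 have eT: "\<e>\<in>T" using generate.one[of D_group A] act_one[of z] nz by (simp add: T_def)
 obtain h where h: "h\<in>T" "!!h'. h'\<in>T ==> norm (h z)<=norm (h' z)"
  using arg_min_if_finite[OF fT, of "%h. norm (h z)"] eT by (metis empty_iff not_le)
 have hH: "h\<in>?H" "norm (h z)<=norm z" and hG: "h\<in>G" using h HG by (auto simp: T_def)
 let ?w = "h z"
 have nw: "norm ?w < 1" using hH nz by simp
 have "dn g ?w<=1" if g: "g\<in>A" for g
 proof -
  have gG: "g\<in>G" using A_G g by blast
  have "norm ?w<=norm (g ?w)"
  proof (cases "norm (g ?w)<=norm z")
   case True
   have "g \<odot> h\<in>?H" by (rule generate.eng[OF generate.incl[OF g] hH(1)])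
   moreover have "(g \<odot> h) z = g ?w" using act_mult[OF gG hG] nz by simp
   ultimately have "g \<odot> h\<in>T" using True by (simp add: T_def)
   then show ?thesis using h(2)[of "g \<odot> h"] \<open>(g \<odot> h) z = g ?w\<close> by simp
  next
   case False then show ?thesis using hH by simp
  qed
  then show ?thesis using dn_ge_iff(2)[OF gG nw] by simp
 qed
 then have "hyp_quot ?w c<=hyp_quot ?w ((h \<odot> k) c)"
  using in_domain[OF nw] G_mult[OF hG k] by blast
 also have "(h \<odot> k) c = ?w" using act_mult[OF hG k] c1 by (simp add: z_def)
 also have "hyp_quot ?w ?w = 0" using hyp_quot_eq_0[OF nw nw] by simp
 finally have "?w = c" using hyp_quot_nonneg[OF nw c1] hyp_quot_eq_0[OF nw c1] by simp
 then have "(h \<odot> k) c = c" using act_mult[OF hG k] c1 by (simp add: z_def)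
 then have "h \<odot> k = \<e>" using no_fixed_point[OF G_mult[OF hG k] _ c1] by blast
 then have "iv k = h" using D.inv_equality[of h k] G_carrier hG k by simp
 then have "k = iv h" using k by (metis inv_inv_G)
 then show ?thesis using D.generate_m_inv_closed[OF Ac hH(1)] by simp
qed

lemma G_word: assumes "k\<in>G" obtains w where "red w" "wprod w = k"
proof -
 have "EX w. set w\<subseteq>A \<and> wprod w = x" if "x\<in>A" for x
  using that G_carrier[OF A_G(1)] by (intro exI[of _ "[x]"]) simp
 then obtain w where w: "set w\<subseteq>A" "wprod w = k"
  using words_subgroup[of A A k] A_inv A_generates[OF assms] by blast
 obtain w' where "red w'" "wprod w' = wprod w"
  using reduce_word[OF subset_refl A_inv w(1)] by auto
 then show ?thesis using that w(2) by simp
qed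

text \<open>No letter has factor above 1 at p, and \<open>comp_contract\<close> carries this over to
  reduced words. It is the form in which parabolicity of p is used.\<close>

lemma dn_p_le: assumes "k\<in>G" shows "dn k p<=1"
proof -
 obtain w where w: "red w" "wprod w = k" using G_word assms by blast
 have "dn g p<=1" if "g\<in>A" for g
  using arcs_at_p[OF that] dn_g0_p dn_inv_g0_p by (cases "dn g p>=1") auto
 moreover have "w~=[] ==> hd w\<in>A" using red_set[OF w(1)] by auto
 ultimately show ?thesis using comp_contract[OF w(1), of p] p_sphere w by auto
qed

text \<open>Finitely many letters suffice for reduced words of a finite generating set. Any g in A
  is a reduced word in them, and its last letter must be g: g 0 lies where the inverse of that
  letter expands, and also where the inverse of g does.\<close>

lemma finite_A: assumes "finitely_generated D_group G" shows "finite A"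
proof -
 obtain S where S: "finite S" "S\<subseteq>G" "generate D_group S = G" using assms by (auto simp: finitely_generated_def)
 have "ALL x:S. EX w. red w \<and> wprod w = x" using G_word S by (metis subsetD)
 then obtain W where W: "!!x. x\<in>S ==> red (W x)" "!!x. x\<in>S ==> wprod (W x) = x" by metis
 define L where "L = (\<Union>x\<in>S. set (W x))"
 define A' where "A' = L Un iv ` L"
 have fin: "finite A'" using S by (simp add: A'_def L_def)
 have LA: "L\<subseteq>A" using W red_set by (auto simp: L_def)
 have A'A: "A'\<subseteq>A" using LA A_inv by (auto simp: A'_def)
 have sym: "iv a\<in>A'" if "a\<in>A'" for a using that LA A_G by (auto simp: A'_def)
 have SW: "EX w. set w\<subseteq>A' \<and> wprod w = x" if "x\<in>S" for x
  using that W by (intro exI[of _ "W x"]) (auto simp: A'_def L_def)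
 have "g\<in>A'" if g: "g\<in>A" for g
 proof -
  have "g\<in>generate D_group S" using S A_G g by blast
  then obtain v where v: "set v\<subseteq>A'" "wprod v = g" using words_subgroup[OF A'A sym SW] by blast
  obtain w where w: "set w\<subseteq>A'" "red w" "wprod w = g" using reduce_word[OF A'A sym v(1)] v(2) by auto
  have ne: "w~=[]" using w(3) A_G(2)[OF g] by auto
  have 1: "dn (iv (last w)) (g 0) > 1" using comp_0(1)[OF w(2) ne] w(3) by simp
  have rg: "red [g]" using g by (simp add: red_Cons)
  have 2: "dn (iv g) (g 0) > 1" using comp_0(1)[OF rg] G_carrier[OF A_G(1)[OF g]] by simp
  have lA': "last w\<in>A'" by (rule subsetD[OF w(1) last_in_set[OF ne]])
  then have lA: "last w\<in>A" using A'A by (rule subsetD[rotated])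
  have gn: "norm (g 0)<=1" using norm_act_le[OF A_G(1)[OF g], of 0] by simp
  have "iv (last w) = iv g"
  proof (rule ccontr)
   assume "iv (last w)~=iv g"
   from arcs_disjoint[OF A_inv[OF lA] A_inv[OF g] this gn 1] 2 show False by simp
  qed
  then have "iv (iv (last w)) = iv (iv g)" by simp
  then have "last w = g" using inv_inv_G[OF A_G(1)[OF lA]] inv_inv_G[OF A_G(1)[OF g]] by simp
  then show ?thesis using lA' by simp
 qed
 then have "A\<subseteq>A'" ..
 then show ?thesis using fin by (rule finite_subset)
qed

text \<open>For a = g n 0 one has dn (inv (g n)) x * |x - a|^2 = 1 - |a|^2, and
  \<open>dn_p_le\<close> bounds the factor by dn k x. In a Stolz angle |x - a| <= M (1 - |a|), so 1
  <= dn k x * M^2 * (1 - |a|), whose right side tends to 0.\<close>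

lemma orbit_p_not_conical: assumes "x\<in>conical_limit_set G" "k\<in>G" shows "k x~=p"
proof
 assume kx: "k x = p"
 obtain g M where g: "!!n. g n\<in>G" "(%n. g n 0) \<longlonglongrightarrow> x" "!!n. dist (g n 0) x<=M * (1 - norm (g n 0))"
  and x: "norm x = 1" using assms by (auto simp: conical_limit_set_def)
 have a1: "norm (g n 0) < 1" for n using norm_act_less[OF g(1)[of n], of 0] by simp
 have M: "M > 0"
 proof -
  have "g 0 0~=x" using a1[of 0] x by auto
  then have "dist (g 0 0) x > 0" by simp
  then show ?thesis using g(3)[of 0] a1[of 0] by (smt (verit) mult_nonpos_nonneg)
 qed
 have bound: "1<=dn k x * M^2 * (1 - norm (g n 0))" for n
 proof -
  let ?a = "g n 0"
  have iG: "iv (g n)\<in>G" using G_inv g by blast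
  have "dn (iv (g n)) x = (1 - (norm ?a)^2) / (norm (1 - cnj ?a * x))^2" using mf(3)[OF iG, of x] x g(1) by simp
  also have "(norm (1 - cnj ?a * x))^2 = (norm (x - ?a))^2" using cmod_sq_ident[of ?a x] x by simp
  finally have d: "dn (iv (g n)) x * (norm (x - ?a))^2 = 1 - (norm ?a)^2" using a1[of n] x by auto
  have "iv (g n) = (iv (g n) \<odot> iv k) \<odot> k"
   using G_carrier[OF iG] G_carrier[OF assms(2)] by (simp add: D.m_assoc D.l_inv)
  then have "dn (iv (g n)) x = dn (iv (g n) \<odot> iv k) p * dn k x"
   using dn_mult[OF G_mult[OF iG G_inv[OF assms(2)]] assms(2), of x] kx x by simp
  also have "...<=1 * dn k x"
   using dn_p_le[OF G_mult[OF iG G_inv[OF assms(2)]]] dn_pos[OF assms(2), of x] x by (intro mult_right_mono) auto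
  finally have "dn (iv (g n)) x * (norm (x - ?a))^2<=dn k x * (norm (x - ?a))^2" by (simp add: mult_right_mono)
  also have "...<=dn k x * (M * (1 - norm ?a))^2"
  proof (intro mult_left_mono power_mono)
   show "norm (x - ?a)<=M * (1 - norm ?a)" using g(3)[of n] by (simp add: dist_norm norm_minus_commute)
   show "0<=dn k x" using dn_pos[OF assms(2), of x] x by simp
  qed simp
  finally have "1 - (norm ?a)^2<=dn k x * (M * (1 - norm ?a))^2" unfolding d .
  then have "(1 - norm ?a) * (1 + norm ?a)<=(1 - norm ?a) * (dn k x * M^2 * (1 - norm ?a))"
   by (simp add: power2_eq_square algebra_simps)
  then have "1 + norm ?a<=dn k x * M^2 * (1 - norm ?a)" using a1[of n] by simp
  then show ?thesis using norm_ge_zero[of ?a] by linarith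
 qed
 have "(%n. dn k x * M^2 * (1 - norm (g n 0))) \<longlonglongrightarrow> dn k x * M^2 * (1 - norm x)"
  by (intro tendsto_intros g)
 then have "1<=dn k x * M^2 * (1 - norm x)" using LIMSEQ_le_const bound by blast
 then show False using x by simp
qed

section \<open>Infinite reduced words and the points they code\<close>

definition reduced_seqs :: "(nat => complex => complex) set" where
 "reduced_seqs = {om. ALL n. om n\<in>A \<and> om (Suc n)~=iv (om n)}"

text \<open>A tail that repeats one parabolic letter codes p, so the excluded sequences belong to
  points of the orbit of p.\<close>

definition good_seqs :: "(nat => complex => complex) set" where
 "good_seqs = {om\<in>reduced_seqs. ALL N. EX n>=N. \<not> (om (Suc n) = om n \<and> om n\<in>parabolic_letters g0)}"

fun prod_seq :: "(nat => complex => complex) => nat => complex => complex" where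
 "prod_seq om 0 = \<e>"
| "prod_seq om (Suc n) = om n \<odot> prod_seq om n"

definition coded :: "(nat => complex => complex) => complex => bool" where
 "coded om x \<longleftrightarrow> norm x = 1 \<and> (ALL i. dn (om i) (prod_seq om i x)>=1)"

lemma seq_A: "om\<in>reduced_seqs ==> om n\<in>A" by (simp add: reduced_seqs_def)

lemma prod_seq_G: "om\<in>reduced_seqs ==> prod_seq om n\<in>G"
 by (induction n) (auto simp: G_one G_mult A_G seq_A)

lemma prod_seq_Suc: "om\<in>reduced_seqs ==> norm x<=1 ==> prod_seq om (Suc n) x = om n (prod_seq om n x)"
 using act_mult[OF A_G(1)[OF seq_A] prod_seq_G] by simp

lemma prod_seq_comp: "om\<in>reduced_seqs ==> prod_seq om (m + n) = wprod (map om [m..<m+n]) \<odot> prod_seq om m"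
proof (induction n)
 case 0 then show ?case using G_carrier[OF prod_seq_G[OF 0, of m]] by simp
next
 case (Suc n)
 have s: "set (map om [m..<m+n])\<subseteq>A" using Suc.prems seq_A by auto
 have "wprod (map om [m..<m + Suc n]) = om (m + n) \<odot> wprod (map om [m..<m+n])"
  using wprod_append[OF s, of "[om (m + n)]"] seq_A[OF Suc.prems] G_carrier[OF A_G(1)[OF seq_A[OF Suc.prems]]] by simp
 then show ?case using Suc.IH[OF Suc.prems] G_carrier[OF wprod_G[OF s]] G_carrier[OF prod_seq_G[OF Suc.prems]]
   G_carrier[OF A_G(1)[OF seq_A[OF Suc.prems]]] by (simp add: D.m_assoc)
qed

lemma red_segment: assumes "om\<in>reduced_seqs" shows "red (map om [m..<m+n])"
proof (induction n arbitrary: m)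
 case (Suc n)
 have "[m..<m + Suc n] = m # [Suc m..<Suc m + n]" by (simp add: upt_rec)
 moreover have "[Suc m..<Suc m + n]~=[] ==> hd [Suc m..<Suc m + n] = Suc m" by (metis hd_upt upt_eq_Nil_conv not_le)
 ultimately show ?case using Suc[of "Suc m"] assms by (auto simp: red_Cons reduced_seqs_def hd_map)
qed simp

lemma prod_seq_inj: assumes w: "om\<in>reduced_seqs" shows "inj (prod_seq om)"
proof (rule linorder_injI)
 fix m n :: nat assume "m < n"
 show "prod_seq om m~=prod_seq om n"
 proof
  assume e: "prod_seq om m = prod_seq om n"
  obtain j where j: "n = m + j" "j > 0" using \<open>m < n\<close> less_imp_add_positive by auto
  let ?k = "wprod (map om [m..<m+j])"
  have kG: "?k\<in>G" using wprod_G[OF red_set[OF red_segment[OF w]]] .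
  have "?k \<odot> prod_seq om m = prod_seq om m" using prod_seq_comp[OF w, of m j] e j by simp
  then have "?k = \<e>" using G_carrier[OF kG] G_carrier[OF prod_seq_G[OF w]] by (simp add: D.l_cancel_one)
  then show False using comp_0(2)[OF red_segment[OF w]] j by simp
 qed
qed

text \<open>The prefixes are distinct group elements, and only finitely many elements keep 0 inside
  a smaller disk.\<close>

lemma centers_to_circle: assumes w: "om\<in>reduced_seqs" and "e > 0"
 shows "EX N. ALL n>=N. 1 - (norm (iv (prod_seq om n) 0))^2 < e"
proof -
 define r where "r = sqrt (max 0 (1 - e))"
 have r: "r < 1" using assms by (simp add: r_def)
 have "finite {n. prod_seq om n\<in>{g\<in>G. norm (g 0)<=r}}"
  using finite_vimageI[OF finite_orbit_origin[OF r] prod_seq_inj[OF w]] by (simp add: vimage_def)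
 then obtain N where "ALL n:{n. prod_seq om n\<in>{g\<in>G. norm (g 0)<=r}}. n < N"
  unfolding finite_nat_set_iff_bounded ..
 then have N: "!!n. prod_seq om n\<in>{g\<in>G. norm (g 0)<=r} ==> n < N" by blast
 have "1 - (norm (iv (prod_seq om n) 0))^2 < e" if "n>=N" for n
 proof -
  have "norm (prod_seq om n 0) > r" using N[of n] that prod_seq_G[OF w, of n] by force
  then have "norm (iv (prod_seq om n) 0) > r" using mf(2)[OF prod_seq_G[OF w]] by simp
  moreover have "r>=0" by (simp add: r_def)
  ultimately have "r^2 < (norm (iv (prod_seq om n) 0))^2" by (simp add: power_strict_mono)
  moreover have "r^2>=1 - e" by (simp add: r_def)
  ultimately show ?thesis by linarith
 qed
 then show ?thesis by blast
qed

lemma cylinder_expands: assumes w: "om\<in>reduced_seqs" and x: "norm x<=1" and d: "!!i. i < n ==> dn (om i) (prod_seq om i x)>=1"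
 shows "dn (prod_seq om n) x>=1"
 using d
proof (induction n)
 case 0 then show ?case using dn_one[OF x] by simp
next
 case (Suc n)
 have "dn (prod_seq om (Suc n)) x = dn (om n) (prod_seq om n x) * dn (prod_seq om n) x"
  using dn_mult[OF A_G(1)[OF seq_A[OF w]] prod_seq_G[OF w] x] by simp
 moreover have "dn (prod_seq om n) x>=1" "dn (om n) (prod_seq om n x)>=1" using Suc by auto
 ultimately show ?case using mult_mono[of 1 "dn (om n) (prod_seq om n x)" 1 "dn (prod_seq om n) x"] by simp
qed

lemma dn_circle: assumes "k\<in>G" "norm x = 1"
 shows "dn k x * (norm (x - iv k 0))^2 = 1 - (norm (iv k 0))^2" "x~=iv k 0"
proof -
 have n: "norm (iv k 0) < 1" using mf(1) assms by blast
 then show "x~=iv k 0" using assms by auto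
 have "(norm (1 - cnj (iv k 0) * x))^2 = (norm (x - iv k 0))^2" using cmod_sq_ident[of "iv k 0" x] assms by simp
 then show "dn k x * (norm (x - iv k 0))^2 = 1 - (norm (iv k 0))^2"
  using mf(3)[OF assms(1), of x] assms \<open>x ~= iv k 0\<close> by simp
qed

text \<open>The prefix expands weakly on its cylinder, and dn k x * |x - a|^2 = 1 - |a|^2 turns this
  into closeness to the centre a. So cylinders shrink although single letters do not expand strictly
  at p.\<close>

lemma cylinder_small: assumes w: "om\<in>reduced_seqs" and x: "norm x = 1" and d: "!!i. i < n ==> dn (om i) (prod_seq om i x)>=1"
 shows "(norm (x - iv (prod_seq om n) 0))^2<=1 - (norm (iv (prod_seq om n) 0))^2"
proof -
 have "1 * (norm (x - iv (prod_seq om n) 0))^2<=dn (prod_seq om n) x * (norm (x - iv (prod_seq om n) 0))^2"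
  using cylinder_expands[OF w _ d] x by (intro mult_right_mono) auto
 then show ?thesis using dn_circle(1)[OF prod_seq_G[OF w] x, of n] by simp
qed

lemma cylinder_diam: assumes w: "om\<in>reduced_seqs" and e: "e > 0"
 obtains n where "ALL x y. norm x = 1 \<and> norm y = 1 \<and> (ALL i<n. dn (om i) (prod_seq om i x)>=1) \<and>
   (ALL i<n. dn (om i) (prod_seq om i y)>=1) --> dist x y < e"
proof -
 obtain n where n: "1 - (norm (iv (prod_seq om n) 0))^2 < (e/2)^2" using centers_to_circle[OF w, of "(e/2)^2"] e by auto
 have "dist x (iv (prod_seq om n) 0) < e/2" if "norm x = 1" "ALL i<n. dn (om i) (prod_seq om i x)>=1" for x
 proof -
  have "(norm (x - iv (prod_seq om n) 0))^2<=1 - (norm (iv (prod_seq om n) 0))^2"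
   by (rule cylinder_small[OF w that(1)]) (use that in auto)
  then have "(norm (x - iv (prod_seq om n) 0))^2 < (e/2)^2" using n by linarith
  then show ?thesis unfolding dist_norm by (rule power2_less_imp_less) (use e in simp)
 qed
 then show ?thesis by (intro that[of n] allI impI) (meson dist_triangle_half_l)
qed

lemma coded_unique: assumes w: "om\<in>reduced_seqs" and "coded om x" "coded om y" shows "x = y"
proof (rule ccontr)
 assume "x~=y"
 then obtain n where "dist x y < dist x y" using cylinder_diam[OF w, of "dist x y"] assms unfolding coded_def
  by (metis zero_less_dist_iff)
 then show False by simp
qed

end

subsection \<open>Coding of the conical limit set\<close>

context cusped_domain
begin

declare prod_seq.simps(2) [simp del]

lemma center_dir: assumes "a\<in>A" shows "norm (iv a 0 / of_real (norm (iv a 0))) = 1" "dn a (iv a 0 / of_real (norm (iv a 0))) > 1"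
proof -
 let ?a = "iv a 0" and ?n = "norm (iv a 0)"
 have n: "?n > 0" "?n < 1" using center_ne_0[OF assms] mf(1)[OF A_G(1)[OF assms]] by auto
 show 1: "norm (?a / of_real ?n) = 1" using n by (simp add: norm_divide)
 have "?a / of_real ?n = (1 / ?n) *\<^sub>R ?a" by (simp add: scaleR_conv_of_real divide_inverse mult.commute)
 then have "?a \<bullet> (?a / of_real ?n) = ?n" using n by (simp add: power2_norm_eq_inner[symmetric] power2_eq_square)
 moreover have "?n^2 < ?n" using n by (simp add: power2_eq_square)
 ultimately show "dn a (?a / of_real ?n) > 1"
  using dn_klein(1)[OF A_G(1)[OF assms], of "?a / of_real ?n"] 1 klein_sphere[OF 1] by simp
qed

text \<open>Built from the end: a point y of the cylinder of the tail is pulled back by the inverse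
  of b. That inverse does not expand strictly at y, because d expands weakly there, so b expands
  weakly at the preimage.\<close>

lemma cylinder_nonempty: "red (b # w) ==> EX z. norm z = 1 \<and> (ALL i<length (b # w). dn ((b # w) ! i) (wprod (take i (b # w)) z)>=1)"
proof (induction w arbitrary: b)
 case Nil
 then have b: "b\<in>A" by (simp add: red_Cons)
 show ?case using center_dir[OF b] act_one by (intro exI[of _ "iv b 0 / of_real (norm (iv b 0))"]) auto
next
 case (Cons d w)
 have b: "b\<in>A" "d\<in>A" "d~=iv b" "red (d # w)" using Cons.prems by (auto simp: red_Cons)
 obtain y where y: "norm y = 1" "!!i. i < length (d # w) ==> dn ((d # w) ! i) (wprod (take i (d # w)) y)>=1"
  using Cons.IH[OF b(4)] by blast
 have y1: "norm y<=1" using y by simp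
 have dy: "dn d y>=1" using y(2)[of 0] y1 by (simp add: act_one)
 have "\<not> dn (iv b) y > 1" using arcs_disjoint[OF A_inv[OF b(1)] b(2) b(3)[symmetric] y1] dy by auto
 then have "dn (iv (iv b)) (iv b y)>=1" using inv_expand(1)[OF A_inv[OF b(1)] y1] by simp
 then have dz: "dn b (iv b y)>=1" using A_G[OF b(1)] by simp
 have nz: "norm (iv b y) = 1" using norm_act_eq1[OF G_inv y(1)] A_G b by blast
 show ?case
 proof (intro exI[of _ "iv b y"] conjI nz allI impI)
  fix i assume i: "i < length (b # d # w)"
  show "dn ((b # d # w) ! i) (wprod (take i (b # d # w)) (iv b y))>=1"
  proof (cases i)
   case 0 then show ?thesis using dz nz by (simp add: act_one)
  next
   case (Suc j)
   have s: "set (take j (d # w))\<subseteq>A" using red_set[OF b(4)] by (meson set_take_subset subset_trans)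
   have "wprod (take i (b # d # w)) (iv b y) = wprod (take j (d # w)) (b (iv b y))"
    using act_mult[OF wprod_G[OF s] A_G(1)[OF b(1)], of "iv b y"] nz Suc by simp
   also have "b (iv b y) = y" using act_inv'[OF A_G(1)[OF b(1)] y1] .
   finally show ?thesis using y(2)[of j] i Suc by simp
  qed
 qed
qed

lemma prod_seq_wprod: assumes "om\<in>reduced_seqs" shows "prod_seq om n = wprod (map om [0..<n])"
 using prod_seq_comp[OF assms, of 0 n] G_carrier[OF wprod_G[OF red_set[OF red_segment[OF assms, of 0 n]]]] by simp

lemma dn_cont: assumes "k\<in>G" shows "continuous_on U1 (dn k)"
proof -
 have "continuous_on U1 (%z. (1 - (norm (iv k 0))^2) / (norm (1 - cnj (iv k 0) * z))^2)"
  using one_minus_cnj_mult_ne_0[OF mf(1)[OF assms]] by (intro continuous_intros) auto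
 then show ?thesis by (rule continuous_on_eq) (use mf(3)[OF assms] in auto)
qed

lemma dn_comp_cont: assumes "a\<in>A" "k\<in>G" shows "continuous_on U1 (%z. dn a (k z))"
 by (rule continuous_on_compose2[OF dn_cont[OF A_G(1)[OF assms(1)]] mf(7)[OF assms(2)]])
  (use norm_act_le[OF assms(2)] in auto)

lemma coded_exists: assumes w: "om\<in>reduced_seqs" obtains x where "coded om x"
proof -
 define F where "F n = {z\<in>sphere 0 1. ALL i:{..<n}. dn (om i) (prod_seq om i z)>=1}" for n
 have "compact (F n)" for n
 proof -
  have "closed {z\<in>sphere 0 1. dn (om i) (prod_seq om i z)>=1}" for i
   by (rule continuous_on_closed_Collect_le[OF continuous_on_const])
    (auto intro: continuous_on_subset[OF dn_comp_cont[OF seq_A[OF w] prod_seq_G[OF w]]])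
  then have "closed (sphere 0 1 Int (\<Inter>i\<in>{..<n}. {z\<in>sphere 0 1. dn (om i) (prod_seq om i z)>=1}))" by (intro closed_Int closed_INT ballI closed_sphere)
  moreover have "F n = sphere 0 1 Int (\<Inter>i\<in>{..<n}. {z\<in>sphere 0 1. dn (om i) (prod_seq om i z)>=1})" by (auto simp: F_def)
  moreover have "bounded (F n)" by (rule bounded_subset[OF bounded_sphere[of 0 1]]) (auto simp: F_def)
  ultimately show ?thesis by (simp add: compact_eq_bounded_closed)
 qed
 moreover have "F n~={}" for n
 proof -
  have r: "red (om 0 # map om [1..<Suc n])" using red_segment[OF w, of 0 "Suc n"] by (simp add: upt_rec del: upt_Suc)
  have e: "om 0 # map om [1..<Suc n] = map om [0..<Suc n]" by (simp add: upt_rec del: upt_Suc)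
  obtain z where z: "norm z = 1" "!!i. i < Suc n ==> dn (map om [0..<Suc n] ! i) (wprod (take i (map om [0..<Suc n])) z)>=1"
   using cylinder_nonempty[OF r] unfolding e by auto
  have "dn (om i) (prod_seq om i z)>=1" if "i < n" for i
   using z(2)[of i] that prod_seq_wprod[OF w] by (simp add: take_map del: upt_Suc)
  then have "z\<in>F n" using z by (simp add: F_def)
  then show ?thesis by blast
 qed
 moreover have "F n\<subseteq>F m" if "m<=n" for m n using that by (auto simp: F_def)
 ultimately have "\<Inter> (range F)~={}" using compact_nest[of F] by blast
 then obtain x where "!!n. x\<in>F n" by blast
 then have "coded om x" unfolding coded_def F_def by auto
 then show ?thesis using that by blast
qed

definition pt :: "(nat => complex => complex) => complex" where "pt om = (THE x. coded om x)"

lemma coded_pt: assumes "om\<in>reduced_seqs" shows "coded om (pt om)"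
proof -
 obtain x where x: "coded om x" using coded_exists[OF assms] by blast
 show ?thesis unfolding pt_def by (rule theI[of _ x]) (use x coded_unique[OF assms] in auto)
qed

lemma pt_eq: "om\<in>reduced_seqs ==> coded om x ==> pt om = x"
 using coded_unique coded_pt by blast

lemma seq_shift: "om\<in>reduced_seqs ==> (%i. om (n + i))\<in>reduced_seqs"
 by (simp add: reduced_seqs_def)

lemma prod_seq_shift: assumes w: "om\<in>reduced_seqs" and x: "norm x<=1"
 shows "prod_seq (%i. om (n + i)) i (prod_seq om n x) = prod_seq om (n + i) x"
proof (induction i)
 case 0 show ?case using act_one norm_act_le[OF prod_seq_G[OF w] x] by simp
next
 case (Suc i)
 show ?case using prod_seq_Suc[OF seq_shift[OF w] norm_act_le[OF prod_seq_G[OF w] x], of n i n] prod_seq_Suc[OF w x, of "n + i"] Suc by simp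
qed

lemma coded_shift: assumes w: "om\<in>reduced_seqs" and x: "coded om x"
 shows "coded (%i. om (n + i)) (prod_seq om n x)"
 using x norm_act_eq1[OF prod_seq_G[OF w], of x n] prod_seq_shift[OF w, of x n] by (auto simp: coded_def)

lemma pt_shift: assumes w: "om\<in>reduced_seqs" shows "pt (%i. om (n + i)) = prod_seq om n (pt om)"
 by (rule pt_eq[OF seq_shift[OF w] coded_shift[OF w coded_pt[OF w]]])

lemma good_shift: assumes "om\<in>good_seqs" shows "(%i. om (n + i))\<in>good_seqs"
 unfolding good_seqs_def
proof (intro CollectI conjI allI)
 show "(%i. om (n + i))\<in>reduced_seqs" using seq_shift assms by (auto simp: good_seqs_def)
 fix N
 obtain m where "m>=n + N" "\<not> (om (Suc m) = om m \<and> om m\<in>parabolic_letters g0)" using assms by (auto simp: good_seqs_def)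
 then show "EX m>=N. \<not> (om (n + Suc m) = om (n + m) \<and> om (n + m)\<in>parabolic_letters g0)"
  by (intro exI[of _ "m - n"]) auto
qed

lemma pt_continuous: assumes w: "om\<in>reduced_seqs" and e: "e > 0"
 obtains n where "ALL om':reduced_seqs. (ALL i<n. om' i = om i) --> dist (pt om) (pt om') < e"
proof -
 obtain n where n: "ALL x y. norm x = 1 \<and> norm y = 1 \<and> (ALL i<n. dn (om i) (prod_seq om i x)>=1) \<and>
   (ALL i<n. dn (om i) (prod_seq om i y)>=1) --> dist x y < e" using cylinder_diam[OF w e] by blast
 have "dist (pt om) (pt om') < e" if w': "om'\<in>reduced_seqs" "ALL i<n. om' i = om i" for om'
 proof -
  have "prod_seq om' i = prod_seq om i" if "i<=n" for i
   using that w'(2) by (induction i) (auto simp: prod_seq.simps)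
  then have "ALL i<n. dn (om i) (prod_seq om i (pt om'))>=1"
   using coded_pt[OF w'(1)] w'(2) unfolding coded_def by (metis less_imp_le)
  then show ?thesis using n coded_pt[OF w'(1)] coded_pt[OF w] by (auto simp: coded_def)
 qed
 then show ?thesis by (intro that[of n]) blast
qed

section \<open>Conical limit points and sequences without parabolic tail\<close>

lemma parabolic_letters_A: "parabolic_letters g0\<subseteq>A"
 using g0A A_inv by (auto simp: parabolic_letters_def)

lemma parabolic_letter_p: "a\<in>parabolic_letters g0 ==> a p = p" "a\<in>parabolic_letters g0 ==> dn a p = 1"
 using g0p inv_g0_p dn_g0_p dn_inv_g0_p by (auto simp: parabolic_letters_def)

text \<open>On the closed disk the regions where b and inv a expand meet at most at p, and only if
  both letters are parabolic; reducedness then gives b = a. In all other cases compactness separates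
  the regions.\<close>

lemma consecutive_gap: assumes a: "a\<in>A" and b: "b\<in>A" "b~=iv a" and np: "\<not> (b = a \<and> a\<in>parabolic_letters g0)"
 obtains d where "d > 0" "ALL x y. norm x = 1 \<and> norm y<=1 \<and> dn b x>=1 \<and> dn (iv a) y>=1 --> dist x y>=d"
proof -
 let ?S = "{x\<in>U1. dn b x>=1}" and ?T = "{x\<in>U1. dn (iv a) x>=1}"
 have cl: "closed {x\<in>U1. dn k x>=1}" if "k\<in>A" for k
  by (rule continuous_on_closed_Collect_le[OF continuous_on_const dn_cont[OF A_G(1)[OF that]]]) auto
 have "compact ?S" unfolding compact_eq_bounded_closed
 proof
  show "bounded ?S" by (rule bounded_subset[OF bounded_cball]) (rule Collect_restrict)
  show "closed ?S" by (rule cl[OF b(1)])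
 qed
 moreover have "closed ?T" using cl[OF A_inv[OF a]] .
 moreover have "?S Int ?T = {}"
 proof -
  have False if x: "norm x<=1" "dn b x>=1" "dn (iv a) x>=1" for x
  proof -
   have "x = p" "dn b x = 1" "dn (iv a) x = 1" using arcs_meet[OF b(1) A_inv[OF a] b(2) x] by auto
   then have "b\<in>{g0, iv g0}" "iv a\<in>{g0, iv g0}" using arcs_at_p b A_inv[OF a] by auto
   moreover have "a = iv (iv a)" using A_G[OF a] by simp
   moreover have "iv (iv g0) = g0" using A_G[OF g0A] by simp
   ultimately have "b = a" "a\<in>{g0, iv g0}" using b(2) by auto
   then show False using np by (simp add: parabolic_letters_def)
  qed
  then show ?thesis by auto
 qed
 ultimately obtain d where "d > 0" "ALL x:?S. ALL y:?T. d<=dist x y" using separate_compact_closed by blast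
 then show ?thesis by (intro that[of d]) auto
qed

text \<open>After a prefix K whose last letter and the next one are not the same parabolic letter, K
  x and K 0 lie in regions at distance at least dl, uniformly as there are finitely many pairs of
  letters. With a = inv K 0, the identity |K x - K 0| * |x - a| = 1 - |a|^2 gives the Stolz
  condition with constant 2 / dl.\<close>

lemma pt_conical: assumes fin: "finite A" and g: "om\<in>good_seqs" shows "pt om\<in>conical_limit_set G"
proof -
 have w: "om\<in>reduced_seqs" using g by (simp add: good_seqs_def)
 define x where "x = pt om"
 have x: "norm x = 1" "!!i. dn (om i) (prod_seq om i x)>=1" using coded_pt[OF w] by (auto simp: x_def coded_def)
 define P where "P = {(a, b). a\<in>A \<and> b\<in>A \<and> b~=iv a \<and> \<not> (b = a \<and> a\<in>parabolic_letters g0)}"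
 have fP: "finite P" by (rule finite_subset[OF _ finite_cartesian_product[OF fin fin]]) (auto simp: P_def)
 have "EX d. d > 0 \<and> (ALL x y. norm x = 1 \<and> norm y<=1 \<and> dn (snd q) x>=1 \<and> dn (iv (fst q)) y>=1 --> dist x y>=d)" if q: "q\<in>P" for q
 proof -
  have "fst q\<in>A" "snd q\<in>A" "snd q~=iv (fst q)" "\<not> (snd q = fst q \<and> fst q\<in>parabolic_letters g0)"
   using q by (auto simp: P_def)
  then obtain d where "d > 0" "ALL x y. norm x = 1 \<and> norm y<=1 \<and> dn (snd q) x>=1 \<and> dn (iv (fst q)) y>=1 --> dist x y>=d"
   by (rule consecutive_gap)
  then show ?thesis by blast
 qed
 then have "ALL q:P. EX d. d > 0 \<and> (ALL x y. norm x = 1 \<and> norm y<=1 \<and> dn (snd q) x>=1 \<and> dn (iv (fst q)) y>=1 --> dist x y>=d)" by blast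
 from bchoice[OF this] obtain D where D': "ALL q:P. D q > 0 \<and> (ALL x y. norm x = 1 \<and> norm y<=1 \<and> dn (snd q) x>=1 \<and> dn (iv (fst q)) y>=1 --> dist x y>=D q)" by blast
 then have D: "!!q. q\<in>P ==> D q > 0"
  "!!q x y. q\<in>P ==> norm x = 1 ==> norm y<=1 ==> dn (snd q) x>=1 ==> dn (iv (fst q)) y>=1 ==> dist x y>=D q" by auto
 define dl where "dl = Min (insert 1 (D ` P))"
 have dl: "dl > 0" "!!q. q\<in>P ==> dl<=D q" unfolding dl_def using fP D by auto
 have "ALL N. EX n>=N. (om n, om (Suc n))\<in>P"
  using g w unfolding good_seqs_def reduced_seqs_def P_def by auto
 then obtain r where r: "!!N. r N>=N" "!!N. (om (r N), om (Suc (r N)))\<in>P" by metis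
 define gs where "gs N = iv (prod_seq om (Suc (r N)))" for N
 have bound: "dist (gs N 0) x<=2 / dl * (1 - norm (gs N 0))" for N
 proof -
  let ?n = "Suc (r N)" let ?K = "prod_seq om ?n"
  have KG: "?K\<in>G" using prod_seq_G[OF w] .
  have Kx: "dn (om ?n) (?K x)>=1" "norm (?K x) = 1" using x norm_act_eq1[OF KG] by auto
  have rd: "red (map om [0..<?n])" using red_segment[OF w, of 0 ?n] by (simp only: add_0)
  have ne: "map om [0..<?n]~=[]" and la: "last (map om [0..<?n]) = om (r N)" by auto
  have K0: "dn (iv (om (r N))) (?K 0)>=1"
   using comp_0(1)[OF rd ne] unfolding la prod_seq_wprod[OF w, of ?n, symmetric] by simp
  have "dl<=dist (?K x) (?K 0)"
   using D(2)[OF r(2)[of N] Kx(2), of "?K 0"] Kx(1) K0 norm_act_le[OF KG, of 0] dl(2)[OF r(2)[of N]] by simp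
  moreover have "dist (?K x) (?K 0) * norm (x - gs N 0) = 1 - (norm (gs N 0))^2"
  proof -
   have a: "1 - (norm (gs N 0))^2>=0" using mf(1)[OF KG] by (simp add: gs_def abs_square_le_1)
   have d0: "dn ?K 0 = 1 - (norm (gs N 0))^2" using mf(3)[OF KG, of 0] by (simp add: gs_def)
   have "(norm (?K x - ?K 0))^2 = dn ?K x * (1 - (norm (gs N 0))^2)"
    using mf(5)[OF KG, of x 0] x(1) d0 by simp
   then have "(norm (?K x - ?K 0))^2 * (norm (x - gs N 0))^2 = (1 - (norm (gs N 0))^2)^2"
    using dn_circle(1)[OF KG x(1)] by (simp add: gs_def power2_eq_square mult_ac)
   then have "(norm (?K x - ?K 0) * norm (x - gs N 0))^2 = (1 - (norm (gs N 0))^2)^2" by (simp add: power_mult_distrib)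
   then show ?thesis unfolding dist_norm using a power2_eq_imp_eq[of "norm (?K x - ?K 0) * norm (x - gs N 0)"] by simp
  qed
  ultimately have "dl * norm (x - gs N 0)<=1 - (norm (gs N 0))^2"
   using mult_right_mono[of dl "dist (?K x) (?K 0)" "norm (x - gs N 0)"] by simp
  also have "... = (1 - norm (gs N 0)) * (1 + norm (gs N 0))" by (simp add: algebra_simps power2_eq_square)
  also have "...<=(1 - norm (gs N 0)) * 2" using mf(1)[OF KG] by (intro mult_left_mono) (auto simp: gs_def)
  finally show ?thesis using dl(1) by (simp add: dist_norm norm_minus_commute field_simps)
 qed
 have "(%N. gs N 0) \<longlonglongrightarrow> x"
  unfolding LIMSEQ_iff
 proof (intro allI impI)
  fix e :: real assume e: "e > 0"
  obtain M where M: "!!n. n>=M ==> 1 - (norm (iv (prod_seq om n) 0))^2 < e^2" using centers_to_circle[OF w, of "e^2"] e by auto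
  have "norm (gs N 0 - x) < e" if "N>=M" for N
  proof -
   have "Suc (r N)>=M" using r(1)[of N] that by simp
   then have "(norm (x - gs N 0))^2 < e^2"
    using cylinder_small[OF w x(1) x(2), of "Suc (r N)"] M[of "Suc (r N)"] unfolding gs_def by fastforce
   then show ?thesis using power2_less_imp_less[of "norm (x - gs N 0)" e] e by (simp add: norm_minus_commute)
  qed
  then show "EX M. ALL N>=M. norm (gs N 0 - x) < e" by blast
 qed
 then show ?thesis unfolding conical_limit_set_def x_def[symmetric] using x(1) bound G_inv[OF prod_seq_G[OF w]]
  by (auto simp: gs_def intro!: exI[of _ gs] exI[of _ "2 / dl"])
qed

text \<open>\<open>approached b x\<close>: the point is a limit of orbit points whose coding words get longer and
 longer and start with \<open>b\<close>.\<close>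

definition approached :: "(complex => complex) => complex => bool" where
 "approached b x \<longleftrightarrow> norm x = 1 \<and> (EX W. (ALL n. red (W n) \<and> W n~=[] \<and> hd (W n) = b) \<and>
   (ALL L. EX N. ALL n>=N. length (W n) > L) \<and> (%n. iv (wprod (W n)) 0) \<longlonglongrightarrow> x)"

text \<open>Pigeonhole: among finitely many letters one is the first letter along a
  subsequence.\<close>

lemma approached_first: assumes fin: "finite A" and x: "norm x = 1"
 and W: "!!n. red (W n)" "ALL L. EX N. ALL n>=N. length (W n) > L" "(%n. iv (wprod (W n)) 0) \<longlonglongrightarrow> x"
 obtains b r where "strict_mono (r :: nat => nat)" "ALL n. W (r n)~=[] \<and> hd (W (r n)) = b" "approached b x"
proof -
 obtain N where N: "!!n. n>=N ==> length (W n) > 0" using W(2) by metis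
 have "(%n. hd (W n)) ` {N..}\<subseteq>A"
 proof (rule image_subsetI)
  fix n assume "n\<in>{N..}"
  then have "W n~=[]" using N by auto
  then show "hd (W n)\<in>A" using red_set[OF W(1)] hd_in_set by blast
 qed
 then have "finite ((%n. hd (W n)) ` {N..})" using fin finite_subset by blast
 then obtain b where b: "infinite ((%n. hd (W n)) -` {b} Int {N..})"
  using inf_img_fin_domE'[of "%n. hd (W n)" "{N..}"] infinite_Ici by metis
 obtain r :: "nat => nat" where r: "strict_mono r" "!!n. r n\<in>(%n. hd (W n)) -` {b} Int {N..}"
  using infinite_enumerate[OF b] by blast
 have ne: "ALL n. W (r n)~=[] \<and> hd (W (r n)) = b" using r(2) N by fastforce
 have "ALL L. EX N. ALL n>=N. length (W (r n)) > L"
  using W(2) seq_suble[OF r(1)] by (meson order_trans)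
 moreover have "(%n. iv (wprod (W (r n))) 0) \<longlonglongrightarrow> x"
  using LIMSEQ_subseq_LIMSEQ[OF W(3) r(1)] by (simp add: o_def)
 ultimately have "approached b x" unfolding approached_def using x W(1) ne by (intro conjI exI[of _ "%n. W (r n)"]) auto
 then show ?thesis using that r(1) ne by blast
qed

text \<open>By \<open>comp_inv_0\<close> the orbit points lie where b expands, and so does their
  limit. Applying b strips the first letter from all the words, and the next letter is found by the
  pigeonhole principle again.\<close>

lemma approached_step: assumes fin: "finite A" and b: "approached b x"
 shows "b\<in>A" "dn b x>=1" "EX d. d~=iv b \<and> approached d (b x)"
proof -
 obtain W where W: "!!n. red (W n)" "!!n. W n~=[]" "!!n. hd (W n) = b"
  "ALL L. EX N. ALL n>=N. length (W n) > L" "(%n. iv (wprod (W n)) 0) \<longlonglongrightarrow> x" and x: "norm x = 1"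
  using b by (auto simp: approached_def)
 show bA: "b\<in>A" using red_set[OF W(1)[of 0]] W(2,3)[of 0] hd_in_set by blast
 have bG: "b\<in>G" using A_G bA by blast
 have dec: "W n = b # tl (W n)" for n using W(2,3)[of n] by (metis list.collapse)
 have y: "norm (iv (wprod (W n)) 0)<=1" for n
  using norm_act_le[OF G_inv[OF wprod_G[OF red_set[OF W(1)]]], of 0] by simp
 have "(%n. dn b (iv (wprod (W n)) 0)) \<longlonglongrightarrow> dn b x"
  by (rule continuous_on_tendsto_compose[OF dn_cont[OF bG] W(5)]) (use x y in "auto intro: always_eventually")
 moreover have "dn b (iv (wprod (W n)) 0)>=1" for n
  using comp_inv_0[of b "tl (W n)"] W(1)[of n] dec[of n] by (metis less_imp_le)
 ultimately show "dn b x>=1" using LIMSEQ_le_const by blast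
 define U where "U n = tl (W n)" for n
 have rU: "red (U n)" "U n~=[] --> hd (U n)~=iv b" for n using W(1)[of n] dec[of n] unfolding U_def by (metis red_Cons)+
 have len: "ALL L. EX N. ALL n>=N. length (U n) > L"
 proof
  fix L obtain N where "ALL n>=N. length (W n) > Suc L" using W(4) by blast
  then show "EX N. ALL n>=N. length (U n) > L" unfolding U_def by (intro exI[of _ N]) auto
 qed
 have Ub: "iv (wprod (U n)) 0 = b (iv (wprod (W n)) 0)" for n
 proof -
  have UG: "wprod (U n)\<in>G" using wprod_G[OF red_set[OF rU(1)]] .
  have "wprod (W n) = wprod (U n) \<odot> b" using dec[of n] unfolding U_def by (metis wprod.simps(2))
  then have "iv (wprod (W n)) = iv b \<odot> iv (wprod (U n))" using D.inv_mult_group[OF G_carrier[OF UG] G_carrier[OF bG]] by simp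
  then have "iv (wprod (W n)) 0 = iv b (iv (wprod (U n)) 0)" using act_mult[OF G_inv[OF bG] G_inv[OF UG], of 0] by simp
  then show ?thesis using act_inv'[OF bG norm_act_le[OF G_inv[OF UG], of 0]] by simp
 qed
 have lim: "(%n. iv (wprod (U n)) 0) \<longlonglongrightarrow> b x" unfolding Ub
  by (rule continuous_on_tendsto_compose[OF mf(7)[OF bG] W(5)]) (use x y in "auto intro: always_eventually")
 obtain d r where "strict_mono (r :: nat => nat)" "ALL n. U (r n)~=[] \<and> hd (U (r n)) = d" "approached d (b x)"
  by (rule approached_first[OF fin norm_act_eq1[OF bG x] rU(1) len lim])
 then show "EX d. d~=iv b \<and> approached d (b x)" using rU(2) by metis
qed

lemma approached_coded: assumes fin: "finite A" and b: "approached b x"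
 obtains om where "om\<in>reduced_seqs" "coded om x"
proof -
 have "EX f. f 0 = (b, x) \<and> (ALL n. approached (fst (f n)) (snd (f n))) \<and>
   (ALL n. fst (f (Suc n))~=iv (fst (f n)) \<and> snd (f (Suc n)) = fst (f n) (snd (f n)))"
 proof -
  obtain f where "f 0 = (b, x)" "!!n. approached (fst (f n)) (snd (f n)) \<and> fst (f (Suc n))~=iv (fst (f n)) \<and> snd (f (Suc n)) = fst (f n) (snd (f n))"
  proof (atomize_elim)
   have "EX f. ALL n. (approached (fst (f n)) (snd (f n)) \<and> (n = 0 --> f n = (b, x))) \<and>
     (fst (f (Suc n))~=iv (fst (f n)) \<and> snd (f (Suc n)) = fst (f n) (snd (f n)))"
   proof (rule dependent_nat_choice)
    show "EX q. approached (fst q) (snd q) \<and> (0 = (0::nat) --> q = (b, x))" using b by auto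
    fix q :: "(complex => complex) \<times> complex" and n :: nat
    assume q: "approached (fst q) (snd q) \<and> (n = 0 --> q = (b, x))"
    obtain d where "d~=iv (fst q)" "approached d (fst q (snd q))" using approached_step(3)[OF fin] q by blast
    then show "EX q'. (approached (fst q') (snd q') \<and> (Suc n = 0 --> q' = (b, x))) \<and> fst q'~=iv (fst q) \<and> snd q' = fst q (snd q)"
     by (intro exI[of _ "(d, fst q (snd q))"]) auto
   qed
   then show "EX f. f 0 = (b, x) \<and> (ALL n. approached (fst (f n)) (snd (f n)) \<and> fst (f (Suc n))~=iv (fst (f n)) \<and> snd (f (Suc n)) = fst (f n) (snd (f n)))"
    by blast
  qed
  then show ?thesis by blast
 qed
 then obtain f where f: "f 0 = (b, x)" "!!n. approached (fst (f n)) (snd (f n))"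
  "!!n. fst (f (Suc n))~=iv (fst (f n))" "!!n. snd (f (Suc n)) = fst (f n) (snd (f n))" by blast
 define om where "om n = fst (f n)" for n
 have w: "om\<in>reduced_seqs" unfolding reduced_seqs_def om_def using f(3) approached_step(1)[OF fin f(2)] by blast
 have x: "norm x = 1" using b by (simp add: approached_def)
 have "snd (f n) = prod_seq om n x" for n
 proof (induction n)
  case 0 then show ?case using f(1) x by (simp add: act_one)
 next
  case (Suc n)
  then show ?case using f(4)[of n] prod_seq_Suc[OF w, of x n] x om_def[of n] by simp
 qed
 then have "coded om x" unfolding coded_def using x approached_step(2)[OF fin f(2)] by (auto simp: om_def)
 then show ?thesis using that w by blast
qed

text \<open>Words of bounded length give finitely many orbit points, all inside the disk, so along a
  sequence tending to the circle the words grow. A code ending in a repeated parabolic letter would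
  put p into the orbit of x.\<close>

lemma conical_coded: assumes fin: "finite A" and x: "x\<in>conical_limit_set G"
 obtains om where "om\<in>good_seqs" "coded om x"
proof -
 obtain g M where g: "!!n. g n\<in>G" "(%n. g n 0) \<longlonglongrightarrow> x" and nx: "norm x = 1"
  using x by (auto simp: conical_limit_set_def)
 have "ALL n. EX w. red w \<and> wprod w = iv (g n)" using G_word[OF G_inv[OF g(1)]] by metis
 then obtain W where W: "!!n. red (W n)" "!!n. wprod (W n) = iv (g n)" by metis
 have Wg: "iv (wprod (W n)) 0 = g n 0" for n unfolding W(2) using g(1) by simp
 have len: "ALL L. EX N. ALL n>=N. length (W n) > L"
 proof
  fix L
  define F where "F = (%w. iv (wprod w) 0) ` {w. set w\<subseteq>A \<and> length w<=L}"
  have "finite F" unfolding F_def using finite_lists_length_le[OF fin] by blast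
  then have "closed F" by (rule finite_imp_closed)
  moreover have "x\<notin>F"
  proof
   assume "x\<in>F"
   then obtain w where w: "set w\<subseteq>A" "x = iv (wprod w) 0" by (auto simp: F_def)
   then show False using norm_act_less[OF G_inv[OF wprod_G[OF w(1)]], of 0] nx by simp
  qed
  ultimately have "open (- F)" "x \<in> - F" by auto
  then obtain N where N: "!!n. n>=N ==> g n 0 \<in> - F" using g(2) unfolding LIMSEQ_def tendsto_def
   by (metis (no_types, lifting) eventually_sequentially g(2) topological_tendstoD)
  have "length (W n) > L" if "n>=N" for n
  proof (rule ccontr)
   assume "\<not> length (W n) > L"
   then have "g n 0\<in>F" unfolding F_def Wg[symmetric] using red_set[OF W(1)] by auto
   then show False using N[OF that] by simp
  qed
  then show "EX N. ALL n>=N. length (W n) > L" by blast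
 qed
 have lim: "(%n. iv (wprod (W n)) 0) \<longlonglongrightarrow> x" unfolding Wg by (rule g(2))
 obtain b r where "strict_mono (r :: nat => nat)" "ALL n. W (r n)~=[] \<and> hd (W (r n)) = b" "approached b x"
  by (rule approached_first[OF fin nx W(1) len lim])
 then obtain om where om: "om\<in>reduced_seqs" "coded om x" using approached_coded[OF fin] by blast
 have "om\<in>good_seqs"
 proof (rule ccontr)
  assume "om\<notin>good_seqs"
  then obtain N where N: "!!n. n>=N ==> om (Suc n) = om n \<and> om n\<in>parabolic_letters g0"
   using om(1) by (auto simp: good_seqs_def)
  have c: "om (N + i) = om N" for i by (induction i) (use N in auto)
  define \<eta> where "\<eta> = (%i::nat. om (N + i))"
  have \<eta>: "\<eta>\<in>reduced_seqs" "coded \<eta> (prod_seq om N x)" using seq_shift[OF om(1)] coded_shift[OF om] by (auto simp: \<eta>_def)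
  have pl: "om N\<in>parabolic_letters g0" using N by blast
  have "prod_seq \<eta> i p = p" for i
   by (induction i) (use prod_seq_Suc[OF \<eta>(1), of p] c parabolic_letter_p(1)[OF pl] p_sphere act_one[of p] in "auto simp: \<eta>_def")
  then have "coded \<eta> p" unfolding coded_def using p_sphere parabolic_letter_p(2)[OF pl] c by (auto simp: \<eta>_def)
  then have "prod_seq om N x = p" using coded_unique[OF \<eta>(1)] \<eta>(2) by blast
  then show False using orbit_p_not_conical[OF x prod_seq_G[OF om(1)]] by blast
 qed
 then show ?thesis using that om(2) by blast
qed

text \<open>Two letters can compete only at p, and no translate of a conical limit point is
  p.\<close>

lemma conical_code_unique: assumes x: "x\<in>conical_limit_set G"
 and "om\<in>reduced_seqs" "coded om x" "om'\<in>reduced_seqs" "coded om' x" shows "om = om'"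
proof -
 have "om n = om' n \<and> prod_seq om n = prod_seq om' n" for n
 proof (induction n)
  case 0
  show ?case
  proof
   show "om 0 = om' 0"
   proof (rule ccontr)
    assume ne: "om 0~=om' 0"
    have nx: "norm x = 1" using assms by (simp add: coded_def)
    have "dn (om 0) x>=1" "dn (om' 0) x>=1"
     using assms(3,5) act_one[of x] unfolding coded_def by (auto dest: spec[of _ 0])
    then have "x = p" using arcs_meet(1)[OF seq_A[OF assms(2)] seq_A[OF assms(4)] ne] nx by simp
    then show False using orbit_p_not_conical[OF x G_one] act_one[of x] nx by simp
   qed
  qed simp
 next
  case (Suc n)
  have e: "prod_seq om (Suc n) = prod_seq om' (Suc n)" using Suc by (simp add: prod_seq.simps)
  have "om (Suc n) = om' (Suc n)"
  proof (rule ccontr)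
   assume ne: "om (Suc n)~=om' (Suc n)"
   let ?y = "prod_seq om (Suc n) x"
   have "dn (om (Suc n)) ?y>=1" "dn (om' (Suc n)) ?y>=1"
    using assms(3,5) e unfolding coded_def by metis+
   moreover have "norm ?y<=1" using norm_act_le[OF prod_seq_G[OF assms(2)]] assms(3) by (simp add: coded_def)
   ultimately have "?y = p" using arcs_meet(1)[OF seq_A[OF assms(2)] seq_A[OF assms(4)] ne] by blast
   then show False using orbit_p_not_conical[OF x prod_seq_G[OF assms(2)]] by blast
  qed
  then show ?case using e by blast
 qed
 then show ?thesis by blast
qed

end

subsection \<open>Coding by blocks\<close>

lemma block_start_Suc_shift:
 "block_start H om (Suc i) = first_block_length H om + block_start H (%n. om (first_block_length H om + n)) i"
 by (induction i) (simp_all add: add.assoc)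

text \<open>One step of the Bowen--Series map, seen on the coding by blocks.\<close>

definition block_step :: "(nat => 'a list) => nat => 'a list" where
 "block_step y = (if length (y 0) > 2 then case_nat (tl (y 0)) (shift y) else shift y)"

text \<open>Consecutive words overlap in one letter, so letters are extracted one at a time by
  \<open>block_step\<close> and not by concatenation.\<close>

definition unblock :: "(nat => 'a list) => nat => 'a" where
 "unblock y n = hd ((block_step ^^ n) y 0)"

lemma unblock_Suc: "unblock y (Suc n) = unblock (block_step y) n"
 by (simp add: unblock_def funpow_swap1)

lemma unblock_add: "unblock y (m + n) = unblock ((block_step ^^ m) y) n"
 by (induction m arbitrary: y) (simp_all add: unblock_Suc funpow_swap1)

lemma block_step_agree: "(ALL i<=Suc n. y i = y' i) ==> (ALL i<=n. block_step y i = block_step y' i)"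
 by (auto simp: block_step_def shift_def split: nat.split)

text \<open>Finitely many letters depend on finitely many words, which makes the coding map
  continuous.\<close>

lemma unblock_agree: "(ALL i<=n. y i = y' i) ==> unblock y n = unblock y' n"
proof (induction n arbitrary: y y')
 case 0 then show ?case by (simp add: unblock_def)
next
 case (Suc n)
 then show ?case unfolding unblock_Suc using block_step_agree by blast
qed

context cusped_domain
begin

abbreviation "F \<equiv> induced_alphabet A g0"
abbreviation "Y \<equiv> markov_shift A g0"
abbreviation "H \<equiv> hyperbolic_letters A g0"

lemma F_cases: assumes "w\<in>F"
 obtains (par) n \<gamma> g where "n>=1" "\<gamma>\<in>parabolic_letters g0" "g\<in>A" "g~=\<gamma>" "g~=iv \<gamma>" "w = replicate n \<gamma> @ [g]"
  | (hyp) h g where "h\<in>H" "g\<in>A" "g~=iv h" "w = [h, g]"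
 using assms unfolding induced_alphabet_def by auto

lemma F_length: "w\<in>F ==> length w>=2" by (erule F_cases) auto

lemma F_set: "w\<in>F ==> set w\<subseteq>A"
 by (erule F_cases) (use parabolic_letters_A in "auto simp: hyperbolic_letters_def")

lemma F_hd: "w\<in>F ==> hd w\<in>A" using F_length[of w] F_set[of w] hd_in_set[of w] by fastforce

lemma F_last: "w\<in>F ==> last w\<in>A" using F_length[of w] F_set[of w] last_in_set[of w] by fastforce

lemma par_ne_inv: assumes "\<gamma>\<in>parabolic_letters g0" shows "\<gamma>~=iv \<gamma>"
 using A_ne_inv[of \<gamma>] assms parabolic_letters_A by auto

text \<open>The reason why \<open>block_step\<close> preserves the shift: a word longer than two
  starts with a repeated parabolic letter and stays in the alphabet when that letter is dropped
  once.\<close>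

lemma F_step: assumes "w\<in>F"
 shows "w ! 1~=iv (w ! 0)" "length w > 2 ==> tl w\<in>F" "length w > 2 ==> hd (tl w) = hd w"
  "length w > 2 ==> hd w\<in>parabolic_letters g0"
  "length w = 2 ==> \<not> (w ! 1 = w ! 0 \<and> w ! 0\<in>parabolic_letters g0)"
proof -
 have "w ! 1~=iv (w ! 0) \<and> (length w > 2 --> tl w\<in>F \<and> hd (tl w) = hd w \<and> hd w\<in>parabolic_letters g0) \<and>
   (length w = 2 --> \<not> (w ! 1 = w ! 0 \<and> w ! 0\<in>parabolic_letters g0))"
  using assms
 proof (cases rule: F_cases)
  case (par n \<gamma> g)
  show ?thesis
  proof (cases "n = 1")
   case True then show ?thesis using par by auto
  next
   case False
   then obtain m where m: "n = Suc (Suc m)" using par(1) by (metis One_nat_def not0_implies_Suc not_one_le_zero)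
   have w: "w = \<gamma> # \<gamma> # replicate m \<gamma> @ [g]" using par m by simp
   have "tl w = replicate (Suc m) \<gamma> @ [g]" using w by simp
   moreover have "replicate (Suc m) \<gamma> @ [g]\<in>F" unfolding induced_alphabet_def using par
    by (intro UnI1 CollectI exI[of _ "Suc m"] exI[of _ \<gamma>] exI[of _ g]) auto
   ultimately show ?thesis using w par_ne_inv[OF par(2)] par by auto
  qed
 next
  case (hyp h g)
  then show ?thesis by (auto simp: hyperbolic_letters_def)
 qed
 then show "w ! 1~=iv (w ! 0)" "length w > 2 ==> tl w\<in>F" "length w > 2 ==> hd (tl w) = hd w"
  "length w > 2 ==> hd w\<in>parabolic_letters g0"
  "length w = 2 ==> \<not> (w ! 1 = w ! 0 \<and> w ! 0\<in>parabolic_letters g0)" by auto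
qed

lemma Y_F: "y\<in>Y ==> y i\<in>F" by (simp add: markov_shift_def)

lemma Y_match: "y\<in>Y ==> last (y i) = hd (y (Suc i))" by (simp add: markov_shift_def)

lemma Y_shift: "y\<in>Y ==> shift y\<in>Y" by (simp add: markov_shift_def shift_def)

lemma Y_shift_pow: "y\<in>Y ==> (shift ^^ n) y\<in>Y" by (induction n) (simp_all add: Y_shift)

lemma Y_step: assumes "y\<in>Y" shows "block_step y\<in>Y"
proof (cases "length (y 0) > 2")
 case True
 have "last (tl (y 0)) = last (y 0)" using True by (cases "y 0") auto
 then show ?thesis using True F_step(2)[OF Y_F[OF assms] True] Y_F[OF assms] Y_match[OF assms]
  unfolding markov_shift_def block_step_def by (auto simp: shift_def split: nat.split)
next
 case False then show ?thesis using Y_shift[OF assms] by (simp add: block_step_def)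
qed

lemma Y_step_pow: "y\<in>Y ==> (block_step ^^ n) y\<in>Y" by (induction n) (simp_all add: Y_step)

lemma unblock_01: assumes "y\<in>Y" shows "unblock y 0 = y 0 ! 0" "unblock y 1 = y 0 ! 1"
proof -
 have l: "length (y 0)>=2" using F_length Y_F assms by blast
 then have ne: "y 0~=[]" by auto
 then show "unblock y 0 = y 0 ! 0" by (simp add: unblock_def hd_conv_nth)
 show "unblock y 1 = y 0 ! 1"
 proof (cases "length (y 0) > 2")
  case True
  then have "tl (y 0)~=[]" by (cases "y 0") auto
  then show ?thesis using True by (simp add: unblock_def block_step_def hd_conv_nth nth_tl)
 next
  case False
  then have "length (y 0) = 2" using l by simp
  then have "y 0 ! 1 = last (y 0)" using ne by (simp add: last_conv_nth)
  then show ?thesis using False Y_match[OF assms, of 0] by (simp add: unblock_def block_step_def shift_def)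
 qed
qed

text \<open>The subtraction of 1 is the overlap: the last letter of a word is the first letter of
  the next.\<close>

lemma step_block: assumes "y\<in>Y" shows "(block_step ^^ (length (y 0) - 1)) y = shift y"
 using assms
proof (induction "length (y 0)" arbitrary: y)
 case 0 then show ?case using F_length Y_F by (metis not_numeral_le_zero)
next
 case (Suc n)
 show ?case
 proof (cases "length (y 0) > 2")
  case True
  have s: "shift (block_step y) = shift y" using True by (simp add: block_step_def shift_def[of "case_nat _ _"])
  have l: "n = length (block_step y 0)" using Suc.hyps(2) True by (simp add: block_step_def)
  then have "n>=2" using F_length[OF Y_F[OF Y_step[OF Suc.prems], of 0]] by simp
  then obtain k where k: "n = Suc k" by (cases n) auto
  have "(block_step ^^ (length (y 0) - 1)) y = (block_step ^^ (length (block_step y 0) - 1)) (block_step y)"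
   using Suc.hyps(2) l k by (metis diff_Suc_1 funpow.simps(2) funpow_swap1 comp_apply)
  also have "... = shift y" using Suc.hyps(1)[OF l Y_step[OF Suc.prems]] s by simp
  finally show ?thesis .
 next
  case False
  then have "length (y 0) = 2" using F_length[OF Y_F[OF Suc.prems, of 0]] by simp
  then show ?thesis by (simp add: block_step_def)
 qed
qed

lemma unblock_shift: assumes "y\<in>Y" shows "unblock y (length (y 0) - 1 + n) = unblock (shift y) n"
 unfolding unblock_add step_block[OF assms] ..

lemma unblock_prefix: assumes "y\<in>Y" shows "map (unblock y) [0..<length (y 0)] = y 0"
 using assms
proof (induction "length (y 0)" arbitrary: y)
 case 0 then show ?case by simp
next
 case (Suc n)
 have l2: "length (y 0)>=2" using F_length Y_F Suc.prems by blast
 show ?case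
 proof (cases "length (y 0) > 2")
  case True
  have l: "n = length (block_step y 0)" using Suc.hyps(2) True by (simp add: block_step_def)
  have IH: "map (unblock (block_step y)) [0..<n] = tl (y 0)"
   using Suc.hyps(1)[OF l Y_step[OF Suc.prems]] l True by (simp add: block_step_def)
  have "map (unblock y) [0..<Suc n] = unblock y 0 # map (%i. unblock y (Suc i)) [0..<n]"
   by (simp add: upt_conv_Cons map_Suc_upt[symmetric] del: upt_Suc)
  also have "... = y 0 ! 0 # tl (y 0)" unfolding unblock_Suc IH[symmetric] using unblock_01(1)[OF Suc.prems] by simp
  also have "... = y 0" using l2 by (cases "y 0") auto
  finally show ?thesis using Suc.hyps(2) by simp
 next
  case False
  then have l: "length (y 0) = 2" using l2 by simp
  have "map (unblock y) [0..<2] = [y 0 ! 0, y 0 ! 1]" using unblock_01[OF Suc.prems] by (simp add: numeral_2_eq_2)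
  also have "... = y 0" using l by (auto simp: numeral_2_eq_2 length_Suc_conv)
  finally show ?thesis using l by simp
 qed
qed

lemma unblock_A: "y\<in>Y ==> unblock y n\<in>A"
 using F_hd Y_F Y_step_pow by (simp add: unblock_def)

lemma unblock_reduced: assumes "y\<in>Y" shows "unblock y\<in>reduced_seqs"
proof -
 have "unblock y (Suc n)~=iv (unblock y n)" for n
  using unblock_01[OF Y_step_pow[OF assms, of n]] unblock_add[of y n 0] unblock_add[of y n 1] F_step(1)[OF Y_F[OF Y_step_pow[OF assms, of n], of 0]] by simp
 then show ?thesis using unblock_A[OF assms] by (simp add: reduced_seqs_def)
qed

text \<open>A word of length two at the head witnesses that the current letter is not a parabolic
  letter about to be repeated, so such words exclude a parabolic tail.\<close>

lemma short_block_soon: assumes "y\<in>Y" shows "EX n. length ((block_step ^^ n) y 0) = 2"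
 using assms
proof (induction "length (y 0)" arbitrary: y)
 case 0 then show ?case using F_length Y_F by (metis not_numeral_le_zero)
next
 case (Suc n)
 show ?case
 proof (cases "length (y 0) > 2")
  case True
  then have "n = length (block_step y 0)" using Suc.hyps(2) by (simp add: block_step_def)
  then obtain k where "length ((block_step ^^ k) (block_step y) 0) = 2" using Suc.hyps(1) Y_step[OF Suc.prems] by blast
  then have "length ((block_step ^^ (Suc k)) y 0) = 2" by (simp add: funpow_swap1)
  then show ?thesis by blast
 next
  case False
  then have "length (y 0) = 2" using F_length[OF Y_F[OF Suc.prems, of 0]] by simp
  then show ?thesis by (intro exI[of _ 0]) simp
 qed
qed

lemma unblock_good: assumes "y\<in>Y" shows "unblock y\<in>good_seqs"
 unfolding good_seqs_def
proof (intro CollectI conjI allI unblock_reduced[OF assms])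
 fix N
 obtain k where k: "length ((block_step ^^ k) ((block_step ^^ N) y) 0) = 2" using short_block_soon[OF Y_step_pow[OF assms]] by blast
 let ?z = "(block_step ^^ (k + N)) y"
 have z: "?z\<in>Y" "length (?z 0) = 2"
  by (rule Y_step_pow[OF assms]) (use k in "simp add: funpow_add")
 have "\<not> (unblock y (Suc (k + N)) = unblock y (k + N) \<and> unblock y (k + N)\<in>parabolic_letters g0)"
  using F_step(5)[OF Y_F[OF z(1), of 0] z(2)] unblock_01[OF z(1)] unblock_add[of y "k + N" 0] unblock_add[of y "k + N" 1] by simp
 then show "EX n>=N. \<not> (unblock y (Suc n) = unblock y n \<and> unblock y n\<in>parabolic_letters g0)"
  by (intro exI[of _ "k + N"]) auto
qed

lemma first_block_prefix: assumes w: "w\<in>F" and pre: "w = map om [0..<length w]"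
 shows "first_block_length H om = length w - 1"
 using w
proof (cases rule: F_cases)
 case (par n \<gamma> g)
 have nth: "om i = w ! i" if "i < length w" for i using pre that by (metis nth_map_upt add_0 diff_zero)
 have i: "om i = \<gamma>" if "i < n" for i using nth[of i] par that by (simp add: nth_append)
 have n: "om n = g" using nth[of n] par by (simp add: nth_append)
 have "(LEAST m. om m~=om 0) = n"
 proof (rule Least_equality)
  show "om n~=om 0" using i[of 0] n par by simp
  fix m assume "om m~=om 0"
  then show "n<=m" using i[of 0] i[of m] par(1) by (cases "m < n") auto
 qed
 moreover have "om 0\<notin>H" using i[of 0] par by (auto simp: hyperbolic_letters_def)
 ultimately show ?thesis using par by (simp add: first_block_length_def)
next
 case (hyp h g)
 have "om 0 = h" using pre hyp by (metis length_greater_0_conv list.distinct(1) nth_Cons_0 nth_map_upt add_0 diff_zero)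
 then show ?thesis using hyp by (simp add: first_block_length_def)
qed

lemma first_block_unblock: "y\<in>Y ==> first_block_length H (unblock y) = length (y 0) - 1"
 by (rule first_block_prefix[OF Y_F]) (simp_all add: unblock_prefix)

text \<open>A word of the alphabet occurring as a prefix determines the length of the first block,
  and thereby itself.\<close>

lemma F_prefix_unique: assumes "y\<in>Y" "w\<in>F" "w = map (unblock y) [0..<length w]" shows "w = y 0"
proof -
 have "length w - 1 = length (y 0) - 1" using first_block_prefix[OF assms(2,3)] first_block_unblock[OF assms(1)] by simp
 then have "length w = length (y 0)" using F_length[OF assms(2)] F_length[OF Y_F[OF assms(1), of 0]] by simp
 then show ?thesis using assms(3) unblock_prefix[OF assms(1)] by simp
qed

text \<open>The \<open>Suc\<close> appends the first letter of the next block, as the words of the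
  alphabet demand.\<close>

definition blocked :: "(nat => complex => complex) => nat => (complex => complex) list" where
 "blocked om i = map om [block_start H om i ..< Suc (block_start H om (Suc i))]"

lemma first_word: assumes g: "om\<in>good_seqs" shows "map om [0..<Suc (first_block_length H om)]\<in>F" "first_block_length H om>=1"
proof -
 have r: "!!n. om n\<in>A" "!!n. om (Suc n)~=iv (om n)" using g by (auto simp: good_seqs_def reduced_seqs_def)
 have "map om [0..<Suc (first_block_length H om)]\<in>F \<and> first_block_length H om>=1"
 proof (cases "om 0\<in>H")
  case True
  have "map om [0..<Suc 1] = [om 0, om 1]" by simp
  moreover have "[om 0, om 1]\<in>F" unfolding induced_alphabet_def using True r(1)[of 1] r(2)[of 0] by auto
  ultimately show ?thesis using True by (simp add: first_block_length_def)
 next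
  case False
  then have pl: "om 0\<in>parabolic_letters g0" using r(1)[of 0] by (simp add: hyperbolic_letters_def)
  have ex: "EX n. om n~=om 0"
  proof (rule ccontr)
   assume "\<nexists>n. om n~=om 0"
   then have "om n = om 0" for n by blast
   then have "om (Suc n) = om n \<and> om n\<in>parabolic_letters g0" for n using pl by metis
   moreover have "EX n. \<not> (om (Suc n) = om n \<and> om n\<in>parabolic_letters g0)" using g by (auto simp: good_seqs_def)
   ultimately show False by blast
  qed
  define n where "n = (LEAST n. om n~=om 0)"
  have n: "om n~=om 0" unfolding n_def using ex by (rule LeastI_ex)
  have lt: "om m = om 0" if "m < n" for m using not_less_Least that unfolding n_def by blast
  have n1: "n>=1" using n by (cases n) auto
  have "om n~=iv (om 0)" using r(2)[of "n - 1"] lt[of "n - 1"] n1 by simp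
  moreover have "map om [0..<n] = map (%_. om 0) [0..<n]"
   by (intro map_cong refl lt) simp
  then have "map om [0..<Suc n] = replicate n (om 0) @ [om n]" by (simp add: map_replicate_const)
  ultimately have "map om [0..<Suc n]\<in>F" unfolding induced_alphabet_def using n n1 pl r(1)[of n]
   by (intro UnI1 CollectI exI[of _ n] exI[of _ "om 0"] exI[of _ "om n"]) auto
  then show ?thesis using False n1 by (simp add: first_block_length_def n_def)
 qed
 then show "map om [0..<Suc (first_block_length H om)]\<in>F" "first_block_length H om>=1" by auto
qed

lemma blocked_0: "blocked om 0 = map om [0..<Suc (first_block_length H om)]"
 by (simp add: blocked_def del: upt_Suc)

lemma blocked_Suc: "blocked om (Suc i) = blocked (%n. om (first_block_length H om + n)) i"
proof -
 let ?k = "first_block_length H om"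
 have "map om [?k + a..<Suc (?k + b)] = map (%n. om (?k + n)) [a..<Suc b]" for a b
  by (intro nth_equalityI) (auto simp: nth_append add.assoc simp del: upt_Suc)
 then show ?thesis unfolding blocked_def by (simp only: block_start_Suc_shift)
qed

lemma blocked_F: "om\<in>good_seqs ==> blocked om i\<in>F"
proof (induction i arbitrary: om)
 case 0 then show ?case using first_word by (simp add: blocked_0 del: upt_Suc)
next
 case (Suc i) then show ?case unfolding blocked_Suc using good_shift by blast
qed

lemma blocked_match: "om\<in>good_seqs ==> last (blocked om i) = hd (blocked om (Suc i))"
proof (induction i arbitrary: om)
 case 0
 have "hd (blocked om (Suc 0)) = om (first_block_length H om)" unfolding blocked_Suc blocked_0
  by (simp add: upt_conv_Cons del: upt_Suc)
 then show ?case by (simp add: blocked_0)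
next
 case (Suc i) then show ?case unfolding blocked_Suc[of om] using good_shift by blast
qed

lemma blocked_Y: "om\<in>good_seqs ==> blocked om\<in>Y"
 by (simp add: markov_shift_def blocked_F blocked_match)

lemma unblock_blocked: "om\<in>good_seqs ==> unblock (blocked om) = om"
proof -
 have "om\<in>good_seqs ==> unblock (blocked om) n = om n" for n
 proof (induction n arbitrary: om rule: less_induct)
  case (less n)
  let ?k = "first_block_length H om"
  have Yb: "blocked om\<in>Y" using blocked_Y less.prems .
  have l: "length (blocked om 0) = Suc ?k" by (simp add: blocked_0 del: upt_Suc)
  show ?case
  proof (cases "n < Suc ?k")
   case True
   have "unblock (blocked om) n = map (unblock (blocked om)) [0..<length (blocked om 0)] ! n" using True l by (simp del: upt_Suc)
   also have "... = blocked om 0 ! n" unfolding unblock_prefix[OF Yb] ..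
   also have "... = om n" using True by (simp add: blocked_0 del: upt_Suc)
   finally show ?thesis .
  next
   case False
   have "unblock (blocked om) (?k + (n - ?k)) = unblock (shift (blocked om)) (n - ?k)"
    using unblock_shift[OF Yb, of "n - ?k"] l by simp
   moreover have "shift (blocked om) = blocked (%n. om (?k + n))" unfolding shift_def blocked_Suc ..
   moreover have "unblock (blocked (%n. om (?k + n))) (n - ?k) = om (?k + (n - ?k))"
    by (rule less.IH[OF _ good_shift[OF less.prems]]) (use False first_word(2)[OF less.prems] in linarith)
   ultimately show ?thesis using False by simp
  qed
 qed
 then show "om\<in>good_seqs ==> unblock (blocked om) = om" by blast
qed

section \<open>The Bowen-Series map on coded points\<close>

lemma Delta_eq: "Delta g = {z. norm z = 1 \<and> dn g z>=1}"
 by (auto simp: Delta_def dn_def)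

text \<open>Two branches compete only at p, and then both letters are parabolic and fix p.\<close>

lemma bowen_series_eq: assumes g: "g\<in>A" and z: "norm z = 1" "dn g z>=1" shows "bowen_series A z = g z"
 unfolding bowen_series_def
proof (rule the_equality)
 show "EX h:A. z\<in>Delta h \<and> g z = h z" using g z by (auto simp: Delta_eq)
 fix y assume "EX h:A. z\<in>Delta h \<and> y = h z"
 then obtain h where h: "h\<in>A" "dn h z>=1" "y = h z" by (auto simp: Delta_eq)
 show "y = g z"
 proof (cases "g = h")
  case False
  have "z = p" using arcs_meet(1)[OF g h(1) False] z h by simp
  moreover have "g\<in>parabolic_letters g0" "h\<in>parabolic_letters g0"
   using arcs_at_p[OF g] arcs_at_p[OF h(1)] z h \<open>z = p\<close> by (auto simp: parabolic_letters_def)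
  ultimately show ?thesis using parabolic_letter_p(1) h by metis
 qed (use h in simp)
qed

lemma bowen_pow: assumes w: "om\<in>reduced_seqs" and c: "coded om x" shows "(bowen_series A ^^ n) x = prod_seq om n x"
proof (induction n)
 case 0 then show ?case using c act_one by (simp add: coded_def)
next
 case (Suc n)
 have n: "norm x<=1" "norm (prod_seq om n x) = 1" using c norm_act_eq1[OF prod_seq_G[OF w]] by (auto simp: coded_def)
 have "bowen_series A (prod_seq om n x) = om n (prod_seq om n x)"
  by (rule bowen_series_eq[OF seq_A[OF w] n(2)]) (use c in "simp add: coded_def")
 then show ?case using Suc prod_seq_Suc[OF w n(1)] by simp
qed

lemma codes_iff: "codes A om x \<longleftrightarrow> om\<in>reduced_seqs \<and> coded om x"
proof
 assume c: "codes A om x"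
 have "om (Suc n)~=iv (om n)" for n
 proof
  assume "om (Suc n) = iv (om n)"
  moreover have "om n\<in>A" "om n \<odot> om (Suc n)~=\<e>" using c by (auto simp: codes_def)
  ultimately show False using D.r_inv G_carrier A_G by metis
 qed
 then have w: "om\<in>reduced_seqs" using c by (simp add: reduced_seqs_def codes_def)
 have x: "norm x = 1" using c unfolding codes_def Delta_eq by (auto dest: spec[of _ 0])
 have "(bowen_series A ^^ n) x = prod_seq om n x" for n
 proof (induction n)
  case 0 then show ?case using x act_one by simp
 next
  case (Suc n)
  have "(bowen_series A ^^ n) x\<in>Delta (om n)" using c by (simp add: codes_def)
  then have "bowen_series A (prod_seq om n x) = om n (prod_seq om n x)"
   unfolding Suc Delta_eq using bowen_series_eq[OF seq_A[OF w]] by simp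
  then show ?case using Suc prod_seq_Suc[OF w, of x n] x by simp
 qed
 then show "om\<in>reduced_seqs \<and> coded om x" using w c x unfolding codes_def coded_def Delta_eq by auto
next
 assume "om\<in>reduced_seqs \<and> coded om x"
 then have w: "om\<in>reduced_seqs" and c: "coded om x" by auto
 have "om n \<odot> om (Suc n)~=\<e>" for n
 proof
  assume e: "om n \<odot> om (Suc n) = \<e>"
  have "iv (om (Suc n)) = om n" using D.inv_equality[OF e] G_carrier A_G seq_A[OF w] by blast
  then have "om (Suc n) = iv (om n)" using inv_inv_G A_G(1)[OF seq_A[OF w]] by metis
  then show False using w by (simp add: reduced_seqs_def)
 qed
 then show "codes A om x" unfolding codes_def bowen_pow[OF w c] Delta_eq using seq_A[OF w] c norm_act_eq1[OF prod_seq_G[OF w]]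
  by (auto simp: coded_def)
qed

end

section \<open>The coding map, blocks and periodic points\<close>

locale cusped_domain_fin = cusped_domain + assumes finite_letters: "finite A"
begin

abbreviation "\<Lambda> \<equiv> conical_limit_set G"

lemma good_reduced: "om\<in>good_seqs ==> om\<in>reduced_seqs" by (simp add: good_seqs_def)

lemma conicalE: assumes "x\<in>\<Lambda>" obtains y where "y\<in>Y" "x = pt (unblock y)"
proof -
 obtain om where "om\<in>good_seqs" "coded om x" using conical_coded[OF finite_letters assms] by blast
 then show ?thesis using that[of "blocked om"] blocked_Y unblock_blocked pt_eq good_reduced by metis
qed

lemma pt_unblock_conical: "y\<in>Y ==> pt (unblock y)\<in>\<Lambda>"
 by (rule pt_conical[OF finite_letters unblock_good])

lemma symbolic_sequence_pt: assumes "y\<in>Y" shows "symbolic_sequence A (pt (unblock y)) = unblock y"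
 unfolding symbolic_sequence_def codes_iff
proof (rule the_equality)
 show "unblock y\<in>reduced_seqs \<and> coded (unblock y) (pt (unblock y))" using unblock_reduced[OF assms] coded_pt by blast
 fix om assume "om\<in>reduced_seqs \<and> coded om (pt (unblock y))"
 then show "om = unblock y"
  using conical_code_unique[OF pt_unblock_conical[OF assms]] unblock_reduced[OF assms] coded_pt by blast
qed

lemma bowen_pow_pt: assumes "y\<in>Y" shows "(bowen_series A ^^ n) (pt (unblock y)) = pt (%i. unblock y (n + i))"
 using bowen_pow[OF unblock_reduced[OF assms] coded_pt[OF unblock_reduced[OF assms]]] pt_shift[OF unblock_reduced[OF assms]] by simp

text \<open>The arcs are closed, so in general membership is weaker than having the prefix w. The
  two agree here because the orbit of a conical limit point avoids p.\<close>

lemma Delta_word_pt: assumes y: "y\<in>Y" and w: "w\<in>F" shows "pt (unblock y)\<in>Delta_word A w \<longleftrightarrow> w = y 0"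
proof -
 let ?om = "unblock y" and ?x = "pt (unblock y)"
 have red: "?om\<in>reduced_seqs" using unblock_reduced[OF y] .
 have c: "coded ?om ?x" using coded_pt[OF red] .
 have "(bowen_series A ^^ i) ?x\<in>Delta (w ! i) \<longleftrightarrow> w ! i = ?om i" if i: "i < length w" for i
 proof -
  let ?z = "prod_seq ?om i ?x"
  have wA: "w ! i\<in>A" using F_set[OF w] i nth_mem by blast
  have nz: "norm ?z = 1" "dn (?om i) ?z>=1" using c norm_act_eq1[OF prod_seq_G[OF red]] by (auto simp: coded_def)
  have "w ! i = ?om i" if "dn (w ! i) ?z>=1"
  proof (rule ccontr)
   assume ne: "w ! i~=?om i"
   have "?z = p" using arcs_meet(1)[OF wA seq_A[OF red] ne _ that nz(2)] nz by simp
   then show False using orbit_p_not_conical[OF pt_unblock_conical[OF y] prod_seq_G[OF red]] by blast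
  qed
  then show ?thesis unfolding bowen_pow[OF red c] Delta_eq using nz by auto
 qed
 then have "?x\<in>Delta_word A w \<longleftrightarrow> (ALL i<length w. w ! i = ?om i)" by (auto simp: Delta_word_def)
 also have "... \<longleftrightarrow> w = map ?om [0..<length w]"
 proof
  assume "ALL i<length w. w ! i = ?om i" then show "w = map ?om [0..<length w]" by (intro nth_equalityI) auto
 next
  assume e: "w = map ?om [0..<length w]"
  show "ALL i<length w. w ! i = ?om i"
  proof (intro allI impI)
   fix i assume "i < length w"
   then show "w ! i = ?om i" using nth_map_upt[of i "length w" 0 ?om] e by simp
  qed
 qed
 also have "... \<longleftrightarrow> w = y 0" using F_prefix_unique[OF y w] unblock_prefix[OF y] by metis
 finally show ?thesis .
qed

lemma induced_map_pt: assumes y: "y\<in>Y" shows "induced_map A g0 (pt (unblock y)) = pt (unblock (shift y))"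
proof -
 have "induced_map A g0 (pt (unblock y)) = (bowen_series A ^^ (length (y 0) - 1)) (pt (unblock y))"
  unfolding induced_map_def
 proof (rule the_equality)
  show "EX w:F. pt (unblock y)\<in>Delta_word A w \<and> (bowen_series A ^^ (length (y 0) - 1)) (pt (unblock y)) = (bowen_series A ^^ (length w - 1)) (pt (unblock y))"
   using Delta_word_pt[OF y Y_F[OF y, of 0]] Y_F[OF y, of 0] by blast
 qed (use Delta_word_pt[OF y] in blast)
 also have "... = pt (%i. unblock y (length (y 0) - 1 + i))" by (rule bowen_pow_pt[OF y])
 also have "(%i. unblock y (length (y 0) - 1 + i)) = unblock (shift y)" using unblock_shift[OF y] by blast
 finally show ?thesis .
qed

lemma induced_map_pow_pt: "y\<in>Y ==> (induced_map A g0 ^^ n) (pt (unblock y)) = pt (unblock ((shift ^^ n) y))"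
 by (induction n) (simp_all add: induced_map_pt Y_shift_pow)

lemma shift_pow_0: "(shift ^^ n) y 0 = y n"
proof -
 have "(shift ^^ n) y i = y (n + i)" for i by (induction n arbitrary: i) (simp_all add: shift_def[of "(shift ^^ _) y"])
 from this[of 0] show ?thesis by simp
qed

lemma pt_unblock_inj: assumes "y\<in>Y" "y'\<in>Y" "pt (unblock y) = pt (unblock y')" shows "y = y'"
proof
 fix i
 have "pt (unblock ((shift ^^ i) y)) = pt (unblock ((shift ^^ i) y'))"
  using assms induced_map_pow_pt by metis
 then have "pt (unblock ((shift ^^ i) y'))\<in>Delta_word A (y i)"
  using Delta_word_pt[OF Y_shift_pow[OF assms(1)] Y_F[OF assms(1)], of i i] shift_pow_0[of i y] by simp
 then show "y i = y' i" using Delta_word_pt[OF Y_shift_pow[OF assms(2)] Y_F[OF assms(1)], of i i] shift_pow_0[of i y'] by simp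
qed

lemma coding_map_eq: assumes y: "y\<in>Y" shows "coding_map G A g0 y = pt (unblock y)"
 unfolding coding_map_def
proof (rule the_equality)
 show "pt (unblock y)\<in>\<Lambda> \<and> (ALL i. (induced_map A g0 ^^ i) (pt (unblock y))\<in>Delta_word A (y i))"
  using pt_unblock_conical[OF y] induced_map_pow_pt[OF y] Delta_word_pt[OF Y_shift_pow[OF y] Y_F[OF y]] shift_pow_0[of _ y] by simp
 fix x assume x: "x\<in>\<Lambda> \<and> (ALL i. (induced_map A g0 ^^ i) x\<in>Delta_word A (y i))"
 obtain y' where y': "y'\<in>Y" "x = pt (unblock y')" using x conicalE by blast
 have "y i = y' i" for i
  using conjunct2[OF x, rule_format, of i] Delta_word_pt[OF Y_shift_pow[OF y'(1)] Y_F[OF y], of i i] shift_pow_0[of i y'] induced_map_pow_pt[OF y'(1), of i] y'(2) by simp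
 then have "y = y'" by blast
 then show "x = pt (unblock y)" using y' by simp
qed

lemma block_start_unblock: "y\<in>Y ==> (%n. unblock y (block_start H (unblock y) i + n)) = unblock ((shift ^^ i) y)
  \<and> block_start H (unblock y) (Suc i) = block_start H (unblock y) i + (length (y i) - 1)"
proof (induction i)
 case 0 then show ?case using first_block_unblock[of y] by simp
next
 case (Suc i)
 have sY: "(shift ^^ i) y\<in>Y" "(shift ^^ Suc i) y\<in>Y" using Y_shift_pow Suc.prems by blast+
 have IH: "!!n. unblock y (block_start H (unblock y) i + n) = unblock ((shift ^^ i) y) n"
  "block_start H (unblock y) (Suc i) = block_start H (unblock y) i + (length (y i) - 1)" using Suc by metis+
 have l: "length (((shift ^^ i) y) 0) = length (y i)" unfolding shift_pow_0 ..
 have 1: "unblock y (block_start H (unblock y) (Suc i) + n) = unblock ((shift ^^ Suc i) y) n" for n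
  using IH(1)[of "length (y i) - 1 + n"] unblock_shift[OF sY(1), of n] IH(2) l by (simp add: add.assoc)
 have "block_start H (unblock y) (Suc (Suc i)) = block_start H (unblock y) (Suc i) + first_block_length H (unblock ((shift ^^ Suc i) y))"
  using 1 by (simp only: block_start.simps(2)[of H "unblock y" "Suc i"])
 also have "first_block_length H (unblock ((shift ^^ Suc i) y)) = length (y (Suc i)) - 1"
  using first_block_unblock[OF sY(2)] shift_pow_0[of "Suc i" y] by simp
 finally show ?case using 1 by blast
qed

lemma block_pt: assumes y: "y\<in>Y" shows "block A g0 (Suc i) (pt (unblock y)) = butlast (y i)"
proof -
 let ?b = "block_start H (unblock y)"
 have sY: "(shift ^^ i) y\<in>Y" using Y_shift_pow y .
 have l: "length (y i)>=2" using F_length Y_F y by blast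
 have "block A g0 (Suc i) (pt (unblock y)) = map (unblock y) [?b i..<?b (Suc i)]"
  unfolding block_def Let_def symbolic_sequence_pt[OF y] by (simp del: block_start.simps)
 also have "... = map (%n. unblock y (?b i + n)) [0..<length (y i) - 1]"
  using conjunct2[OF block_start_unblock[OF y, of i]] by (intro nth_equalityI) (simp_all del: block_start.simps)
 also have "... = map (unblock ((shift ^^ i) y)) [0..<length (y i) - 1]"
  using conjunct1[OF block_start_unblock[OF y, of i]] by simp
 also have "... = butlast (map (unblock ((shift ^^ i) y)) [0..<length (y i)])"
  using l by (intro nth_equalityI) (auto simp: nth_butlast)
 also have "... = butlast (y i)" using unblock_prefix[OF sY] shift_pow_0[of i y] by simp
 finally show ?thesis .
qed

text \<open>A block lacks the last letter of its word, but that letter opens the next block; so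
  equality of all blocks is equality of all words.\<close>

lemma periodic_pt: assumes y: "y\<in>Y"
 shows "pt (unblock y)\<in>periodic_points G A g0 n \<longleftrightarrow> (shift ^^ n) y = y"
proof -
 have sh: "(shift ^^ n) y i = y (n + i)" for i
  using shift_pow_0[of i "(shift ^^ n) y"] shift_pow_0[of "i + n" y] by (simp add: funpow_add add.commute)
 have "pt (unblock y)\<in>periodic_points G A g0 n \<longleftrightarrow> (ALL i>=1. block A g0 i (pt (unblock y)) = block A g0 (i + n) (pt (unblock y)))"
  using pt_unblock_conical[OF y] by (simp add: periodic_points_def)
 also have "... \<longleftrightarrow> (ALL i. butlast (y i) = butlast (y (i + n)))"
 proof
  assume L: "ALL i>=1. block A g0 i (pt (unblock y)) = block A g0 (i + n) (pt (unblock y))"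
  show "ALL i. butlast (y i) = butlast (y (i + n))"
   using L[rule_format, of "Suc _"] block_pt[OF y] by simp
 next
  assume Rr: "ALL i. butlast (y i) = butlast (y (i + n))"
  show "ALL i>=1. block A g0 i (pt (unblock y)) = block A g0 (i + n) (pt (unblock y))"
  proof (intro allI impI)
   fix i :: nat assume "i>=1"
   then obtain j where "i = Suc j" by (cases i) auto
   then show "block A g0 i (pt (unblock y)) = block A g0 (i + n) (pt (unblock y))" using Rr block_pt[OF y] by simp
  qed
 qed
 also have "... \<longleftrightarrow> (ALL i. y (n + i) = y i)"
 proof
  assume b: "ALL i. butlast (y i) = butlast (y (i + n))"
  have l: "length (y i)>=2" for i using F_length Y_F y by blast
  have h: "hd (y i) = hd (butlast (y i))" for i using l[of i] by (cases "y i" rule: list.exhaust) (auto split: if_splits)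
  have dec: "y i = butlast (y i) @ [hd (butlast (y (Suc i)))]" for i
  proof -
   have "y i~=[]" using l[of i] by auto
   then have "y i = butlast (y i) @ [last (y i)]" by simp
   then show ?thesis using Y_match[OF y, of i] h[of "Suc i"] by simp
  qed
  show "ALL i. y (n + i) = y i"
  proof
   fix i
   have "y (i + n) = butlast (y (i + n)) @ [hd (butlast (y (Suc i + n)))]" using dec[of "i + n"] by simp
   also have "... = butlast (y i) @ [hd (butlast (y (Suc i)))]" using b by metis
   also have "... = y i" using dec[of i] by simp
   finally show "y (n + i) = y i" by (simp add: add.commute)
  qed
 qed (simp add: add.commute)
 also have "... \<longleftrightarrow> (shift ^^ n) y = y" using sh by (auto simp: fun_eq_iff)
 finally show ?thesis .
qed

lemma pt_unblock_continuous: assumes y: "y\<in>Y" and e: "e > 0"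
 obtains n where "ALL y':Y. (ALL i<n. y' i = y i) --> dist (pt (unblock y)) (pt (unblock y')) < e"
proof -
 obtain n where n: "ALL om':reduced_seqs. (ALL i<n. om' i = unblock y i) --> dist (pt (unblock y)) (pt om') < e"
  by (rule pt_continuous[OF unblock_reduced[OF y] e])
 have "dist (pt (unblock y)) (pt (unblock y')) < e" if y': "y'\<in>Y" "ALL i<n. y' i = y i" for y'
 proof -
  have "unblock y' i = unblock y i" if "i < n" for i by (rule unblock_agree) (use y'(2) that in auto)
  then show ?thesis using n unblock_reduced[OF y'(1)] by blast
 qed
 then show ?thesis by (intro that[of n]) blast
qed

end

subsection \<open>Markov shifts with finitely many states and countably many edges\<close>

text \<open>Doeblin's argument: for a fixed target, the maximum and the minimum over the starting
  states are monotone in time, and two steps shrink their difference by the factor 1 - dl, where dl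
  is the least two-step probability.\<close>

lemma finite_stochastic_convergence:
 fixes Q :: "nat => 'v => 'v => real"
 assumes V: "finite V" "V~={}"
  and nonneg: "!!n a b. a\<in>V ==> b\<in>V ==> Q n a b>=0"
  and sum1: "!!n a. a\<in>V ==> (\<Sum>b\<in>V. Q n a b) = 1"
  and CK: "!!m n a b. a\<in>V ==> b\<in>V ==> Q (m + n) a b = (\<Sum>c\<in>V. Q m a c * Q n c b)"
  and pos: "!!a b. a\<in>V ==> b\<in>V ==> Q 2 a b > 0"
 obtains \<pi> where "ALL b:V. \<pi> b>=0" "(\<Sum>b\<in>V. \<pi> b) = 1"
  "ALL a:V. ALL b:V. (%n. Q n a b) \<longlonglongrightarrow> \<pi> b"
  "ALL b:V. ALL n. (\<Sum>a\<in>V. \<pi> a * Q n a b) = \<pi> b"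
proof -
 define M where "M n b = Max ((%a. Q n a b) ` V)" for n b
 define m where "m n b = Min ((%a. Q n a b) ` V)" for n b
 define dl where "dl = Min ((%(a, b). Q 2 a b) ` (V \<times> V))"
 have dl: "dl > 0" "!!a b. a\<in>V ==> b\<in>V ==> dl<=Q 2 a b"
  unfolding dl_def using V pos by (auto simp: Min_gr_iff intro!: Min_le)
 have le: "m n b<=Q n a b" "Q n a b<=M n b" if "a\<in>V" for n a b
  unfolding m_def M_def using V that by auto
 obtain a0 where a0: "a0\<in>V" using V by blast
 have dl1: "dl<=1"
 proof -
  have "Q 2 a0 a0<=(\<Sum>b\<in>V. Q 2 a0 b)" by (rule member_le_sum) (use V a0 nonneg in auto)
  then show ?thesis using dl(2)[OF a0 a0] sum1[OF a0, of 2] by simp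
 qed
 have between: "m n b<=Q (k + n) a b" "Q (k + n) a b<=M n b" if ab: "a\<in>V" "b\<in>V" for n k a b
 proof -
  have "(\<Sum>c\<in>V. Q k a c * Q n c b)<=(\<Sum>c\<in>V. Q k a c * M n b)"
   using le nonneg ab by (intro sum_mono mult_left_mono) auto
  then show "Q (k + n) a b<=M n b" using sum1[OF ab(1), of k] CK[OF ab] by (simp add: sum_distrib_right[symmetric])
  have "(\<Sum>c\<in>V. Q k a c * Q n c b)>=(\<Sum>c\<in>V. Q k a c * m n b)"
   using le nonneg ab by (intro sum_mono mult_left_mono) auto
  then show "Q (k + n) a b>=m n b" using sum1[OF ab(1), of k] CK[OF ab] by (simp add: sum_distrib_right[symmetric])
 qed
 have mM: "m n b<=M n b" for n b using le[OF a0] order_trans by blast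
 have contract: "M (2 + n) b - m (2 + n) b<=(1 - dl) * (M n b - m n b)" if b: "b\<in>V" for n b
 proof -
  have "m n b\<in>(%a. Q n a b) ` V" unfolding m_def using V by (intro Min_in) auto
  then obtain c0 where c0: "c0\<in>V" "m n b = Q n c0 b" by auto
  have "Q (2 + n) a b<=M n b - dl * (M n b - m n b)" if a: "a\<in>V" for a
  proof -
   have "Q (2 + n) a b = Q 2 a c0 * Q n c0 b + (\<Sum>c\<in>V - {c0}. Q 2 a c * Q n c b)"
    using CK[OF a b, of 2 n] V c0 by (simp add: sum.remove)
   also have "...<=Q 2 a c0 * m n b + (\<Sum>c\<in>V - {c0}. Q 2 a c * M n b)"
    using c0 le nonneg a by (intro add_mono sum_mono mult_left_mono) auto
   also have "(\<Sum>c\<in>V - {c0}. Q 2 a c * M n b) = (1 - Q 2 a c0) * M n b"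
    using sum1[OF a, of 2] V c0 by (simp add: sum_distrib_right[symmetric] sum.remove)
   also have "Q 2 a c0 * m n b + (1 - Q 2 a c0) * M n b = M n b - Q 2 a c0 * (M n b - m n b)"
    by (simp add: algebra_simps)
   also have "...<=M n b - dl * (M n b - m n b)"
    using dl(2)[OF a c0(1)] mM[of n b] by (simp add: mult_right_mono)
   finally show ?thesis .
  qed
  then have 1: "M (2 + n) b<=M n b - dl * (M n b - m n b)"
   unfolding M_def[of "2 + n"] using V by (subst Max_le_iff) auto
  have 2: "m (2 + n) b>=m n b"
  proof -
   have "m n b<=Q (2 + n) a b" if "a\<in>V" for a using between(1)[OF that b] .
   then show ?thesis unfolding m_def[of "2 + n"] using V by (subst Min_ge_iff) auto
  qed
  show ?thesis using 1 2 by (simp add: algebra_simps)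
 qed
 have mono: "m n b<=m (Suc n) b" "M (Suc n) b<=M n b" if b: "b\<in>V" for n b
 proof -
  have "m n b<=Q (1 + n) a b" "Q (1 + n) a b<=M n b" if "a\<in>V" for a using between[OF that b] by blast+
  then show "m n b<=m (Suc n) b" "M (Suc n) b<=M n b" using V unfolding m_def[of "Suc n"] M_def[of "Suc n"] by auto
 qed
 have "EX l. ALL a:V. (%n. Q n a b) \<longlonglongrightarrow> l" if b: "b\<in>V" for b
 proof -
  have inc: "incseq (%n. m n b)" and dec: "decseq (%n. M n b)"
   using mono[OF b] by (auto intro: incseq_SucI decseq_SucI)
  have "m n b<=M 0 b" "m 0 b<=M n b" for n
   using mM[of n b] decseqD[OF dec, of 0 n] incseqD[OF inc, of 0 n] by auto
  then obtain l u where l: "(%n. m n b) \<longlonglongrightarrow> l" and u: "(%n. M n b) \<longlonglongrightarrow> u"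
   using incseq_convergent[OF inc] decseq_convergent[OF dec] by metis
  have "(%n. M (2 + n) b - m (2 + n) b) \<longlonglongrightarrow> u - l"
   using LIMSEQ_ignore_initial_segment[OF tendsto_diff[OF u l], of 2] by (simp add: add.commute)
  moreover have "(%n. (1 - dl) * (M n b - m n b)) \<longlonglongrightarrow> (1 - dl) * (u - l)"
   by (intro tendsto_intros u l)
  ultimately have "u - l<=(1 - dl) * (u - l)" using contract[OF b] by (intro LIMSEQ_le) auto
  then have "dl * (u - l)<=0" by (simp add: algebra_simps)
  moreover have "l<=u" using mM by (intro LIMSEQ_le[OF l u]) auto
  ultimately have "u = l" using dl(1) by (simp add: mult_le_0_iff)
  then have ul: "(%n. M n b) \<longlonglongrightarrow> l" using u by simp
  have "(%n. Q n a b) \<longlonglongrightarrow> l" if "a\<in>V" for a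
   by (rule tendsto_sandwich[OF always_eventually always_eventually l ul]) (use le[OF that] in blast)+
  then show ?thesis by blast
 qed
 then obtain \<pi> where \<pi>: "!!a b. a\<in>V ==> b\<in>V ==> (%n. Q n a b) \<longlonglongrightarrow> \<pi> b" by metis
 show ?thesis
 proof (rule that[of \<pi>])
  show "ALL b:V. \<pi> b>=0"
   using LIMSEQ_le_const[OF \<pi>[OF a0]] nonneg[OF a0] by blast
  have "(%n. \<Sum>b\<in>V. Q n a0 b) \<longlonglongrightarrow> (\<Sum>b\<in>V. \<pi> b)" by (intro tendsto_sum \<pi> a0)
  then show "(\<Sum>b\<in>V. \<pi> b) = 1" using sum1[OF a0] by (simp add: LIMSEQ_const_iff)
  show "ALL b:V. ALL n. (\<Sum>a\<in>V. \<pi> a * Q n a b) = \<pi> b"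
  proof (intro ballI allI)
   fix b n assume b: "b\<in>V"
   show "(\<Sum>a\<in>V. \<pi> a * Q n a b) = \<pi> b"
   proof (rule LIMSEQ_unique)
   show "(%k. Q (k + n) a0 b) \<longlonglongrightarrow> \<pi> b" using \<pi>[OF a0 b] by (rule LIMSEQ_ignore_initial_segment)
   have "(%k. \<Sum>a\<in>V. Q k a0 a * Q n a b) \<longlonglongrightarrow> (\<Sum>a\<in>V. \<pi> a * Q n a b)"
    by (intro tendsto_sum tendsto_mult \<pi> a0 tendsto_const)
   then show "(%k. Q (k + n) a0 b) \<longlonglongrightarrow> (\<Sum>a\<in>V. \<pi> a * Q n a b)" using CK[OF a0 b] by simp
   qed
  qed
 qed (use \<pi> in blast)
qed

locale edge_shift =
 fixes E :: "'e set" and s t :: "'e => 'v" and V :: "'v set" and p :: "'v => 'e pmf"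
 assumes finV: "finite V" and neV: "V~={}"
  and set_p: "v\<in>V ==> set_pmf (p v) = {e\<in>E. s e = v}"
  and s_V: "e\<in>E ==> s e\<in>V" and t_V: "e\<in>E ==> t e\<in>V"
  and two_step: "a\<in>V ==> b\<in>V ==> EX e:E. EX e':E. s e = a \<and> t e = s e' \<and> t e' = b"
begin

definition X :: "(nat => 'e) set" where "X = {y. ALL i. y i\<in>E \<and> t (y i) = s (y (Suc i))}"

definition B :: "(nat => 'e) measure" where "B = sigma X {U. openin (sequence_topology E X) U}"

definition cyl :: "'e list => (nat => 'e) set" where "cyl w = {y\<in>X. ALL i<length w. y i = w ! i}"

definition pe :: "'e => real" where "pe e = pmf (p (s e)) e"

definition K :: "'v => 'v pmf" where "K a = map_pmf t (p a)"

fun Kn :: "nat => 'v => 'v pmf" where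
 "Kn 0 a = return_pmf a"
| "Kn (Suc n) a = bind_pmf (K a) (Kn n)"

lemma countable_E: "countable E"
proof -
 have "E = (\<Union>v\<in>V. set_pmf (p v))" using set_p s_V by auto
 also have "countable \<dots>" by (rule countable_UN[OF countable_finite[OF finV]]) (rule countable_set_pmf)
 finally show ?thesis .
qed

lemma countable_words: "countable {w. set w\<subseteq>E}"
 using countable_lists[OF countable_E] by (simp add: lists_eq_set)

lemma pe_pos: "e\<in>E ==> pe e > 0"
 using set_p[OF s_V[of e]] by (auto simp: pe_def pmf_positive)

lemma pe_le_1: "pe e<=1" by (simp add: pe_def pmf_le_1)

lemma cyl_map: "y\<in>X ==> y\<in>cyl (map y [0..<n])" by (simp add: cyl_def)

lemma cyl_mapD: "y'\<in>cyl (map y [0..<n]) ==> i < n ==> y' i = y i" by (simp add: cyl_def)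

lemma X_E: "y\<in>X ==> y i\<in>E" by (simp add: X_def)

lemma prefix_words: "y\<in>X ==> set (map y [0..<n])\<subseteq>E" by (auto simp: X_def)

lemma openD:
 assumes "openin (sequence_topology E X) U" "y\<in>U"
 shows "U\<subseteq>X" "EX n. cyl (map y [0..<n])\<subseteq>U"
proof -
 obtain T where T: "openin (product_topology (%_. discrete_topology E) UNIV) T" "U = T Int X"
  using assms by (auto simp: sequence_topology_def openin_subtopology)
 then show "U\<subseteq>X" by simp
 have "y\<in>T" using T assms by simp
 then obtain F where F: "finite {i. F i~=E}" "y\<in>PiE UNIV F" "PiE UNIV F\<subseteq>T"
  using T(1) unfolding openin_product_topology_alt by (auto simp: topspace_discrete_topology) 
 define n where "n = Suc (Max (insert 0 {i. F i~=E}))"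
 have n: "F i = E" if "i>=n" for i
 proof (rule ccontr)
  assume "F i~=E"
  then have "i<=Max (insert 0 {i. F i~=E})" using F(1) by (intro Max_ge) auto
  then show False using that by (simp add: n_def)
 qed
 have "y'\<in>U" if y': "y'\<in>cyl (map y [0..<n])" for y'
 proof -
  have yX: "y'\<in>X" using y' by (simp add: cyl_def)
  have "y' i\<in>F i" for i
  proof (cases "i < n")
   case True then show ?thesis using cyl_mapD[OF y'] F(2) by (auto simp: PiE_iff)
  next
   case False then show ?thesis using n[of i] X_E[OF yX] by simp
  qed
  then show ?thesis using F(3) T(2) yX by (auto simp: PiE_iff subset_iff)
 qed
 then show "EX n. cyl (map y [0..<n])\<subseteq>U" by blast
qed

lemma open_cyl: assumes "set w\<subseteq>E" shows "openin (sequence_topology E X) (cyl w)"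
proof -
 define F where "F i = (if i < length w then {w ! i} else E)" for i
 have "openin (product_topology (%_. discrete_topology E) UNIV) (PiE UNIV F)"
  unfolding openin_PiE_gen
 proof (intro disjI2 conjI ballI)
  show "finite {i\<in>UNIV. F i~=topspace (discrete_topology E)}"
   by (rule finite_subset[of _ "{..<length w}"]) (auto simp: F_def)
  show "openin (discrete_topology E) (F i)" for i using assms nth_mem by (fastforce simp: F_def)
 qed
 moreover have "cyl w = PiE UNIV F Int X" by (auto simp: cyl_def F_def PiE_iff X_def split: if_splits)
 ultimately show ?thesis unfolding sequence_topology_def openin_subtopology by blast
qed

lemma cyl_sub: "cyl w\<subseteq>X" by (auto simp: cyl_def)

lemma space_B [simp]: "space B = X"
 unfolding B_def by (rule space_measure_of) (auto simp: sequence_topology_def openin_subtopology)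

lemma sets_B: "sets B = sigma_sets X (cyl ` {w. set w\<subseteq>E})"
proof -
 have sub: "{U. openin (sequence_topology E X) U}\<subseteq>Pow X"
  by (auto simp: sequence_topology_def openin_subtopology)
 have "sigma_sets X {U. openin (sequence_topology E X) U} = sigma_sets X (cyl ` {w. set w\<subseteq>E})"
 proof (rule sigma_sets_eqI)
  fix U assume "U\<in>{U. openin (sequence_topology E X) U}"
  then have U: "openin (sequence_topology E X) U" by simp
  have "U = \<Union> (cyl ` {w. set w\<subseteq>E \<and> cyl w\<subseteq>U})"
  proof (intro equalityI subsetI)
   fix y assume y: "y\<in>U"
   obtain n where n: "cyl (map y [0..<n])\<subseteq>U" using openD(2)[OF U y] by blast
   have yX: "y\<in>X" using openD(1)[OF U y] y by blast
   show "y\<in>\<Union> (cyl ` {w. set w\<subseteq>E \<and> cyl w\<subseteq>U})"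
    using n cyl_map[OF yX] prefix_words[OF yX] by blast
  qed auto
  also have "...\<in>sigma_sets X (cyl ` {w. set w\<subseteq>E})"
   by (rule sigma_sets_UNION) (auto intro: countable_image countable_subset[OF _ countable_words] sigma_sets.Basic)
  finally show "U\<in>sigma_sets X (cyl ` {w. set w\<subseteq>E})" .
 next
  fix U assume "U\<in>cyl ` {w. set w\<subseteq>E}"
  then show "U\<in>sigma_sets X {U. openin (sequence_topology E X) U}" using open_cyl by auto
 qed
 then show ?thesis unfolding B_def using sub by simp
qed

lemma cyl_B [measurable]: "cyl w\<in>sets B"
proof (cases "set w\<subseteq>E")
 case True then show ?thesis unfolding sets_B by auto
next
 case False
 then obtain i where i: "i < length w" "w ! i\<notin>E" by (metis in_set_conv_nth subsetI)
 have False if "y\<in>cyl w" for y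
 proof -
  have "y\<in>X" "y i = w ! i" using that i by (auto simp: cyl_def)
  then show False using i X_E[of y i] by simp
 qed
 then have "cyl w = {}" by blast
 then show ?thesis by simp
qed

lemma cyl_Nil: "cyl [] = X" by (simp add: cyl_def)

lemma cyl_Int: "cyl w Int cyl w'\<in>insert {} (cyl ` {w. set w\<subseteq>E})" if "set w\<subseteq>E" "set w'\<subseteq>E"
proof -
 have *: "cyl w Int cyl w'\<in>insert {} (cyl ` {w. set w\<subseteq>E})"
  if "length w<=length w'" "set w'\<subseteq>E" for w w'
 proof (cases "ALL i<length w. w ! i = w' ! i")
  case True
  then have "cyl w Int cyl w' = cyl w'" using that by (auto simp: cyl_def)
  then show ?thesis using that by blast
 next
  case False
  then have "cyl w Int cyl w' = {}" using that by (fastforce simp: cyl_def)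
  then show ?thesis by simp
 qed
 show ?thesis
  using *[of w w'] *[of w' w] that by (cases "length w<=length w'") (auto simp: Int_commute)
qed

lemma measure_eq_cyl:
 assumes M: "prob_space M" "space M = X" "sets M = sets B" and N: "sets N = sets B"
  and eq: "!!w. set w\<subseteq>E ==> emeasure M (cyl w) = emeasure N (cyl w)"
 shows "M = N"
proof (rule measure_eqI_generator_eq[where E = "insert {} (cyl ` {w. set w\<subseteq>E})" and \<Omega> = X and A = "%_. X"])
 show "Int_stable (insert {} (cyl ` {w. set w\<subseteq>E}))"
  unfolding Int_stable_def using cyl_Int by auto
 show "insert {} (cyl ` {w. set w\<subseteq>E})\<subseteq>Pow X" using cyl_sub by auto
 have e: "sigma_sets X (insert {} (cyl ` {w. set w\<subseteq>E})) = sigma_sets X (cyl ` {w. set w\<subseteq>E})"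
  by (rule sigma_sets_eqI) (auto intro: sigma_sets.Empty)
 show "sets M = sigma_sets X (insert {} (cyl ` {w. set w\<subseteq>E}))" unfolding e M(3) sets_B ..
 show "sets N = sigma_sets X (insert {} (cyl ` {w. set w\<subseteq>E}))" unfolding e N sets_B ..
 show "range (%_. X)\<subseteq>insert {} (cyl ` {w. set w\<subseteq>E})" using cyl_Nil by auto
 interpret prob_space M by fact
 show "emeasure M X~=\<infinity>" by simp
qed (use eq in auto)

lemma measurable_into_B:
 assumes "f\<in>space N \<rightarrow> X" "!!w. set w\<subseteq>E ==> f -` cyl w Int space N\<in>sets N"
 shows "f\<in>N \<rightarrow>\<^sub>M B"
proof -
 have "f\<in>N \<rightarrow>\<^sub>M sigma X (cyl ` {w. set w\<subseteq>E})"
  using assms cyl_sub by (intro measurable_measure_of) auto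
 moreover have "sets (sigma X (cyl ` {w. set w\<subseteq>E})) = sets B" unfolding sets_B
  using cyl_sub by (intro sets_measure_of) auto
 ultimately show ?thesis using measurable_cong_sets by blast
qed

lemma shift_X: "y\<in>X ==> shift y\<in>X" by (simp add: X_def shift_def)

lemma shift_pow: "(shift ^^ n) y = (%i. y (n + i))"
proof (induction n)
 case (Suc n)
 have "(shift ^^ Suc n) y = shift ((shift ^^ n) y)" by simp
 also have "... = shift (%i. y (n + i))" by (simp only: Suc.IH)
 also have "... = (%i. y (Suc n + i))" by (simp add: shift_def[of "%i. y (n + i)"])
 finally show ?case .
qed simp

lemma shift_vimage_cyl: "shift -` cyl w Int X = (\<Union>e\<in>E. cyl (e # w))"
proof (intro equalityI subsetI)
 fix y assume y: "y\<in>shift -` cyl w Int X"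
 have "y i = (y 0 # w) ! i" if "i < length (y 0 # w)" for i
  using y that by (cases i) (auto simp: cyl_def shift_def)
 then have "y\<in>cyl (y 0 # w)" using y unfolding cyl_def by blast
 then show "y\<in>(\<Union>e\<in>E. cyl (e # w))" using y X_E by blast
next
 fix y assume "y\<in>(\<Union>e\<in>E. cyl (e # w))"
 then obtain e where y: "y\<in>X" "!!i. i < Suc (length w) ==> y i = (e # w) ! i" by (auto simp: cyl_def)
 have "shift y i = w ! i" if "i < length w" for i using y(2)[of "Suc i"] that by (simp add: shift_def)
 then show "y\<in>shift -` cyl w Int X" using y(1) shift_X by (simp add: cyl_def)
qed

lemma shift_measurable [measurable]: "shift\<in>B \<rightarrow>\<^sub>M B"
proof (rule measurable_into_B)
 fix w show "shift -` cyl w Int space B\<in>sets B"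
  unfolding space_B shift_vimage_cyl using countable_E by (intro sets.countable_UN') auto
qed (use shift_X in auto)

lemma shift_pow_measurable [measurable]: "(shift ^^ n)\<in>B \<rightarrow>\<^sub>M B"
proof (induction n)
 case (Suc n)
 from measurable_comp[OF this shift_measurable] show ?case by simp
qed (simp add: id_def)

lemma prefix_measurable: "(%y. map y [0..<n])\<in>B \<rightarrow>\<^sub>M count_space {w. set w\<subseteq>E}"
proof (subst measurable_count_space_eq_countable[OF countable_words], intro conjI ballI)
 show "(%y. map y [0..<n])\<in>space B \<rightarrow> {w. set w\<subseteq>E}" using prefix_words by auto
 fix w assume "w\<in>{w. set w\<subseteq>E}"
 show "(%y. map y [0..<n]) -` {w} Int space B\<in>sets B"
 proof (cases "length w = n")
  case True
  then have "(%y. map y [0..<n]) -` {w} Int space B = cyl w"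
  proof (intro equalityI subsetI)
   fix y assume y: "y\<in>(%y. map y [0..<n]) -` {w} Int space B"
   then have "y i = w ! i" if "i < n" for i using that nth_map_upt[of i n 0 y] by auto
   then show "y\<in>cyl w" using y True by (simp add: cyl_def)
  next
   fix y assume "y\<in>cyl w"
   then show "y\<in>(%y. map y [0..<n]) -` {w} Int space B" using True
    by (auto simp: cyl_def intro: nth_equalityI)
  qed
  then show ?thesis by simp
 next
  case False
  then have "(%y. map y [0..<n]) -` {w} Int space B = {}" by auto
  then show ?thesis by simp
 qed
qed

lemma coord_measurable: "(%y. y i)\<in>B \<rightarrow>\<^sub>M count_space E"
proof -
 have "(%y. (map y [0..<Suc i]) ! i)\<in>B \<rightarrow>\<^sub>M count_space E"
 proof (subst measurable_count_space_eq_countable[OF countable_E], intro conjI ballI)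
  fix e assume "e\<in>E"
  have "(%y. (map y [0..<Suc i]) ! i) -` {e} Int space B = (%y. map y [0..<Suc i]) -` {w. w ! i = e \<and> set w\<subseteq>E} Int space B"
   using prefix_words by (auto simp del: upt_Suc)
  also have "...\<in>sets B" by (rule measurable_sets[OF prefix_measurable]) auto
  finally show "(%y. (map y [0..<Suc i]) ! i) -` {e} Int space B\<in>sets B" .
 qed (auto simp: X_E simp del: upt_Suc)
 then show ?thesis by (simp add: nth_append)
qed

lemma real_coord_measurable [measurable]: "(%y. f (y i) :: real)\<in>borel_measurable B"
 by (rule measurable_compose[OF coord_measurable]) simp

lemma real_prefix_measurable [measurable]: "(%y. f (map y [0..<n]) :: real)\<in>borel_measurable B"
 by (rule measurable_compose[OF prefix_measurable]) simp

lemma set_K: "a\<in>V ==> set_pmf (K a)\<subseteq>V"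
 using set_p t_V by (auto simp: K_def)

lemma set_Kn: "a\<in>V ==> set_pmf (Kn n a)\<subseteq>V"
proof (induction n arbitrary: a)
 case (Suc n)
 have "set_pmf (Kn n b)\<subseteq>V" if "b\<in>set_pmf (K a)" for b using that Suc set_K by blast
 then show ?case by auto
qed simp

lemma pmf_bind_V: "set_pmf M\<subseteq>V ==> pmf (bind_pmf M f) b = (\<Sum>c\<in>V. pmf M c * pmf (f c) b)"
 unfolding pmf_bind using finV by (subst integral_measure_pmf_real[of V]) (auto simp: mult.commute)

lemma Kn_add: "Kn (m + n) a = bind_pmf (Kn m a) (Kn n)"
proof (induction m arbitrary: a)
 case (Suc m)
 then have "Kn (m + n) = (%x. bind_pmf (Kn m x) (Kn n))" by (intro ext)
 then show ?case by (simp add: bind_assoc_pmf)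
qed (simp add: bind_return_pmf)

lemma Kn_pos2: assumes "a\<in>V" "b\<in>V" shows "pmf (Kn 2 a) b > 0"
proof -
 obtain e e' where e: "e\<in>E" "e'\<in>E" "s e = a" "t e = s e'" "t e' = b" using two_step assms by blast
 have "e\<in>set_pmf (p a)" "e'\<in>set_pmf (p (t e))" using e set_p[OF assms(1)] set_p[OF t_V[OF e(1)]] by auto
 then have "b\<in>set_pmf (Kn 2 a)" using e by (auto simp: numeral_2_eq_2 K_def intro!: bexI[of _ e])
 then show ?thesis by (simp add: pmf_positive)
qed

text \<open>The limit of the transition probabilities does not depend on the start; both uniqueness
  and equidistribution rest on this convergence.\<close>

lemma stationary_exists:
 obtains \<pi> :: "'v pmf" where "set_pmf \<pi>\<subseteq>V" "bind_pmf \<pi> K = \<pi>"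
  "!!a b. a\<in>V ==> b\<in>V ==> (%n. pmf (Kn n a) b) \<longlonglongrightarrow> pmf \<pi> b"
proof -
 have one: "(\<Sum>b\<in>V. pmf (Kn n a) b) = 1" if "a\<in>V" for a n
  by (rule sum_pmf_eq_1[OF finV set_Kn[OF that]])
 have CK: "pmf (Kn (m + n) a) b = (\<Sum>c\<in>V. pmf (Kn m a) c * pmf (Kn n c) b)" if "a\<in>V" for m n a b
  unfolding Kn_add by (rule pmf_bind_V[OF set_Kn[OF that]])
 obtain f where "ALL b:V. f b>=0" "(\<Sum>b\<in>V. f b) = 1"
  "ALL a:V. ALL b:V. (%n. pmf (Kn n a) b) \<longlonglongrightarrow> f b"
  "ALL b:V. ALL n. (\<Sum>a\<in>V. f a * pmf (Kn n a) b) = f b"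
  by (rule finite_stochastic_convergence[of V "%n a b. pmf (Kn n a) b", OF finV neV pmf_nonneg one CK Kn_pos2])
 then have f: "!!b. b\<in>V ==> f b>=0" "(\<Sum>b\<in>V. f b) = 1"
  "!!a b. a\<in>V ==> b\<in>V ==> (%n. pmf (Kn n a) b) \<longlonglongrightarrow> f b"
  "!!b n. b\<in>V ==> (\<Sum>a\<in>V. f a * pmf (Kn n a) b) = f b" by auto
 define g where "g b = (if b\<in>V then f b else 0)" for b
 have "(\<integral>\<^sup>+b. ennreal (g b) \<partial>count_space UNIV) = (\<integral>\<^sup>+b. ennreal (g b) \<partial>count_space V)"
  by (subst nn_integral_count_space_indicator) (auto simp: g_def indicator_def intro!: nn_integral_cong)
 also have "... = (\<Sum>b\<in>V. ennreal (f b))" using finV by (simp add: nn_integral_count_space_finite g_def)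
 also have "... = 1" using f by (simp add: sum_ennreal)
 finally have one: "(\<integral>\<^sup>+b. ennreal (g b) \<partial>count_space UNIV) = 1" .
 define \<pi> where "\<pi> = embed_pmf g"
 have \<pi>: "pmf \<pi> b = g b" for b unfolding \<pi>_def by (rule pmf_embed_pmf) (use f one in "auto simp: g_def")
 have sV: "set_pmf \<pi>\<subseteq>V" by (auto simp: set_pmf_iff \<pi> g_def split: if_splits)
 have "Kn 0 = return_pmf" by (rule ext) simp
 then have K1: "Kn 1 a = K a" for a by (simp add: bind_return_pmf')
 have "bind_pmf \<pi> K = \<pi>"
 proof (rule pmf_eqI)
  fix b
  show "pmf (bind_pmf \<pi> K) b = pmf \<pi> b"
  proof (cases "b\<in>V")
   case True
   then show ?thesis unfolding pmf_bind_V[OF sV] using f(4)[OF True, of 1] unfolding K1 by (simp add: \<pi> g_def)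
  next
   case False
   then have "b\<notin>set_pmf (bind_pmf \<pi> K)" using sV set_K by fastforce
   then show ?thesis using False by (simp add: pmf_eq_0_set_pmf \<pi> g_def)
  qed
 qed
 then show ?thesis using that[of \<pi>] sV f(3) by (simp add: \<pi> g_def)
qed

end

subsection \<open>Markov measures\<close>

context edge_shift
begin

definition adm :: "'e list => bool" where
 "adm w \<longleftrightarrow> set w\<subseteq>E \<and> successively (%a b. t a = s b) w"

definition wprob :: "'e list => real" where "wprob w = prod_list (map pe w)"

lemma adm_Cons: "adm (e # w) \<longleftrightarrow> e\<in>E \<and> adm w \<and> (w~=[] --> t e = s (hd w))"
 by (cases w) (auto simp: adm_def)

lemma adm_nth: "adm w \<longleftrightarrow> (ALL i<length w. w ! i\<in>E) \<and> (ALL i. Suc i < length w --> t (w ! i) = s (w ! Suc i))"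
proof (induction w)
 case (Cons e w)
 show ?case
 proof
  assume a: "adm (e # w)"
  then have w: "ALL i<length w. w ! i\<in>E" "ALL i. Suc i < length w --> t (w ! i) = s (w ! Suc i)"
   and e: "e\<in>E" "w~=[] --> t e = s (hd w)" using Cons by (auto simp: adm_Cons)
  have "(e # w) ! i\<in>E" if "i < length (e # w)" for i using w e that by (cases i) auto
  moreover have "t ((e # w) ! i) = s ((e # w) ! Suc i)" if "Suc i < length (e # w)" for i
   using w e that by (cases i) (auto simp: hd_conv_nth)
  ultimately show "(ALL i<length (e # w). (e # w) ! i\<in>E) \<and> (ALL i. Suc i < length (e # w) --> t ((e # w) ! i) = s ((e # w) ! Suc i))"
   by blast
 next
  assume a: "(ALL i<length (e # w). (e # w) ! i\<in>E) \<and> (ALL i. Suc i < length (e # w) --> t ((e # w) ! i) = s ((e # w) ! Suc i))"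
  have "w ! i\<in>E" if "i < length w" for i using a that by (auto dest: spec[of _ "Suc i"])
  moreover have "t (w ! i) = s (w ! Suc i)" if "Suc i < length w" for i
  proof -
   have "t ((e # w) ! Suc i) = s ((e # w) ! Suc (Suc i))" using a that by (metis Suc_less_eq length_Cons)
   then show ?thesis by simp
  qed
  moreover have "e\<in>E" using a by auto
  moreover have "t e = s (hd w)" if "w~=[]"
  proof -
   have "t ((e # w) ! 0) = s ((e # w) ! Suc 0)" using a that by (metis Suc_less_eq length_Cons length_greater_0_conv)
   then show ?thesis using that by (simp add: hd_conv_nth)
  qed
  ultimately show "adm (e # w)" unfolding adm_Cons using Cons by blast
 qed
qed (simp add: adm_def)

lemma X_adm: "y\<in>X ==> adm (map y [0..<n])"
 unfolding adm_nth by (auto simp: X_def)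

lemma cyl_adm: "y\<in>cyl w ==> adm w"
proof -
 assume y: "y\<in>cyl w"
 then have "map y [0..<length w] = w" by (auto simp: cyl_def intro: nth_equalityI)
 then show "adm w" using X_adm[of y "length w"] y cyl_sub by (metis subsetD)
qed

lemma wprob_nth: "wprob w = (\<Prod>i<length w. pe (w ! i))"
proof (induction w)
 case (Cons e w)
 then show ?case by (simp add: wprob_def prod.lessThan_Suc_shift del: prod.lessThan_Suc)
qed (simp add: wprob_def)

lemma wprob_Cons: "wprob (e # w) = pe e * wprob w" by (simp add: wprob_def)

lemma wprob_pos: "set w\<subseteq>E ==> wprob w > 0"
 unfolding wprob_def by (induction w) (auto simp: pe_pos)

text \<open>The default edge keeps every trajectory in the shift, so that no null set has to be
  removed.\<close>

definition out_edge :: "'v => 'e => 'e" where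
 "out_edge v e = (if e\<in>E \<and> s e = v then e else (SOME e'. e'\<in>E \<and> s e' = v))"

lemma out_edge: assumes "v\<in>V" shows "out_edge v e\<in>E" "s (out_edge v e) = v"
proof -
 have "set_pmf (p v)~={}" by (rule set_pmf_not_empty)
 then have "EX e'. e'\<in>E \<and> s e' = v" using set_p[OF assms] by auto
 then have "(SOME e'. e'\<in>E \<and> s e' = v)\<in>E \<and> s (SOME e'. e'\<in>E \<and> s e' = v) = v" by (rule someI_ex)
 then show "out_edge v e\<in>E" "s (out_edge v e) = v" by (auto simp: out_edge_def)
qed

text \<open>The chain is driven by independent edges \<open>om (i, v)\<close>, the choice made at time \<open>i\<close> if the
 current vertex is \<open>v\<close>; only at time \<open>0\<close> all of them have the initial distribution.\<close>

fun traj :: "(nat \<times> 'v => 'e) => nat => 'e" where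
 "traj om 0 = (let e = om (0, SOME v. v\<in>V) in if e\<in>E then e else (SOME e. e\<in>E))"
| "traj om (Suc i) = out_edge (t (traj om i)) (om (Suc i, t (traj om i)))"

lemma E_nonempty: "E~={}"
 using neV set_p set_pmf_not_empty by fastforce

lemma traj_E: "traj om i\<in>E"
proof (induction i)
 case 0
 have "(SOME e. e\<in>E)\<in>E" using E_nonempty by (simp add: some_in_eq)
 then show ?case by (simp add: Let_def)
next
 case (Suc i)
 then show ?case using out_edge t_V by simp
qed

lemma traj_X: "traj om\<in>X"
 unfolding X_def using traj_E out_edge t_V by auto

definition drive :: "'v pmf => nat \<times> 'v => 'e measure" where
 "drive \<pi> = (%(i, v). measure_pmf (if i = 0 then bind_pmf \<pi> p else p v))"

definition markov :: "'v pmf => (nat => 'e) measure" where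
 "markov \<pi> = distr (PiM UNIV (drive \<pi>)) B traj"

lemma traj_measurable_coord: "(%om. traj om i)\<in>PiM UNIV (drive \<pi>) \<rightarrow>\<^sub>M count_space E"
proof (induction i)
 case 0
 have c: "(%om. om (0, SOME v. v\<in>V))\<in>PiM UNIV (drive \<pi>) \<rightarrow>\<^sub>M count_space UNIV"
  using measurable_component_singleton[of "(0, SOME v. v\<in>V)" UNIV "drive \<pi>"]
  by (simp add: drive_def)
 have "(%e. if e\<in>E then e else (SOME e. e\<in>E))\<in>count_space UNIV \<rightarrow>\<^sub>M count_space E"
  using some_in_eq[of E] E_nonempty by auto
 from measurable_compose[OF c this] show ?case by (simp add: Let_def)
next
 case (Suc i)
 have tm: "(%om. t (traj om i))\<in>PiM UNIV (drive \<pi>) \<rightarrow>\<^sub>M count_space V"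
  by (rule measurable_compose[OF Suc]) (use t_V in auto)
 have "(%om. out_edge v (om (Suc i, v)))\<in>PiM UNIV (drive \<pi>) \<rightarrow>\<^sub>M count_space E" if v: "v\<in>V" for v
 proof -
  have c: "(%om. om (Suc i, v))\<in>PiM UNIV (drive \<pi>) \<rightarrow>\<^sub>M count_space UNIV"
   using measurable_component_singleton[of "(Suc i, v)" UNIV "drive \<pi>"] by (simp add: drive_def)
  show ?thesis by (rule measurable_compose[OF c]) (use out_edge[OF v] in auto)
 qed
 from measurable_compose_countable'[OF this tm countable_finite[OF finV]] show ?case by simp
qed

lemma cyl_vimage: "f -` cyl w Int S = {om\<in>S. ALL i<length w. f om i = w ! i}" if "!!om. f om\<in>X"
 using that by (auto simp: cyl_def)

lemma traj_measurable: "traj\<in>PiM UNIV (drive \<pi>) \<rightarrow>\<^sub>M B"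
proof (rule measurable_into_B)
 fix w
 have "{om\<in>space (PiM UNIV (drive \<pi>)). ALL i:{..<length w}. traj om i = w ! i}\<in>sets (PiM UNIV (drive \<pi>))"
 proof (intro sets.sets_Collect_finite_All)
  fix i
  have "{om\<in>space (PiM UNIV (drive \<pi>)). traj om i = w ! i} = (%om. traj om i) -` {w ! i} Int space (PiM UNIV (drive \<pi>))" by auto
  also have "... = (%om. traj om i) -` ({w ! i} Int E) Int space (PiM UNIV (drive \<pi>))" using traj_E by auto
  also have "...\<in>sets (PiM UNIV (drive \<pi>))" by (rule measurable_sets[OF traj_measurable_coord]) simp
  finally show "{om\<in>space (PiM UNIV (drive \<pi>)). traj om i = w ! i}\<in>sets (PiM UNIV (drive \<pi>))" .
 qed simp
 then show "traj -` cyl w Int space (PiM UNIV (drive \<pi>))\<in>sets (PiM UNIV (drive \<pi>))"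
  unfolding cyl_vimage[of traj, OF traj_X] by (simp only: Ball_def lessThan_iff)
qed (use traj_X in auto)

lemma prob_markov: "prob_space (markov \<pi>)"
proof -
 have pps: "prob_space (drive \<pi> j)" for j by (cases j) (simp add: drive_def measure_pmf.prob_space_axioms)
 interpret product_prob_space "drive \<pi>" UNIV by (rule product_prob_spaceI[OF pps])
 show ?thesis unfolding markov_def by (rule P.prob_space_distr[OF traj_measurable])
qed

lemma space_markov [simp]: "space (markov \<pi>) = X" and sets_markov [simp]: "sets (markov \<pi>) = sets B"
 by (auto simp: markov_def)

lemma measure_out_edge: assumes "v\<in>V" "e\<in>E" "s e = v"
 shows "emeasure (measure_pmf (p v)) {e'. out_edge v e' = e} = ennreal (pe e)"
proof -
 have "emeasure (measure_pmf (p v)) {e'. out_edge v e' = e} = emeasure (measure_pmf (p v)) ({e'. out_edge v e' = e} Int set_pmf (p v))"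
  by (rule emeasure_Int_set_pmf[symmetric])
 also have "{e'. out_edge v e' = e} Int set_pmf (p v) = {e}"
  using assms set_p[OF assms(1)] by (auto simp: out_edge_def)
 finally show ?thesis using assms by (simp add: emeasure_pmf_single pe_def)
qed

lemma pmf_bind_p: assumes "set_pmf \<pi>\<subseteq>V" "e\<in>E" shows "pmf (bind_pmf \<pi> p) e = pmf \<pi> (s e) * pe e"
proof -
 have "pmf (bind_pmf \<pi> p) e = (\<Sum>c\<in>V. pmf \<pi> c * pmf (p c) e)" by (rule pmf_bind_V[OF assms(1)])
 also have "... = (\<Sum>c\<in>V. if c = s e then pmf \<pi> (s e) * pe e else 0)"
  using set_p assms(2) by (intro sum.cong) (auto simp: pe_def pmf_eq_0_set_pmf)
 also have "... = pmf \<pi> (s e) * pe e" using finV s_V[OF assms(2)] by simp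
 finally show ?thesis .
qed

lemma markov_cyl:
 assumes \<pi>: "set_pmf \<pi>\<subseteq>V" and w: "adm w" "w~=[]"
 shows "emeasure (markov \<pi>) (cyl w) = ennreal (pmf \<pi> (s (hd w)) * wprob w)"
proof -
 let ?P = "PiM UNIV (drive \<pi>)"
 have pps: "prob_space (drive \<pi> j)" for j by (cases j) (simp add: drive_def measure_pmf.prob_space_axioms)
 interpret product_prob_space "drive \<pi>" UNIV by (rule product_prob_spaceI[OF pps])
 have wE: "w ! i\<in>E" if "i < length w" for i using w that by (simp add: adm_nth)
 \<comment> \<open>\<open>idx i\<close> is the coordinate read at time i if the trajectory has
   followed w so far, and \<open>Sx i\<close> contains the values that prolong w. Distinct times
   read distinct coordinates, hence the product.\<close>
 define idx where "idx i = (i, if i = 0 then SOME v. v\<in>V else t (w ! (i - 1)))" for i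
 define Sx where "Sx i = (if i = 0 then {e. (if e\<in>E then e else (SOME e. e\<in>E)) = w ! 0} else {e. out_edge (t (w ! (i - 1))) e = w ! i})" for i
 have inj: "inj_on idx {..<length w}" by (auto simp: inj_on_def idx_def)
 have "emeasure (markov \<pi>) (cyl w) = emeasure ?P (traj -` cyl w Int space ?P)"
  unfolding markov_def by (rule emeasure_distr[OF traj_measurable cyl_B])
 also have "traj -` cyl w Int space ?P = {om\<in>space ?P. ALL j:idx ` {..<length w}. om j\<in>Sx (fst j)}"
 proof -
  have "(ALL i<length w. traj om i = w ! i) \<longleftrightarrow> (ALL i<length w. om (idx i)\<in>Sx i)" for om
  proof -
   have "(ALL i<n. traj om i = w ! i) \<longleftrightarrow> (ALL i<n. om (idx i)\<in>Sx i)" for n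
   proof (induction n)
    case (Suc n)
    have "traj om n = w ! n \<longleftrightarrow> om (idx n)\<in>Sx n" if "ALL i<n. traj om i = w ! i"
     using that by (cases n) (auto simp: idx_def Sx_def Let_def)
    then show ?case using Suc by (metis less_Suc_eq)
   qed simp
   then show ?thesis .
  qed
  then show ?thesis unfolding cyl_vimage[of traj, OF traj_X] by (auto simp: idx_def)
 qed
 also have "emeasure ?P \<dots> = (\<Prod>j\<in>idx ` {..<length w}. emeasure (drive \<pi> j) (Sx (fst j)))"
  by (rule emeasure_PiM_Collect) (auto simp: drive_def)
 also have "... = (\<Prod>i<length w. emeasure (drive \<pi> (idx i)) (Sx i))"
  by (subst prod.reindex[OF inj]) (simp add: idx_def)
 also have "... = (\<Prod>i<length w. ennreal (if i = 0 then pmf \<pi> (s (hd w)) * pe (w ! 0) else pe (w ! i)))"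
 proof (rule prod.cong[OF refl])
  fix i assume i: "i\<in>{..<length w}"
  show "emeasure (drive \<pi> (idx i)) (Sx i) = ennreal (if i = 0 then pmf \<pi> (s (hd w)) * pe (w ! 0) else pe (w ! i))"
  proof (cases i)
   case 0
   have sub: "set_pmf (bind_pmf \<pi> p)\<subseteq>E" using \<pi> set_p by auto
   have "emeasure (measure_pmf (bind_pmf \<pi> p)) (Sx 0) = emeasure (measure_pmf (bind_pmf \<pi> p)) (Sx 0 Int set_pmf (bind_pmf \<pi> p))"
    by (rule emeasure_Int_set_pmf[symmetric])
   also have "Sx 0 Int set_pmf (bind_pmf \<pi> p) = {w ! 0} Int set_pmf (bind_pmf \<pi> p)" using sub by (auto simp: Sx_def)
   also have "emeasure (measure_pmf (bind_pmf \<pi> p)) \<dots> = ennreal (pmf (bind_pmf \<pi> p) (w ! 0))"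
    by (simp only: emeasure_Int_set_pmf emeasure_pmf_single)
   finally show ?thesis using 0 pmf_bind_p[OF \<pi> wE[of 0]] w i by (simp add: drive_def idx_def hd_conv_nth)
  next
   case (Suc j)
   then have "t (w ! j) = s (w ! i)" using w i by (simp add: adm_nth)
   then show ?thesis using Suc measure_out_edge[of "t (w ! j)" "w ! i"] s_V[OF wE[of i]] wE[of i] i
    by (simp add: drive_def idx_def Sx_def)
  qed
 qed
 also have "... = ennreal (\<Prod>i<length w. if i = 0 then pmf \<pi> (s (hd w)) * pe (w ! 0) else pe (w ! i))"
  by (rule prod_ennreal) (auto simp: pe_def)
 also have "(\<Prod>i<length w. if i = 0 then pmf \<pi> (s (hd w)) * pe (w ! 0) else pe (w ! i)) = pmf \<pi> (s (hd w)) * wprob w"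
 proof (cases w)
  case (Cons e u)
  then show ?thesis unfolding wprob_nth
   by (simp add: prod.lessThan_Suc_shift mult.assoc del: prod.lessThan_Suc)
 qed (use w in simp)
 finally show ?thesis .
qed

lemma emeasure_edge_split:
 assumes "sets M = sets B" "S\<in>sets B" "S\<subseteq>(\<Union>e\<in>E. D e)" "!!e. e\<in>E ==> D e\<in>sets B" "disjoint_family_on D E"
 shows "emeasure M S = (\<integral>\<^sup>+e. emeasure M (S Int D e) \<partial>count_space E)"
proof -
 have "emeasure M S = emeasure M (\<Union>e\<in>E. S Int D e)" using assms(3) by (intro arg_cong[where f = "emeasure M"]) auto
 also have "disjoint_family_on (%e. S Int D e) E" using assms(5) unfolding disjoint_family_on_def by blast
 then have "emeasure M (\<Union>e\<in>E. S Int D e) = (\<integral>\<^sup>+e. emeasure M (S Int D e) \<partial>count_space E)"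
  by (intro emeasure_UN_countable) (use assms countable_E in auto)
 finally show ?thesis .
qed

lemma cyl_Cons_disjoint: "disjoint_family_on (%e. cyl (e # w)) E"
proof -
 have "y 0 = e" if "y\<in>cyl (e # w)" for y e using that by (auto simp: cyl_def)
 then show ?thesis unfolding disjoint_family_on_def by blast
qed

lemma cyl_snoc_disjoint: "disjoint_family_on (%e. cyl (w @ [e])) E"
proof -
 have "y (length w) = e" if "y\<in>cyl (w @ [e])" for y e
  using that by (auto simp: cyl_def dest: spec[of _ "length w"])
 then show ?thesis unfolding disjoint_family_on_def by blast
qed

lemma cyl_snoc_Un: "cyl w = (\<Union>e\<in>E. cyl (w @ [e]))"
proof (intro equalityI subsetI)
 fix y assume y: "y\<in>cyl w"
 then have "y\<in>cyl (w @ [y (length w)])" by (auto simp: cyl_def nth_append less_Suc_eq)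
 moreover have "y (length w)\<in>E" using y X_E by (auto simp: cyl_def)
 ultimately show "y\<in>(\<Union>e\<in>E. cyl (w @ [e]))" by blast
next
 fix y assume "y\<in>(\<Union>e\<in>E. cyl (w @ [e]))"
 then obtain e where e: "y\<in>X" "ALL i<Suc (length w). y i = (w @ [e]) ! i" by (auto simp: cyl_def)
 have "y i = w ! i" if "i < length w" for i using e(2)[rule_format, of i] that by (simp add: nth_append)
 then show "y\<in>cyl w" using e(1) by (simp add: cyl_def)
qed

lemma emeasure_shift_cyl:
 assumes "sets M = sets B"
 shows "emeasure M (shift -` cyl w Int X) = (\<integral>\<^sup>+e. emeasure M (cyl (e # w)) \<partial>count_space E)"
 unfolding shift_vimage_cyl
 by (rule emeasure_UN_countable) (use assms countable_E cyl_Cons_disjoint in auto)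

lemma emeasure_cyl_snoc:
 assumes "sets M = sets B"
 shows "emeasure M (cyl w) = (\<integral>\<^sup>+e. emeasure M (cyl (w @ [e])) \<partial>count_space E)"
 by (subst cyl_snoc_Un, rule emeasure_UN_countable) (use assms countable_E cyl_snoc_disjoint in auto)

text \<open>The sum is the probability that an edge, drawn after drawing its source from \<pi>, ends
  at b.\<close>

lemma edge_flow:
 assumes \<pi>: "set_pmf \<pi>\<subseteq>V"
 shows "(\<integral>\<^sup>+e. ennreal (if t e = b then pmf \<pi> (s e) * pe e else 0) \<partial>count_space E) = ennreal (pmf (bind_pmf \<pi> K) b)"
proof -
 let ?q = "bind_pmf \<pi> p"
 have "bind_pmf \<pi> K = map_pmf t ?q" unfolding K_def map_bind_pmf ..
 then have "ennreal (pmf (bind_pmf \<pi> K) b) = emeasure (measure_pmf ?q) (t -` {b})" by (simp add: ennreal_pmf_map)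
 also have "... = emeasure (measure_pmf ?q) (t -` {b} Int set_pmf ?q)" by (rule emeasure_Int_set_pmf[symmetric])
 also have "t -` {b} Int set_pmf ?q = (t -` {b} Int E) Int set_pmf ?q" using \<pi> set_p by auto
 also have "emeasure (measure_pmf ?q) \<dots> = emeasure (measure_pmf ?q) (t -` {b} Int E)" by (simp only: emeasure_Int_set_pmf)
 also have "... = (\<integral>\<^sup>+e. pmf ?q e \<partial>count_space (t -` {b} Int E))" by (simp add: nn_integral_pmf)
 also have "... = (\<integral>\<^sup>+e. ennreal (pmf ?q e) * indicator (t -` {b} Int E) e \<partial>count_space UNIV)" by (simp add: nn_integral_count_space_indicator)
 also have "... = (\<integral>\<^sup>+e. ennreal (if t e = b then pmf \<pi> (s e) * pe e else 0) * indicator E e \<partial>count_space UNIV)"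
  using pmf_bind_p[OF \<pi>] by (intro nn_integral_cong) (auto simp: indicator_def)
 also have "... = (\<integral>\<^sup>+e. ennreal (if t e = b then pmf \<pi> (s e) * pe e else 0) \<partial>count_space E)"
  by (simp add: nn_integral_count_space_indicator)
 finally show ?thesis by simp
qed

text \<open>Summing over all edges put in front of w collects the mass flowing into the first vertex
  of w, which stationarity identifies with its mass under \<pi>.\<close>

lemma markov_invariant:
 assumes \<pi>: "set_pmf \<pi>\<subseteq>V" and st: "bind_pmf \<pi> K = \<pi>"
 shows "markov \<pi>\<in>invariant_probabilities B shift"
proof -
 interpret prob_space "markov \<pi>" by (rule prob_markov)
 have sm: "shift\<in>markov \<pi> \<rightarrow>\<^sub>M B" using shift_measurable by (simp add: measurable_cong_sets[of "markov \<pi>" B B B])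
 have "emeasure (distr (markov \<pi>) B shift) (cyl w) = emeasure (markov \<pi>) (cyl w)" for w
 proof -
  have "emeasure (distr (markov \<pi>) B shift) (cyl w) = emeasure (markov \<pi>) (shift -` cyl w Int X)"
   using emeasure_distr[OF sm cyl_B] by simp
  also have "... = (\<integral>\<^sup>+e. emeasure (markov \<pi>) (cyl (e # w)) \<partial>count_space E)" by (rule emeasure_shift_cyl) simp
  also have "... = emeasure (markov \<pi>) (cyl w)"
  proof (cases "w = []")
   case True
   then show ?thesis using emeasure_cyl_snoc[of "markov \<pi>" "[]"] by simp
  next
   case ne: False
   show ?thesis
   proof (cases "adm w")
    case False
    then have "cyl w = {}" "!!e. cyl (e # w) = {}" using cyl_adm adm_Cons by blast+
    then show ?thesis by simp
   next
    case True
    have "emeasure (markov \<pi>) (cyl (e # w)) = ennreal (if t e = s (hd w) then pmf \<pi> (s e) * pe e else 0) * ennreal (wprob w)" if e: "e\<in>E" for e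
    proof (cases "t e = s (hd w)")
     case t: True
     then have "adm (e # w)" using True e by (simp add: adm_Cons)
     then show ?thesis using markov_cyl[OF \<pi>, of "e # w"] t
      by (simp add: wprob_Cons ennreal_mult'[symmetric] wprob_pos pe_def mult.assoc)
    next
     case t: False
     then have "cyl (e # w) = {}" using cyl_adm[of _ "e # w"] ne by (auto simp: adm_Cons)
     then show ?thesis using t by simp
    qed
    then have "(\<integral>\<^sup>+e. emeasure (markov \<pi>) (cyl (e # w)) \<partial>count_space E)
      = (\<integral>\<^sup>+e. ennreal (if t e = s (hd w) then pmf \<pi> (s e) * pe e else 0) * ennreal (wprob w) \<partial>count_space E)"
     by (intro nn_integral_cong) auto
    also have "... = ennreal (pmf \<pi> (s (hd w))) * ennreal (wprob w)"
    proof -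
     have "s (hd w)\<in>V" using True ne s_V by (metis adm_def hd_in_set subsetD)
     then show ?thesis using edge_flow[OF \<pi>] st by (simp add: nn_integral_multc)
    qed
    also have "... = emeasure (markov \<pi>) (cyl w)"
     using markov_cyl[OF \<pi> True ne] by (simp add: ennreal_mult')
    finally show ?thesis .
   qed
  qed
  finally show ?thesis .
 qed
 then have "distr (markov \<pi>) B shift = markov \<pi>"
  by (intro measure_eq_cyl prob_space_distr sm) auto
 then show ?thesis unfolding invariant_probabilities_def
  using prob_space_axioms shift_measurable by auto
qed

end

subsection \<open>Entropy of finite partitions\<close>

text \<open>Apply ln x <= x - 1 to the quotient T / N, whose mean is at most the total of T. As N
  only has to dominate the law of Z, it may be the probability of a coarser variable.\<close>

lemma gibbs_inequality:
 fixes T N :: "'z => real"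
 assumes M: "prob_space M" and K: "countable K" and Z: "Z\<in>M \<rightarrow>\<^sub>M count_space K"
  and T: "!!z. z\<in>K ==> T z>=0" "(\<integral>\<^sup>+z. ennreal (T z) \<partial>count_space K)<=1"
  and N: "!!z. z\<in>K ==> measure M (Z -` {z} Int space M)<=N z"
  and pos: "AE x in M. T (Z x) > 0"
  and int: "integrable M (%x. ln (T (Z x)))" "integrable M (%x. ln (N (Z x)))"
 shows "(\<integral>x. ln (T (Z x)) \<partial>M)<=(\<integral>x. ln (N (Z x)) \<partial>M)"
proof -
 interpret prob_space M by fact
 have ZK: "Z x\<in>K" if "x\<in>space M" for x using measurable_space[OF Z that] by simp
 have Zs: "Z -` {z} Int space M\<in>sets M" if "z\<in>K" for z using measurable_sets[OF Z, of "{z}"] that by simp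
 have N0: "N z>=0" if "z\<in>K" for z using N[OF that] measure_nonneg order_trans by blast
 have meas: "(%x. h (Z x) :: real)\<in>borel_measurable M" for h
  by (rule measurable_compose[OF Z]) simp
 have "AE x in M. ALL z:K. N z = 0 --> Z x~=z"
 proof (subst AE_ball_countable[OF K], intro ballI)
  fix z assume z: "z\<in>K"
  show "AE x in M. N z = 0 --> Z x~=z"
  proof (cases "N z = 0")
   case True
   then have "measure M (Z -` {z} Int space M) = 0" using N[OF z] measure_nonneg[of M] by (metis order_antisym)
   then have "Z -` {z} Int space M\<in>null_sets M" using Zs[OF z] by (auto simp: emeasure_eq_measure)
   then have "AE x in M. x\<notin>Z -` {z} Int space M" by (rule AE_not_in)
   then show ?thesis by (rule AE_mp) (rule AE_I2, auto)
  qed simp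
 qed
 then have Npos: "AE x in M. N (Z x) > 0"
  by (rule AE_mp) (rule AE_I2, use ZK N0 in "force simp: less_le")
 define f where "f x = T (Z x) / N (Z x)" for x
 have f0: "f x>=0" if "x\<in>space M" for x unfolding f_def using T(1) N0 ZK[OF that] by (intro divide_nonneg_nonneg) auto
 have "(\<integral>\<^sup>+x. ennreal (f x) \<partial>M) = (\<integral>\<^sup>+x. (\<integral>\<^sup>+z. ennreal (T z / N z) * indicator (Z -` {z} Int space M) x \<partial>count_space K) \<partial>M)"
 proof (rule nn_integral_cong)
  fix x assume x: "x\<in>space M"
  have "(\<integral>\<^sup>+z. ennreal (T z / N z) * indicator (Z -` {z} Int space M) x \<partial>count_space K)
   = (\<integral>\<^sup>+z. ennreal (f x) * indicator {Z x} z \<partial>count_space K)"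
   using x by (intro nn_integral_cong) (auto simp: indicator_def f_def)
  also have "... = ennreal (f x)" using ZK[OF x] by (simp add: nn_integral_cmult_indicator)
  finally show "ennreal (f x) = (\<integral>\<^sup>+z. ennreal (T z / N z) * indicator (Z -` {z} Int space M) x \<partial>count_space K)" by simp
 qed
 also have "... = (\<integral>\<^sup>+z. (\<integral>\<^sup>+x. ennreal (T z / N z) * indicator (Z -` {z} Int space M) x \<partial>M) \<partial>count_space K)"
  by (rule nn_integral_count_space_nn_integral[OF K]) (use Zs in measurable)
 also have "...<=(\<integral>\<^sup>+z. ennreal (T z) \<partial>count_space K)"
 proof (rule nn_integral_mono)
  fix z assume "z\<in>space (count_space K)"
  then have z: "z\<in>K" by simp
  have "(\<integral>\<^sup>+x. ennreal (T z / N z) * indicator (Z -` {z} Int space M) x \<partial>M) = ennreal (T z / N z) * emeasure M (Z -` {z} Int space M)"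
   using Zs[OF z] by (simp add: nn_integral_cmult_indicator)
  also have "... = ennreal (T z / N z * measure M (Z -` {z} Int space M))"
   unfolding emeasure_eq_measure using T(1)[OF z] N0[OF z] by (intro ennreal_mult'[symmetric]) simp
  also have "...<=ennreal (T z)"
  proof (rule ennreal_leI)
   have "T z / N z * measure M (Z -` {z} Int space M)<=T z / N z * N z"
    using T(1)[OF z] N0[OF z] N[OF z] by (intro mult_left_mono) auto
   also have "...<=T z" using T(1)[OF z] by simp
   finally show "T z / N z * measure M (Z -` {z} Int space M)<=T z" .
  qed
  finally show "(\<integral>\<^sup>+x. ennreal (T z / N z) * indicator (Z -` {z} Int space M) x \<partial>M)<=ennreal (T z)" .
 qed
 also have "...<=1" by (rule T(2))
 finally have le1: "(\<integral>\<^sup>+x. ennreal (f x) \<partial>M)<=1" .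
 have fm: "f\<in>borel_measurable M" unfolding f_def[abs_def] using meas[of "%z. T z / N z"] .
 have fi: "integrable M f"
  by (rule integrableI_nonneg[OF fm]) (use f0 le1 in "auto intro!: AE_I2 simp: le_less_trans")
 have "ennreal (\<integral>x. f x \<partial>M)<=1" using le1 nn_integral_eq_integral[OF fi] f0 by (auto intro!: AE_I2)
 then have f1: "(\<integral>x. f x \<partial>M)<=1" by simp
 have "(\<integral>x. ln (T (Z x)) - ln (N (Z x)) \<partial>M)<=(\<integral>x. f x - 1 \<partial>M)"
 proof (rule integral_mono_AE)
  show "AE x in M. ln (T (Z x)) - ln (N (Z x))<=f x - 1"
   using pos Npos
  proof eventually_elim
   case (elim x)
   then have "ln (T (Z x)) - ln (N (Z x)) = ln (f x)" by (simp add: f_def ln_div)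
   also have "...<=f x - 1" using elim by (intro ln_le_minus_one) (simp add: f_def)
   finally show ?case .
  qed
 qed (use int fi in auto)
 also have "... = (\<integral>x. f x \<partial>M) - 1" using fi by (simp add: prob_space)
 also have "...<=0" using f1 by simp
 finally show ?thesis using int by simp
qed

text \<open>Fekete's lemma; the limit is the infimum.\<close>

lemma subadditive_converges:
 fixes a :: "nat => real"
 assumes sub: "!!m n. a (m + n)<=a m + a n" and nonneg: "!!n. a n>=0"
 shows "convergent (%n. a n / real n)"
proof -
 define l where "l = Inf ((%n. a n / real n) ` {1..})"
 have bdd: "bdd_below ((%n. a n / real n) ` {1..})" using nonneg by (intro bdd_belowI[of _ 0]) auto
 have low: "l<=a n / real n" if "n>=1" for n unfolding l_def by (rule cInf_lower[OF _ bdd]) (use that in auto)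
 have mult: "a (q * m)<=real q * a m" if "q>=1" for q m
  using that
 proof (induction q rule: nat_induct_at_least)
  case (Suc q)
  then show ?case using sub[of m "q * m"] by (simp add: algebra_simps)
 qed simp
 have "(%n. a n / real n) \<longlonglongrightarrow> l"
  unfolding LIMSEQ_iff
 proof (intro allI impI)
  fix e :: real assume e: "e > 0"
  have "EX x:(%n. a n / real n) ` {1..}. x < l + e/2"
   unfolding l_def[symmetric] using cInf_lessD[of "(%n. a n / real n) ` {1..}" "l + e/2"] e by (auto simp: l_def)
  then obtain m where m: "m>=1" "a m / real m < l + e/2" by auto
  define C where "C = Max (a ` {..m})"
  have C: "a r<=C" if "r<=m" for r unfolding C_def by (rule Max_ge) (use that in auto)
  have C0: "C>=0" using C[of 0] nonneg[of 0] by simp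
  obtain N0 where N0: "real N0 > 2 * C / e" using reals_Archimedean2 by blast
  have "norm (a n / real n - l) < e" if n: "n>=max (max m 1) N0" for n
  proof -
   have n1: "n>=1" "n>=m" "n>=N0" using n by auto
   have "n div m>=1" using n1 m by (simp add: div_greater_zero_iff Suc_leI)
   have "a n = a ((n div m) * m + n mod m)" by simp
   also have "...<=a ((n div m) * m) + a (n mod m)" by (rule sub)
   also have "...<=real (n div m) * a m + C" using mult[OF \<open>n div m >= 1\<close>] C[of "n mod m"] m
    by (intro add_mono) (auto intro: less_imp_le mod_less_divisor)
   finally have 1: "a n<=real (n div m) * a m + C" .
   have "real (n div m) * a m = real (n div m) * real m * (a m / real m)" using m by simp
   also have "...<=real n * (a m / real m)"
   proof (rule mult_right_mono)
    have "n div m * m<=n" by simp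
    then show "real (n div m) * real m<=real n" by (metis of_nat_le_iff of_nat_mult)
   qed (use nonneg in auto)
   finally have "a n / real n<=a m / real m + C / real n" using 1 n1 by (simp add: field_simps)
   moreover have "C / real n < e / 2"
   proof -
    have "2 * C / e < real n" using N0 n1 by (meson less_le_trans of_nat_mono)
    then show ?thesis using e n1 by (simp add: field_simps)
   qed
   ultimately have "a n / real n < l + e" using m(2) by linarith
   then show ?thesis using low[OF n1(1)] by simp
  qed
  then show "EX N. ALL n>=N. norm (a n / real n - l) < e" by blast
 qed
 then show ?thesis unfolding convergent_def by blast
qed

section \<open>Itineraries and the entropy rate of an invariant measure\<close>

context edge_shift
begin

text \<open>Cells of the refined partition are indexed by functions, so that sums run over a finite
  product. The empty intersections, which \<open>refined_partition\<close> removes, contribute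
  0.\<close>

definition cells_set :: "nat => (nat => (nat => 'e) set) => (nat => 'e) set" where
 "cells_set n C = {y\<in>X. ALL i<n. (shift ^^ i) y\<in>C i}"

definition cell_of :: "(nat => 'e) set set => (nat => 'e) => (nat => 'e) set" where
 "cell_of P y = (THE C. C\<in>P \<and> y\<in>C)"

definition itin :: "(nat => 'e) set set => nat => (nat => 'e) => nat => (nat => 'e) set" where
 "itin P n y = (\<lambda>i\<in>{..<n}. cell_of P ((shift ^^ i) y))"

definition entr :: "(nat => 'e) measure => (nat => 'e) set set => nat => real" where
 "entr nu P n = - (\<Sum>C\<in>PiE {..<n} (%_. P). measure nu (cells_set n C) * ln (measure nu (cells_set n C)))"

lemma shift_pow_X: "y\<in>X ==> (shift ^^ n) y\<in>X" by (induction n) (simp_all add: shift_X)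

lemma shift_pow_add: "(shift ^^ m) ((shift ^^ n) y) = (shift ^^ (m + n)) y" by (simp add: funpow_add)

end

locale inv_measure = edge_shift +
 fixes nu :: "(nat => 'a) measure"
 assumes inv: "nu\<in>invariant_probabilities B shift"
begin

lemma prob_nu: "prob_space nu" and space_nu [simp]: "space nu = X" and sets_nu [simp]: "sets nu = sets B"
 and distr_nu: "distr nu B shift = nu"
 using inv by (auto simp: invariant_probabilities_def)

sublocale prob_space nu by (rule prob_nu)

lemma meas_nu: "f\<in>B \<rightarrow>\<^sub>M N ==> f\<in>nu \<rightarrow>\<^sub>M N"
 using measurable_cong_sets[of nu B N N] by simp

lemma distr_pow: "distr nu B (shift ^^ n) = nu"
proof (induction n)
 case 0
 have "distr nu B (%x. x) = distr nu nu (%x. x)" by (rule distr_cong) auto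
 then show ?case by (simp add: id_def distr_id)
next
 case (Suc n)
 have "distr nu B (shift ^^ Suc n) = distr (distr nu B (shift ^^ n)) B shift"
  using distr_distr[OF shift_measurable meas_nu[OF shift_pow_measurable[of n]]] by simp
 then show ?case using Suc distr_nu by metis
qed

lemma integral_pow: fixes f :: "(nat => 'a) => real" assumes f: "f\<in>borel_measurable B"
 shows "(\<integral>y. f ((shift ^^ n) y) \<partial>nu) = (\<integral>y. f y \<partial>nu)"
 using integral_distr[OF meas_nu[OF shift_pow_measurable[of n]] f] distr_pow by simp

lemma integrable_pow: fixes f :: "(nat => 'a) => real" assumes f: "integrable nu f"
 shows "integrable nu (%y. f ((shift ^^ n) y))"
proof -
 have m: "shift ^^ n\<in>nu \<rightarrow>\<^sub>M B" by (rule meas_nu[OF shift_pow_measurable])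
 have "f\<in>borel_measurable B" using borel_measurable_integrable[OF f] measurable_cong_sets[of nu B borel borel, OF sets_nu refl] by blast
 then show ?thesis using integrable_distr_eq[OF m, of f] f distr_pow by simp
qed

lemma measure_pow: assumes "S\<in>sets B" shows "measure nu ((shift ^^ n) -` S Int X) = measure nu S"
 using measure_distr[OF meas_nu[OF shift_pow_measurable[of n]] assms] distr_pow by simp

end

locale inv_partition = inv_measure +
 fixes P :: "(nat => 'a) set set"
 assumes finP: "finite P" and measP: "P\<subseteq>sets nu" and partP: "partition_on X P"
begin

lemma cell_of: assumes "y\<in>X" shows "cell_of P y\<in>P" "y\<in>cell_of P y" "C\<in>P ==> y\<in>C ==> cell_of P y = C"
proof -
 obtain C where C: "C\<in>P" "y\<in>C" using partP assms by (auto simp: partition_on_def)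
 have u: "D = C" if "D\<in>P" "y\<in>D" for D using partP C that by (auto simp: partition_on_def disjoint_def)
 have e: "cell_of P y = C" unfolding cell_of_def by (rule the_equality) (use C u in blast)+
 show "cell_of P y\<in>P" "y\<in>cell_of P y" "C'\<in>P ==> y\<in>C' ==> cell_of P y = C'" for C'
  unfolding e using C u by blast+
qed

lemma P_ne: "P~={}"
proof -
 obtain v where "v\<in>V" using neV by blast
 have "traj (%_. undefined)\<in>X" by (rule traj_X)
 then show ?thesis using cell_of(1) by blast
qed

lemma P_sets: "C\<in>P ==> C\<in>sets B" using measP by auto

lemma itin_PiE: "y\<in>X ==> itin P n y\<in>PiE {..<n} (%_. P)"
 using cell_of(1) shift_pow_X by (auto simp: itin_def)

lemma itin_eq: assumes "y\<in>X" "C\<in>PiE {..<n} (%_. P)" shows "itin P n y = C \<longleftrightarrow> y\<in>cells_set n C"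
proof
 assume "itin P n y = C"
 then have "cell_of P ((shift ^^ i) y) = C i" if "i < n" for i using that by (auto simp: itin_def)
 then show "y\<in>cells_set n C" using cell_of(2)[OF shift_pow_X[OF assms(1)]] assms(1) by (fastforce simp: cells_set_def)
next
 assume y: "y\<in>cells_set n C"
 show "itin P n y = C"
 proof (rule PiE_ext[OF itin_PiE[OF assms(1)] assms(2)])
  fix i assume i: "i\<in>{..<n}"
  then have "C i\<in>P" "(shift ^^ i) y\<in>C i" using assms(2) y by (auto simp: cells_set_def PiE_iff)
  then show "itin P n y i = C i" using i cell_of(3)[OF shift_pow_X[OF assms(1)]] by (simp add: itin_def)
 qed
qed

lemma cells_set_sets: assumes "C\<in>PiE {..<n} (%_. P)" shows "cells_set n C\<in>sets B"
proof -
 have "{y\<in>space B. ALL i:{..<n}. (shift ^^ i) y\<in>C i}\<in>sets B"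
 proof (rule sets.sets_Collect_finite_All)
  fix i assume "i\<in>{..<n}"
  then have "C i\<in>sets B" using assms P_sets by (auto simp: PiE_iff)
  from measurable_sets[OF shift_pow_measurable[of i] this]
  show "{y\<in>space B. (shift ^^ i) y\<in>C i}\<in>sets B" by (simp add: vimage_def Int_def conj_commute)
 qed simp
 then show ?thesis by (simp only: cells_set_def space_B Ball_def lessThan_iff)
qed

lemma fin_PiE: "finite (PiE {..<n::nat} (%_. P))" using finP by (intro finite_PiE) auto

lemma itin_measurable: "itin P n\<in>B \<rightarrow>\<^sub>M count_space (PiE {..<n} (%_. P))"
proof (subst measurable_count_space_eq_countable[OF countable_finite[OF fin_PiE]], intro conjI ballI)
 show "itin P n\<in>space B \<rightarrow> PiE {..<n} (%_. P)" using itin_PiE by auto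
 fix C assume C: "C\<in>PiE {..<n} (%_. P)"
 have "itin P n -` {C} Int space B = cells_set n C" using itin_eq[OF _ C] by (auto simp: cells_set_def)
 then show "itin P n -` {C} Int space B\<in>sets B" using cells_set_sets[OF C] by simp
qed

lemma entropy_eq: "partition_entropy nu (refined_partition nu shift P n) = entr nu P n"
proof -
 let ?J = "PiE {..<n} (%_. P)"
 let ?f = "%S. measure nu S * ln (measure nu S)"
 let ?J' = "{C\<in>?J. cells_set n C~={}}"
 have e: "space nu Int (\<Inter>i<n. (shift ^^ i) -` C i) = cells_set n (restrict C {..<n})" for C
  by (auto simp: cells_set_def)
 have "refined_partition nu shift P n = cells_set n ` ?J'"
 proof (intro equalityI subsetI)
  fix S assume "S\<in>refined_partition nu shift P n"
  then obtain C where C: "S = cells_set n (restrict C {..<n})" "ALL i<n. C i\<in>P" "S~={}"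
   unfolding refined_partition_def e by auto
  then show "S\<in>cells_set n ` ?J'" by (intro image_eqI[of _ _ "restrict C {..<n}"]) auto
 next
  fix S assume "S\<in>cells_set n ` ?J'"
  then obtain C where C: "S = cells_set n C" "C\<in>?J" "S~={}" by auto
  then have "restrict C {..<n} = C" by (simp add: PiE_restrict)
  then show "S\<in>refined_partition nu shift P n" unfolding refined_partition_def e using C
   by (auto simp: PiE_iff intro!: exI[of _ C])
 qed
 moreover have "inj_on (cells_set n) ?J'"
 proof (rule inj_onI)
  fix C D assume C: "C\<in>?J'" and D: "D\<in>?J'" and "cells_set n C = cells_set n D"
  then obtain y where "y\<in>cells_set n C" "y\<in>cells_set n D" by auto
  then show "C = D" using itin_eq[of y C n] itin_eq[of y D n] C D by (auto simp: cells_set_def)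
 qed
 ultimately have "(\<Sum>S\<in>refined_partition nu shift P n. ?f S) = (\<Sum>C\<in>?J'. ?f (cells_set n C))"
  by (simp add: sum.reindex)
 also have "... = (\<Sum>C\<in>?J. ?f (cells_set n C))"
  by (rule sum.mono_neutral_left[OF fin_PiE]) auto
 finally show ?thesis by (simp add: partition_entropy_def entr_def)
qed

lemma finite_itin_integral: fixes f :: "(nat => (nat => 'a) set) => real"
 shows "integrable nu (%y. f (itin P n y))"
  "(\<integral>y. f (itin P n y) \<partial>nu) = (\<Sum>C\<in>PiE {..<n} (%_. P). measure nu (cells_set n C) * f C)"
proof -
 let ?J = "PiE {..<n} (%_. P)"
 have e: "f (itin P n y) = (\<Sum>C\<in>?J. f C * indicator (cells_set n C) y)" if "y\<in>X" for y
 proof -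
  have "(\<Sum>C\<in>?J. f C * indicator (cells_set n C) y) = (\<Sum>C\<in>?J. if C = itin P n y then f C else 0)"
   using itin_eq[OF that] by (intro sum.cong) (auto simp: indicator_def)
  then show ?thesis using fin_PiE itin_PiE[OF that] by simp
 qed
 have i: "integrable nu (%y. \<Sum>C\<in>?J. f C * indicator (cells_set n C) y)"
  by (intro Bochner_Integration.integrable_sum integrable_mult_right integrable_real_indicator) (auto simp: cells_set_sets emeasure_eq_measure)
 show "integrable nu (%y. f (itin P n y))" using i by (subst Bochner_Integration.integrable_cong[OF refl e]) simp_all
 have "(\<integral>y. f (itin P n y) \<partial>nu) = (\<integral>y. (\<Sum>C\<in>?J. f C * indicator (cells_set n C) y) \<partial>nu)"
  by (rule Bochner_Integration.integral_cong[OF refl]) (use e in auto)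
 also have "... = (\<Sum>C\<in>?J. \<integral>y. f C * indicator (cells_set n C) y \<partial>nu)"
  by (rule Bochner_Integration.integral_sum) (auto simp: cells_set_sets emeasure_eq_measure intro!: integrable_mult_right integrable_real_indicator)
 also have "... = (\<Sum>C\<in>?J. measure nu (cells_set n C) * f C)"
  by (intro sum.cong refl) (auto simp: cells_set_def mult.commute intro!: arg_cong[where f = "measure nu"])
 finally show "(\<integral>y. f (itin P n y) \<partial>nu) = (\<Sum>C\<in>?J. measure nu (cells_set n C) * f C)" .
qed

lemma entr_integral: "entr nu P n = - (\<integral>y. ln (measure nu (cells_set n (itin P n y))) \<partial>nu)"
 unfolding finite_itin_integral(2)[of "%C. ln (measure nu (cells_set n C))"] entr_def ..

lemma entr_nonneg: "entr nu P n>=0"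
proof -
 have "measure nu S * ln (measure nu S)<=0" for S
  by (cases "measure nu S = 0") (auto intro!: mult_nonneg_nonpos simp: zero_less_measure_iff)
 then show ?thesis unfolding entr_def neg_0_le_iff_le by (intro sum_nonpos)
qed

lemma AE_cells_pos: "AE y in nu. measure nu (cells_set n (itin P n y)) > 0"
proof -
 have "AE y in nu. ALL C:PiE {..<n} (%_. P). measure nu (cells_set n C) = 0 --> y\<notin>cells_set n C"
 proof (subst AE_ball_countable[OF countable_finite[OF fin_PiE]], intro ballI)
  fix C assume C: "C\<in>PiE {..<n} (%_. P)"
  show "AE y in nu. measure nu (cells_set n C) = 0 --> y\<notin>cells_set n C"
  proof (cases "measure nu (cells_set n C) = 0")
   case True
   then have "cells_set n C\<in>null_sets nu" using cells_set_sets[OF C] by (auto simp: emeasure_eq_measure)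
   then show ?thesis using AE_not_in by force
  qed simp
 qed
 then show ?thesis
 proof (rule AE_mp, intro AE_I2 impI)
  fix y assume y: "y\<in>space nu" and a: "ALL C:PiE {..<n} (%_. P). measure nu (cells_set n C) = 0 --> y\<notin>cells_set n C"
  have "y\<in>cells_set n (itin P n y)" using itin_eq[OF _ itin_PiE, of y y n] y by simp
  then have "measure nu (cells_set n (itin P n y))~=0" using a itin_PiE y by auto
  then show "measure nu (cells_set n (itin P n y)) > 0" by (simp add: zero_less_measure_iff)
 qed
qed

text \<open>The itinerary of length n + m is a function of its first n cells and of the itinerary
  started at time n. The entropy of a pair is at most the sum of the entropies, and by invariance
  the second component has the law of an itinerary started at time 0.\<close>

lemma entr_subadd: "entr nu P (n + m)<=entr nu P n + entr nu P m"
proof -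
 \<comment> \<open>Base exp 1 turns the logarithm of the library entropy into the natural one of
   \<open>partition_entropy\<close>.\<close>
 interpret information_space nu "exp 1" by unfold_locales simp
 let ?J = "%n :: nat. PiE {..<n} (%_. P)"
 let ?Y = "%y. itin P m ((shift ^^ n) y)"
 have sf: "simple_function nu Z" and H: "entropy_Pow Z
   = - (\<Sum>C\<in>?J k. measure nu (Z -` {C} Int space nu) * ln (measure nu (Z -` {C} Int space nu)))"
  if Z: "Z\<in>nu \<rightarrow>\<^sub>M count_space (?J k)" for Z k
 proof -
  have sub: "Z ` space nu\<subseteq>?J k" using measurable_space[OF Z] by auto
  show sf: "simple_function nu Z" unfolding simple_function_def
  proof (intro conjI ballI)
   show "finite (Z ` space nu)" by (rule finite_subset[OF sub fin_PiE])
   show "Z -` {C} Int space nu\<in>sets nu" if "C\<in>Z ` space nu" for C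
    by (rule measurable_sets[OF Z]) (use sub that in auto)
  qed
  have "(\<Sum>C\<in>Z ` space nu. measure nu (Z -` {C} Int space nu) * ln (measure nu (Z -` {C} Int space nu)))
    = (\<Sum>C\<in>?J k. measure nu (Z -` {C} Int space nu) * ln (measure nu (Z -` {C} Int space nu)))"
  proof (rule sum.mono_neutral_left[OF fin_PiE sub], intro ballI)
   fix C assume "C\<in>?J k - Z ` space nu"
   then have "Z -` {C} Int space nu = {}" by auto
   then show "measure nu (Z -` {C} Int space nu) * ln (measure nu (Z -` {C} Int space nu)) = 0" by simp
  qed
  then show "entropy_Pow Z
    = - (\<Sum>C\<in>?J k. measure nu (Z -` {C} Int space nu) * ln (measure nu (Z -` {C} Int space nu)))"
   unfolding entropy_simple_distributed[OF simple_distributedI[OF sf measure_nonneg refl]] log_ln[symmetric] by simp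
 qed
 have im: "itin P k\<in>nu \<rightarrow>\<^sub>M count_space (?J k)" for k by (rule meas_nu[OF itin_measurable])
 have Ym: "?Y\<in>nu \<rightarrow>\<^sub>M count_space (?J m)"
  by (rule measurable_compose[OF meas_nu[OF shift_pow_measurable] itin_measurable])
 have vim: "itin P k -` {C} Int X = cells_set k C" if "C\<in>?J k" for k C
  using itin_eq[OF _ that] by (auto simp: cells_set_def)
 have H1: "entropy_Pow (itin P k) = entr nu P k" for k
  unfolding H[OF im] entr_def by (intro arg_cong[where f = uminus] sum.cong refl) (simp add: vim)
 have "measure nu (?Y -` {C} Int X) = measure nu (cells_set m C)" if C: "C\<in>?J m" for C
 proof -
  have "?Y -` {C} Int X = (shift ^^ n) -` cells_set m C Int X"
   unfolding vim[OF C, symmetric] using shift_pow_X by auto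
  then show ?thesis using measure_pow[OF cells_set_sets[OF C]] by simp
 qed
 then have H2: "entropy_Pow ?Y = entr nu P m"
  unfolding H[OF Ym] entr_def by (intro arg_cong[where f = uminus] sum.cong refl) simp
 define f where "f = (%(C, D). \<lambda>i\<in>{..<n + m}. if i < n then C i else D (i - n) :: (nat => 'a) set)"
 have glue: "f \<circ> (%y. (itin P n y, ?Y y)) = itin P (n + m)"
  by (intro ext) (auto simp: f_def itin_def shift_pow_add)
 have "entr nu P (n + m)<=entropy_Pow (%y. (itin P n y, ?Y y))"
  using entropy_data_processing[OF simple_function_Pair[OF sf[OF im[of n]] sf[OF Ym]], of f] unfolding glue H1 .
 also have "...<=entr nu P n + entr nu P m"
  unfolding entropy_chain_rule[OF sf[OF im[of n]] sf[OF Ym]] H1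
  using conditional_entropy_less_eq_entropy[OF sf[OF Ym] sf[OF im[of n]]] unfolding H2 by simp
 finally show ?thesis .
qed

lemma entropy_rate_convergent: "convergent (%n. entr nu P n / real n)"
 by (rule subadditive_converges) (rule entr_subadd, rule entr_nonneg)

end

subsection \<open>Coding by a biased chain\<close>

lemma pmf_bind_map_inj:
 assumes "!!x' y'. h x' y' = h x y ==> x' = x \<and> y' = y"
 shows "pmf (bind_pmf D (%x. map_pmf (h x) (f x))) (h x y) = pmf D x * pmf (f x) y"
proof -
 have "pmf (map_pmf (h x') (f x')) (h x y) = indicator {x} x' * pmf (f x) y" for x'
 proof (cases "x' = x")
  case True
  have "h x -` {h x y} = {y}" using assms by blast
  then show ?thesis using True by (simp add: pmf_map measure_pmf_single)
 next
  case False
  then have "h x' -` {h x y} = {}" using assms by blast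
  then show ?thesis using False by (simp add: pmf_map)
 qed
 then show ?thesis by (simp add: pmf_bind measure_pmf_single)
qed

lemma finite_enumerated_below: assumes "countable W" shows "finite {w\<in>W. to_nat_on W w < N}"
 by (rule finite_imageD[of "to_nat_on W"])
  (use inj_on_to_nat_on[OF assms] in \<open>auto intro: finite_subset[of _ "{..<N}"] inj_on_subset\<close>)

context edge_shift
begin

text \<open>Unlike single cylinders, these sets form an algebra, as the approximation of measurable
  sets requires.\<close>

definition pcyl :: "nat => 'e list set => (nat => 'e) set" where
 "pcyl m U = {y\<in>X. map y [0..<m]\<in>U}"

lemma pcyl_B [measurable]: "pcyl m U\<in>sets B"
proof -
 have "pcyl m U = (%y. map y [0..<m]) -` (U Int {w. set w\<subseteq>E}) Int space B"
  using X_E by (auto simp: pcyl_def)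
 also have "...\<in>sets B" by (rule measurable_sets[OF prefix_measurable]) auto
 finally show ?thesis .
qed

lemma pcyl_lift: assumes "m<=m'" shows "pcyl m U = pcyl m' {w. take m w\<in>U}"
proof -
 have "take m (map y [0..<m']) = map y [0..<m]" for y :: "nat => 'e" using assms by (simp add: take_map)
 then show ?thesis by (simp add: pcyl_def)
qed

lemma cyl_pcyl: "cyl w = pcyl (length w) {w}"
proof -
 have "map y [0..<length w] = w \<longleftrightarrow> (ALL i<length w. y i = w ! i)" for y
  using map_eq_conv[of y "[0..<length w]" "(!) w"] unfolding map_nth by auto
 then show ?thesis unfolding cyl_def pcyl_def by simp
qed

fun walk :: "('e list => 'e pmf) => nat => 'e list pmf" where
 "walk q 0 = return_pmf []"
| "walk q (Suc n) = bind_pmf (walk q n) (%w. map_pmf (%e. w @ [e]) (q w))"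

lemma pmf_walk_snoc: "pmf (walk q (Suc n)) (w @ [e]) = pmf (walk q n) w * pmf (q w) e"
 using pmf_bind_map_inj[of "%w e. w @ [e]" w e] by simp

lemma pmf_walk: "pmf (walk q n) (map y [0..<n]) = (\<Prod>i<n. pmf (q (map y [0..<i])) (y i))"
proof (induction n)
 case (Suc n)
 have "pmf (walk q (Suc n)) (map y [0..<n] @ [y n]) = pmf (walk q n) (map y [0..<n]) * pmf (q (map y [0..<n])) (y n)"
  by (rule pmf_walk_snoc)
 then show ?case using Suc by simp
qed simp

text \<open>The Markov chain, except that after the word \<open>u0\<close> the edge \<open>e0\<close> gets the additional weight
 \<open>ep\<close>. A measure that follows \<open>u0\<close> by \<open>e0\<close> more often than the chain does is coded more
 efficiently by this process, the gain being \<open>gain\<close>.\<close>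

definition biased :: "'e list => 'e => real => 'e list => 'e pmf" where
 "biased u0 e0 ep w = (if w = [] then bind_pmf (pmf_of_set V) p
   else if EX x. w = x @ u0
    then bind_pmf (bernoulli_pmf ep) (%b. if b then return_pmf e0 else p (t (last w)))
   else p (t (last w)))"

definition gain :: "'e list => 'e => real => (nat => 'e) => real" where
 "gain u0 e0 ep y = indicator (cyl (u0 @ [e0])) y * ln (1 - ep + ep / pe e0)
   + (indicator (cyl u0) y - indicator (cyl (u0 @ [e0])) y) * ln (1 - ep)"

lemma cyl_snoc: "y\<in>cyl (w @ [e]) \<longleftrightarrow> y\<in>cyl w \<and> y (length w) = e"
 by (auto simp: cyl_def nth_append less_Suc_eq)

lemma prefix_ends: assumes "y\<in>X"
 shows "(EX x. map y [0..<i] = x @ u) \<longleftrightarrow> length u<=i \<and> (shift ^^ (i - length u)) y\<in>cyl u"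
proof
 assume "EX x. map y [0..<i] = x @ u"
 then obtain x where x: "map y [0..<i] = x @ u" by blast
 then have l: "i = length x + length u" by (metis length_append length_map length_upt diff_zero)
 have "y (length x + j) = u ! j" if "j < length u" for j
 proof -
  have "y (length x + j) = map y [0..<i] ! (length x + j)" using l that by simp
  then show ?thesis using x by (simp add: nth_append)
 qed
 then show "length u<=i \<and> (shift ^^ (i - length u)) y\<in>cyl u"
  using l shift_pow_X[OF assms] by (auto simp: cyl_def shift_pow)
next
 assume a: "length u<=i \<and> (shift ^^ (i - length u)) y\<in>cyl u"
 have u: "y (i - length u + j) = u ! j" if "j < length u" for j using a that unfolding cyl_def shift_pow by blast
 have "map y [0..<i] = map y [0..<i - length u] @ u"
 proof (rule nth_equalityI)
  fix j assume j: "j < length (map y [0..<i])"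
  show "map y [0..<i] ! j = (map y [0..<i - length u] @ u) ! j"
   using j a u[of "j - (i - length u)"] by (cases "j < i - length u") (auto simp: nth_append)
 qed (use a in simp)
 then show "EX x. map y [0..<i] = x @ u" by blast
qed

text \<open>The first edge starts at a uniformly chosen vertex. This costs ln (card V) once,
  independently of the length of the path.\<close>

lemma pmf_biased_0: assumes "e\<in>E" shows "pmf (biased u0 e0 ep []) e = pe e / card V"
 using pmf_bind_p[of "pmf_of_set V" e] assms finV neV s_V[OF assms] by (simp add: biased_def)

text \<open>After u0 the mixture changes the probability of e0 by the factor 1 - ep + ep / pe e0 and
  that of any other edge by 1 - ep; the logarithms of these factors are the two terms of
  \<open>gain\<close>.\<close>

lemma pmf_biased:
 assumes y: "y\<in>X" and i: "i > 0" and u0: "u0~=[]" "adm (u0 @ [e0])" and ep: "0<=ep" "ep < 1"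
 shows "pmf (biased u0 e0 ep (map y [0..<i])) (y i) > 0"
  and "ln (pmf (biased u0 e0 ep (map y [0..<i])) (y i))
   = ln (pe (y i)) + (if length u0<=i then gain u0 e0 ep ((shift ^^ (i - length u0)) y) else 0)"
proof -
 let ?z = "(shift ^^ (i - length u0)) y"
 have ne: "map y [0..<i]~=[]" using i by simp
 obtain j where j: "i = Suc j" using i gr0_implies_Suc by blast
 have "last (map y [0..<i]) = y j" by (simp add: j)
 then have tl: "t (last (map y [0..<i])) = s (y i)" using y j by (simp add: X_def)
 have pos: "pe (y i) > 0" "pe e0 > 0" using pe_pos X_E[OF y] u0 by (auto simp: adm_def)
 have "pmf (biased u0 e0 ep (map y [0..<i])) (y i) > 0 \<and> ln (pmf (biased u0 e0 ep (map y [0..<i])) (y i))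
   = ln (pe (y i)) + (if length u0<=i then gain u0 e0 ep ?z else 0)"
 proof (cases "length u0<=i \<and> ?z\<in>cyl u0")
  case False
  then have "?z\<notin>cyl (u0 @ [e0])" if "length u0<=i" using that cyl_snoc by blast
  then have "(if length u0<=i then gain u0 e0 ep ?z else 0) = 0" using False by (auto simp: gain_def)
  moreover have ex: "\<not> (EX x. map y [0..<i] = x @ u0)" unfolding prefix_ends[OF y] by (rule False)
  then have "biased u0 e0 ep (map y [0..<i]) = p (s (y i))" unfolding biased_def tl if_not_P[OF ne] by (rule if_not_P)
  ultimately show ?thesis using pos by (simp add: pe_def)
 next
  case True
  have "EX x. map y [0..<i] = x @ u0" unfolding prefix_ends[OF y] by (rule True)
  then have "biased u0 e0 ep (map y [0..<i]) = bind_pmf (bernoulli_pmf ep) (%b. if b then return_pmf e0 else p (s (y i)))"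
   unfolding biased_def tl if_not_P[OF ne] by (rule if_P)
  then have val: "pmf (biased u0 e0 ep (map y [0..<i])) (y i) = ep * (if y i = e0 then 1 else 0) + (1 - ep) * pe (y i)"
   using ep by (simp add: pmf_bind pe_def)
  have z: "?z (length u0) = y i" using True by (simp add: shift_pow)
  show ?thesis
  proof (cases "y i = e0")
   case e: True
   then have zc: "?z\<in>cyl (u0 @ [e0])" using True z by (simp add: cyl_snoc)
   have "1 - ep + ep / pe e0 > 0" using ep pos by (intro add_pos_nonneg) auto
   moreover have "ep + (1 - ep) * pe e0 = pe e0 * (1 - ep + ep / pe e0)" using pos by (simp add: field_simps)
   ultimately show ?thesis using val e zc True pos by (simp add: gain_def ln_mult_pos)
  next
   case e: False
   then have "?z\<notin>cyl (u0 @ [e0])" using z by (simp add: cyl_snoc)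
   then show ?thesis using val e True pos ep by (simp add: gain_def ln_mult_pos)
  qed
 qed
 then show "pmf (biased u0 e0 ep (map y [0..<i])) (y i) > 0"
  and "ln (pmf (biased u0 e0 ep (map y [0..<i])) (y i))
   = ln (pe (y i)) + (if length u0<=i then gain u0 e0 ep ?z else 0)" by blast+
qed

lemma ln_pmf_biased_walk:
 assumes y: "y\<in>X" and u0: "u0~=[]" "adm (u0 @ [e0])" and ep: "0<=ep" "ep < 1" and n: "n > 0"
 shows "pmf (walk (biased u0 e0 ep) n) (map y [0..<n]) > 0"
  and "ln (pmf (walk (biased u0 e0 ep) n) (map y [0..<n]))
   = (\<Sum>i<n. ln (pe (y i))) + (\<Sum>j<n - length u0. gain u0 e0 ep ((shift ^^ j) y)) - ln (card V)"
proof -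
 let ?f = "%i. pmf (biased u0 e0 ep (map y [0..<i])) (y i)"
 let ?g = "%i. if length u0<=i then gain u0 e0 ep ((shift ^^ (i - length u0)) y) else 0"
 have cV: "card V > 0" using finV neV by (simp add: card_gt_0_iff)
 have f0: "?f 0 > 0" "ln (?f 0) = ln (pe (y 0)) + ?g 0 - ln (card V)"
  using pmf_biased_0[OF X_E[OF y, of 0]] pe_pos[OF X_E[OF y, of 0]] cV u0 by (simp_all add: ln_div)
 have f: "?f i > 0" "ln (?f i) = ln (pe (y i)) + ?g i - (if i = 0 then ln (card V) else 0)" for i
  using f0 pmf_biased[OF y _ u0 ep, of i] by (cases "i = 0"; simp)+
 show "pmf (walk (biased u0 e0 ep) n) (map y [0..<n]) > 0"
  unfolding pmf_walk by (rule prod_pos) (use f in blast)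
 have "ln (pmf (walk (biased u0 e0 ep) n) (map y [0..<n])) = (\<Sum>i<n. ln (?f i))"
  unfolding pmf_walk by (rule ln_prod[OF finite_lessThan]) (rule less_imp_neq[OF f(1), symmetric])
 also have "... = (\<Sum>i<n. ln (pe (y i))) + (\<Sum>i<n. ?g i) - (\<Sum>i<n. if i = 0 then ln (card V) else 0)"
  unfolding f(2) by (simp add: sum.distrib sum_subtractf)
 also have "(\<Sum>i<n. if i = 0 then ln (card V) else 0) = ln (card V)" using n by simp
 \<comment> \<open>The gain at time i belongs to the occurrence of u0 that starts at i - length u0,
   which explains the shorter range of summation.\<close>
 also have "(\<Sum>i<n. ?g i) = (\<Sum>i\<in>{length u0..<n}. ?g i)"
  by (rule sum.mono_neutral_right) auto
 also have "... = (\<Sum>j<n - length u0. gain u0 e0 ep ((shift ^^ j) y))"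
  by (rule sum.reindex_bij_witness[of _ "%j. j + length u0" "%i. i - length u0"]) auto
 finally show "ln (pmf (walk (biased u0 e0 ep) n) (map y [0..<n]))
   = (\<Sum>i<n. ln (pe (y i))) + (\<Sum>j<n - length u0. gain u0 e0 ep ((shift ^^ j) y)) - ln (card V)" .
qed

end

section \<open>Approximation of measurable cells by prefix sets\<close>

context inv_measure
begin

text \<open>The sets that can be approximated in measure form a sigma-algebra containing the
  cylinders. For a countable union, a finite subunion of almost the same measure is approximated
  instead.\<close>

lemma pcyl_approx:
 assumes "S\<in>sets B"
 shows "ALL \<eta>>0. EX m U. measure nu (sym_diff S (pcyl m U)) < \<eta>"
proof -
 define Ap where "Ap S \<longleftrightarrow> S\<in>sets B \<and> (ALL \<eta>>0. EX m U. measure nu (sym_diff S (pcyl m U)) < \<eta>)" for S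
 have apI: "EX m U. measure nu (sym_diff S (pcyl m U)) < \<eta>" if "Ap S" "\<eta> > 0" for S \<eta> using that by (simp add: Ap_def)
 have apB: "S\<in>sets B" if "Ap S" for S using that by (simp add: Ap_def)
 have Un: "Ap (S Un T)" if S: "Ap S" and T: "Ap T" for S T
  unfolding Ap_def
 proof (intro conjI allI impI)
  fix \<eta> :: real assume \<eta>: "\<eta> > 0"
  obtain m U where 1: "measure nu (sym_diff S (pcyl m U)) < \<eta>/2" using apI[OF S, of "\<eta>/2"] \<eta> by auto
  obtain k W where 2: "measure nu (sym_diff T (pcyl k W)) < \<eta>/2" using apI[OF T, of "\<eta>/2"] \<eta> by auto
  define l where "l = max m k"
  obtain U' W' where e: "pcyl m U = pcyl l U'" "pcyl k W = pcyl l W'"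
   using pcyl_lift[of m l U] pcyl_lift[of k l W] by (auto simp: l_def)
  have u: "pcyl l (U' Un W') = pcyl l U' Un pcyl l W'" by (auto simp: pcyl_def)
  have m: "sym_diff S (pcyl l U')\<in>sets nu" "sym_diff T (pcyl l W')\<in>sets nu" using apB S T by auto
  have "measure nu (sym_diff (S Un T) (pcyl l (U' Un W')))<=measure nu (sym_diff S (pcyl l U') Un sym_diff T (pcyl l W'))"
   unfolding u by (rule finite_measure_mono) (use m in blast)+
  also have "...<=measure nu (sym_diff S (pcyl l U')) + measure nu (sym_diff T (pcyl l W'))"
   by (rule measure_Un_le[OF m])
  also have "... < \<eta>" using 1 2 e by simp
  finally show "EX m U. measure nu (sym_diff (S Un T) (pcyl m U)) < \<eta>" by blast
 qed (use S T apB in blast)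
 have empty: "Ap {}"
  unfolding Ap_def
 proof (intro conjI allI impI)
  fix \<eta> :: real assume "\<eta> > 0"
  moreover have "pcyl 0 {} = {}" by (auto simp: pcyl_def)
  ultimately have "measure nu (sym_diff {} (pcyl 0 {})) < \<eta>" by simp
  then show "EX m U. measure nu (sym_diff {} (pcyl m U)) < \<eta>" by blast
 qed simp
 have "S\<in>sigma_sets X (cyl ` {w. set w\<subseteq>E})" using assms by (simp add: sets_B)
 then have "Ap S"
 proof (induction rule: sigma_sets.induct)
  case (Basic S)
  then obtain w where w: "S = cyl w" by auto
  show ?case unfolding Ap_def
  proof (intro conjI allI impI)
   fix \<eta> :: real assume "\<eta> > 0"
   then have "measure nu (sym_diff S (pcyl (length w) {w})) < \<eta>" unfolding w cyl_pcyl[symmetric] by simp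
   then show "EX m U. measure nu (sym_diff S (pcyl m U)) < \<eta>" by blast
  qed (simp add: w)
 next
  case (Compl S)
  show ?case unfolding Ap_def
  proof (intro conjI allI impI)
   fix \<eta> :: real assume "\<eta> > 0"
   then obtain m U where U: "measure nu (sym_diff S (pcyl m U)) < \<eta>" using apI[OF Compl.IH] by blast
   have "S\<subseteq>X" using sets.sets_into_space[OF apB[OF Compl.IH]] by simp
   then have "sym_diff (X - S) (pcyl m (- U)) = sym_diff S (pcyl m U)" by (auto simp: pcyl_def)
   then show "EX m U. measure nu (sym_diff (X - S) (pcyl m U)) < \<eta>" using U by metis
  next
   show "X - S\<in>sets B" using apB[OF Compl.IH] sets.compl_sets[of S B] by simp
  qed
 next
  case (Union A)
  have fin: "Ap (\<Union>i<n. A i)" for n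
  proof (induction n)
   case (Suc n)
   have "(\<Union>i<Suc n. A i) = (\<Union>i<n. A i) Un A n" by (auto simp: less_Suc_eq)
   then show ?case using Un[OF Suc.IH Union.IH[of n]] by metis
  qed (simp add: empty)
  have AB: "A i\<in>sets B" for i using apB[OF Union.IH[of i]] .
  have UB: "(\<Union>i. A i)\<in>sets B" using AB by blast
  show ?case unfolding Ap_def
  proof (intro conjI allI impI UB)
   fix \<eta> :: real assume \<eta>: "\<eta> > 0"
   have "(%n. measure nu (\<Union>i<n. A i)) \<longlonglongrightarrow> measure nu (\<Union>n. \<Union>i<n. A i)"
   proof (rule finite_Lim_measure_incseq)
    show "range (%n. \<Union>i<n. A i)\<subseteq>sets nu" using apB[OF fin] by auto
    show "incseq (%n. \<Union>i<n. A i)" by (intro incseq_SucI UN_mono) auto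
   qed
   moreover have "(\<Union>n. \<Union>i<n. A i) = (\<Union>i. A i)" by (fact UN_UN_finite_eq[of A, unfolded atLeast0LessThan])
   ultimately have lim: "(%n. measure nu (\<Union>i<n. A i)) \<longlonglongrightarrow> measure nu (\<Union>i. A i)" by simp
   have "eventually (%n. measure nu (\<Union>i<n. A i) > measure nu (\<Union>i. A i) - \<eta>/2) sequentially"
    by (rule order_tendstoD(1)[OF lim]) (use \<eta> in simp)
   then obtain n where n: "measure nu (\<Union>i<n. A i) > measure nu (\<Union>i. A i) - \<eta>/2"
    using eventually_happens'[OF sequentially_bot] by blast
   obtain m U where U: "measure nu (sym_diff (\<Union>i<n. A i) (pcyl m U)) < \<eta>/2" using apI[OF fin[of n], of "\<eta>/2"] \<eta> by auto
   have m: "(\<Union>i. A i) - (\<Union>i<n. A i)\<in>sets nu" "sym_diff (\<Union>i<n. A i) (pcyl m U)\<in>sets nu" using UB apB[OF fin] by auto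
   have "measure nu ((\<Union>i. A i) - (\<Union>i<n. A i)) = measure nu (\<Union>i. A i) - measure nu (\<Union>i<n. A i)"
    by (rule finite_measure_Diff) (use UB apB[OF fin[of n]] in auto)
   then have d: "measure nu ((\<Union>i. A i) - (\<Union>i<n. A i)) < \<eta>/2" using n by simp
   have "measure nu (sym_diff (\<Union>i. A i) (pcyl m U))<=measure nu (((\<Union>i. A i) - (\<Union>i<n. A i)) Un sym_diff (\<Union>i<n. A i) (pcyl m U))"
    by (rule finite_measure_mono) (use m in blast)+
   also have "...<=measure nu ((\<Union>i. A i) - (\<Union>i<n. A i)) + measure nu (sym_diff (\<Union>i<n. A i) (pcyl m U))"
    by (rule measure_Un_le[OF m])
   also have "... < \<eta>" using d U by simp
   finally show "EX m U. measure nu (sym_diff (\<Union>i. A i) (pcyl m U)) < \<eta>" by blast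
  qed
 qed (rule empty)
 then show ?thesis by (simp add: Ap_def)
qed

end

context inv_partition
begin

text \<open>All cells are approximated by prefix sets of a common length m. If the prefix lies in
  exactly one of these sets, g guesses the corresponding cell; wrong guesses then occur only in the
  symmetric differences.\<close>

lemma cells_from_prefixes:
 assumes \<eta>: "\<eta> > 0"
 obtains m g where "ALL u. g u\<in>P" "{y\<in>X. cell_of P y~=g (map y [0..<m])}\<in>sets B"
  "measure nu {y\<in>X. cell_of P y~=g (map y [0..<m])}<=\<eta>"
proof -
 have cP: "card P > 0" using finP P_ne by (simp add: card_gt_0_iff)
 have "ALL C:P. EX m U. measure nu (sym_diff C (pcyl m U)) < \<eta> / card P"
  using pcyl_approx[OF P_sets] \<eta> cP by simp
 then obtain mm UU where U: "!!C. C\<in>P ==> measure nu (sym_diff C (pcyl (mm C) (UU C))) < \<eta> / card P" by metis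
 define m where "m = Max (mm ` P)"
 have "mm C<=m" if "C\<in>P" for C unfolding m_def using finP that by simp
 define W where "W C = {w. take (mm C) w\<in>UU C}" for C
 have W: "pcyl (mm C) (UU C) = pcyl m (W C)" if "C\<in>P" for C
  unfolding W_def by (rule pcyl_lift) (use \<open>C \<in> P ==> mm C <= m\<close> that in blast)
 define g where "g u = (if EX! C. C\<in>P \<and> u\<in>W C then THE C. C\<in>P \<and> u\<in>W C else SOME C. C\<in>P)" for u
 have gP: "g u\<in>P" for u
 proof (cases "EX! C. C\<in>P \<and> u\<in>W C")
  case True
  then have "g u = (THE C. C\<in>P \<and> u\<in>W C)" by (simp add: g_def)
  then show ?thesis using theI'[OF True] by simp
 next
  case False
  then have "g u = (SOME C. C\<in>P)" by (simp add: g_def)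
  then show ?thesis using P_ne by (simp add: some_in_eq)
 qed
 let ?Bad = "{y\<in>X. cell_of P y~=g (map y [0..<m])}"
 have "?Bad = (\<Union>C\<in>P. C - pcyl m {u. g u = C})"
 proof (intro equalityI subsetI)
  fix y assume y: "y\<in>?Bad"
  then show "y\<in>(\<Union>C\<in>P. C - pcyl m {u. g u = C})" using cell_of(1,2)[of y] by (auto simp: pcyl_def)
 next
  fix y assume "y\<in>(\<Union>C\<in>P. C - pcyl m {u. g u = C})"
  then obtain C where C: "C\<in>P" "y\<in>C" "y\<notin>pcyl m {u. g u = C}" by blast
  then have yX: "y\<in>X" using sets.sets_into_space[OF P_sets[OF C(1)]] by auto
  then show "y\<in>?Bad" using C cell_of(3)[OF yX C(1,2)] by (auto simp: pcyl_def)
 qed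
 also have "...\<in>sets B" using finP P_sets by (intro sets.finite_UN sets.Diff) auto
 finally have Bad: "?Bad\<in>sets B" .
 have "?Bad\<subseteq>(\<Union>C\<in>P. sym_diff C (pcyl (mm C) (UU C)))"
 proof (rule subsetI, rule ccontr)
  fix y assume b: "y\<in>?Bad" and nn: "y\<notin>(\<Union>C\<in>P. sym_diff C (pcyl (mm C) (UU C)))"
  have y: "y\<in>X" "cell_of P y~=g (map y [0..<m])" using b by auto
  let ?C = "cell_of P y"
  have yC: "y\<in>C \<longleftrightarrow> map y [0..<m]\<in>W C" if C: "C\<in>P" for C
  proof -
   have "y\<notin>sym_diff C (pcyl m (W C))" using nn C unfolding W[OF C, symmetric] by blast
   then show ?thesis using y(1) by (auto simp: pcyl_def)
  qed
  have un: "D\<in>P \<and> map y [0..<m]\<in>W D \<longleftrightarrow> D = ?C" for D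
   using cell_of[OF y(1)] yC by metis
  have "g (map y [0..<m]) = ?C" unfolding g_def un by simp
  then show False using y(2) by simp
 qed
 then have "measure nu ?Bad<=measure nu (\<Union>C\<in>P. sym_diff C (pcyl (mm C) (UU C)))"
  by (rule finite_measure_mono) (use finP P_sets in auto)
 also have "...<=(\<Sum>C\<in>P. measure nu (sym_diff C (pcyl (mm C) (UU C))))"
  by (rule measure_UNION_le[OF finP]) (use P_sets in auto)
 also have "...<=(\<Sum>C\<in>P. \<eta> / card P)" using U by (intro sum_mono less_imp_le)
 also have "... = \<eta>" using cP by simp
 finally show ?thesis using that[of g m] gP Bad by blast
qed

end

subsection \<open>Upper bound for the entropy\<close>

context edge_shift
begin

text \<open>The ideal code length of the first edge when paths are coded according to the
  chain.\<close>

definition info :: "(nat => 'e) => real" where "info y = - ln (pe (y 0))"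

lemma info_measurable [measurable]: "info\<in>borel_measurable B"
 unfolding info_def[abs_def] by (rule real_coord_measurable)

lemma info_nonneg: "y\<in>X ==> info y>=0"
 using pe_pos[OF X_E[of y 0]] pe_le_1[of "y 0"] by (simp add: info_def)

end

context inv_measure
begin

lemma prob_X: "measure nu X = 1" using prob_space by simp

definition mean_gain :: "'a list => 'a => real => real" where
 "mean_gain u0 e0 ep = measure nu (cyl (u0 @ [e0])) * ln (1 - ep + ep / pe e0)
   + (measure nu (cyl u0) - measure nu (cyl (u0 @ [e0]))) * ln (1 - ep)"

lemma gain_integral: "integrable nu (gain u0 e0 ep)" "(\<integral>y. gain u0 e0 ep y \<partial>nu) = mean_gain u0 e0 ep"
proof -
 have i: "integrable nu (indicator (cyl w) :: _ => real)" for w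
  by (rule integrable_real_indicator) (auto simp: emeasure_eq_measure)
 have m: "(\<integral>y. indicator (cyl w) y \<partial>nu) = measure nu (cyl w)" for w
  using cyl_sub[of w] by (simp add: Int_absorb1 Int_absorb2)
 show "integrable nu (gain u0 e0 ep)" unfolding gain_def[abs_def]
  by (intro Bochner_Integration.integrable_add integrable_mult_left Bochner_Integration.integrable_diff i)
 show "(\<integral>y. gain u0 e0 ep y \<partial>nu) = mean_gain u0 e0 ep" unfolding gain_def mean_gain_def
  using i[of u0] i[of "u0 @ [e0]"] m[of u0] m[of "u0 @ [e0]"] by simp
qed

lemma ln_walk_integral:
 assumes I: "integrable nu info" and u0: "u0~=[]" "adm (u0 @ [e0])" and ep: "0<=ep" "ep < 1" and n: "n > 0"
 defines "W y \<equiv> ln (pmf (walk (biased u0 e0 ep) n) (map y [0..<n]))"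
 shows "integrable nu W"
  and "(\<integral>y. W y \<partial>nu) = real (n - length u0) * mean_gain u0 e0 ep - n * (\<integral>y. info y \<partial>nu) - ln (card V)"
proof -
 have e: "W y = (\<Sum>i<n. - info ((shift ^^ i) y)) + (\<Sum>j<n - length u0. gain u0 e0 ep ((shift ^^ j) y)) - ln (card V)" if "y\<in>X" for y
  using ln_pmf_biased_walk(2)[OF that u0 ep n] by (simp add: W_def info_def shift_pow)
 let ?R = "%y. (\<Sum>i<n. - info ((shift ^^ i) y)) + (\<Sum>j<n - length u0. gain u0 e0 ep ((shift ^^ j) y)) - ln (card V)"
 have i1: "integrable nu (%y. - info ((shift ^^ i) y))" for i using integrable_pow[OF I] by simp
 have i2: "integrable nu (%y. gain u0 e0 ep ((shift ^^ i) y))" for i by (rule integrable_pow[OF gain_integral(1)])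
 have g: "gain u0 e0 ep\<in>borel_measurable B"
  using borel_measurable_integrable[OF gain_integral(1)] measurable_cong_sets[of nu B borel borel, OF sets_nu refl] by blast
 have s1: "integrable nu (%y. \<Sum>i<n. - info ((shift ^^ i) y))" and s2: "integrable nu (%y. \<Sum>j<n - length u0. gain u0 e0 ep ((shift ^^ j) y))"
  by (intro Bochner_Integration.integrable_sum i1 i2)+
 have R: "integrable nu ?R" by (intro Bochner_Integration.integrable_diff Bochner_Integration.integrable_add s1 s2) simp
 show "integrable nu W" using R by (subst Bochner_Integration.integrable_cong[OF refl e]) simp_all
 have "(\<integral>y. W y \<partial>nu) = (\<integral>y. ?R y \<partial>nu)" by (rule Bochner_Integration.integral_cong[OF refl]) (use e in simp)
 also have "... = (\<integral>y. (\<Sum>i<n. - info ((shift ^^ i) y)) \<partial>nu) + (\<integral>y. (\<Sum>j<n - length u0. gain u0 e0 ep ((shift ^^ j) y)) \<partial>nu) - ln (card V)"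
  using s1 s2 by (simp add: prob_X)
 also have "(\<integral>y. (\<Sum>i<n. - info ((shift ^^ i) y)) \<partial>nu) = (\<Sum>i<n. - (\<integral>y. info y \<partial>nu))"
  using i1 integral_pow[OF info_measurable] by (subst Bochner_Integration.integral_sum) auto
 also have "(\<integral>y. (\<Sum>j<n - length u0. gain u0 e0 ep ((shift ^^ j) y)) \<partial>nu) = (\<Sum>j<n - length u0. mean_gain u0 e0 ep)"
  using i2 integral_pow[OF g] gain_integral(2) by (subst Bochner_Integration.integral_sum) auto
 finally show "(\<integral>y. W y \<partial>nu) = real (n - length u0) * mean_gain u0 e0 ep - n * (\<integral>y. info y \<partial>nu) - ln (card V)" by simp
qed

end

context inv_partition
begin

text \<open>Gibbs' inequality for the pair Z of itinerary and path of length n + m. The competitor T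
  lets the biased process choose the path and then draws each cell from a window of m letters, by a
  law \<kappa> that favours the guess g. N is the probability of the itinerary alone, which
  dominates that of the pair, so the entropy of the itinerary is what gets bounded.\<close>

lemma entr_upper:
 assumes I: "integrable nu info" and u0: "u0~=[]" "adm (u0 @ [e0])" and ep: "0<=ep" "ep < 1"
  and dl: "0 < dl" "dl < 1" and gP: "!!u. g u\<in>P"
  and Bad: "{y\<in>X. cell_of P y~=g (map y [0..<m])}\<in>sets B" (is "?Bad\<in>_")
  and n: "n > 0"
 shows "entr nu P n<=(n + m) * (\<integral>y. info y \<partial>nu) + ln (card V) - real (n + m - length u0) * mean_gain u0 e0 ep
  + n * (measure nu ?Bad * ln (card P / dl) - ln (1 - dl))"
proof -
 let ?J = "PiE {..<n} (%_. P)"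
 let ?W = "walk (biased u0 e0 ep) (n + m)"
 have cP: "card P > 0" using finP P_ne by (simp add: card_gt_0_iff)
 \<comment> \<open>The share dl is spread evenly over P, so that \<kappa> never vanishes: a right
   guess costs at most -ln (1 - dl) and a wrong one ln (card P / dl).\<close>
 define \<kappa> where "\<kappa> u C = (if C = g u then 1 - dl + dl / card P else dl / card P)" for u C
 have \<kappa>pos: "\<kappa> u C > 0" for u C using dl cP by (auto simp: \<kappa>_def intro!: add_pos_pos)
 have \<kappa>sum: "(\<Sum>C\<in>P. \<kappa> u C) = 1" for u
 proof -
  have "(\<Sum>C\<in>P. \<kappa> u C) = (\<Sum>C\<in>P. (if C = g u then 1 - dl else 0) + dl / card P)"
   by (rule sum.cong) (auto simp: \<kappa>_def)
  also have "... = (1 - dl) + dl" using finP gP cP P_ne by (simp add: sum.distrib)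
  finally show ?thesis by simp
 qed
 have \<kappa>ln: "- ln (\<kappa> (map y [0..<m]) (cell_of P y))<=indicator ?Bad y * ln (card P / dl) - ln (1 - dl)" if "y\<in>X" for y
 proof (cases "y\<in>?Bad")
  case True
  then have "- ln (\<kappa> (map y [0..<m]) (cell_of P y)) = ln (card P / dl)" using dl cP by (simp add: \<kappa>_def ln_div)
  moreover have "ln (1 - dl)<=0" using dl by simp
  ultimately show ?thesis using True by simp
 next
  case False
  then have "\<kappa> (map y [0..<m]) (cell_of P y)>=1 - dl" using dl cP that by (simp add: \<kappa>_def)
  then have "ln (1 - dl)<=ln (\<kappa> (map y [0..<m]) (cell_of P y))" using dl \<kappa>pos by (subst ln_le_cancel_iff) auto
  then show ?thesis using False by simp
 qed
 define Z where "Z y = (itin P n y, map y [0..<n + m])" for y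
 define K where "K = ?J \<times> {w. set w\<subseteq>E}"
 define T where "T = (%(C, w). pmf ?W w * (\<Prod>i<n. \<kappa> (take m (drop i w)) (C i)))"
 define N where "N = (%(C, w :: 'a list). measure nu (cells_set n C))"
 have cK: "countable K" unfolding K_def using countable_finite[OF fin_PiE] countable_words by (rule countable_SIGMA)
 have Zm: "Z\<in>nu \<rightarrow>\<^sub>M count_space K"
 proof (subst measurable_count_space_eq_countable[OF cK], intro conjI ballI)
  show "Z\<in>space nu \<rightarrow> K" using itin_PiE prefix_words by (auto simp: Z_def K_def simp del: set_map)
  fix z assume "z\<in>K"
  then obtain C w where z: "z = (C, w)" "C\<in>?J" by (auto simp: K_def)
  have "Z -` {z} Int space nu = cells_set n C Int pcyl (n + m) {w}"
   using itin_eq[OF _ z(2)] z(1) by (auto simp: Z_def pcyl_def cells_set_def)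
  then show "Z -` {z} Int space nu\<in>sets nu" using cells_set_sets[OF z(2)] by simp
 qed
 have T0: "T z>=0" for z unfolding T_def split_beta by (intro mult_nonneg_nonneg prod_nonneg pmf_nonneg less_imp_le[OF \<kappa>pos])
 have Tsum: "(\<integral>\<^sup>+z. ennreal (T z) \<partial>count_space K)<=1"
 proof -
  have in1: "(\<Sum>C\<in>?J. T (C, w)) = pmf ?W w" for w
  proof -
   have "(\<Sum>C\<in>?J. \<Prod>i<n. \<kappa> (take m (drop i w)) (C i)) = (\<Prod>i<n. \<Sum>C\<in>P. \<kappa> (take m (drop i w)) C)"
    by (rule prod_sum_PiE[symmetric]) (use finP in auto)
   then show ?thesis using \<kappa>sum by (simp add: T_def sum_distrib_left[symmetric])
  qed
  have "(\<integral>\<^sup>+z. ennreal (T z) \<partial>count_space K) = (\<integral>\<^sup>+z. ennreal (T z) * indicator K z \<partial>count_space UNIV)"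
   by (simp add: nn_integral_count_space_indicator)
  also have "... = (\<integral>\<^sup>+w. (\<integral>\<^sup>+C. ennreal (T (C, w)) * indicator K (C, w) \<partial>count_space UNIV) \<partial>count_space UNIV)"
   by (rule nn_integral_snd_count_space[symmetric])
  also have "...<=(\<integral>\<^sup>+w. ennreal (pmf ?W w) \<partial>count_space UNIV)"
  proof (rule nn_integral_mono)
   fix w
   have "(\<integral>\<^sup>+C. ennreal (T (C, w)) * indicator K (C, w) \<partial>count_space UNIV)<=(\<integral>\<^sup>+C. ennreal (T (C, w)) * indicator ?J C \<partial>count_space UNIV)"
    by (rule nn_integral_mono) (auto simp: K_def indicator_def)
   also have "... = (\<integral>\<^sup>+C. ennreal (T (C, w)) \<partial>count_space ?J)" by (simp add: nn_integral_count_space_indicator)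
   also have "... = (\<Sum>C\<in>?J. ennreal (T (C, w)))" by (rule nn_integral_count_space_finite[OF fin_PiE])
   also have "... = ennreal (pmf ?W w)" using in1[of w] T0 by (simp add: sum_ennreal)
   finally show "(\<integral>\<^sup>+C. ennreal (T (C, w)) * indicator K (C, w) \<partial>count_space UNIV)<=ennreal (pmf ?W w)" .
  qed
  also have "... = 1" by (simp add: nn_integral_pmf)
  finally show ?thesis .
 qed
 let ?k = "%y. ln (\<kappa> (map y [0..<m]) (cell_of P y))"
 have Tpos: "T (Z y) > 0" and lnT: "ln (T (Z y)) = ln (pmf ?W (map y [0..<n + m])) + (\<Sum>i<n. ?k ((shift ^^ i) y))" if y: "y\<in>X" for y
 proof -
  have "take m (drop i (map y [0..<n + m])) = map ((shift ^^ i) y) [0..<m]" if "i < n" for i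
   using that by (intro nth_equalityI) (auto simp: shift_pow)
  then have e: "T (Z y) = pmf ?W (map y [0..<n + m]) * (\<Prod>i<n. \<kappa> (map ((shift ^^ i) y) [0..<m]) (cell_of P ((shift ^^ i) y)))"
   by (auto simp: T_def Z_def itin_def intro!: prod.cong)
  have pos: "pmf ?W (map y [0..<n + m]) > 0" by (rule ln_pmf_biased_walk(1)[OF y u0 ep]) (use n in simp)
  have pp: "(\<Prod>i<n. \<kappa> (map ((shift ^^ i) y) [0..<m]) (cell_of P ((shift ^^ i) y))) > 0" by (rule prod_pos) (use \<kappa>pos in blast)
  show "T (Z y) > 0" unfolding e using pos pp by (rule mult_pos_pos)
  show "ln (T (Z y)) = ln (pmf ?W (map y [0..<n + m])) + (\<Sum>i<n. ?k ((shift ^^ i) y))"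
   unfolding e ln_mult_pos[OF pos pp] by (subst ln_prod[OF finite_lessThan]) (rule less_imp_neq[OF \<kappa>pos, symmetric], rule refl)
 qed
 have kI: "integrable nu ?k"
 proof -
  let ?h = "%y. indicator ?Bad y * ln (dl / card P) + (1 - indicator ?Bad y) * ln (1 - dl + dl / card P)"
  have "integrable nu (indicator ?Bad :: _ => real)" by (rule integrable_real_indicator) (use Bad in "auto simp: emeasure_eq_measure")
  then have h: "integrable nu ?h"
   by (intro Bochner_Integration.integrable_add integrable_mult_left Bochner_Integration.integrable_diff) simp_all
  have "?k y = ?h y" if "y\<in>X" for y using that by (cases "y\<in>?Bad") (auto simp: \<kappa>_def)
  then show ?thesis using h by (subst Bochner_Integration.integrable_cong[OF refl, of _ _ ?h]) simp_all
 qed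
 have kB: "?k\<in>borel_measurable B"
  using borel_measurable_integrable[OF kI] measurable_cong_sets[of nu B borel borel, OF sets_nu refl] by blast
 have kS: "integrable nu (%y. \<Sum>i<n. ?k ((shift ^^ i) y))"
  by (intro Bochner_Integration.integrable_sum integrable_pow[OF kI])
 have nm: "n + m > 0" using n by simp
 note W = ln_walk_integral[OF I u0 ep nm]
 have gibbs: "(\<integral>y. ln (T (Z y)) \<partial>nu)<=(\<integral>y. ln (N (Z y)) \<partial>nu)"
 proof (rule gibbs_inequality[OF prob_nu cK Zm])
  show "T z>=0" for z by (rule T0)
  show "(\<integral>\<^sup>+z. ennreal (T z) \<partial>count_space K)<=1" by (rule Tsum)
  show "measure nu (Z -` {z} Int space nu)<=N z" if zK: "z\<in>K" for z
  proof -
   obtain C w where z: "z = (C, w)" "C\<in>?J" using zK by (auto simp: K_def)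
   have "Z -` {z} Int space nu\<subseteq>cells_set n C" using itin_eq[OF _ z(2)] z(1) by (auto simp: Z_def)
   then show ?thesis unfolding N_def z(1) prod.case by (rule finite_measure_mono) (use cells_set_sets[OF z(2)] in simp)
  qed
  show "AE y in nu. T (Z y) > 0" by (rule AE_I2) (use Tpos in simp)
  show "integrable nu (%y. ln (T (Z y)))"
   by (subst Bochner_Integration.integrable_cong[OF refl lnT]) (use W(1) kS in auto)
  show "integrable nu (%y. ln (N (Z y)))" unfolding N_def Z_def prod.case by (rule finite_itin_integral(1))
 qed
 have kint: "- (\<integral>y. ?k y \<partial>nu)<=measure nu ?Bad * ln (card P / dl) - ln (1 - dl)"
 proof -
  have bi: "integrable nu (indicator ?Bad :: _ => real)" by (rule integrable_real_indicator) (use Bad in "auto simp: emeasure_eq_measure")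
  then have ri: "integrable nu (%y. indicator ?Bad y * ln (card P / dl) - ln (1 - dl))"
   by (intro Bochner_Integration.integrable_diff integrable_mult_left) simp_all
  have "(\<integral>y. - ?k y \<partial>nu)<=(\<integral>y. indicator ?Bad y * ln (card P / dl) - ln (1 - dl) \<partial>nu)"
   by (rule integral_mono[OF _ ri]) (use kI \<kappa>ln in auto)
  also have "... = (\<integral>y. indicator ?Bad y \<partial>nu) * ln (card P / dl) - ln (1 - dl)" using bi by (simp add: prob_X)
  also have "(\<integral>y. indicator ?Bad y \<partial>nu) = measure nu ?Bad" by (simp add: Int_def conj_ac)
  finally show ?thesis by simp
 qed
 have "(\<integral>y. ln (T (Z y)) \<partial>nu) = (\<integral>y. ln (pmf ?W (map y [0..<n + m])) + (\<Sum>i<n. ?k ((shift ^^ i) y)) \<partial>nu)"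
  by (rule Bochner_Integration.integral_cong[OF refl]) (use lnT in simp)
 also have "... = (\<integral>y. ln (pmf ?W (map y [0..<n + m])) \<partial>nu) + (\<integral>y. (\<Sum>i<n. ?k ((shift ^^ i) y)) \<partial>nu)"
  by (rule Bochner_Integration.integral_add[OF W(1) kS])
 also have "(\<integral>y. (\<Sum>i<n. ?k ((shift ^^ i) y)) \<partial>nu) = (\<Sum>i<n. \<integral>y. ?k y \<partial>nu)"
  unfolding Bochner_Integration.integral_sum[OF integrable_pow[OF kI]] using integral_pow[OF kB] by simp
 finally have T: "(\<integral>y. ln (T (Z y)) \<partial>nu) = (\<integral>y. ln (pmf ?W (map y [0..<n + m])) \<partial>nu) + n * (\<integral>y. ?k y \<partial>nu)" by simp
 have "entr nu P n = - (\<integral>y. ln (N (Z y)) \<partial>nu)" unfolding entr_integral N_def Z_def prod.case ..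
 also have "... <= - (\<integral>y. ln (T (Z y)) \<partial>nu)" using gibbs by simp
 also have "... = (n + m) * (\<integral>y. info y \<partial>nu) + ln (card V) - real (n + m - length u0) * mean_gain u0 e0 ep + n * (- (\<integral>y. ?k y \<partial>nu))"
  unfolding T W(2) by simp
 also have "n * (- (\<integral>y. ?k y \<partial>nu))<=n * (measure nu ?Bad * ln (card P / dl) - ln (1 - dl))"
  by (rule mult_left_mono[OF kint]) simp
 finally show ?thesis by simp
qed

lemma entropy_rate_upper:
 assumes I: "integrable nu info" and u0: "u0~=[]" "adm (u0 @ [e0])" and ep: "0<=ep" "ep < 1"
 shows "lim (%n. entr nu P n / n)<=(\<integral>y. info y \<partial>nu) - mean_gain u0 e0 ep"
proof (rule field_le_epsilon)
 fix e :: real assume e: "e > 0"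
 let ?I = "\<integral>y. info y \<partial>nu" and ?G = "mean_gain u0 e0 ep"
 \<comment> \<open>dl makes a right guess cost at most e / 2, and \<eta> below limits the mean cost
   of wrong guesses to e / 2. The terms that do not grow with n are collected in D.\<close>
 define dl where "dl = 1 - exp (- (e / 2))"
 have dl: "0 < dl" "dl < 1" "ln (1 - dl) = - (e / 2)" using e by (auto simp: dl_def)
 have cP: "card P > 0" using finP P_ne by (simp add: card_gt_0_iff)
 have "real (card P) / dl > 1" using cP dl by (simp add: less_divide_eq)
 then have l: "ln (card P / dl) > 0" by simp
 define \<eta> where "\<eta> = e / 2 / ln (card P / dl)"
 have "\<eta> > 0" using e l by (simp add: \<eta>_def)
 from cells_from_prefixes[OF this] obtain m g where g: "ALL u. g u\<in>P"
  "{y\<in>X. cell_of P y~=g (map y [0..<m])}\<in>sets B" "measure nu {y\<in>X. cell_of P y~=g (map y [0..<m])}<=\<eta>" .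
 have c: "measure nu {y\<in>X. cell_of P y~=g (map y [0..<m])} * ln (card P / dl) - ln (1 - dl)<=e"
 proof -
  have "measure nu {y\<in>X. cell_of P y~=g (map y [0..<m])} * ln (card P / dl)<=\<eta> * ln (card P / dl)"
   using g(3) l by (intro mult_right_mono) auto
  also have "... = e / 2" using l by (simp add: \<eta>_def)
  finally show ?thesis using dl by simp
 qed
 define D where "D = m * ?I + ln (card V) - (real m - length u0) * ?G"
 have up: "entr nu P n / n<=?I - ?G + e + D / n" if n: "n>=Suc (length u0)" for n
 proof -
  have n0: "n > 0" using n by simp
  have "real (n + m - length u0) = real n + real m - length u0" using n by (simp add: of_nat_diff)
  then have "entr nu P n<=(real n + m) * ?I + ln (card V) - (real n + m - length u0) * ?G
   + n * (measure nu {y\<in>X. cell_of P y~=g (map y [0..<m])} * ln (card P / dl) - ln (1 - dl))"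
   using entr_upper[OF I u0 ep dl(1,2) g(1)[rule_format] g(2) n0] by simp
  also have "...<=(real n + m) * ?I + ln (card V) - (real n + m - length u0) * ?G + n * e"
   by (intro add_left_mono mult_left_mono c) simp
  also have "... = n * (?I - ?G + e) + D" by (simp add: D_def algebra_simps)
  finally show ?thesis using n0 by (simp add: field_simps)
 qed
 have "(%n. ?I - ?G + e + D / real n) \<longlonglongrightarrow> ?I - ?G + e + 0"
  by (intro tendsto_add tendsto_const lim_const_over_n)
 moreover have "(%n. entr nu P n / n) \<longlonglongrightarrow> lim (%n. entr nu P n / n)"
  using entropy_rate_convergent by (simp add: convergent_LIMSEQ_iff)
 ultimately have "lim (%n. entr nu P n / n)<=?I - ?G + e + 0"
  using up by (intro LIMSEQ_le) blast+
 then show "lim (%n. entr nu P n / n)<=?I - ?G + e" by simp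
qed

end

context inv_measure
begin

lemma ks_upper:
 assumes "integrable nu info" "u0~=[]" "adm (u0 @ [e0])" "0<=ep" "ep < 1"
 shows "ks_entropy nu shift<=ereal ((\<integral>y. info y \<partial>nu) - mean_gain u0 e0 ep)"
 unfolding ks_entropy_def
proof (rule SUP_least)
 fix P assume "P\<in>{P. finite P \<and> P\<subseteq>sets nu \<and> partition_on (space nu) P}"
 then interpret inv_partition E s t V p nu P by unfold_locales auto
 show "ereal (lim (%n. partition_entropy nu (refined_partition nu shift P n) / real n))<=ereal ((\<integral>y. info y \<partial>nu) - mean_gain u0 e0 ep)"
  unfolding entropy_eq using entropy_rate_upper[OF assms] by simp
qed

end

subsection \<open>Uniqueness\<close>

lemma count_space_integral_eqD:
 fixes f g :: "'a => ennreal"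
 assumes le: "!!x. x\<in>A ==> f x<=g x" and eq: "(\<integral>\<^sup>+x. f x \<partial>count_space A) = (\<integral>\<^sup>+x. g x \<partial>count_space A)"
  and fin: "(\<integral>\<^sup>+x. f x \<partial>count_space A)~=\<infinity>" and x: "x\<in>A"
 shows "f x = g x"
proof -
 have "(\<integral>\<^sup>+x. g x - f x \<partial>count_space A) = (\<integral>\<^sup>+x. g x \<partial>count_space A) - (\<integral>\<^sup>+x. f x \<partial>count_space A)"
  by (rule nn_integral_diff) (use le fin in "auto simp: AE_count_space")
 also have "... = 0" using eq fin by simp
 finally have "g x - f x = 0" using x by (auto simp: nn_integral_0_iff_AE AE_count_space)
 then show ?thesis using le[OF x] by (simp add: antisym ennreal_minus_eq_0)
qed

context edge_shift
begin

text \<open>By induction both measures give a cylinder the same mass, which is the sum over its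
  one-letter extensions; domination of the summands then forces equality.\<close>

lemma prob_le_cyl_eq:
 assumes M: "prob_space M" "space M = X" "sets M = sets B" and N: "prob_space N" "space N = X" "sets N = sets B"
  and le: "!!w. set w\<subseteq>E ==> emeasure M (cyl w)<=emeasure N (cyl w)"
 shows "M = N"
proof (rule measure_eq_cyl[OF M N(3)])
 fix w assume "set w\<subseteq>E"
 then show "emeasure M (cyl w) = emeasure N (cyl w)"
 proof (induction w rule: rev_induct)
  case Nil
  show ?case using prob_space.emeasure_space_1[OF M(1)] prob_space.emeasure_space_1[OF N(1)] M(2) N(2) by (simp add: cyl_Nil)
 next
  case (snoc e w)
  interpret M: prob_space M by (rule M(1))
  have w: "set w\<subseteq>E" and e: "e\<in>E" using snoc.prems by auto
  have "(\<integral>\<^sup>+e. emeasure M (cyl (w @ [e])) \<partial>count_space E) = (\<integral>\<^sup>+e. emeasure N (cyl (w @ [e])) \<partial>count_space E)"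
   using snoc.IH[OF w] unfolding emeasure_cyl_snoc[OF M(3), of w] emeasure_cyl_snoc[OF N(3), of w] .
  moreover have "(\<integral>\<^sup>+e. emeasure M (cyl (w @ [e])) \<partial>count_space E)~=\<infinity>"
   unfolding emeasure_cyl_snoc[OF M(3), of w, symmetric] by simp
  ultimately show ?case
   by (rule count_space_integral_eqD[rotated, OF _ _ e]) (use le w in auto)
 qed
qed

definition stationary :: "'v pmf" where
 "stationary = (SOME \<pi>. set_pmf \<pi>\<subseteq>V \<and> bind_pmf \<pi> K = \<pi> \<and> (ALL a:V. ALL b:V. (%n. pmf (Kn n a) b) \<longlonglongrightarrow> pmf \<pi> b))"

lemma stationary: "set_pmf stationary\<subseteq>V" "bind_pmf stationary K = stationary"
 "a\<in>V ==> b\<in>V ==> (%n. pmf (Kn n a) b) \<longlonglongrightarrow> pmf stationary b"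
proof -
 have "EX \<pi>. set_pmf \<pi>\<subseteq>V \<and> bind_pmf \<pi> K = \<pi> \<and> (ALL a:V. ALL b:V. (%n. pmf (Kn n a) b) \<longlonglongrightarrow> pmf \<pi> b)"
  using stationary_exists by metis
 from someI_ex[OF this, folded stationary_def]
 show "set_pmf stationary\<subseteq>V" "bind_pmf stationary K = stationary"
  "a\<in>V ==> b\<in>V ==> (%n. pmf (Kn n a) b) \<longlonglongrightarrow> pmf stationary b" by blast+
qed

definition chain :: "(nat => 'e) measure" where "chain = markov stationary"

lemma chain_inv: "chain\<in>invariant_probabilities B shift"
 unfolding chain_def by (rule markov_invariant[OF stationary(1,2)])

lemma chain_cyl: "adm w ==> w~=[] ==> emeasure chain (cyl w) = ennreal (pmf stationary (s (hd w)) * wprob w)"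
 unfolding chain_def by (rule markov_cyl[OF stationary(1)])

lemma wprob_snoc: "wprob (w @ [e]) = wprob w * pe e" by (simp add: wprob_def)

end

context inv_measure
begin

text \<open>If the entropy reaches the mean information, \<open>ks_upper\<close> makes the mean gain
  nonpositive for every bias. It is 0 at bias 0 with derivative a / pe e - b, where a and b are the
  measures of the two cylinders, so this derivative cannot be positive.\<close>

lemma transition_le:
 assumes I: "integrable nu info" and h: "ks_entropy nu shift>=ereal (\<integral>y. info y \<partial>nu)" and u: "u~=[]"
 shows "measure nu (cyl (u @ [e]))<=measure nu (cyl u) * pe e"
proof (cases "adm (u @ [e])")
 case False
 then have "cyl (u @ [e]) = {}" using cyl_adm by blast
 then show ?thesis by (simp add: pe_def)
next
 case adm: True
 then have q: "pe e > 0" using pe_pos by (simp add: adm_def)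
 define a where "a = measure nu (cyl (u @ [e]))"
 define b where "b = measure nu (cyl u)"
 define F where "F ep = a * ln (1 - ep + ep / pe e) + (b - a) * ln (1 - ep)" for ep
 have F: "F ep<=0" if "0<=ep" "ep < 1" for ep
 proof -
  have "ereal (\<integral>y. info y \<partial>nu)<=ereal ((\<integral>y. info y \<partial>nu) - mean_gain u e ep)"
   by (rule order_trans[OF h ks_upper[OF I u adm that]])
  then show ?thesis by (simp add: mean_gain_def F_def a_def b_def)
 qed
 have d: "(F has_real_derivative a * (- 1 + 1 / pe e) - (b - a)) (at 0)"
  unfolding F_def using q by (auto intro!: derivative_eq_intros)
 show ?thesis
 proof (rule ccontr)
  assume "\<not> ?thesis"
  then have "a > b * pe e" by (simp add: a_def b_def)
  then have "a * (- 1 + 1 / pe e) - (b - a) > 0" using q by (simp add: field_simps)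
  from DERIV_pos_inc_right[OF d this] obtain x where x: "x > 0" "ALL h>0. h < x --> F 0 < F (0 + h)" by blast
  define h where "h = min (x / 2) (1 / 2)"
  have "0 < h" "h < x" "h < 1" using x(1) by (auto simp: h_def min_def)
  then show False using x(2) F[of h] by (auto simp: F_def)
 qed
qed

lemma cyl_append_le:
 assumes I: "integrable nu info" and h: "ks_entropy nu shift>=ereal (\<integral>y. info y \<partial>nu)" and u: "u~=[]"
 shows "measure nu (cyl (u @ w))<=measure nu (cyl u) * wprob w"
proof (induction w rule: rev_induct)
 case (snoc e w)
 have "measure nu (cyl (u @ w @ [e]))<=measure nu (cyl (u @ w)) * pe e"
  using transition_le[OF I h, of "u @ w" e] u by simp
 also have "...<=measure nu (cyl u) * wprob w * pe e" by (rule mult_right_mono[OF snoc]) (simp add: pe_def)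
 finally show ?case by (simp add: wprob_snoc mult.assoc)
qed (simp add: wprob_def)

text \<open>\<open>transition_le\<close> needs a nonempty past, so by invariance an edge is put in
  front of w; this bounds nu on \<open>cyl w\<close> by \<alpha> (s (hd w)) * wprob w. Applied to
  single edges it says that \<alpha> is at most its image under K, and iteration bounds \<alpha> by
  the stationary law. Hence nu is dominated by the chain on cylinders, which forces
  equality.\<close>

lemma uniqueness:
 assumes I: "integrable nu info" and h: "ks_entropy nu shift>=ereal (\<integral>y. info y \<partial>nu)"
 shows "nu = chain"
proof -
 define \<alpha> where "\<alpha> v = measure nu {y\<in>X. s (y 0) = v}" for v
 have sB: "{y\<in>X. f (y 0) = v}\<in>sets B" for f :: "'a => 'b" and v
 proof -
  have "{y\<in>X. f (y 0) = v} = (%y. y 0) -` {e\<in>E. f e = v} Int space B" using X_E by auto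
  also have "...\<in>sets B" by (rule measurable_sets[OF coord_measurable]) auto
  finally show ?thesis .
 qed
 have \<alpha>t: "measure nu {y\<in>X. t (y 0) = v} = \<alpha> v" for v
 proof -
  have "{y\<in>X. t (y 0) = v} = (shift ^^ 1) -` {y\<in>X. s (y 0) = v} Int X"
   using shift_X by (auto simp: X_def shift_def)
  then show ?thesis using measure_pow[OF sB, of 1 s v] by (simp add: \<alpha>_def)
 qed
 have \<alpha>tE: "(\<integral>\<^sup>+e. ennreal (if t e = v then measure nu (cyl [e]) else 0) \<partial>count_space E) = ennreal (\<alpha> v)" for v
 proof -
  have "emeasure nu {y\<in>X. t (y 0) = v} = (\<integral>\<^sup>+e. emeasure nu ({y\<in>X. t (y 0) = v} Int cyl [e]) \<partial>count_space E)"
  proof (rule emeasure_edge_split[OF sets_nu sB _ _ cyl_Cons_disjoint])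
   show "{y\<in>X. t (y 0) = v}\<subseteq>(\<Union>e\<in>E. cyl [e])" using X_E by (auto simp: cyl_def)
  qed simp
  also have "... = (\<integral>\<^sup>+e. ennreal (if t e = v then measure nu (cyl [e]) else 0) \<partial>count_space E)"
  proof (rule nn_integral_cong)
   fix e
   have "{y\<in>X. t (y 0) = v} Int cyl [e] = (if t e = v then cyl [e] else {})" by (auto simp: cyl_def)
   then show "emeasure nu ({y\<in>X. t (y 0) = v} Int cyl [e]) = ennreal (if t e = v then measure nu (cyl [e]) else 0)"
    by (simp add: emeasure_eq_measure)
  qed
  finally show ?thesis using \<alpha>t by (simp add: emeasure_eq_measure)
 qed
 have inv_cyl: "emeasure nu (cyl w) = (\<integral>\<^sup>+e. emeasure nu (cyl (e # w)) \<partial>count_space E)" for w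
 proof -
  have "measure nu (shift -` cyl w Int X) = measure nu (cyl w)" using measure_pow[of "cyl w" 1] by simp
  then have "emeasure nu (cyl w) = emeasure nu (shift -` cyl w Int X)" by (simp add: emeasure_eq_measure)
  also have "... = (\<integral>\<^sup>+e. emeasure nu (cyl (e # w)) \<partial>count_space E)" by (rule emeasure_shift_cyl[OF sets_nu])
  finally show ?thesis .
 qed
 have w0: "wprob w>=0" for w unfolding wprob_nth by (intro prod_nonneg) (simp add: pe_def)
 have le1: "measure nu (cyl w)<=\<alpha> (s (hd w)) * wprob w" if w: "w~=[]" for w
 proof -
  have "emeasure nu (cyl w)<=(\<integral>\<^sup>+e. ennreal (if t e = s (hd w) then measure nu (cyl [e]) else 0) * ennreal (wprob w) \<partial>count_space E)"
   unfolding inv_cyl[of w]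
  proof (rule nn_integral_mono)
   fix e
   show "emeasure nu (cyl (e # w))<=ennreal (if t e = s (hd w) then measure nu (cyl [e]) else 0) * ennreal (wprob w)"
   proof (cases "t e = s (hd w)")
    case True
    then show ?thesis using cyl_append_le[OF I h, of "[e]" w] w0[of w]
     by (simp add: emeasure_eq_measure ennreal_mult'[symmetric])
   next
    case False
    then have "cyl (e # w) = {}" using cyl_adm[of _ "e # w"] w by (auto simp: adm_Cons)
    then show ?thesis by simp
   qed
  qed
  also have "... = ennreal (\<alpha> (s (hd w))) * ennreal (wprob w)" by (simp add: nn_integral_multc \<alpha>tE)
  also have "... = ennreal (\<alpha> (s (hd w)) * wprob w)" by (simp add: ennreal_mult' \<alpha>_def)
  finally show ?thesis using w0[of w] by (simp add: emeasure_eq_measure \<alpha>_def)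
 qed
 have \<alpha>0: "\<alpha> v>=0" for v by (simp add: \<alpha>_def)
 have \<alpha>V: "\<alpha> v = 0" if "v\<notin>V" for v
 proof -
  have e: "{y\<in>X. s (y 0) = v} = {}" using s_V X_E that by auto
  show ?thesis unfolding \<alpha>_def e by simp
 qed
 have \<alpha>1: "(\<Sum>v\<in>V. \<alpha> v) = 1"
 proof -
  have "(\<Sum>v\<in>V. \<alpha> v) = measure nu (\<Union>v\<in>V. {y\<in>X. s (y 0) = v})" unfolding \<alpha>_def
   by (rule finite_measure_finite_Union[symmetric, OF finV]) (use sB in "auto simp: disjoint_family_on_def")
  also have "(\<Union>v\<in>V. {y\<in>X. s (y 0) = v}) = X" using s_V X_E by auto
  finally show ?thesis by (simp add: prob_X)
 qed
 have "(\<integral>\<^sup>+v. ennreal (\<alpha> v) \<partial>count_space UNIV) = (\<integral>\<^sup>+v. ennreal (\<alpha> v) \<partial>count_space V)"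
  by (subst nn_integral_count_space_indicator) (auto simp: indicator_def \<alpha>V intro!: nn_integral_cong)
 also have "... = 1" using finV \<alpha>0 \<alpha>1 by (simp add: nn_integral_count_space_finite sum_ennreal)
 finally have emb: "(\<integral>\<^sup>+v. ennreal (\<alpha> v) \<partial>count_space UNIV) = 1" .
 define q where "q = embed_pmf \<alpha>"
 have q: "pmf q v = \<alpha> v" for v unfolding q_def by (rule pmf_embed_pmf[OF \<alpha>0 emb])
 have qV: "set_pmf q\<subseteq>V" using \<alpha>V unfolding set_pmf_eq q by blast
 have step: "pmf q b<=pmf (bind_pmf q K) b" for b
 proof -
  have "ennreal (pmf q b)<=(\<integral>\<^sup>+e. ennreal (if t e = b then pmf q (s e) * pe e else 0) \<partial>count_space E)"
   unfolding q \<alpha>tE[symmetric]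
   by (rule nn_integral_mono) (use le1[of "[_]"] in "auto simp: wprob_def intro!: ennreal_leI")
  then show ?thesis unfolding edge_flow[OF qV] by simp
 qed
 have iter: "pmf q b<=pmf (bind_pmf q (Kn n)) b" for n b
 proof (induction n)
  case 0
  have "Kn 0 = return_pmf" by (rule ext) simp
  then show ?case by (simp add: bind_return_pmf')
 next
  case (Suc n)
  have "pmf (bind_pmf q (Kn n)) b<=pmf (bind_pmf (bind_pmf q K) (Kn n)) b"
  proof -
   have "set_pmf (bind_pmf q K)\<subseteq>V" using qV set_K by auto
   then show ?thesis unfolding pmf_bind_V[OF qV] by (subst pmf_bind_V) (auto intro!: sum_mono mult_right_mono step)
  qed
  also have "Kn (Suc n) = (%x. bind_pmf (K x) (Kn n))" by (rule ext) simp
  then have "bind_pmf (bind_pmf q K) (Kn n) = bind_pmf q (Kn (Suc n))" by (simp only: bind_assoc_pmf)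
  finally show ?case by (rule order_trans[OF Suc])
 qed
 have le2: "\<alpha> b<=pmf stationary b" if b: "b\<in>V" for b
 proof -
  have "(%n. \<Sum>c\<in>V. pmf q c * pmf (Kn n c) b) \<longlonglongrightarrow> (\<Sum>c\<in>V. pmf q c * pmf stationary b)"
   by (intro tendsto_sum tendsto_mult tendsto_const stationary(3) b)
  moreover have "(\<Sum>c\<in>V. pmf q c * pmf stationary b) = pmf stationary b" using \<alpha>1 by (simp add: sum_distrib_right[symmetric] q)
  ultimately have "(%n. \<Sum>c\<in>V. pmf q c * pmf (Kn n c) b) \<longlonglongrightarrow> pmf stationary b" by simp
  then show ?thesis using iter[of b] unfolding pmf_bind_V[OF qV] by (intro LIMSEQ_le_const) (auto simp: q)
 qed
 have chain: "prob_space chain" "space chain = X" "sets chain = sets B" using chain_inv by (auto simp: invariant_probabilities_def)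
 show ?thesis
 proof (rule prob_le_cyl_eq[OF prob_nu space_nu sets_nu chain])
  fix w
  show "emeasure nu (cyl w)<=emeasure chain (cyl w)"
  proof (cases "adm w \<and> w~=[]")
   case True
   then have "s (hd w)\<in>V" using s_V by (cases w) (auto simp: adm_Cons)
   then have "\<alpha> (s (hd w)) * wprob w<=pmf stationary (s (hd w)) * wprob w" using le2 w0 by (intro mult_right_mono) auto
   then show ?thesis using le1[of w] True by (simp add: chain_cyl emeasure_eq_measure ennreal_leI)
  next
   case False
   show ?thesis
   proof (cases "w = []")
    case True
    then show ?thesis using prob_space.emeasure_space_1[OF chain(1)] chain(2) emeasure_space_1 by (simp add: cyl_Nil)
   next
    case w: False
    then have "cyl w = {}" using cyl_adm False by blast
    then show ?thesis by simp
   qed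
  qed
 qed
qed

end

subsection \<open>Entropy of the Markov measure\<close>

context edge_shift
begin

sublocale chain: inv_measure E s t V p chain
 by unfold_locales (rule chain_inv)

lemma chain_snoc_le: assumes e: "e\<in>E" shows "emeasure chain (cyl (w @ [e]))<=emeasure chain (cyl w) * ennreal (pe e)"
proof (cases "adm (w @ [e])")
 case False
 then have "cyl (w @ [e]) = {}" using cyl_adm by blast
 then show ?thesis by simp
next
 case adm: True
 show ?thesis
 proof (cases "w = []")
  case True
  have "pmf stationary (s e) * pe e<=pe e" by (rule mult_left_le_one_le) (auto simp: pe_def pmf_le_1)
  then show ?thesis using True chain_cyl[OF adm] chain.emeasure_space_1 by (simp add: cyl_Nil wprob_def ennreal_leI)
 next
  case False
  then have "adm w" using adm by (auto simp: adm_def successively_append_iff)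
  then show ?thesis using chain_cyl[OF adm] chain_cyl[of w] False
   by (simp add: wprob_snoc ennreal_mult''[symmetric] pe_def mult.assoc)
 qed
qed

text \<open>The bound has to hold under incomplete knowledge of the past, because a finite partition
  hides the letters outside D.\<close>

lemma chain_coord_le: assumes e: "e\<in>E" shows "measure chain {x\<in>pcyl n U. x n = e}<=measure chain (pcyl n U) * pe e"
proof -
 let ?U = "{w\<in>U. length w = n \<and> set w\<subseteq>E}"
 have c: "countable ?U" by (rule countable_subset[OF _ countable_words]) auto
 have p: "pcyl n U = (\<Union>w\<in>?U. cyl w)"
 proof (intro equalityI subsetI)
  fix y assume "y\<in>pcyl n U"
  then have y: "y\<in>X" "map y [0..<n]\<in>U" by (auto simp: pcyl_def)
  then show "y\<in>(\<Union>w\<in>?U. cyl w)" using cyl_map[OF y(1), of n] prefix_words[OF y(1), of n]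
   by (intro UN_I[of "map y [0..<n]"]) auto
 next
  fix y assume "y\<in>(\<Union>w\<in>?U. cyl w)"
  then obtain w where w: "w\<in>U" "length w = n" "y\<in>cyl w" by auto
  then show "y\<in>pcyl n U" unfolding cyl_pcyl by (auto simp: pcyl_def)
 qed
 have "{x\<in>pcyl n U. x n = e} = (\<Union>w\<in>?U. cyl (w @ [e]))" unfolding p by (auto simp: cyl_snoc)
 moreover have d: "disjoint_family_on cyl ?U" by (auto simp: disjoint_family_on_def cyl_pcyl pcyl_def)
 have "disjoint_family_on (%w. cyl (w @ [e])) ?U"
  unfolding disjoint_family_on_def
 proof (intro ballI impI)
  fix w w' assume "w\<in>?U" "w'\<in>?U" "w~=w'"
  then have "cyl w Int cyl w' = {}" using d unfolding disjoint_family_on_def by blast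
  then show "cyl (w @ [e]) Int cyl (w' @ [e]) = {}" using cyl_snoc by blast
 qed
 ultimately have "emeasure chain {x\<in>pcyl n U. x n = e} = (\<integral>\<^sup>+w. emeasure chain (cyl (w @ [e])) \<partial>count_space ?U)"
  using c by (simp add: emeasure_UN_countable)
 also have "...<=(\<integral>\<^sup>+w. emeasure chain (cyl w) * ennreal (pe e) \<partial>count_space ?U)"
  by (intro nn_integral_mono chain_snoc_le e)
 also have "... = emeasure chain (pcyl n U) * ennreal (pe e)"
  unfolding p by (subst emeasure_UN_countable[OF _ c d]) (auto simp: nn_integral_multc)
 finally show ?thesis by (simp add: chain.emeasure_eq_measure ennreal_mult'[symmetric] pe_def)
qed

lemma chain_agree_le:
 assumes y: "y\<in>X"
 shows "measure chain {x\<in>X. ALL i<n. y i\<in>D --> x i = y i}<=(\<Prod>i<n. if y i\<in>D then pe (y i) else 1)"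
proof (induction n)
 case 0
 show ?case using chain.prob_X by simp
next
 case (Suc n)
 have p: "{x\<in>X. ALL i<n. y i\<in>D --> x i = y i} = pcyl n {w. ALL i<n. y i\<in>D --> w ! i = y i}"
  by (auto simp: pcyl_def)
 show ?case
 proof (cases "y n\<in>D")
  case True
  have "{x\<in>X. ALL i<Suc n. y i\<in>D --> x i = y i} = {x\<in>{x\<in>X. ALL i<n. y i\<in>D --> x i = y i}. x n = y n}"
   using True by (auto simp: less_Suc_eq)
  then have "measure chain {x\<in>X. ALL i<Suc n. y i\<in>D --> x i = y i}<=measure chain {x\<in>X. ALL i<n. y i\<in>D --> x i = y i} * pe (y n)"
   unfolding p using chain_coord_le[OF X_E[OF y]] by simp
  also have "...<=(\<Prod>i<n. if y i\<in>D then pe (y i) else 1) * pe (y n)" by (rule mult_right_mono[OF Suc]) (simp add: pe_def)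
  finally show ?thesis using True by simp
 next
  case False
  then have "{x\<in>X. ALL i<Suc n. y i\<in>D --> x i = y i} = {x\<in>X. ALL i<n. y i\<in>D --> x i = y i}"
   by (auto simp: less_Suc_eq)
  then show ?thesis using Suc False by simp
 qed
qed

text \<open>The partition singles out the edges of D and lumps the others into R. A cell of the
  refinement fixes the letters in D, so by \<open>chain_agree_le\<close> its measure is at most the
  product of their probabilities, and the entropy is at least the information carried by D.\<close>

lemma ks_chain_lower_finite:
 assumes D: "finite D" "D\<subseteq>E"
 shows "ks_entropy chain shift>=ereal (\<integral>y. (if y 0\<in>D then info y else 0) \<partial>chain)"
proof -
 define R where "R = X - (\<Union>e\<in>D. cyl [e])"
 \<comment> \<open>A partition has no empty cells, but R may be empty.\<close>
 define P where "P = insert R ((%e. cyl [e]) ` D) - {{}}"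
 have R: "y\<in>R \<longleftrightarrow> y\<in>X \<and> y 0\<notin>D" for y by (auto simp: R_def cyl_def)
 have P_cases: "A = R \<or> (EX e:D. A = cyl [e])" if "A\<in>P" for A using that unfolding P_def by blast
 have finP: "finite P" using D by (simp add: P_def)
 have single: "y\<in>cyl [e] \<longleftrightarrow> y\<in>X \<and> y 0 = e" for y e by (simp add: cyl_def)
 have "R\<in>sets B"
  unfolding R_def using sets.top[of B] D by (intro sets.Diff sets.finite_UN) auto
 then have mP: "P\<subseteq>sets chain" by (auto simp: P_def)
 have part: "partition_on X P"
 proof (rule partition_onI)
  show "\<Union>P = X"
  proof (intro equalityI subsetI)
   fix y assume "y\<in>\<Union>P"
   then obtain A where "A\<in>P" "y\<in>A" by blast
   then show "y\<in>X" using P_cases[of A] R[of y] single[of y] by metis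
  next
   fix y assume y: "y\<in>X"
   show "y\<in>\<Union>P"
   proof (cases "y 0\<in>D")
    case True
    then have "cyl [y 0]\<in>P" using single[of y "y 0"] y unfolding P_def by blast
    then show ?thesis using single[of y "y 0"] y by blast
   next
    case False
    then have "R\<in>P" using R[of y] y unfolding P_def by blast
    then show ?thesis using R[of y] y False by blast
   qed
  qed
  show "disjnt A B" if "A\<in>P" "B\<in>P" "A~=B" for A B
   unfolding disjnt_iff using P_cases[OF that(1)] P_cases[OF that(2)] that(3) R single by metis
 qed (auto simp: P_def)
 interpret inv_partition E s t V p chain P by unfold_locales (use finP mP part in auto)
 let ?h = "%y. if y 0\<in>D then info y else 0"
 have hB: "?h\<in>borel_measurable B"
  unfolding info_def by (rule real_coord_measurable[of "%e. if e\<in>D then - ln (pe e) else 0"])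
 have hI: "integrable chain ?h"
 proof (rule chain.integrable_const_bound)
  show "AE y in chain. norm (?h y)<=Max ((%e. \<bar>ln (pe e)\<bar>) ` D Un {0})"
   using D by (intro AE_I2) (auto simp: info_def)
  show "?h\<in>borel_measurable chain" by (rule chain.meas_nu[OF hB])
 qed
 have lower: "entr chain P n>=n * (\<integral>y. ?h y \<partial>chain)" for n
 proof -
  have "(\<integral>y. ln (measure chain (cells_set n (itin P n y))) \<partial>chain)<=(\<integral>y. (\<Sum>i<n. - ?h ((shift ^^ i) y)) \<partial>chain)"
  proof (rule integral_mono_AE[OF finite_itin_integral(1)])
   show "integrable chain (%y. \<Sum>i<n. - ?h ((shift ^^ i) y))"
    using chain.integrable_pow[OF hI] by (intro Bochner_Integration.integrable_sum) simp
   show "AE y in chain. ln (measure chain (cells_set n (itin P n y)))<=(\<Sum>i<n. - ?h ((shift ^^ i) y))"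
    using AE_cells_pos[of n] AE_space
   proof eventually_elim
    case (elim y)
    then have y: "y\<in>X" by simp
    have "cells_set n (itin P n y)\<subseteq>{x\<in>X. ALL i<n. y i\<in>D --> x i = y i}"
    proof (intro subsetI CollectI conjI allI impI)
     fix x assume x: "x\<in>cells_set n (itin P n y)"
     then show xX: "x\<in>X" by (simp add: cells_set_def)
     fix i assume i: "i < n" "y i\<in>D"
     have ci: "(shift ^^ i) y\<in>cyl [y i]" using shift_pow_X[OF y, of i] by (simp add: cyl_def shift_pow)
     then have "cyl [y i]\<in>P" using i by (auto simp: P_def)
     then have "cell_of P ((shift ^^ i) y) = cyl [y i]" using cell_of(3)[OF shift_pow_X[OF y]] ci by blast
     moreover have "(shift ^^ i) x\<in>cell_of P ((shift ^^ i) y)" using x i by (simp add: cells_set_def itin_def)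
     ultimately have "(shift ^^ i) x 0 = y i" by (simp add: cyl_def)
     then show "x i = y i" by (simp add: shift_pow)
    qed
    moreover have "{x\<in>X. ALL i<n. y i\<in>D --> x i = y i}\<in>sets chain"
    proof -
     have "{x\<in>X. ALL i<n. y i\<in>D --> x i = y i} = pcyl n {w. ALL i<n. y i\<in>D --> w ! i = y i}"
      by (auto simp: pcyl_def)
     then show ?thesis by simp
    qed
    ultimately have "measure chain (cells_set n (itin P n y))<=(\<Prod>i<n. if y i\<in>D then pe (y i) else 1)"
     using chain.finite_measure_mono chain_agree_le[OF y] order_trans by meson
    moreover have pp: "(if y i\<in>D then pe (y i) else 1) > 0" for i using pe_pos[OF X_E[OF y]] by simp
    ultimately have "ln (measure chain (cells_set n (itin P n y)))<=ln (\<Prod>i<n. if y i\<in>D then pe (y i) else 1)"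
     using elim(1) by (subst ln_le_cancel_iff) (auto intro!: prod_pos)
    also have "... = (\<Sum>i<n. ln (if y i\<in>D then pe (y i) else 1))"
     by (rule ln_prod[OF finite_lessThan]) (rule less_imp_neq[OF pp, symmetric])
    also have "... = (\<Sum>i<n. - ?h ((shift ^^ i) y))" by (intro sum.cong refl) (simp add: shift_pow info_def)
    finally show ?case .
   qed
  qed
  also have "... = (\<Sum>i<n. - (\<integral>y. ?h y \<partial>chain))"
   using chain.integrable_pow[OF hI] chain.integral_pow[OF hB] by (subst Bochner_Integration.integral_sum) auto
  finally show ?thesis unfolding entr_integral by simp
 qed
 have "(%n. entr chain P n / n) \<longlonglongrightarrow> lim (%n. entr chain P n / n)"
  using entropy_rate_convergent by (simp add: convergent_LIMSEQ_iff)
 then have "(\<integral>y. ?h y \<partial>chain)<=lim (%n. entr chain P n / n)"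
  by (rule LIMSEQ_le_const) (use lower in "auto intro!: exI[of _ 1] simp: field_simps")
 then have "ereal (\<integral>y. ?h y \<partial>chain)<=ereal (lim (%n. partition_entropy chain (refined_partition chain shift P n) / n))"
  unfolding entropy_eq by simp
 also have "...<=ks_entropy chain shift" unfolding ks_entropy_def
  by (rule SUP_upper) (use finP mP part in auto)
 finally show ?thesis .
qed

text \<open>Finite sets of edges exhaust E, and integrability of \<open>info\<close> makes the
  partial informations converge.\<close>

lemma ks_chain_lower:
 assumes I: "integrable chain info"
 shows "ks_entropy chain shift>=ereal (\<integral>y. info y \<partial>chain)"
proof -
 define D where "D N = {e\<in>E. to_nat_on E e < N}" for N
 have D: "finite (D N)" "D N\<subseteq>E" for N
  using finite_enumerated_below[OF countable_E] by (auto simp: D_def)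
 have m: "(%y. if y 0\<in>D N then info y else 0)\<in>borel_measurable chain" for N
  unfolding info_def
  by (rule chain.meas_nu) (rule real_coord_measurable[of "%e. if e\<in>D N then - ln (pe e) else 0"])
 have "(%N. \<integral>y. (if y 0\<in>D N then info y else 0) \<partial>chain) \<longlonglongrightarrow> (\<integral>y. info y \<partial>chain)"
 proof (rule integral_dominated_convergence[OF _ m I])
  show "info\<in>borel_measurable chain" by (rule chain.meas_nu[OF info_measurable])
  show "AE y in chain. norm (if y 0\<in>D N then info y else 0)<=info y" for N
   by (rule AE_I2) (use info_nonneg in auto)
  show "AE y in chain. (%N. if y 0\<in>D N then info y else 0) \<longlonglongrightarrow> info y"
  proof (rule AE_I2)
   fix y assume "y\<in>space chain"
   then have "y 0\<in>E" using X_E by simp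
   then have "eventually (%N. (if y 0\<in>D N then info y else 0) = info y) sequentially"
    unfolding eventually_sequentially by (intro exI[of _ "Suc (to_nat_on E (y 0))"]) (auto simp: D_def)
   then show "(%N. if y 0\<in>D N then info y else 0) \<longlonglongrightarrow> info y" by (rule tendsto_eventually)
  qed
 qed
 then have "(%N. ereal (\<integral>y. (if y 0\<in>D N then info y else 0) \<partial>chain)) \<longlonglongrightarrow> ereal (\<integral>y. info y \<partial>chain)"
  by simp
 then show ?thesis
  by (rule LIMSEQ_le_const2) (use ks_chain_lower_finite[OF D] in blast)
qed

lemma chain_info_integrable:
 assumes "(\<integral>\<^sup>+e. ennreal (pe e * - ln (pe e)) \<partial>count_space E) < \<infinity>"
 shows "integrable chain info"
proof (rule integrableI_nonneg)
 show "info\<in>borel_measurable chain" by (rule chain.meas_nu[OF info_measurable])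
 show "AE y in chain. 0<=info y" by (rule AE_I2) (use info_nonneg in auto)
 have "(\<integral>\<^sup>+y. ennreal (info y) \<partial>chain) = (\<integral>\<^sup>+y. (\<integral>\<^sup>+e. ennreal (- ln (pe e)) * indicator (cyl [e]) y \<partial>count_space E) \<partial>chain)"
 proof (rule nn_integral_cong)
  fix y assume "y\<in>space chain"
  then have y: "y\<in>X" by simp
  have "(\<integral>\<^sup>+e. ennreal (- ln (pe e)) * indicator (cyl [e]) y \<partial>count_space E)
   = (\<integral>\<^sup>+e. ennreal (info y) * indicator {y 0} e \<partial>count_space E)"
   using y by (intro nn_integral_cong) (auto simp: indicator_def cyl_def info_def)
  also have "... = ennreal (info y)" using X_E[OF y, of 0] by (simp add: nn_integral_cmult_indicator)
  finally show "ennreal (info y) = (\<integral>\<^sup>+e. ennreal (- ln (pe e)) * indicator (cyl [e]) y \<partial>count_space E)" by simp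
 qed
 also have "... = (\<integral>\<^sup>+e. (\<integral>\<^sup>+y. ennreal (- ln (pe e)) * indicator (cyl [e]) y \<partial>chain) \<partial>count_space E)"
 proof (rule nn_integral_count_space_nn_integral[OF countable_E])
  fix e show "(%y. ennreal (- ln (pe e)) * indicator (cyl [e]) y)\<in>borel_measurable chain"
   by (intro borel_measurable_times_ennreal borel_measurable_indicator) auto
 qed
 also have "...<=(\<integral>\<^sup>+e. ennreal (pe e * - ln (pe e)) \<partial>count_space E)"
 proof (rule nn_integral_mono)
  fix e assume "e\<in>space (count_space E)"
  then have e: "e\<in>E" by simp
  have l: "- ln (pe e)>=0" using pe_pos[OF e] pe_le_1[of e] by simp
  have "emeasure chain (cyl [e])<=ennreal (pe e)" using chain_snoc_le[OF e, of "[]"] chain.emeasure_space_1 by (simp add: cyl_Nil)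
  then have "ennreal (- ln (pe e)) * emeasure chain (cyl [e])<=ennreal (- ln (pe e)) * ennreal (pe e)" by (rule mult_left_mono) simp
  also have "... = ennreal (pe e * - ln (pe e))" unfolding ennreal_mult'[OF l, symmetric] by (simp add: mult.commute)
  finally show "(\<integral>\<^sup>+y. ennreal (- ln (pe e)) * indicator (cyl [e]) y \<partial>chain)<=ennreal (pe e * - ln (pe e))"
   by (simp add: nn_integral_cmult_indicator)
 qed
 also have "... < \<infinity>" by fact
 finally show "(\<integral>\<^sup>+y. ennreal (info y) \<partial>chain) < \<infinity>" .
qed

text \<open>The potential is c - info up to a coboundary, whose integral against an invariant
  measure vanishes. So entropy competes with mean information, the supremum is c, and equality is
  the case of \<open>uniqueness\<close>.\<close>

lemma equilibrium_state_iff: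
 assumes I: "integrable chain info"
  and \<phi>: "!!y. y\<in>X ==> \<phi> y = c - info y + u (s (y 0)) - u (s (y 1))"
 shows "equilibrium_state B shift \<phi> nu \<longleftrightarrow> nu = chain"
proof -
 have ph: "integrable nu \<phi> \<longleftrightarrow> integrable nu info" "integrable nu info ==> (\<integral>y. \<phi> y \<partial>nu) = c - (\<integral>y. info y \<partial>nu)"
  if "nu\<in>invariant_probabilities B shift" for nu
 proof -
  interpret inv_measure E s t V p nu by unfold_locales (rule that)
  let ?u = "%y. u (s (y 0))"
  have ui: "integrable nu ?u"
  proof (rule integrable_const_bound)
   show "AE y in nu. norm (?u y)<=Max ((%v. \<bar>u v\<bar>) ` V)"
    using finV s_V X_E by (intro AE_I2) auto
   show "?u\<in>borel_measurable nu" by (rule meas_nu) (rule real_coord_measurable)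
  qed
  have u1: "integrable nu (%y. u (s (y 1)))" "(\<integral>y. u (s (y 1)) \<partial>nu) = (\<integral>y. ?u y \<partial>nu)"
   using integrable_pow[OF ui, of 1] integral_pow[of ?u 1, OF real_coord_measurable] by (simp_all add: shift_def)
  have e: "\<phi> y = c - info y + ?u y - u (s (y 1))" "info y = c - \<phi> y + ?u y - u (s (y 1))" if "y\<in>space nu" for y
   using \<phi>[of y] that by simp_all
  show "integrable nu \<phi> \<longleftrightarrow> integrable nu info"
  proof
   assume "integrable nu \<phi>"
   then show "integrable nu info"
    by (subst Bochner_Integration.integrable_cong[OF refl e(2)]) (use ui u1 in "auto intro!: Bochner_Integration.integrable_add Bochner_Integration.integrable_diff")
  next
   assume "integrable nu info"
   then show "integrable nu \<phi>"
    by (subst Bochner_Integration.integrable_cong[OF refl e(1)]) (use ui u1 in "auto intro!: Bochner_Integration.integrable_add Bochner_Integration.integrable_diff")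
  qed
  assume ii: "integrable nu info"
  have "(\<integral>y. \<phi> y \<partial>nu) = (\<integral>y. c - info y + ?u y - u (s (y 1)) \<partial>nu)"
   by (rule Bochner_Integration.integral_cong[OF refl e(1)])
  also have "... = c - (\<integral>y. info y \<partial>nu) + (\<integral>y. ?u y \<partial>nu) - (\<integral>y. u (s (y 1)) \<partial>nu)"
   using ii ui u1(1) by (simp add: prob_X)
  finally show "(\<integral>y. \<phi> y \<partial>nu) = c - (\<integral>y. info y \<partial>nu)" using u1(2) by simp
 qed
 have up: "ks_entropy nu shift<=ereal (\<integral>y. info y \<partial>nu)" if "nu\<in>invariant_probabilities B shift" "integrable nu info" for nu
 proof -
  interpret inv_measure E s t V p nu by unfold_locales (rule that(1))
  \<comment> \<open>Any admissible pair of edges will do: for ep = 0 the gain vanishes and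
    \<open>ks_upper\<close> becomes the plain bound.\<close>
  obtain v where "v\<in>V" using neV by blast
  then obtain e e' where "e\<in>E" "e'\<in>E" "t e = s e'" using two_step by blast
  then have "adm ([e] @ [e'])" by (simp add: adm_def)
  from ks_upper[OF that(2) _ this, of 0] show ?thesis by (simp add: mean_gain_def)
 qed
 have press: "ks_entropy nu shift + ereal (\<integral>y. \<phi> y \<partial>nu)<=ereal c"
  if nu: "nu\<in>invariant_probabilities B shift" "integrable nu \<phi>" for nu
 proof -
  have i: "integrable nu info" using ph(1) nu by blast
  have "ks_entropy nu shift + ereal (\<integral>y. \<phi> y \<partial>nu)<=ereal (\<integral>y. info y \<partial>nu) + ereal (\<integral>y. \<phi> y \<partial>nu)"
   by (rule add_right_mono[OF up[OF nu(1) i]])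
  then show ?thesis using ph(2)[OF nu(1) i] by simp
 qed
 have chain_phi: "integrable chain \<phi>" using ph(1)[OF chain_inv] I by blast
 have chain_press: "ks_entropy chain shift + ereal (\<integral>y. \<phi> y \<partial>chain) = ereal c"
 proof -
  have "ks_entropy chain shift = ereal (\<integral>y. info y \<partial>chain)"
   using up[OF chain_inv I] ks_chain_lower[OF I] by (rule antisym)
  then show ?thesis using ph(2)[OF chain_inv I] by simp
 qed
 have sup: "(SUP nu\<in>{nu\<in>invariant_probabilities B shift. integrable nu \<phi>}. ks_entropy nu shift + ereal (\<integral>y. \<phi> y \<partial>nu)) = ereal c"
 proof (rule antisym)
  show "(SUP nu\<in>{nu\<in>invariant_probabilities B shift. integrable nu \<phi>}. ks_entropy nu shift + ereal (\<integral>y. \<phi> y \<partial>nu))<=ereal c"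
   by (rule SUP_least) (use press in blast)
  show "ereal c<=(SUP nu\<in>{nu\<in>invariant_probabilities B shift. integrable nu \<phi>}. ks_entropy nu shift + ereal (\<integral>y. \<phi> y \<partial>nu))"
   by (rule SUP_upper2[of chain]) (use chain_inv chain_phi chain_press in auto)
 qed
 show ?thesis
 proof
  assume "equilibrium_state B shift \<phi> nu"
  then have nu: "nu\<in>invariant_probabilities B shift" "integrable nu \<phi>" "ks_entropy nu shift + ereal (\<integral>y. \<phi> y \<partial>nu) = ereal c"
   unfolding equilibrium_state_def sup by auto
  have i: "integrable nu info" using ph(1) nu by blast
  interpret inv_measure E s t V p nu by unfold_locales (rule nu(1))
  have "ks_entropy nu shift>=ereal (\<integral>y. info y \<partial>nu)"
   using nu(3) ph(2)[OF nu(1) i] by (cases "ks_entropy nu shift") auto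
  from uniqueness[OF i this] show "nu = chain" .
 next
  assume "nu = chain"
  then show "equilibrium_state B shift \<phi> nu" unfolding equilibrium_state_def sup using chain_inv chain_phi chain_press by simp
 qed
qed

end

subsection \<open>Closed paths\<close>

text \<open>Redrawing a sample uniformly within its class does not change a law that is constant on
  classes. The classes will be the periodic orbits.\<close>

lemma bind_pmf_of_set_classes:
 assumes D: "!!x. x\<in>set_pmf D ==> finite (C x) \<and> x\<in>C x"
  and cls: "!!x z. x\<in>set_pmf D ==> z\<in>C x ==> C z = C x \<and> pmf D z = pmf D x"
 shows "bind_pmf D (%x. pmf_of_set (C x)) = D"
proof (rule pmf_eqI)
 fix z
 have zin: "z\<in>set_pmf D" if "x\<in>set_pmf D" "z\<in>C x" for x
  using conjunct2[OF cls[OF that]] that(1) unfolding set_pmf_iff by simp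
 have e: "pmf (pmf_of_set (C x)) z = indicator (C x) z / card (C x)" if "x\<in>set_pmf D" for x
  by (intro pmf_of_set) (use D[OF that] in blast)+
 show "pmf (bind_pmf D (%x. pmf_of_set (C x))) z = pmf D z"
 proof (cases "z\<in>set_pmf D")
  case True
  then have C: "finite (C z)" "z\<in>C z" using D[OF True] by blast+
  have "pmf (bind_pmf D (%x. pmf_of_set (C x))) z = (\<integral>x. indicator (C z) x / card (C z) \<partial>measure_pmf D)"
   unfolding pmf_bind
  proof (intro integral_cong_AE)
   show "AE x in measure_pmf D. pmf (pmf_of_set (C x)) z = indicator (C z) x / real (card (C z))"
   proof (rule AE_pmfI)
    fix x assume x: "x\<in>set_pmf D"
    show "pmf (pmf_of_set (C x)) z = indicator (C z) x / real (card (C z))"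
    proof (cases "z\<in>C x")
     case zx: True
     then have "C z = C x" using cls[OF x] by blast
     moreover have "x\<in>C x" using D[OF x] by blast
     ultimately show ?thesis using e[OF x] zx by simp
    next
     case zx: False
     then have "x\<notin>C z" using cls[OF True, of x] C(2) by blast
     then show ?thesis using e[OF x] zx by simp
    qed
   qed
  qed simp_all
  also have "... = (\<Sum>x\<in>C z. pmf D x) / card (C z)"
   using C(1) by (simp add: measure_measure_pmf_finite)
  also have "(\<Sum>x\<in>C z. pmf D x) = (\<Sum>x\<in>C z. pmf D z)" by (intro sum.cong refl) (use cls[OF True] in blast)
  finally show ?thesis using C(1) card_gt_0_iff[of "C z"] C(2) by auto
 next
  case False
  have "z\<notin>set_pmf (bind_pmf D (%x. pmf_of_set (C x)))"
  proof
   assume "z\<in>set_pmf (bind_pmf D (%x. pmf_of_set (C x)))"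
   then obtain x where x: "x\<in>set_pmf D" "z\<in>set_pmf (pmf_of_set (C x))" by auto
   moreover have "finite (C x)" "C x~={}" using D[OF x(1)] by blast+
   ultimately have "z\<in>C x" by (simp add: set_pmf_of_set)
   then show False using zin[OF x(1)] False by blast
  qed
  then have "pmf (bind_pmf D (%x. pmf_of_set (C x))) z = 0" unfolding pmf_eq_0_set_pmf .
  moreover have "pmf D z = 0" using False unfolding pmf_eq_0_set_pmf .
  ultimately show ?thesis by (simp only:)
 qed
qed

context edge_shift
begin

lemma locally_determined_measurable:
 fixes f :: "(nat => 'e) => 'm::metric_space"
 assumes f: "!!y e. y\<in>X ==> e > 0 ==> EX k. ALL z:X. (ALL i<k. z i = y i) --> dist (f z) (f y) < e"
 shows "f\<in>borel_measurable B"
proof (rule borel_measurableI)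
 fix S :: "'m set" assume S: "open S"
 have "f -` S Int X = \<Union> (cyl ` {w. set w\<subseteq>E \<and> cyl w\<subseteq>f -` S Int X})"
 proof (intro equalityI subsetI)
  fix y assume y: "y\<in>f -` S Int X"
  then obtain e where e: "e > 0" "ball (f y) e\<subseteq>S" using S open_contains_ball by blast
  obtain k where k: "ALL z:X. (ALL i<k. z i = y i) --> dist (f z) (f y) < e" using f[of y e] y e by blast
  have "cyl (map y [0..<k])\<subseteq>f -` S Int X"
  proof
   fix z assume z: "z\<in>cyl (map y [0..<k])"
   then have zX: "z\<in>X" using cyl_sub by blast
   then have "dist (f z) (f y) < e" using k cyl_mapD[OF z] by blast
   then show "z\<in>f -` S Int X" using e(2) zX by (auto simp: dist_commute)
  qed
  then show "y\<in>\<Union> (cyl ` {w. set w\<subseteq>E \<and> cyl w\<subseteq>f -` S Int X})"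
   using y cyl_map[of y k] prefix_words[of y k] by blast
 qed blast
 also have "...\<in>sets B"
  by (intro sets.countable_Union countable_image countable_subset[OF _ countable_words]) auto
 finally show "f -` S Int space B\<in>sets B" by simp
qed

section \<open>Random paths and the weights of closed paths\<close>

definition endv :: "'v => 'e list => 'v" where "endv a w = (if w = [] then a else t (last w))"

fun paths :: "nat => 'v => 'e list pmf" where
 "paths 0 a = return_pmf []"
| "paths (Suc n) a = bind_pmf (p a) (%e. map_pmf ((#) e) (paths n (t e)))"

lemma endv_Cons: "endv a (e # w) = endv (t e) w" by (simp add: endv_def)

lemma map_endv_paths: "map_pmf (endv a) (paths n a) = Kn n a"
proof (induction n arbitrary: a)
 case (Suc n)
 have "map_pmf (endv a) (paths (Suc n) a) = bind_pmf (p a) (%e. map_pmf (endv (t e)) (paths n (t e)))"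
  by (simp add: map_bind_pmf pmf.map_comp comp_def endv_Cons)
 also have "... = Kn (Suc n) a" by (simp add: Suc K_def bind_map_pmf)
 finally show ?case .
qed (simp add: endv_def)

lemma paths_length: "w\<in>set_pmf (paths n a) ==> length w = n"
 by (induction n arbitrary: a w) auto

lemma paths_add: "paths (m + n) a = bind_pmf (paths m a) (%w. map_pmf ((@) w) (paths n (endv a w)))"
proof (induction m arbitrary: a)
 case 0
 have "(@) [] = (%w :: 'e list. w)" by auto
 then show ?case by (simp add: bind_return_pmf endv_def pmf.map_ident)
next
 case (Suc m)
 have ap: "(@) (e # w) = (%w'. e # w @ w')" for e :: 'e and w by auto
 show ?case by (simp add: Suc map_bind_pmf bind_assoc_pmf bind_map_pmf pmf.map_comp comp_def endv_Cons ap)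
qed

lemma pmf_paths_Cons: "pmf (paths (Suc n) a) (e # w) = pmf (p a) e * pmf (paths n (t e)) w"
 using pmf_bind_map_inj[of "(#)" e w] by simp

lemma pmf_paths:
 "a\<in>V ==> pmf (paths n a) w = (if length w = n \<and> adm w \<and> (w~=[] --> s (hd w) = a) then wprob w else 0)"
proof (induction n arbitrary: a w)
 case 0
 then show ?case by (auto simp: indicator_def adm_def wprob_def)
next
 case (Suc n)
 show ?case
 proof (cases w)
  case Nil
  then have "w\<notin>set_pmf (paths (Suc n) a)" by auto
  then show ?thesis using Nil by (simp add: pmf_eq_0_set_pmf)
 next
  case (Cons e u)
  show ?thesis
  proof (cases "e\<in>E \<and> s e = a")
   case True
   then show ?thesis unfolding Cons pmf_paths_Cons using Suc.IH[of "t e" u] t_V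
    by (auto simp: adm_Cons wprob_Cons pe_def)
  next
   case False
   then have "pmf (p a) e = 0" using set_p[OF Suc.prems] by (auto simp: pmf_eq_0_set_pmf)
   then show ?thesis unfolding Cons pmf_paths_Cons using False by (auto simp: adm_Cons)
  qed
 qed
qed

definition loops :: "nat => 'e list set" where
 "loops n = {w. length w = n \<and> adm w \<and> t (last w) = s (hd w)}"

text \<open>A closed word is counted once, as a path that starts at its initial vertex a and returns
  to a.\<close>

lemma loops_paths:
 assumes n: "n > 0"
 shows "(\<integral>\<^sup>+w. ennreal (wprob w) * indicator (loops n Int S) w \<partial>count_space UNIV)
  = (\<Sum>a\<in>V. emeasure (measure_pmf (paths n a)) ({w. endv a w = a} Int S))"
proof -
 have e: "ennreal (wprob w) * indicator (loops n Int S) w = (\<Sum>a\<in>V. ennreal (pmf (paths n a) w) * indicator ({w. endv a w = a} Int S) w)" for w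
 proof (cases "w\<in>S \<and> length w = n \<and> adm w")
  case False
  then show ?thesis by (auto simp: loops_def pmf_paths)
 next
  case True
  then have ne: "w~=[]" using n by auto
  then have hV: "s (hd w)\<in>V" using True s_V by (cases w) (auto simp: adm_Cons)
  have "(\<Sum>a\<in>V. ennreal (pmf (paths n a) w) * indicator ({w. endv a w = a} Int S) w)
   = (\<Sum>a\<in>V. if a = s (hd w) then ennreal (wprob w) * indicator (loops n Int S) w else 0)"
   using True ne by (intro sum.cong refl) (auto simp: pmf_paths loops_def endv_def indicator_def)
  then show ?thesis using finV hV by simp
 qed
 have "(\<integral>\<^sup>+w. ennreal (wprob w) * indicator (loops n Int S) w \<partial>count_space UNIV)
  = (\<Sum>a\<in>V. \<integral>\<^sup>+w. ennreal (pmf (paths n a) w) * indicator ({w. endv a w = a} Int S) w \<partial>count_space UNIV)"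
  unfolding e by (rule nn_integral_sum) simp
 also have "... = (\<Sum>a\<in>V. emeasure (measure_pmf (paths n a)) ({w. endv a w = a} Int S))"
 proof (rule sum.cong[OF refl])
  fix a
  show "(\<integral>\<^sup>+w. ennreal (pmf (paths n a) w) * indicator ({w. endv a w = a} Int S) w \<partial>count_space UNIV)
   = emeasure (measure_pmf (paths n a)) ({w. endv a w = a} Int S)"
   by (simp add: nn_integral_pmf nn_integral_count_space_indicator[symmetric])
 qed
 finally show ?thesis .
qed

text \<open>By \<open>loops_total\<close> this is the total weight of the closed words; as it tends
  to 1, it can serve as normalisation for large n.\<close>

definition trace :: "nat => real" where "trace n = (\<Sum>a\<in>V. pmf (Kn n a) a)"

lemma emeasure_endv: "emeasure (measure_pmf (paths n a)) {w. endv a w = b} = ennreal (pmf (Kn n a) b)"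
 unfolding map_endv_paths[symmetric] ennreal_pmf_map by (simp add: vimage_def)

lemma loops_total: assumes "n > 0"
 shows "(\<integral>\<^sup>+w. ennreal (wprob w) * indicator (loops n) w \<partial>count_space UNIV) = ennreal (trace n)"
 using loops_paths[OF assms, of UNIV] by (simp add: emeasure_endv trace_def sum_ennreal)

text \<open>Having read u, the path has to return from the end of u to its start within the
  remaining n - length u steps.\<close>

lemma loops_prefix:
 assumes u: "adm u" "u~=[]" and n: "length u<=n"
 shows "(\<integral>\<^sup>+w. ennreal (wprob w) * indicator (loops n Int {w. take (length u) w = u}) w \<partial>count_space UNIV)
  = ennreal (wprob u * pmf (Kn (n - length u) (t (last u))) (s (hd u)))"
proof -
 let ?k = "length u" and ?b = "t (last u)" and ?S = "{w. take (length u) w = u}"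
 obtain m where m: "n = ?k + m" using n le_Suc_ex by blast
 have n0: "n > 0" using u n by (metis length_greater_0_conv less_le_trans)
 have hV: "s (hd u)\<in>V" using u s_V by (cases u) (auto simp: adm_Cons)
 have w0: "wprob u > 0" using u by (intro wprob_pos) (simp add: adm_def)
 have "emeasure (measure_pmf (paths n a)) ({w. endv a w = a} Int ?S) = (if a = s (hd u) then ennreal (wprob u * pmf (Kn m ?b) a) else 0)" if a: "a\<in>V" for a
 proof -
  have in1: "emeasure (measure_pmf (map_pmf ((@) w) (paths m (endv a w)))) ({w. endv a w = a} Int ?S)
    = indicator {u} w * ennreal (pmf (Kn m ?b) a)" if w: "w\<in>set_pmf (paths ?k a)" for w
  proof (cases "w = u")
   case True
   have e: "endv a (u @ w') = endv ?b w'" for w' using u(2) by (simp add: endv_def)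
   have "emeasure (measure_pmf (map_pmf ((@) u) (paths m (endv a u)))) ({w. endv a w = a} Int ?S)
    = emeasure (measure_pmf (paths m ?b)) {w. endv ?b w = a}"
    using u by (simp add: emeasure_map_pmf vimage_def e endv_def[of a u])
   then show ?thesis using True by (simp add: emeasure_endv)
  next
   case False
   then have "((@) w) -` ({w. endv a w = a} Int ?S) = {}" using paths_length[OF w] by auto
   then show ?thesis using False by (simp add: emeasure_map_pmf)
  qed
  have "emeasure (measure_pmf (paths n a)) ({w. endv a w = a} Int ?S)
    = (\<integral>\<^sup>+w. emeasure (measure_pmf (map_pmf ((@) w) (paths m (endv a w)))) ({w. endv a w = a} Int ?S) \<partial>measure_pmf (paths ?k a))"
   unfolding m paths_add by (rule emeasure_bind_pmf)
  also have "... = (\<integral>\<^sup>+w. indicator {u} w * ennreal (pmf (Kn m ?b) a) \<partial>measure_pmf (paths ?k a))"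
   by (rule nn_integral_cong_AE) (rule AE_pmfI, rule in1)
  also have "... = emeasure (measure_pmf (paths ?k a)) {u} * ennreal (pmf (Kn m ?b) a)"
   by (subst nn_integral_multc) simp_all
  also have "... = (if a = s (hd u) then ennreal (wprob u * pmf (Kn m ?b) a) else 0)"
   using u w0 by (auto simp: emeasure_pmf_single pmf_paths[OF a] ennreal_mult')
  finally show ?thesis .
 qed
 then show ?thesis unfolding loops_paths[OF n0] using finV hV m by simp
qed

lemma trace_tendsto: "trace \<longlonglongrightarrow> 1"
proof -
 have "trace \<longlonglongrightarrow> (\<Sum>a\<in>V. pmf stationary a)" unfolding trace_def[abs_def]
  by (intro tendsto_sum stationary(3))
 then show ?thesis by (simp add: sum_pmf_eq_1[OF finV stationary(1)])
qed

definition per :: "'e list => nat => 'e" where "per w i = w ! (i mod length w)"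

definition loop_pmf :: "nat => 'e list pmf" where
 "loop_pmf n = embed_pmf (%w. wprob w * indicator (loops n) w / trace n)"

lemma wprob_nonneg: "wprob w>=0"
 unfolding wprob_nth by (intro prod_nonneg) (simp add: pe_def)

lemma pmf_loop: assumes n: "n > 0" and tr: "trace n > 0"
 shows "pmf (loop_pmf n) w = wprob w * indicator (loops n) w / trace n"
proof -
 have "(\<integral>\<^sup>+w. ennreal (wprob w * indicator (loops n) w / trace n) \<partial>count_space UNIV)
  = (\<integral>\<^sup>+w. (ennreal (wprob w) * indicator (loops n) w) / ennreal (trace n) \<partial>count_space UNIV)"
  using tr wprob_nonneg by (intro nn_integral_cong) (auto simp: divide_ennreal indicator_def)
 also have "... = 1" using tr by (simp add: nn_integral_divide loops_total[OF n] divide_ennreal)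
 finally show ?thesis unfolding loop_pmf_def
  by (intro pmf_embed_pmf) (use tr wprob_nonneg in auto)
qed

lemma emeasure_loop: assumes n: "n > 0" and tr: "trace n > 0"
 shows "emeasure (measure_pmf (loop_pmf n)) S = (\<integral>\<^sup>+w. ennreal (wprob w) * indicator (loops n Int S) w \<partial>count_space UNIV) / ennreal (trace n)"
proof -
 have "emeasure (measure_pmf (loop_pmf n)) S = (\<integral>\<^sup>+w. pmf (loop_pmf n) w \<partial>count_space S)" by (simp add: nn_integral_pmf)
 also have "... = (\<integral>\<^sup>+w. ennreal (pmf (loop_pmf n) w) * indicator S w \<partial>count_space UNIV)"
  by (simp add: nn_integral_count_space_indicator)
 also have "... = (\<integral>\<^sup>+w. (ennreal (wprob w) * indicator (loops n Int S) w) / ennreal (trace n) \<partial>count_space UNIV)"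
  unfolding pmf_loop[OF n tr]
  using tr wprob_nonneg by (intro nn_integral_cong) (auto simp: divide_ennreal indicator_def)
 finally show ?thesis by (simp add: nn_integral_divide)
qed

lemma set_loop: assumes n: "n > 0" and tr: "trace n > 0" shows "set_pmf (loop_pmf n) = loops n"
proof -
 have "wprob w > 0" if "w\<in>loops n" for w using that by (intro wprob_pos) (auto simp: loops_def adm_def)
 then show ?thesis using tr by (force simp: set_pmf_iff pmf_loop[OF n tr] indicator_def)
qed

lemma per_shift: "(shift ^^ length w) (per w) = per w" by (rule ext) (simp add: shift_pow per_def)

lemma per_X: assumes "w\<in>loops n" "n > 0" shows "per w\<in>X"
proof -
 have w: "adm w" "length w = n" "t (last w) = s (hd w)" "w~=[]" using assms by (auto simp: loops_def)
 have "t (w ! (i mod n)) = s (w ! (Suc i mod n))" for i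
 proof (cases "Suc (i mod n) = n")
  case True
  then have "Suc i mod n = 0" by (simp add: mod_Suc)
  moreover have "i mod n = n - 1" using True by simp
  ultimately show ?thesis using w assms(2) by (simp add: last_conv_nth hd_conv_nth)
 next
  case False
  then have "Suc (i mod n) < n" "Suc i mod n = Suc (i mod n)" using assms(2) by (simp_all add: mod_Suc Suc_lessI)
  then show ?thesis using w(1,2) by (simp add: adm_nth)
 qed
 moreover have "w ! (i mod n)\<in>E" for i using w(1,2) assms(2) by (simp add: adm_nth)
 ultimately show ?thesis using w(2) by (simp add: X_def per_def)
qed

lemma per_prefix: "length w = n ==> map (per w) [0..<n] = w"
 by (intro nth_equalityI) (auto simp: per_def)

lemma periodic_nth: assumes "(shift ^^ n) y = y" shows "y i = y (i mod n)"
proof -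
 have "y (k * n + j) = y j" for k j
 proof (induction k)
  case (Suc k)
  have "y (n + (k * n + j)) = ((shift ^^ n) y) (k * n + j)" by (simp add: shift_pow)
  then show ?case using Suc assms by (simp add: add.assoc)
 qed simp
 from this[of "i div n" "i mod n"] show ?thesis by simp
qed

lemma periodic_loop: assumes y: "y\<in>X" "(shift ^^ n) y = y" and n: "n > 0"
 shows "map y [0..<n]\<in>loops n" "per (map y [0..<n]) = y"
proof -
 obtain m where m: "n = Suc m" using n gr0_implies_Suc by blast
 have "y n = y 0" using periodic_nth[OF y(2), of n] by simp
 then have "t (y m) = s (y 0)" using y(1) m by (auto simp: X_def)
 moreover have "last (map y [0..<n]) = y m" using m by simp
 moreover have "hd (map y [0..<n]) = y 0" using m by (simp add: hd_map hd_upt del: upt_Suc)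
 ultimately show "map y [0..<n]\<in>loops n" using X_adm[OF y(1)] by (simp add: loops_def del: upt_Suc)
 show "per (map y [0..<n]) = y"
  using periodic_nth[OF y(2)] n by (intro ext) (simp add: per_def del: upt_Suc)
qed

text \<open>Starting a closed orbit at another point permutes the factors cyclically, so the weight
  is constant on the orbit.\<close>

lemma wprob_rotate: assumes "(shift ^^ n) y = y" "y\<in>X"
 shows "wprob (map ((shift ^^ i) y) [0..<n]) = wprob (map y [0..<n])"
proof -
 have "(\<Prod>j<n. pe (y (i + j))) = (\<Prod>j<n. pe (y j))"
 proof (induction i)
  case (Suc i)
  have "y (i + n) = y i" using fun_cong[OF assms(1), of i] unfolding shift_pow by (simp add: add.commute)
  have "(\<Prod>j<n. pe (y (Suc i + j))) * pe (y i) = (\<Prod>j<Suc n. pe (y (i + j)))"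
   unfolding prod.lessThan_Suc_shift by (simp add: mult.commute)
  also have "... = (\<Prod>j<n. pe (y (i + j))) * pe (y i)" using \<open>y (i + n) = y i\<close> by simp
  finally have "(\<Prod>j<n. pe (y (Suc i + j))) * pe (y i) = (\<Prod>j<n. pe (y (i + j))) * pe (y i)" .
  then show ?case using Suc pe_pos[OF X_E[OF assms(2), of i]] by simp
 qed simp
 then show ?thesis by (simp add: wprob_nth shift_pow del: upt_Suc)
qed

end

subsection \<open>Equidistribution of periodic points\<close>

context edge_shift
begin

definition periodic_pmf :: "nat => (nat => 'e) pmf" where "periodic_pmf n = map_pmf per (loop_pmf n)"

lemma set_periodic: assumes n: "n > 0" and tr: "trace n > 0"
 shows "set_pmf (periodic_pmf n) = {y\<in>X. (shift ^^ n) y = y}"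
proof -
 have "per ` loops n = {y\<in>X. (shift ^^ n) y = y}"
 proof (intro equalityI subsetI)
  fix y assume "y\<in>per ` loops n"
  then obtain w where w: "w\<in>loops n" "y = per w" by blast
  then have "length w = n" by (simp add: loops_def)
  then show "y\<in>{y\<in>X. (shift ^^ n) y = y}" using w per_X[OF w(1) n] per_shift[of w] by simp
 next
  fix y assume "y\<in>{y\<in>X. (shift ^^ n) y = y}"
  then have "y\<in>X" "(shift ^^ n) y = y" by auto
  from periodic_loop[OF this n] show "y\<in>per ` loops n" by (metis image_eqI)
 qed
 then show ?thesis by (simp add: periodic_pmf_def set_loop[OF n tr])
qed

lemma pmf_periodic: assumes n: "n > 0" and tr: "trace n > 0" and y: "y\<in>X" "(shift ^^ n) y = y"
 shows "pmf (periodic_pmf n) y = wprob (map y [0..<n]) / trace n"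
proof -
 have inj: "inj_on per (set_pmf (loop_pmf n))"
 proof (rule inj_onI)
  fix w w' assume "w\<in>set_pmf (loop_pmf n)" "w'\<in>set_pmf (loop_pmf n)" and e: "per w = per w'"
  then have "length w = n" "length w' = n" by (auto simp: set_loop[OF n tr] loops_def)
  then show "w = w'" using per_prefix[of w n] per_prefix[of w' n] e by metis
 qed
 have w: "map y [0..<n]\<in>loops n" "per (map y [0..<n]) = y" using periodic_loop[OF y n] .
 have "pmf (map_pmf per (loop_pmf n)) (per (map y [0..<n])) = pmf (loop_pmf n) (map y [0..<n])"
  by (rule pmf_map_inj[OF inj]) (use w(1) set_loop[OF n tr] in blast)
 then show ?thesis unfolding periodic_pmf_def w(2) using w(1) by (simp add: pmf_loop[OF n tr])
qed

lemma periodic_cyl: assumes n: "n > 0" and tr: "trace n > 0" and u: "adm u" "u~=[]" "length u<=n"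
 shows "measure (measure_pmf (periodic_pmf n)) (cyl u) = wprob u * pmf (Kn (n - length u) (t (last u))) (s (hd u)) / trace n"
proof -
 have "emeasure (measure_pmf (loop_pmf n)) (per -` cyl u) = emeasure (measure_pmf (loop_pmf n)) (per -` cyl u Int set_pmf (loop_pmf n))"
  by (rule emeasure_Int_set_pmf[symmetric])
 also have "per -` cyl u Int set_pmf (loop_pmf n) = {w. take (length u) w = u} Int set_pmf (loop_pmf n)"
 proof -
  have "per w\<in>cyl u \<longleftrightarrow> take (length u) w = u" if w: "w\<in>loops n" for w
  proof -
   have l: "length w = n" using w by (simp add: loops_def)
   have "per w\<in>cyl u \<longleftrightarrow> (ALL i<length u. w ! i = u ! i)"
    using per_X[OF w n] l u(3) by (simp add: cyl_def per_def)
   also have "... \<longleftrightarrow> take (length u) w = u" using l u(3) by (auto simp: list_eq_iff_nth_eq)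
   finally show ?thesis .
  qed
  then show ?thesis unfolding set_loop[OF n tr] by blast
 qed
 also have "emeasure (measure_pmf (loop_pmf n)) \<dots> = emeasure (measure_pmf (loop_pmf n)) {w. take (length u) w = u}"
  by (rule emeasure_Int_set_pmf)
 also have "... = ennreal (wprob u * pmf (Kn (n - length u) (t (last u))) (s (hd u)) / trace n)"
  unfolding emeasure_loop[OF n tr] loops_prefix[OF u(1,2,3)] using tr wprob_nonneg by (simp add: divide_ennreal)
 finally have "measure (measure_pmf (loop_pmf n)) (per -` cyl u) = wprob u * pmf (Kn (n - length u) (t (last u))) (s (hd u)) / trace n"
  using tr wprob_nonneg by (simp add: measure_pmf.emeasure_eq_measure)
 then show ?thesis by (simp add: periodic_pmf_def measure_map_pmf)
qed

lemma trace_eventually: "eventually (%n. n > 0 \<and> trace n > 0) sequentially"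
 using order_tendstoD(1)[OF trace_tendsto zero_less_one] eventually_gt_at_top[of 0] by eventually_elim simp

lemma periodic_cyl_tendsto: assumes u: "u~=[]"
 shows "(%n. measure (measure_pmf (periodic_pmf n)) (cyl u)) \<longlonglongrightarrow> measure chain (cyl u)"
proof (cases "adm u")
 case False
 then have "cyl u = {}" using cyl_adm by blast
 then show ?thesis by simp
next
 case True
 have V: "s (hd u)\<in>V" "t (last u)\<in>V"
  using True u s_V[of "hd u"] t_V[of "last u"] by (auto simp: adm_def subset_iff)
 have "(%n. pmf (Kn (n - length u) (t (last u))) (s (hd u))) \<longlonglongrightarrow> pmf stationary (s (hd u))"
  by (rule LIMSEQ_offset[of _ "length u"]) (use stationary(3)[OF V(2,1)] in simp)
 then have "(%n. wprob u * pmf (Kn (n - length u) (t (last u))) (s (hd u)) / trace n) \<longlonglongrightarrow> wprob u * pmf stationary (s (hd u)) / 1"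
  by (intro tendsto_divide tendsto_mult tendsto_const trace_tendsto) simp_all
 moreover have "measure chain (cyl u) = wprob u * pmf stationary (s (hd u))"
  using chain_cyl[OF True u] wprob_nonneg by (simp add: chain.emeasure_eq_measure mult.commute)
 ultimately have l: "(%n. wprob u * pmf (Kn (n - length u) (t (last u))) (s (hd u)) / trace n) \<longlonglongrightarrow> measure chain (cyl u)" by simp
 show ?thesis
 proof (rule Lim_transform_eventually[OF l])
  show "\<forall>\<^sub>F n in sequentially. wprob u * pmf (Kn (n - length u) (t (last u))) (s (hd u)) / trace n = measure (measure_pmf (periodic_pmf n)) (cyl u)"
   using trace_eventually eventually_ge_at_top[of "length u"]
   by eventually_elim (use periodic_cyl True u in simp)
 qed
qed

text \<open>Stated for an arbitrary probability measure, so that the same finite sum approximates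
  both the chain and the periodic measures; the mass outside U enters only through 1 minus the mass
  of its cylinders.\<close>

lemma integral_cyl_approx:
 fixes \<Phi> :: "(nat => 'e) => real"
 assumes M: "prob_space M" and AX: "AE y in M. y\<in>X" and cM: "!!u. cyl u\<in>sets M"
  and \<Phi>M: "\<Phi>\<in>borel_measurable M" and C: "!!y. y\<in>X ==> \<bar>\<Phi> y\<bar><=C"
  and U: "finite U" "!!u. u\<in>U ==> length u = k" and e: "e>=0"
  and c: "!!u y. u\<in>U ==> y\<in>cyl u ==> \<bar>\<Phi> y - c u\<bar><=e"
 shows "\<bar>(\<integral>y. \<Phi> y \<partial>M) - (\<Sum>u\<in>U. c u * measure M (cyl u))\<bar><=e + C * (1 - (\<Sum>u\<in>U. measure M (cyl u)))"
proof -
 interpret prob_space M by (rule M)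
 have ci: "integrable M (indicator (cyl u) :: _ => real)" for u
  by (rule integrable_real_indicator) (auto simp: cM emeasure_eq_measure)
 have cm: "(\<integral>y. indicator (cyl u) y \<partial>M) = measure M (cyl u)" for u
  using sets.sets_into_space[OF cM[of u]] by (simp add: Int_absorb2)
 have \<Phi>i: "integrable M \<Phi>"
  by (rule integrable_const_bound[OF _ \<Phi>M]) (use AX C in "auto elim: eventually_mono")
 have s1: "integrable M (%y. \<Sum>u\<in>U. c u * indicator (cyl u) y)" and s2: "integrable M (%y. \<Sum>u\<in>U. indicator (cyl u) y :: real)"
  by (intro Bochner_Integration.integrable_sum integrable_mult_right ci)+
 have pw: "\<bar>\<Phi> y - (\<Sum>u\<in>U. c u * indicator (cyl u) y)\<bar><=e + C * (1 - (\<Sum>u\<in>U. indicator (cyl u) y))" if y: "y\<in>X" for y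
 proof -
  have one: "(\<Sum>u\<in>U. f u * indicator (cyl u) y) = (if map y [0..<k]\<in>U then f (map y [0..<k]) else 0)" for f :: "'e list => real"
  proof -
   have "(\<Sum>u\<in>U. f u * indicator (cyl u) y) = (\<Sum>u\<in>U. if u = map y [0..<k] then f u else 0)"
   proof (rule sum.cong[OF refl])
    fix u assume "u\<in>U"
    then have "cyl u = pcyl k {u}" using U(2) cyl_pcyl by metis
    then have "y\<in>cyl u \<longleftrightarrow> u = map y [0..<k]" using y by (auto simp: pcyl_def)
    then show "f u * indicator (cyl u) y = (if u = map y [0..<k] then f u else 0)" by (simp add: indicator_def)
   qed
   then show ?thesis using U(1) by simp
  qed
  show ?thesis
   using one[of c] one[of "%_. 1"] c[of "map y [0..<k]" y] cyl_map[OF y, of k] C[OF y] e by auto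
 qed
 have "\<bar>(\<integral>y. \<Phi> y \<partial>M) - (\<Sum>u\<in>U. c u * measure M (cyl u))\<bar> = \<bar>\<integral>y. \<Phi> y - (\<Sum>u\<in>U. c u * indicator (cyl u) y) \<partial>M\<bar>"
  using \<Phi>i s1 ci cm by (simp add: Bochner_Integration.integral_sum)
 also have "...<=(\<integral>y. \<bar>\<Phi> y - (\<Sum>u\<in>U. c u * indicator (cyl u) y)\<bar> \<partial>M)" by (rule integral_abs_bound)
 also have "...<=(\<integral>y. e + C * (1 - (\<Sum>u\<in>U. indicator (cyl u) y)) \<partial>M)"
 proof (rule integral_mono_AE)
  show "integrable M (%y. \<bar>\<Phi> y - (\<Sum>u\<in>U. c u * indicator (cyl u) y)\<bar>)"
   by (intro Bochner_Integration.integrable_abs Bochner_Integration.integrable_diff \<Phi>i s1)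
  show "integrable M (%y. e + C * (1 - (\<Sum>u\<in>U. indicator (cyl u) y)))"
   by (intro Bochner_Integration.integrable_add integrable_mult_right Bochner_Integration.integrable_diff s2) simp_all
  show "AE y in M. \<bar>\<Phi> y - (\<Sum>u\<in>U. c u * indicator (cyl u) y)\<bar><=e + C * (1 - (\<Sum>u\<in>U. indicator (cyl u) y))"
   using AX by eventually_elim (rule pw)
 qed
 also have "... = e + C * (1 - (\<Sum>u\<in>U. measure M (cyl u)))"
 proof -
  have "(\<integral>y. (\<Sum>u\<in>U. indicator (cyl u) y :: real) \<partial>M) = (\<Sum>u\<in>U. measure M (cyl u))"
   using ci cm by (subst Bochner_Integration.integral_sum) auto
  then show ?thesis using s2 prob_space by simp
 qed
 finally show ?thesis .
qed

text \<open>The shift need not be compact. Tightness is inherited from the limit: finitely many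
  cylinders that carry almost all of the chain also carry almost all of the periodic measures for
  large n, since measures of cylinders converge.\<close>

lemma periodic_weak_convergence:
 fixes \<Phi> :: "(nat => 'e) => real"
 assumes cont: "!!y e. y\<in>X ==> e > 0 ==> EX k. ALL z:X. (ALL i<k. z i = y i) --> dist (\<Phi> z) (\<Phi> y) < e"
  and C: "!!y. y\<in>X ==> \<bar>\<Phi> y\<bar><=C"
 shows "(%n. \<integral>y. \<Phi> y \<partial>measure_pmf (periodic_pmf n)) \<longlonglongrightarrow> (\<integral>y. \<Phi> y \<partial>chain)"
proof (rule tendstoI)
 fix e0 :: real assume "e0 > 0"
 define e where "e = e0 / 6"
 have e: "e > 0" using \<open>e0 > 0\<close> by (simp add: e_def)
 obtain v where "v\<in>V" using neV by blast
 have C0: "C>=0" using C[OF traj_X] abs_ge_zero order_trans by blast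
 \<comment> \<open>The 1 covers C = 0; C * d <= e makes the contribution of the mass outside the
   chosen cylinders at most e.\<close>
 define d where "d = e / (C + 1)"
 have d: "d > 0" "C * d<=e" using e C0 by (auto simp: d_def field_simps)
 \<comment> \<open>Words on whose cylinder \<Phi> oscillates by at most e; pointwise continuity
   alone makes them exhaust the shift as k grows.\<close>
 define W where "W k = {w. length w = k \<and> set w\<subseteq>E \<and> (ALL z:cyl w. ALL z':cyl w. \<bar>\<Phi> z - \<Phi> z'\<bar><=e)}" for k
 have up: "(%k. measure chain (pcyl k (W k))) \<longlonglongrightarrow> measure chain (\<Union>k. pcyl k (W k))"
 proof (rule chain.finite_Lim_measure_incseq)
  show "range (%k. pcyl k (W k))\<subseteq>sets chain" by auto
  show "incseq (%k. pcyl k (W k))"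
  proof (rule incseq_SucI, rule subsetI)
   fix k y assume "y\<in>pcyl k (W k)"
   then have y: "y\<in>X" and w: "!!z z'. z\<in>cyl (map y [0..<k]) ==> z'\<in>cyl (map y [0..<k]) ==> \<bar>\<Phi> z - \<Phi> z'\<bar><=e"
    unfolding pcyl_def W_def by blast+
   have sub: "cyl (map y [0..<Suc k])\<subseteq>cyl (map y [0..<k])" by (auto simp: cyl_snoc)
   have "map y [0..<Suc k]\<in>W (Suc k)"
    unfolding W_def using prefix_words[OF y] w sub by (simp del: upt_Suc) blast
   then show "y\<in>pcyl (Suc k) (W (Suc k))" using y unfolding pcyl_def by blast
  qed
 qed
 have "(\<Union>k. pcyl k (W k)) = X"
 proof (intro equalityI subsetI)
  fix y assume y: "y\<in>X"
  obtain k where k: "ALL z:X. (ALL i<k. z i = y i) --> dist (\<Phi> z) (\<Phi> y) < e / 2" using cont[OF y, of "e / 2"] e by auto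
  have "\<bar>\<Phi> z - \<Phi> z'\<bar><=e" if "z\<in>cyl (map y [0..<k])" "z'\<in>cyl (map y [0..<k])" for z z'
  proof -
   have "z\<in>X" "z'\<in>X" using that cyl_sub by blast+
   then have "dist (\<Phi> z) (\<Phi> y) < e / 2" "dist (\<Phi> z') (\<Phi> y) < e / 2" using k cyl_mapD[OF that(1)] cyl_mapD[OF that(2)] by blast+
   then show ?thesis unfolding dist_real_def by linarith
  qed
  then have "map y [0..<k]\<in>W k" unfolding W_def using prefix_words[OF y, of k] by simp
  then show "y\<in>(\<Union>k. pcyl k (W k))" using y unfolding pcyl_def by blast
 qed (auto simp: pcyl_def)
 with up have "(%k. measure chain (pcyl k (W k))) \<longlonglongrightarrow> 1" by (simp add: chain.prob_X)
 then have "eventually (%k. measure chain (pcyl k (W k)) > 1 - d / 2) sequentially"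
  by (rule order_tendstoD(1)) (use d in simp)
 then have "eventually (%k. k > 0 \<and> measure chain (pcyl k (W k)) > 1 - d / 2) sequentially"
  using eventually_gt_at_top[of 0] by eventually_elim simp
 then obtain k where k: "k > 0" "measure chain (pcyl k (W k)) > 1 - d / 2"
  using eventually_happens'[OF sequentially_bot] by blast
 have cW: "countable (W k)" by (rule countable_subset[OF _ countable_words]) (auto simp: W_def)
 define Wf where "Wf N = {w\<in>W k. to_nat_on (W k) w < N}" for N
 have finW: "finite (Wf N)" for N unfolding Wf_def by (rule finite_enumerated_below[OF cW])
 have "(%N. measure chain (pcyl k (Wf N))) \<longlonglongrightarrow> measure chain (\<Union>N. pcyl k (Wf N))"
 proof (rule chain.finite_Lim_measure_incseq)
  show "range (%N. pcyl k (Wf N))\<subseteq>sets chain" by auto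
  show "incseq (%N. pcyl k (Wf N))" by (auto simp: incseq_def pcyl_def Wf_def)
 qed
 moreover have "(\<Union>N. pcyl k (Wf N)) = pcyl k (W k)" by (auto simp: pcyl_def Wf_def)
 ultimately have "eventually (%N. measure chain (pcyl k (Wf N)) > 1 - d) sequentially"
  using k(2) d(1) by (intro order_tendstoD(1)) auto
 then obtain N where N: "measure chain (pcyl k (Wf N)) > 1 - d" using eventually_happens'[OF sequentially_bot] by blast
 define U where "U = Wf N"
 have U: "finite U" "!!u. u\<in>U ==> length u = k" using finW by (auto simp: U_def Wf_def W_def)
 have mU: "measure chain (pcyl k U) = (\<Sum>u\<in>U. measure chain (cyl u))"
 proof -
  have "pcyl k U = (\<Union>u\<in>U. pcyl k {u})" by (auto simp: pcyl_def)
  also have "measure chain \<dots> = (\<Sum>u\<in>U. measure chain (pcyl k {u}))"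
  proof (rule chain.finite_measure_finite_Union[OF U(1)])
   show "(%u. pcyl k {u}) ` U\<subseteq>sets chain" by auto
   show "disjoint_family_on (%u. pcyl k {u}) U" by (auto simp: disjoint_family_on_def pcyl_def)
  qed
  also have "... = (\<Sum>u\<in>U. measure chain (cyl u))" using U(2) cyl_pcyl by (intro sum.cong refl) metis
  finally show ?thesis .
 qed
 define c where "c u = \<Phi> (SOME z. z\<in>cyl u)" for u
 have c: "\<bar>\<Phi> y - c u\<bar><=e" if "u\<in>U" "y\<in>cyl u" for u y
 proof -
  have "(SOME z. z\<in>cyl u)\<in>cyl u" by (rule someI[of "%z. z\<in>cyl u", OF that(2)])
  then show ?thesis using that unfolding U_def Wf_def W_def c_def by blast
 qed
 let ?S = "%n. \<Sum>u\<in>U. measure (measure_pmf (periodic_pmf n)) (cyl u)" and ?S' = "\<Sum>u\<in>U. measure chain (cyl u)"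
 let ?A = "%n. \<Sum>u\<in>U. c u * measure (measure_pmf (periodic_pmf n)) (cyl u)" and ?A' = "\<Sum>u\<in>U. c u * measure chain (cyl u)"
 have une: "u~=[]" if "u\<in>U" for u using U(2)[OF that] k(1) by auto
 have S: "?S \<longlonglongrightarrow> ?S'" and A: "?A \<longlonglongrightarrow> ?A'"
  using une by (intro tendsto_sum tendsto_mult tendsto_const periodic_cyl_tendsto; blast)+
 have \<Phi>B: "\<Phi>\<in>borel_measurable B" by (rule locally_determined_measurable[OF cont])
 have ap: "\<bar>(\<integral>y. \<Phi> y \<partial>chain) - ?A'\<bar><=e + C * (1 - ?S')"
  by (rule integral_cyl_approx[OF chain.prob_nu _ _ _ C U _ c]) (use e chain.meas_nu[OF \<Phi>B] in auto)
 have apn: "\<bar>(\<integral>y. \<Phi> y \<partial>measure_pmf (periodic_pmf n)) - ?A n\<bar><=e + C * (1 - ?S n)" if "n > 0" "trace n > 0" for n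
  by (rule integral_cyl_approx[OF measure_pmf.prob_space_axioms _ _ _ C U _ c])
   (use e set_periodic[OF that] in "auto simp: AE_measure_pmf_iff")
 have S'1: "?S' > 1 - d" using N mU unfolding U_def by simp
 have "eventually (%n. ?S n > 1 - d) sequentially" by (rule order_tendstoD(1)[OF S S'1])
 moreover have "eventually (%n. dist (?A n) ?A' < e) sequentially" by (rule tendstoD[OF A e])
 ultimately show "eventually (%n. dist (\<integral>y. \<Phi> y \<partial>measure_pmf (periodic_pmf n)) (\<integral>y. \<Phi> y \<partial>chain) < e0) sequentially"
  using trace_eventually
 proof eventually_elim
  case (elim n)
  have "C * (1 - ?S n)<=C * d" "C * (1 - ?S')<=C * d" using elim S'1 C0 by (intro mult_left_mono; simp)+
  then have "\<bar>(\<integral>y. \<Phi> y \<partial>measure_pmf (periodic_pmf n)) - ?A n\<bar><=2 * e" "\<bar>(\<integral>y. \<Phi> y \<partial>chain) - ?A'\<bar><=2 * e"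
   using ap apn[of n] elim d(2) by linarith+
  moreover have "\<bar>?A n - ?A'\<bar> < e" using elim by (simp add: dist_real_def)
  ultimately have "\<bar>(\<integral>y. \<Phi> y \<partial>measure_pmf (periodic_pmf n)) - (\<integral>y. \<Phi> y \<partial>chain)\<bar> < 5 * e" by linarith
  then show ?case using e by (simp add: dist_real_def e_def)
 qed
qed

text \<open>The law of periodic points is constant on orbits, so replacing a point by the uniform
  law on its orbit leaves it unchanged. This holds also if the orbit has fewer than n points, as
  \<open>orbit_distribution\<close> is uniform on the set of points.\<close>

lemma periodic_orbits:
 assumes n: "n > 0" and tr: "trace n > 0"
 shows "bind_pmf (periodic_pmf n) (orbit_distribution shift n) = periodic_pmf n"
 unfolding orbit_distribution_def
proof (rule bind_pmf_of_set_classes)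
 fix y assume y: "y\<in>set_pmf (periodic_pmf n)"
 then have yX: "y\<in>X" and yp: "(shift ^^ n) y = y" using set_periodic[OF n tr] by auto
 have "(shift ^^ 0) y\<in>(%i. (shift ^^ i) y) ` {..<n}" using n by blast
 then show "finite ((%i. (shift ^^ i) y) ` {..<n}) \<and> y\<in>(%i. (shift ^^ i) y) ` {..<n}" by simp
 fix z assume "z\<in>(%i. (shift ^^ i) y) ` {..<n}"
 then obtain i where i: "i < n" "z = (shift ^^ i) y" by blast
 have mod: "(shift ^^ j) y = (shift ^^ (j mod n)) y" for j
 proof
  fix l
  have "((shift ^^ j) y) l = y ((j + l) mod n)" using periodic_nth[OF yp] by (simp add: shift_pow)
  also have "... = y ((j mod n + l) mod n)" by (simp add: mod_add_left_eq)
  also have "... = ((shift ^^ (j mod n)) y) l" using periodic_nth[OF yp] by (simp add: shift_pow)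
  finally show "((shift ^^ j) y) l = ((shift ^^ (j mod n)) y) l" .
 qed
 have zp: "(shift ^^ n) z = z"
  unfolding i(2) shift_pow_add by (subst add.commute) (simp only: shift_pow_add[symmetric] yp)
 have zX: "z\<in>X" unfolding i(2) by (rule shift_pow_X[OF yX])
 have "(%j. (shift ^^ j) z) ` {..<n} = (%j. (shift ^^ j) y) ` {..<n}"
 proof (intro equalityI subsetI)
  fix x assume "x\<in>(%j. (shift ^^ j) z) ` {..<n}"
  then obtain j where "x = (shift ^^ (j + i)) y" unfolding i(2) shift_pow_add by blast
  then have "x = (shift ^^ ((j + i) mod n)) y" using mod by metis
  then show "x\<in>(%j. (shift ^^ j) y) ` {..<n}" using n by (intro image_eqI[of _ _ "(j + i) mod n"]) auto
 next
  fix x assume "x\<in>(%j. (shift ^^ j) y) ` {..<n}"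
  then obtain j where j: "j < n" "x = (shift ^^ j) y" by blast
  \<comment> \<open>From z, n - i further steps lead back to y.\<close>
  define k where "k = (j + (n - i)) mod n"
  have "(k + i) mod n = (j + (n - i) + i) mod n" unfolding k_def by (rule mod_add_left_eq)
  also have "... = j" using i(1) j(1) by simp
  finally have "(shift ^^ (k + i)) y = (shift ^^ j) y" using mod[of "k + i"] by simp
  then have "x = (shift ^^ k) z" unfolding i(2) shift_pow_add j(2) by simp
  then show "x\<in>(%j. (shift ^^ j) z) ` {..<n}" using n by (intro image_eqI[of _ _ k]) (auto simp: k_def)
 qed
 moreover have "pmf (periodic_pmf n) z = pmf (periodic_pmf n) y"
 proof -
  have "wprob (map z [0..<n]) = wprob (map y [0..<n])" unfolding i(2) by (rule wprob_rotate[OF yp yX])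
  then show ?thesis using pmf_periodic[OF n tr zX zp] pmf_periodic[OF n tr yX yp] by simp
 qed
 ultimately show "(%j. (shift ^^ j) z) ` {..<n} = (%j. (shift ^^ j) y) ` {..<n} \<and> pmf (periodic_pmf n) z = pmf (periodic_pmf n) y" ..
qed

end

subsection \<open>The shift of the induced map\<close>

context edge_shift
begin

lemma chain_info_integrable_pmf:
 assumes "!!a. a\<in>V ==> integrable (measure_pmf (p a)) (%e. ln (pe e))"
 shows "integrable chain info"
proof (rule chain_info_integrable)
 have "(\<integral>\<^sup>+e. ennreal (pe e * - ln (pe e)) \<partial>count_space E) = (\<integral>\<^sup>+e. ennreal (pe e * - ln (pe e)) * indicator E e \<partial>count_space UNIV)"
  by (simp add: nn_integral_count_space_indicator)
 also have "... = (\<integral>\<^sup>+e. (\<Sum>a\<in>V. ennreal (pmf (p a) e) * ennreal (- ln (pe e))) \<partial>count_space UNIV)"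
 proof (rule nn_integral_cong)
  fix e
  show "ennreal (pe e * - ln (pe e)) * indicator E e = (\<Sum>a\<in>V. ennreal (pmf (p a) e) * ennreal (- ln (pe e)))"
  proof (cases "e\<in>E")
   case True
   have "(\<Sum>a\<in>V. ennreal (pmf (p a) e) * ennreal (- ln (pe e))) = (\<Sum>a\<in>V. if a = s e then ennreal (pe e) * ennreal (- ln (pe e)) else 0)"
    using set_p True by (intro sum.cong refl) (auto simp: pe_def pmf_eq_0_set_pmf)
   also have "... = ennreal (pe e) * ennreal (- ln (pe e))" using finV s_V[OF True] by simp
   also have "... = ennreal (pe e * - ln (pe e))" by (rule ennreal_mult'[symmetric]) (simp add: pe_def)
   finally show ?thesis using True by simp
  next
   case False
   then have "pmf (p a) e = 0" if "a\<in>V" for a using set_p[OF that] by (auto simp: pmf_eq_0_set_pmf)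
   then show ?thesis using False by simp
  qed
 qed
 also have "... = (\<Sum>a\<in>V. \<integral>\<^sup>+e. ennreal (pmf (p a) e) * ennreal (- ln (pe e)) \<partial>count_space UNIV)"
  by (rule nn_integral_sum) simp
 also have "... = (\<Sum>a\<in>V. \<integral>\<^sup>+e. ennreal (- ln (pe e)) \<partial>measure_pmf (p a))" by (simp add: nn_integral_measure_pmf)
 also have "... < \<infinity>"
 proof -
  have "(\<integral>\<^sup>+e. ennreal (- ln (pe e)) \<partial>measure_pmf (p a)) < \<infinity>" if a: "a\<in>V" for a
  proof -
   have "(\<integral>\<^sup>+e. ennreal (- ln (pe e)) \<partial>measure_pmf (p a))<=(\<integral>\<^sup>+e. ennreal (norm (ln (pe e))) \<partial>measure_pmf (p a))"
    by (intro nn_integral_mono ennreal_leI) simp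
   also have "... < \<infinity>" using assms[OF a] unfolding integrable_iff_bounded by blast
   finally show ?thesis .
  qed
  then show ?thesis using finV by simp
 qed
 finally show "(\<integral>\<^sup>+e. ennreal (pe e * - ln (pe e)) \<partial>count_space E) < \<infinity>" .
qed

end

context cusped_domain_fin
begin

text \<open>\<open>coding_space\<close> contains codes of limit points only; this puts the constant
  parabolic sequences, which code p, at the disposal of the mixing argument.\<close>

lemma p_limit_point: "p\<in>limit_set G"
proof -
 define om where "om = (%n :: nat. g0)"
 have w: "om\<in>reduced_seqs" using g0A A_ne_inv[OF g0A] unfolding reduced_seqs_def om_def by simp
 have fix_p: "prod_seq om n p = p" for n
 proof (induction n)
  case 0
  show ?case using p_sphere act_one by simp
 next
  case (Suc n)
  then show ?case using prod_seq_Suc[OF w, of p n] p_sphere g0p by (simp add: om_def)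
 qed
 have "p islimpt (%g. g 0) ` G"
  unfolding islimpt_approachable
 proof (intro allI impI)
  fix e :: real assume e: "e > 0"
  obtain n where n: "1 - (norm (iv (prod_seq om n) 0))^2 < e^2" using centers_to_circle[OF w, of "e^2"] e by auto
  have "(norm (p - iv (prod_seq om n) 0))^2<=1 - (norm (iv (prod_seq om n) 0))^2"
   by (rule cylinder_small[OF w p_sphere]) (use fix_p dn_g0_p in "simp add: om_def")
  then have "(norm (p - iv (prod_seq om n) 0))^2 < e^2" using n by linarith
  then have "norm (p - iv (prod_seq om n) 0) < e" by (rule power2_less_imp_less) (use e in simp)
  moreover have "p~=iv (prod_seq om n) 0" by (rule dn_circle(2)[OF prod_seq_G[OF w] p_sphere])
  moreover have "iv (prod_seq om n)\<in>G" by (rule G_inv[OF prod_seq_G[OF w]])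
  ultimately show "EX x':(%g. g 0) ` G. x'~=p \<and> dist x' p < e"
   by (intro bexI[of _ "iv (prod_seq om n) 0"]) (auto simp: dist_norm norm_minus_commute)
 qed
 then show ?thesis using p_sphere by (simp add: limit_set_def)
qed

text \<open>With parabolic letters only, every reduced sequence is constant. The coding space then
  consists of two isolated points that the shift never connects.\<close>

lemma H_nonempty:
 assumes "bowen_series_mixing G A"
 shows "H~={}"
proof
 assume "H = {}"
 then have A: "A = {g0, iv g0}" using parabolic_letters_A by (auto simp: hyperbolic_letters_def parabolic_letters_def)
 have ii: "iv (iv g0) = g0" using A_G(1)[OF g0A] by simp
 have const: "(%n. a)\<in>coding_space G A" if a: "a\<in>A" for a
 proof -
  have ap: "a p = p" "dn a p = 1" using parabolic_letter_p[of a] a A by (auto simp: parabolic_letters_def)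
  have "(%n. a)\<in>reduced_seqs" using a A_ne_inv[OF a] unfolding reduced_seqs_def by simp
  moreover have "coded (%n. a) p"
  proof -
   have "prod_seq (%n. a) n p = p" for n
   proof (induction n)
    case 0 show ?case using p_sphere act_one by simp
   next
    case (Suc n)
    then show ?case using prod_seq_Suc[OF \<open>(%n. a) \<in> reduced_seqs\<close>, of p n] p_sphere ap by simp
   qed
   then show ?thesis unfolding coded_def using p_sphere ap by simp
  qed
  ultimately show ?thesis unfolding coding_space_def using codes_iff p_limit_point by blast
 qed
 have opn: "openin (sequence_topology A (coding_space G A)) {om\<in>coding_space G A. om 0 = a}" if a: "a\<in>A" for a
 proof -
  let ?P = "PiE UNIV (%i::nat. if i = 0 then {a} else A)"
  have "openin (product_topology (%_. discrete_topology A) UNIV) ?P"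
   unfolding openin_PiE_gen
  proof (intro disjI2 conjI ballI)
   show "finite {i\<in>UNIV. (if i = (0 :: nat) then {a} else A)~=topspace (discrete_topology A)}"
    by (rule finite_subset[of _ "{0 :: nat}"]) auto
   show "openin (discrete_topology A) (if i = 0 then {a} else A)" for i :: nat using a by simp
  qed
  moreover have "{om\<in>coding_space G A. om 0 = a} = ?P Int coding_space G A"
   by (auto simp: coding_space_def codes_def PiE_iff split: if_splits)
  ultimately show ?thesis unfolding sequence_topology_def openin_subtopology by blast
 qed
 let ?U = "{om\<in>coding_space G A. om 0 = g0}" and ?V = "{om\<in>coding_space G A. om 0 = iv g0}"
 have iA: "iv g0\<in>A" by (rule A_inv[OF g0A])
 have "?U~={}" "?V~={}" using const[OF g0A] const[OF iA] by force+
 with assms opn[OF g0A] opn[OF iA] obtain N where "ALL n>=N. (shift ^^ n) ` ?U Int ?V~={}"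
  unfolding bowen_series_mixing_def topologically_mixing_def by meson
 then obtain om where w: "om\<in>coding_space G A" "om 0 = g0" "((shift ^^ N) om) 0 = iv g0" by blast
 then obtain x where "codes A om x" by (auto simp: coding_space_def)
 then have red: "om\<in>reduced_seqs" using codes_iff by blast
 have "om n = g0" for n
 proof (induction n)
  case (Suc n)
  have "om (Suc n)\<in>A" "om (Suc n)~=iv (om n)" using red by (auto simp: reduced_seqs_def)
  then show ?case using A Suc by auto
 qed (rule w(2))
 then show False using w(3) A_ne_inv[OF g0A] by (simp add: shift_pow_0)
qed

end

section \<open>Transition probabilities of the induced shift and its equilibrium state\<close>

locale cusped_domain_free = cusped_domain_fin +
 assumes H_ne: "H~={}"
begin

lemma A_split: "A = H Un parabolic_letters g0" "H Int parabolic_letters g0 = {}" "finite H" "card (parabolic_letters g0) = 2"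
 "finite (parabolic_letters g0)"
 using parabolic_letters_A finite_letters A_ne_inv[OF g0A]
 by (auto simp: hyperbolic_letters_def) (auto simp: parabolic_letters_def)

lemma H_inv: "h\<in>H ==> iv h\<in>H"
proof -
 assume h: "h\<in>H"
 then have hA: "h\<in>A" "h~=g0" "h~=iv g0" by (auto simp: hyperbolic_letters_def parabolic_letters_def)
 have "iv (iv h) = h" "iv (iv g0) = g0" using A_G(1)[OF hA(1)] A_G(1)[OF g0A] by simp_all
 then have "iv h~=g0" "iv h~=iv g0" using hA by metis+
 then show "iv h\<in>H" using A_inv[OF hA(1)] by (auto simp: hyperbolic_letters_def parabolic_letters_def)
qed

lemma A_minus_par: assumes "\<gamma>\<in>parabolic_letters g0" shows "A - {\<gamma>, iv \<gamma>} = H"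
proof -
 have "iv (iv g0) = g0" using A_G(1)[OF g0A] by simp
 then have "{\<gamma>, iv \<gamma>} = parabolic_letters g0" using assms by (auto simp: parabolic_letters_def)
 then show ?thesis by (simp add: hyperbolic_letters_def)
qed

text \<open>The Perron--Frobenius data: \<open>W w * r (last w)\<close> with \<open>W w = exp (- (length w - 1))\<close>, summed over the
 words \<open>w\<close> of the alphabet with first letter \<open>a\<close>, is \<open>growth * r a\<close>. As \<open>r\<close> is \<open>1\<close> on \<open>H\<close>, the value
 on the parabolic letters is the positive root of a quadratic equation.\<close>

definition par_value :: real where
 "par_value = (sqrt ((real (card H) - 1)^2 + 8 * real (card H) * exp 1 / (exp 1 - 1)) - (real (card H) - 1)) / 4"

text \<open>Sum of r over the successors of a hyperbolic letter: the letters of H except the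
  inverse, and the two parabolic letters.\<close>

definition hyp_total :: real where "hyp_total = real (card H) - 1 + 2 * par_value"

definition growth :: real where "growth = exp (- 1) * hyp_total"

definition r :: "(complex => complex) => real" where "r a = (if a\<in>H then 1 else par_value)"

lemma card_H: "real (card H)>=1"
 using H_ne A_split(3) by (simp add: Suc_leI card_gt_0_iff)

text \<open>Up to the factor exp 1, the last equation is the eigenvector equation at a parabolic
  letter: a geometric series gives the words starting with it the total weight card H / (exp 1 -
  1).\<close>

lemma par_value: "par_value > 0" "hyp_total > 0" "hyp_total * par_value = card H * exp 1 / (exp 1 - 1)"
proof -
 let ?m = "real (card H)" and ?q = "8 * real (card H) * exp 1 / (exp 1 - 1) :: real"
 have e1: "exp 1 > (1 :: real)" by simp
 then have q: "?q > 0" using card_H by (intro divide_pos_pos mult_pos_pos) auto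
 let ?s = "sqrt ((?m - 1)^2 + ?q)"
 have s2: "?s^2 = (?m - 1)^2 + ?q" using q by simp
 have s: "?s > ?m - 1" by (rule real_less_rsqrt) (use q in simp)
 show v: "par_value > 0" unfolding par_value_def using s by simp
 then show "hyp_total > 0" unfolding hyp_total_def using card_H by simp
 have "hyp_total * par_value = (?s^2 - (?m - 1)^2) / 8"
 proof -
  have "(m - 1 + 2 * ((t - (m - 1)) / 4)) * ((t - (m - 1)) / 4) = (t^2 - (m - 1)^2) / 8" for m t :: real
   by (simp add: power2_eq_square field_simps)
  then show ?thesis unfolding hyp_total_def par_value_def .
 qed
 also have "... = ?q / 8" unfolding s2 by simp
 also have "... = ?m * exp 1 / (exp 1 - 1)" using e1 by (simp add: field_simps)
 finally show "hyp_total * par_value = ?m * exp 1 / (exp 1 - 1)" .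
qed

lemma r_pos: "r a > 0" using par_value by (simp add: r_def)

lemma growth_pos: "growth > 0" using par_value by (simp add: growth_def)

definition hyp_next :: "(complex => complex) => (complex => complex) pmf" where
 "hyp_next h = embed_pmf (%g. if g\<in>A - {iv h} then r g / hyp_total else 0)"

text \<open>\<open>geometric_pmf\<close> starts at 0, hence \<open>Suc n\<close>. Since r is 1 on H,
  the last letter of a parabolic word is uniform on H and independent of the length.\<close>

definition step_pmf :: "(complex => complex) => (complex => complex) list pmf" where
 "step_pmf a = (if a\<in>H then map_pmf (%g. [a, g]) (hyp_next a)
   else map_pmf (%(n, g). replicate (Suc n) a @ [g]) (pair_pmf (geometric_pmf (1 - exp (- 1))) (pmf_of_set H)))"

lemma pmf_hyp_next: assumes h: "h\<in>H"
 shows "pmf (hyp_next h) g = (if g\<in>A - {iv h} then r g / hyp_total else 0)"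
proof -
 have "(\<Sum>g\<in>A - {iv h}. r g) = (\<Sum>g\<in>(H - {iv h}) Un parabolic_letters g0. r g)"
  using A_split(1,2) H_inv[OF h] by (intro sum.cong) auto
 also have "... = (\<Sum>g\<in>H - {iv h}. r g) + (\<Sum>g\<in>parabolic_letters g0. r g)"
  by (rule sum.union_disjoint) (use A_split in auto)
 also have "(\<Sum>g\<in>H - {iv h}. r g) = (\<Sum>g\<in>H - {iv h}. 1)" by (intro sum.cong) (auto simp: r_def)
 also have "... = real (card H) - 1" using H_inv[OF h] A_split(3) card_H by simp
 also have "(\<Sum>g\<in>parabolic_letters g0. r g) = (\<Sum>g\<in>parabolic_letters g0. par_value)"
  using A_split(2) by (intro sum.cong) (auto simp: r_def)
 also have "... = 2 * par_value" using A_split(4) by simp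
 finally have tot: "(\<Sum>g\<in>A - {iv h}. r g / hyp_total) = 1" using par_value(2) by (simp add: sum_divide_distrib[symmetric] hyp_total_def)
 have "(\<integral>\<^sup>+g. ennreal (if g\<in>A - {iv h} then r g / hyp_total else 0) \<partial>count_space UNIV)
  = (\<integral>\<^sup>+g. ennreal (r g / hyp_total) \<partial>count_space (A - {iv h}))"
  by (subst nn_integral_count_space_indicator) (auto simp: indicator_def intro!: nn_integral_cong)
 also have "... = (\<Sum>g\<in>A - {iv h}. ennreal (r g / hyp_total))" using finite_letters by (intro nn_integral_count_space_finite) simp
 also have "... = 1" using tot r_pos par_value(2) by (subst sum_ennreal) (auto intro!: divide_nonneg_pos less_imp_le)
 finally show ?thesis unfolding hyp_next_def
  by (intro pmf_embed_pmf) (use r_pos par_value(2) in "auto intro!: divide_nonneg_pos less_imp_le")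
qed

lemma set_hyp_next: "h\<in>H ==> set_pmf (hyp_next h) = A - {iv h}"
 using r_pos par_value(2) by (auto simp: set_pmf_eq pmf_hyp_next less_imp_neq[symmetric])

lemma exp_m1: "0 < 1 - exp (- 1 :: real)" "1 - exp (- 1 :: real) < 1" by simp_all

lemma set_step: assumes a: "a\<in>A" shows "set_pmf (step_pmf a) = {w\<in>F. hd w = a}"
proof (cases "a\<in>H")
 case True
 have "set_pmf (step_pmf a) = (%g. [a, g]) ` (A - {iv a})" using True by (simp add: step_pmf_def set_hyp_next)
 also have "... = {w\<in>F. hd w = a}"
 proof (intro equalityI subsetI)
  fix w assume "w\<in>(%g. [a, g]) ` (A - {iv a})"
  then show "w\<in>{w\<in>F. hd w = a}" using True by (auto simp: induced_alphabet_def)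
 next
  fix w assume "w\<in>{w\<in>F. hd w = a}"
  then have w: "w\<in>F" "hd w = a" by auto
  from w(1) show "w\<in>(%g. [a, g]) ` (A - {iv a})"
  proof (cases rule: F_cases)
   case (par n \<gamma> g)
   then have "hd w = \<gamma>" by (cases n) auto
   then show ?thesis using w True par A_split(2) by auto
  next
   case (hyp h g)
   then show ?thesis using w by auto
  qed
 qed
 finally show ?thesis .
next
 case False
 then have ap: "a\<in>parabolic_letters g0" using a A_split(1) by blast
 have "set_pmf (step_pmf a) = (%(n, g). replicate (Suc n) a @ [g]) ` (UNIV \<times> H)"
  using False set_pmf_geometric[OF exp_m1] H_ne A_split(3) by (simp add: step_pmf_def set_pair_pmf set_pmf_of_set)
 also have "... = {w\<in>F. hd w = a}"
 proof (intro equalityI subsetI)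
  fix w assume "w\<in>(%(n, g). replicate (Suc n) a @ [g]) ` (UNIV \<times> H)"
  then obtain n g where w: "w = replicate (Suc n) a @ [g]" "g\<in>A - {a, iv a}" using A_minus_par[OF ap] by auto
  then have "w\<in>F" unfolding induced_alphabet_def using ap by (intro UnI1 CollectI exI[of _ "Suc n"] exI[of _ a] exI[of _ g]) auto
  then show "w\<in>{w\<in>F. hd w = a}" using w by simp
 next
  fix w assume "w\<in>{w\<in>F. hd w = a}"
  then have w: "w\<in>F" "hd w = a" by auto
  from w(1) show "w\<in>(%(n, g). replicate (Suc n) a @ [g]) ` (UNIV \<times> H)"
  proof (cases rule: F_cases)
   case (par n \<gamma> g)
   obtain m where m: "n = Suc m" using par(1) by (cases n) auto
   then have "\<gamma> = a" using w par by simp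
   moreover have "g\<in>H" using par A_minus_par[OF par(2)] by blast
   ultimately show ?thesis using par(6) m by (intro image_eqI[of _ _ "(m, g)"]) auto
  next
   case (hyp h g)
   then show ?thesis using w False by auto
  qed
 qed
 finally show ?thesis .
qed

lemma pmf_step: assumes w: "w\<in>F"
 shows "pmf (step_pmf (hd w)) w = exp (- (real (length w) - 1)) * r (last w) / (growth * r (hd w))"
 using w
proof (cases rule: F_cases)
 case (par n \<gamma> g)
 obtain m where m: "n = Suc m" using par(1) by (cases n) auto
 have gH: "g\<in>H" using par A_minus_par[OF par(2)] by blast
 have \<gamma>H: "\<gamma>\<notin>H" using par(2) A_split(2) by blast
 have hw: "hd w = \<gamma>" "last w = g" "length w = Suc (Suc m)" using par(6) m by auto
 have inj: "inj (%(n, g). replicate (Suc n) \<gamma> @ [g])"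
 proof (rule injI)
  fix x y assume e: "(%(n, g). replicate (Suc n) \<gamma> @ [g]) x = (%(n, g). replicate (Suc n) \<gamma> @ [g]) y"
  obtain n g n' g' where xy: "x = (n, g)" "y = (n', g')" by (cases x, cases y)
  have "replicate (Suc n) \<gamma> @ [g] = replicate (Suc n') \<gamma> @ [g']" using e xy by simp
  then have "replicate (Suc n) \<gamma> = replicate (Suc n') \<gamma>" "g = g'" using append1_eq_conv by blast+
  then have "Suc n = Suc n'" by (metis length_replicate)
  then show "x = y" using \<open>g = g'\<close> xy by simp
 qed
 have "pmf (step_pmf \<gamma>) w = pmf (pair_pmf (geometric_pmf (1 - exp (- 1))) (pmf_of_set H)) (m, g)"
  using pmf_map_inj'[OF inj, of _ "(m, g)"] \<gamma>H par(6) m by (simp add: step_pmf_def)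
 also have "... = exp (- 1) ^ m * (1 - exp (- 1)) / card H" using gH H_ne A_split(3) by (simp add: pmf_pair pmf_geometric)
 also have "exp (- 1 :: real) ^ m = exp (- real m)" by (simp add: exp_of_nat_mult[symmetric])
 finally have l: "pmf (step_pmf \<gamma>) w = exp (- real m) * (1 - exp (- 1)) / card H" .
 have "growth * r \<gamma> = exp (- 1) * (card H * exp 1 / (exp 1 - 1))"
  using par_value(3) \<gamma>H by (simp add: growth_def r_def mult.assoc)
 also have "... = card H / (exp 1 - 1)" by (simp add: exp_minus)
 finally have gr: "growth * r \<gamma> = card H / (exp 1 - 1)" .
 have "exp (- (real (Suc (Suc m)) - 1)) = exp (- real m) * exp (- 1 :: real)" by (simp add: exp_add[symmetric])
 moreover have "1 - exp (- 1) = exp (- 1 :: real) * (exp 1 - 1)" by (simp add: right_diff_distrib exp_add[symmetric])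
 ultimately show ?thesis unfolding hw gr l using gH card_H by (simp add: r_def)
next
 case (hyp h g)
 have inj: "inj (%g :: complex => complex. [h, g])" by (rule injI) simp
 have "pmf (step_pmf h) w = pmf (hyp_next h) g" using pmf_map_inj'[OF inj, of "hyp_next h" g] hyp by (simp add: step_pmf_def)
 also have "... = r g / hyp_total" using hyp by (simp add: pmf_hyp_next)
 finally show ?thesis using hyp par_value(2) by (simp add: growth_def r_def[of h])
qed

sublocale blocks: edge_shift F hd last A step_pmf
proof
 show "finite A" by (rule finite_letters)
 show "A~={}" using g0A by blast
 show "set_pmf (step_pmf v) = {e\<in>F. hd e = v}" if "v\<in>A" for v by (rule set_step[OF that])
 show "hd e\<in>A" "last e\<in>A" if "e\<in>F" for e using F_hd F_last that by blast+
 fix a b assume a: "a\<in>A" and b: "b\<in>A"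
 have hypF: "[h, g]\<in>F" if "h\<in>H" "g\<in>A" "g~=iv h" for h g using that by (auto simp: induced_alphabet_def)
 have parF: "[\<gamma>, h]\<in>F" if "\<gamma>\<in>parabolic_letters g0" "h\<in>H" for \<gamma> h
 proof -
  have "[\<gamma>, h] = replicate 1 \<gamma> @ [h]" by simp
  moreover have "h\<in>A - {\<gamma>, iv \<gamma>}" using A_minus_par[OF that(1)] that(2) by simp
  ultimately show ?thesis unfolding induced_alphabet_def using that(1) by blast
 qed
 have par0: "g0\<in>parabolic_letters g0" by (simp add: parabolic_letters_def)
 have sep: "x~=iv h" if "h\<in>H" "x\<in>parabolic_letters g0" for x h using H_inv[OF that(1)] that(2) A_split(2) by blast
 have path: "EX e:F. EX e':F. hd e = a \<and> last e = hd e' \<and> last e' = b" if "[a, x]\<in>F" "[x, b]\<in>F" for x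
  using that by (intro bexI[of _ "[a, x]"] bexI[of _ "[x, b]"]) simp_all
 \<comment> \<open>Intermediate letter: g0 between two hyperbolic letters, the hyperbolic letter
   itself in the mixed cases, any letter of H between two parabolic ones.\<close>
 consider "a\<in>H" "b\<in>H" | "a\<in>H" "b\<in>parabolic_letters g0" | "a\<in>parabolic_letters g0" "b\<in>H"
  | "a\<in>parabolic_letters g0" "b\<in>parabolic_letters g0" using a b A_split(1) by blast
 then show "EX e:F. EX e':F. hd e = a \<and> last e = hd e' \<and> last e' = b"
 proof cases
  case 1
  show ?thesis by (rule path[of g0]) (use 1 hypF parF par0 sep g0A in blast)+
 next
  case 2
  show ?thesis by (rule path[of a]) (use 2 hypF sep a b A_ne_inv[OF a] in auto)
 next
  case 3
  show ?thesis by (rule path[of b]) (use 3 hypF parF b A_ne_inv[OF b] in auto)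
 next
  case 4
  obtain h where h: "h\<in>H" using H_ne by blast
  show ?thesis by (rule path[of h]) (use 4 h hypF parF sep b in auto)
 qed
qed

lemma X_eq: "blocks.X = Y" by (simp add: blocks.X_def markov_shift_def)

lemma B_eq: "blocks.B = markov_borel A g0" by (simp add: blocks.B_def markov_borel_def X_eq)

lemma pe_eq: "w\<in>F ==> blocks.pe w = exp (- (real (length w) - 1)) * r (last w) / (growth * r (hd w))"
 unfolding blocks.pe_def by (rule pmf_step)

lemma ln_pe: assumes "w\<in>F"
 shows "ln (blocks.pe w) = - (real (length w) - 1) + ln (r (last w)) - ln growth - ln (r (hd w))"
 unfolding pe_eq[OF assms] using r_pos[of "hd w"] r_pos[of "last w"] growth_pos by (simp add: ln_div ln_mult_pos)

text \<open>For a parabolic first letter the logarithm is affine in the exponent, and a geometric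
  variable has finite mean; for a hyperbolic one there are finitely many words.\<close>

lemma info_integrable: "integrable blocks.chain blocks.info"
proof (rule blocks.chain_info_integrable_pmf)
 fix a assume a: "a\<in>A"
 show "integrable (measure_pmf (step_pmf a)) (%w. ln (blocks.pe w))"
 proof (cases "a\<in>H")
  case True
  have "finite (set_pmf (step_pmf a))" using True finite_letters by (simp add: step_pmf_def set_hyp_next)
  then show ?thesis by (rule integrable_measure_pmf_finite)
 next
  case False
  let ?g = "geometric_pmf (1 - exp (- 1))"
  define C where "C = - 1 - ln growth - ln (r a)"
  have "integrable (measure_pmf ?g) real" by (rule integrable_real_geometric_pmf) simp
  then have "integrable (measure_pmf ?g) (%n. - real n + C)" by simp
  then have "integrable (measure_pmf (map_pmf fst (pair_pmf ?g (pmf_of_set H)))) (%n. - real n + C)" by (simp add: map_fst_pair_pmf)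
  then have i: "integrable (measure_pmf (pair_pmf ?g (pmf_of_set H))) (%x. - real (fst x) + C)"
   by (simp add: integrable_map_pmf_eq)
  have "AE x in measure_pmf (pair_pmf ?g (pmf_of_set H)). ln (blocks.pe (case x of (n, g) => replicate (Suc n) a @ [g])) = - real (fst x) + C"
  proof (rule AE_pmfI)
   fix x assume "x\<in>set_pmf (pair_pmf ?g (pmf_of_set H))"
   then obtain n g where x: "x = (n, g)" "g\<in>H" using H_ne A_split(3) by auto
   let ?w = "replicate (Suc n) a @ [g]"
   have "?w\<in>set_pmf (step_pmf a)" using False x(2) H_ne A_split(3) set_pmf_geometric[OF exp_m1] by (force simp: step_pmf_def)
   then have "?w\<in>F" using set_step[OF a] by blast
   then show "ln (blocks.pe (case x of (n, g) => replicate (Suc n) a @ [g])) = - real (fst x) + C"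
    using x(2) by (simp add: x(1) ln_pe C_def r_def[of g])
  qed
  then have "integrable (measure_pmf (pair_pmf ?g (pmf_of_set H))) (%x. ln (blocks.pe (case x of (n, g) => replicate (Suc n) a @ [g])))"
   using i by (subst integrable_cong_AE) auto
  then show ?thesis using False by (simp add: step_pmf_def integrable_map_pmf_eq)
 qed
qed

abbreviation potential where "potential \<equiv> (%y. - real (length (block A g0 1 (coding_map G A g0 y))))"

lemma potential_eq: assumes "y\<in>Y" shows "potential y = - (real (length (y 0)) - 1)"
proof -
 have "length (y 0)>=2" by (rule F_length[OF Y_F[OF assms]])
 then show ?thesis using block_pt[OF assms, of 0] by (simp add: coding_map_eq[OF assms])
qed

text \<open>By \<open>ln_pe\<close> the potential is ln growth - info plus the coboundary of ln r,
  so ln growth is the pressure.\<close>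

lemma equilibrium: "equilibrium_state (markov_borel A g0) shift potential nu \<longleftrightarrow> nu = blocks.chain"
 unfolding B_eq[symmetric]
proof (rule blocks.equilibrium_state_iff[OF info_integrable, where c = "ln growth" and u = "%a. ln (r a)"])
 fix y assume "y\<in>blocks.X"
 then have y: "y\<in>Y" by (simp add: X_eq)
 have "last (y 0) = hd (y 1)" using Y_match[OF y, of 0] by simp
 then show "potential y = ln growth - blocks.info y + ln (r (hd (y 0))) - ln (r (hd (y 1)))"
  unfolding potential_eq[OF y] blocks.info_def ln_pe[OF Y_F[OF y]] by simp
qed

end

subsection \<open>Periodic measures\<close>

text \<open>Turns the unordered sums of \<open>periodic_measure\<close> into expectations;
  boundedness of f provides absolute summability.\<close>

lemma infsum_pmf: fixes f :: "'a => real" assumes "!!x. \<bar>f x\<bar><=1" "set_pmf D\<subseteq>S"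
 shows "(\<Sum>\<^sub>\<infinity>x\<in>S. pmf D x * f x) = measure_pmf.expectation D f"
proof -
 have "Infinite_Set_Sum.abs_summable_on (%x. pmf D x * f x) UNIV"
  by (rule Infinite_Set_Sum.abs_summable_on_comparison_test[OF pmf_abs_summable[of D UNIV]])
   (use assms in "auto simp: abs_mult intro: mult_left_le")
 then have "measure_pmf.expectation D f = (\<Sum>\<^sub>\<infinity>x. pmf D x * f x)"
  unfolding pmf_expectation_eq_infsetsum by (rule infsetsum_infsum)
 also have "... = (\<Sum>\<^sub>\<infinity>x\<in>S. pmf D x * f x)"
  by (rule infsum_cong_neutral) (use assms(2) in "auto simp: set_pmf_eq")
 finally show ?thesis by simp
qed

context cusped_domain_free
begin

abbreviation cm where "cm \<equiv> coding_map G A g0"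

lemma cm_conical: "y\<in>Y ==> cm y\<in>\<Lambda>"
 using coding_map_eq pt_unblock_conical by simp

lemma cm_continuous: assumes y: "y\<in>Y" and e: "e > 0"
 shows "EX k. ALL z:Y. (ALL i<k. z i = y i) --> dist (cm z) (cm y) < e"
proof -
 obtain n where n: "ALL y':Y. (ALL i<n. y' i = y i) --> dist (pt (unblock y)) (pt (unblock y')) < e"
  by (rule pt_unblock_continuous[OF assms])
 have "dist (cm z) (cm y) < e" if "z\<in>Y" "ALL i<n. z i = y i" for z
 proof -
  have "dist (pt (unblock y)) (pt (unblock z)) < e" using n that by blast
  then show ?thesis unfolding coding_map_eq[OF y] coding_map_eq[OF that(1)] by (subst dist_commute)
 qed
 then show ?thesis by blast
qed

lemma cm_measurable: "cm\<in>blocks.chain \<rightarrow>\<^sub>M restrict_space borel \<Lambda>"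
proof (rule measurable_restrict_space2)
 show "cm\<in>space blocks.chain \<rightarrow> \<Lambda>" using cm_conical by (simp add: X_eq)
 show "cm\<in>borel_measurable blocks.chain"
  by (rule blocks.chain.meas_nu[OF blocks.locally_determined_measurable]) (use cm_continuous in "simp add: X_eq")
qed

lemma observable_continuous:
 fixes \<phi> :: "complex => real"
 assumes \<phi>: "continuous_on \<Lambda> \<phi>" and y: "y\<in>Y" and e: "e > 0"
 shows "EX k. ALL z:Y. (ALL i<k. z i = y i) --> dist (\<phi> (cm z)) (\<phi> (cm y)) < e"
proof -
 obtain d where d: "d > 0" "!!x. x\<in>\<Lambda> ==> dist x (cm y) < d ==> dist (\<phi> x) (\<phi> (cm y)) < e"
  using \<phi> cm_conical[OF y] e unfolding continuous_on_iff by metis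
 obtain k where "ALL z:Y. (ALL i<k. z i = y i) --> dist (cm z) (cm y) < d" using cm_continuous[OF y d(1)] by blast
 then show ?thesis using d(2) cm_conical by blast
qed

text \<open>Up to the factor \<open>growth ^ n\<close>, the weight of a periodic point is the probability of its block
 sequence: along a closed orbit the factors \<open>r\<close> cancel.\<close>

lemma block_weight_periodic:
 assumes y: "y\<in>Y" and yp: "(shift ^^ n) y = y"
 shows "block_weight A g0 n (cm y) = growth ^ n * blocks.wprob (map y [0..<n])"
proof -
 have l: "length (y i)>=2" for i by (rule F_length[OF Y_F[OF y]])
 have len: "real (length (block A g0 (Suc i) (cm y))) = real (length (y i)) - 1" for i
  using block_pt[OF y, of i] l[of i] by (simp add: coding_map_eq[OF y])
 have "(\<Sum>i=1..n. real (length (block A g0 i (cm y)))) = (\<Sum>i<n. real (length (block A g0 (Suc i) (cm y))))"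
  by (rule sum.reindex_bij_witness[of _ Suc "%i. i - 1"]) auto
 then have "block_weight A g0 n (cm y) = exp (\<Sum>i<n. - (real (length (y i)) - 1))"
  by (simp only: block_weight_def len sum_negf)
 also have "... = (\<Prod>i<n. exp (- (real (length (y i)) - 1)))" by (simp add: exp_sum)
 finally have w: "block_weight A g0 n (cm y) = (\<Prod>i<n. exp (- (real (length (y i)) - 1)))" .
 have tele: "(\<Prod>i<k. blocks.pe (y i)) * growth ^ k * r (hd (y 0)) = (\<Prod>i<k. exp (- (real (length (y i)) - 1))) * r (hd (y k))" for k
 proof (induction k)
  case (Suc k)
  have "blocks.pe (y k) * growth * r (hd (y k)) = exp (- (real (length (y k)) - 1)) * r (hd (y (Suc k)))"
   using r_pos[of "hd (y k)"] growth_pos Y_match[OF y, of k] by (simp add: pe_eq[OF Y_F[OF y]])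
  have "(\<Prod>i<Suc k. blocks.pe (y i)) * growth ^ Suc k * r (hd (y 0))
   = ((\<Prod>i<k. blocks.pe (y i)) * growth ^ k * r (hd (y 0))) * (blocks.pe (y k) * growth)" by simp
  also have "... = (\<Prod>i<k. exp (- (real (length (y i)) - 1))) * (blocks.pe (y k) * growth * r (hd (y k)))"
   unfolding Suc.IH by (simp add: mult_ac)
  finally show ?case using \<open>blocks.pe (y k) * growth * r (hd (y k)) = _\<close> by simp
 qed simp
 have "y n = y 0" using blocks.periodic_nth[OF yp, of n] by simp
 then have "(\<Prod>i<n. blocks.pe (y i)) * growth ^ n = (\<Prod>i<n. exp (- (real (length (y i)) - 1)))"
  using tele[of n] r_pos[of "hd (y 0)"] by simp
 then show ?thesis by (simp add: w blocks.wprob_nth mult.commute)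
qed

lemma periodic_points_eq: "periodic_points G A g0 n = cm ` {y\<in>Y. (shift ^^ n) y = y}"
proof (intro equalityI subsetI)
 fix x assume x: "x\<in>periodic_points G A g0 n"
 then have "x\<in>\<Lambda>" by (simp add: periodic_points_def)
 then obtain y where y: "y\<in>Y" "x = pt (unblock y)" by (rule conicalE)
 then have "(shift ^^ n) y = y" using periodic_pt[OF y(1), of n] x by simp
 then show "x\<in>cm ` {y\<in>Y. (shift ^^ n) y = y}" using y coding_map_eq[OF y(1)] by (intro image_eqI[of _ _ y]) auto
next
 fix x assume "x\<in>cm ` {y\<in>Y. (shift ^^ n) y = y}"
 then show "x\<in>periodic_points G A g0 n" using periodic_pt coding_map_eq by auto
qed

lemma cm_inj: "inj_on cm Y"
 by (rule inj_onI) (use pt_unblock_inj coding_map_eq in auto)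

text \<open>The weights are growth ^ n * trace n times the law of the periodic points, so
  normalising removes the constant, and \<open>periodic_orbits\<close> absorbs the orbit averages.
  c0 is a total extension of the coding map: the measure of a pmf lives on all functions, while the
  image has to lie in \<Lambda>.\<close>

lemma periodic_measure_eq:
 assumes n: "n > 0" and tr: "blocks.trace n > 0"
  and c0: "c0\<in>UNIV \<rightarrow> \<Lambda>" "!!y. y\<in>Y ==> c0 y = cm y"
 shows "periodic_measure G A g0 n = distr (measure_pmf (blocks.periodic_pmf n)) (restrict_space borel \<Lambda>) c0"
proof -
 let ?P = "blocks.periodic_pmf n" and ?Per = "periodic_points G A g0 n" and ?w = "block_weight A g0 n"
 let ?S = "{y\<in>Y. (shift ^^ n) y = y}" and ?orb = "orbit_distribution (induced_map A g0) n"
 define D where "D = map_pmf c0 ?P"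
 have setP: "set_pmf ?P = ?S" using blocks.set_periodic[OF n tr] by (simp add: X_eq)
 have Dcm: "D = map_pmf cm ?P" unfolding D_def by (rule map_pmf_cong) (use setP c0(2) in auto)
 have setD: "set_pmf D = ?Per" unfolding Dcm periodic_points_eq by (simp add: setP)
 have w: "?w x = growth ^ n * blocks.trace n * pmf D x" if x: "x\<in>?Per" for x
 proof -
  obtain y where y: "y\<in>Y" "(shift ^^ n) y = y" "x = cm y" using x unfolding periodic_points_eq by blast
  have "pmf D x = pmf ?P y" unfolding Dcm y(3)
   by (rule pmf_map_inj) (use setP y cm_inj in "auto intro: inj_on_subset")
  also have "... = blocks.wprob (map y [0..<n]) / blocks.trace n"
   by (rule blocks.pmf_periodic[OF n tr]) (use y in "simp_all add: X_eq")
  finally show ?thesis using tr by (simp add: y(3) block_weight_periodic[OF y(1,2)])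
 qed
 have sums: "(\<Sum>\<^sub>\<infinity>x\<in>?Per. ?w x * f x) = growth ^ n * blocks.trace n * measure_pmf.expectation D f"
  if "!!x. \<bar>f x\<bar><=1" for f :: "complex => real"
 proof -
  have "(\<Sum>\<^sub>\<infinity>x\<in>?Per. ?w x * f x) = (\<Sum>\<^sub>\<infinity>x\<in>?Per. growth ^ n * blocks.trace n * (pmf D x * f x))"
   by (rule infsum_cong) (simp add: w)
  also have "... = growth ^ n * blocks.trace n * (\<Sum>\<^sub>\<infinity>x\<in>?Per. pmf D x * f x)" by (rule infsum_cmult_right')
  also have "(\<Sum>\<^sub>\<infinity>x\<in>?Per. pmf D x * f x) = measure_pmf.expectation D f"
   by (rule infsum_pmf) (use that setD in auto)
  finally show ?thesis .
 qed
 have tot: "(\<Sum>\<^sub>\<infinity>x\<in>?Per. ?w x) = growth ^ n * blocks.trace n" using sums[of "%_. 1"] by simp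
 have orb: "bind_pmf D ?orb = D"
 proof -
  have "?orb (cm y) = map_pmf cm (orbit_distribution shift n y)" if y: "y\<in>Y" for y
  proof -
   have sub: "(%i. (shift ^^ i) y) ` {..<n}\<subseteq>Y" using Y_shift_pow[OF y] by auto
   have "(induced_map A g0 ^^ i) (cm y) = cm ((shift ^^ i) y)" for i
    using induced_map_pow_pt[OF y, of i] coding_map_eq[OF y] coding_map_eq[OF Y_shift_pow[OF y]] by simp
   then have "(%i. (induced_map A g0 ^^ i) (cm y)) ` {..<n} = cm ` (%i. (shift ^^ i) y) ` {..<n}"
    by (simp add: image_image)
   then show ?thesis unfolding orbit_distribution_def
    using map_pmf_of_set_inj[OF inj_on_subset[OF cm_inj sub]] n by (simp add: lessThan_empty_iff)
  qed
  then have "bind_pmf D ?orb = bind_pmf ?P (%y. map_pmf cm (orbit_distribution shift n y))"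
   unfolding Dcm bind_map_pmf by (intro bind_pmf_cong refl) (use setP in auto)
  also have "... = D" unfolding map_bind_pmf[symmetric] blocks.periodic_orbits[OF n tr] Dcm ..
  finally show ?thesis .
 qed
 let ?R = "restrict_space borel \<Lambda>" and ?N = "distr (measure_pmf ?P) (restrict_space borel \<Lambda>) c0"
 have c0m: "c0\<in>measure_pmf ?P \<rightarrow>\<^sub>M ?R" using c0(1) by (simp add: measurable_pmf_measure1 space_restrict_space)
 have "ennreal (inverse (\<Sum>\<^sub>\<infinity>x\<in>?Per. ?w x) * (\<Sum>\<^sub>\<infinity>x\<in>?Per. ?w x * measure_pmf.prob (?orb x) E)) = emeasure ?N E" if E: "E\<in>sets ?R" for E
 proof -
  have "inverse (\<Sum>\<^sub>\<infinity>x\<in>?Per. ?w x) * (\<Sum>\<^sub>\<infinity>x\<in>?Per. ?w x * measure_pmf.prob (?orb x) E)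
   = measure_pmf.expectation D (%x. measure_pmf.prob (?orb x) E)"
  proof -
   have 1: "inverse a * (a * c) = c" if "a > 0" for a c :: real using that by (simp add: field_simps)
   have 2: "growth ^ n * blocks.trace n > 0" using growth_pos tr by simp
   have 3: "(\<Sum>\<^sub>\<infinity>x\<in>?Per. ?w x * measure_pmf.prob (?orb x) E)
    = growth ^ n * blocks.trace n * measure_pmf.expectation D (%x. measure_pmf.prob (?orb x) E)"
    by (rule sums) (simp add: measure_pmf.prob_le_1)
   show ?thesis unfolding tot 3 by (rule 1[OF 2])
  qed
  also have "... = measure_pmf.prob (bind_pmf D ?orb) E"
   unfolding measure_pmf_bind
   by (subst measure_pmf.measure_bind[where N = "count_space UNIV"]) (auto simp: measurable_pmf_measure1 space_subprob_algebra measure_pmf.subprob_space_axioms)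
  also have "... = measure_pmf.prob D E" unfolding orb ..
  finally show ?thesis unfolding D_def using emeasure_distr[OF c0m E]
   by (simp add: measure_map_pmf measure_pmf.emeasure_eq_measure)
 qed
 then have "periodic_measure G A g0 n = measure_of \<Lambda> (sets ?R) (emeasure ?N)"
  unfolding periodic_measure_def
  by (intro measure_of_eq) (use sets.sets_into_space[of _ ?R] sets.sigma_sets_eq[of ?R] in "auto simp: space_restrict_space")
 also have "... = ?N" using measure_of_of_measure[of ?N] by (simp add: space_restrict_space)
 finally show ?thesis .
qed

lemma weak_convergence:
 "weak_star_convergence \<Lambda> (periodic_measure G A g0) (distr blocks.chain (restrict_space borel \<Lambda>) cm)"
 unfolding weak_star_convergence_def
proof (intro allI impI, elim conjE)
 fix \<phi> :: "complex => real" assume cont: "continuous_on \<Lambda> \<phi>" and "bounded (\<phi> ` \<Lambda>)"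
 then obtain C where C: "!!x. x\<in>\<Lambda> ==> \<bar>\<phi> x\<bar><=C" unfolding bounded_iff by force
 have \<phi>m: "\<phi>\<in>borel_measurable (restrict_space borel \<Lambda>)" by (rule borel_measurable_continuous_on_restrict[OF cont])
 have "blocks.X~={}" using blocks.traj_X by blast
 then obtain y0 where y0: "y0\<in>Y" using X_eq by blast
 define c0 where "c0 y = (if y\<in>Y then cm y else cm y0)" for y
 have c0: "c0\<in>UNIV \<rightarrow> \<Lambda>" "!!y. y\<in>Y ==> c0 y = cm y" using cm_conical y0 by (auto simp: c0_def)
 have "(%n. \<integral>y. \<phi> (cm y) \<partial>measure_pmf (blocks.periodic_pmf n)) \<longlonglongrightarrow> (\<integral>y. \<phi> (cm y) \<partial>blocks.chain)"
  by (rule blocks.periodic_weak_convergence[where C = C])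
   (use observable_continuous[OF cont] C cm_conical in "simp_all add: X_eq")
 moreover have "(\<integral>y. \<phi> (cm y) \<partial>blocks.chain) = (\<integral>x. \<phi> x \<partial>distr blocks.chain (restrict_space borel \<Lambda>) cm)"
  by (rule integral_distr[OF cm_measurable \<phi>m, symmetric])
 \<comment> \<open>The identification of the measures holds for n > 0 with positive trace, that is,
   for all large n.\<close>
 moreover have "eventually (%n. (\<integral>y. \<phi> (cm y) \<partial>measure_pmf (blocks.periodic_pmf n)) = (\<integral>x. \<phi> x \<partial>periodic_measure G A g0 n)) sequentially"
  using blocks.trace_eventually
 proof eventually_elim
  case (elim n)
  let ?P = "blocks.periodic_pmf n"
  have c0m: "c0\<in>measure_pmf ?P \<rightarrow>\<^sub>M restrict_space borel \<Lambda>"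
   using c0(1) by (simp add: measurable_pmf_measure1 space_restrict_space)
  have "(\<integral>x. \<phi> x \<partial>periodic_measure G A g0 n) = (\<integral>y. \<phi> (c0 y) \<partial>measure_pmf ?P)"
   using elim by (simp add: periodic_measure_eq[OF _ _ c0] integral_distr[OF c0m \<phi>m])
  also have "... = (\<integral>y. \<phi> (cm y) \<partial>measure_pmf ?P)"
  proof (rule integral_cong_AE)
   show "AE y in measure_pmf ?P. \<phi> (c0 y) = \<phi> (cm y)"
    using blocks.set_periodic[of n] elim c0(2) by (intro AE_pmfI) (auto simp: X_eq)
  qed simp_all
  finally show ?case by simp
 qed
 ultimately show "(%n. \<integral>x. \<phi> x \<partial>periodic_measure G A g0 n) \<longlonglongrightarrow> (\<integral>x. \<phi> x \<partial>distr blocks.chain (restrict_space borel \<Lambda>) cm)"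
  by (simp only: Lim_transform_eventually)
qed

end

theorem proposition1p5:
 fixes G A :: "(complex \<Rightarrow> complex) set" and c p :: complex and \<gamma>0 :: "complex \<Rightarrow> complex"
 assumes "fuchsian_group G"
  and "finitely_generated D_group G"
  and "free_subgroup D_group G"
  and "\<exists>g\<in>G. parabolic g"
  and "c \<in> ball 0 1"
  and A: "A = side_pairings G c"
  and "\<forall>g\<in>A. side_of G c g \<subseteq> isometric_circle g"
  and "vertices G c = {p}"
  and "\<gamma>0 \<in> A"
  and "\<gamma>0 p = p"
  and "bowen_series_mixing G A"
 shows "\<exists>\<mu>. (\<forall>\<nu>. equilibrium_state (markov_borel A \<gamma>0) shift
         (\<lambda>y. - real (length (block A \<gamma>0 1 (coding_map G A \<gamma>0 y)))) \<nu> \<longleftrightarrow> \<nu> = \<mu>) \<and>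
      weak_star_convergence (conical_limit_set G) (periodic_measure G A \<gamma>0)
       (distr \<mu> (restrict_space borel (conical_limit_set G)) (coding_map G A \<gamma>0))"
proof -
 interpret cusped_domain G c A p \<gamma>0
  by unfold_locales (use assms in auto)
 interpret cusped_domain_fin G c A p \<gamma>0
  by unfold_locales (rule finite_A[OF assms(2)])
 interpret cusped_domain_free G c A p \<gamma>0
  by unfold_locales (rule H_nonempty[OF assms(11)])
 show ?thesis using equilibrium weak_convergence by blast
qed

end
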